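(* Let $A$ be a real $d\times d$ matrix all of whose eigenvalues have strictly negative real parts, let $B$ be a real $d\times m$ matrix such that $(A,B)$ is a controllable pair, and let $a\in\mathbb{R}^d$, $\gamma\in\mathbb{R}^m$, $\kappa>0$, $\zeta_2>0$. For $\varepsilon>0$ let $\widehat\lambda(\varepsilon)$ be the Lyapunov exponent of the system $$dv(t)=Av(t)\,dt+B\,dW(t),\qquad\ddot\varphi(t)+2\varepsilon^2\zeta_2\dot\varphi(t)+\bigl(\kappa^2-\varepsilon\langle a,v(t)\rangle\bigr)\varphi(t)=\sum_{\ell=1}^m\varepsilon\gamma_\ell\,\varphi(t)\,\dot W_\ell(t).$$ Then $$\widehat\lambda(\varepsilon)=\varepsilon^2\bigl(-\zeta_2+\lambda_2(2\kappa)\bigr)+O(\varepsilon^4)\quad\text{as }\varepsilon\to0,$$ where $$\lambda_2(\omega)=\frac{\pi}{\omega^2}\Bigl(\langle a,\widehat S_A(\omega)Ra\rangle+\langle a,\widehat S_A(\omega)B\gamma\rangle+\frac{\|\gamma\|^2}{2\pi}\Bigr).$$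
   Context: $W=(W_1,\dots,W_m)$ is a standard $m$-dimensional Brownian motion. $(A,B)$ is a controllable pair if $\mathrm{rank}\{B,AB,\dots,A^{d-1}B\}=d$. $R=\int_0^\infty e^{tA}BB^*e^{tA^*}\,dt$ is the covariance matrix of the stationary probability measure of $v$, and $\widehat S_A(\omega)=\frac1\pi\int_0^\infty e^{tA}\cos\omega t\,dt$. The equation for $\varphi$ is understood as the It\^o (equivalently Stratonovich) system $d\varphi=\dot\varphi\,dt$, $d\dot\varphi=[-2\varepsilon^2\zeta_2\dot\varphi-(\kappa^2-\varepsilon\langle a,v\rangle)\varphi]dt+\varepsilon\varphi\sum_\ell\gamma_\ell\,dW_\ell$. The Lyapunov exponent is the almost-sure limit $\widehat\lambda(\varepsilon)=\lim_{t\to\infty}\frac1t\log\|(\varphi(t),\dot\varphi(t))\|$, which (for small $\varepsilon>0$) exists and takes the same nonrandom value for all initial conditions with $(\varphi(0),\dot\varphi(0))\ne(0,0)$. *)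

theory Defs
  imports "HOL-Probability.Probability" "HOL-Library.Landau_Symbols"
begin

section \<open>Linear algebra\<close>

definition matrix_power :: "real^'n^'n \<Rightarrow> nat \<Rightarrow> real^'n^'n" where
  "matrix_power A k = (((**) A) ^^ k) (mat 1)"

definition matrix_exp :: "real^'n^'n \<Rightarrow> real^'n^'n" where
  "matrix_exp A = (\<Sum>k. (1 / fact k) *\<^sub>R matrix_power A k)"

definition complex_eigenvalue :: "real^'n^'n \<Rightarrow> complex \<Rightarrow> bool" where
  "complex_eigenvalue A z \<longleftrightarrow>
     (\<exists>x :: complex^'n. x \<noteq> 0 \<and> map_matrix complex_of_real A *v x = z *s x)"

text \<open>The union below is the set of columns of the block matrix with blocks
  \<open>B, A B, \<dots>, A\<^sup>d\<^sup>-\<^sup>1 B\<close>, so its dimension is the rank of that matrix.\<close>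

definition controllable_pair :: "real^'d^'d \<Rightarrow> real^'m^'d \<Rightarrow> bool" where
  "controllable_pair A B \<longleftrightarrow>
     dim (\<Union>k<CARD('d). columns (matrix_power A k ** B)) = CARD('d)"

definition stationary_cov :: "real^'d^'d \<Rightarrow> real^'m^'d \<Rightarrow> real^'d^'d" where
  "stationary_cov A B =
     integral {0..} (\<lambda>t. matrix_exp (t *\<^sub>R A) ** B ** transpose B ** matrix_exp (t *\<^sub>R transpose A))"

definition S_hat :: "real^'d^'d \<Rightarrow> real \<Rightarrow> real^'d^'d" where
  "S_hat A \<omega> = (1 / pi) *\<^sub>R integral {0..} (\<lambda>t. cos (\<omega> * t) *\<^sub>R matrix_exp (t *\<^sub>R A))"

definition lambda2 :: "real^'d^'d \<Rightarrow> real^'m^'d \<Rightarrow> real^'d \<Rightarrow> real^'m \<Rightarrow> real \<Rightarrow> real" where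
  "lambda2 A B a \<gamma> \<omega> = pi / \<omega>\<^sup>2 *
     (a \<bullet> (S_hat A \<omega> *v (stationary_cov A B *v a))
      + a \<bullet> (S_hat A \<omega> *v (B *v \<gamma>))
      + (norm \<gamma>)\<^sup>2 / (2 * pi))"


section \<open>Brownian motion and the It\^o integral\<close>

text \<open>Time is indexed by \<^typ>\<open>real\<close> in order to use the library's notion of filtration, but
  only times \<open>t \<ge> 0\<close> matter below.\<close>

definition filtered_prob_space :: "'w measure \<Rightarrow> (real \<Rightarrow> 'w measure) \<Rightarrow> bool" where
  "filtered_prob_space M F \<longleftrightarrow>
     prob_space M \<and> filtration (space M) F \<and> (\<forall>t. subalgebra M (F t))"

definition continuous_adapted ::
  "'w measure \<Rightarrow> (real \<Rightarrow> 'w measure) \<Rightarrow> (real \<Rightarrow> 'w \<Rightarrow> 'b::topological_space) \<Rightarrow> bool" where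
  "continuous_adapted M F X \<longleftrightarrow>
     (\<forall>t\<ge>0. X t \<in> borel_measurable (F t)) \<and>
     (\<forall>w\<in>space M. continuous_on {0..} (\<lambda>t. X t w))"

text \<open>The density of the increment is the product of the \<open>N(0, t - s)\<close> densities of its
  components, which are therefore independent.\<close>

definition standard_brownian_motion ::
  "'w measure \<Rightarrow> (real \<Rightarrow> 'w measure) \<Rightarrow> (real \<Rightarrow> 'w \<Rightarrow> real^'m) \<Rightarrow> bool" where
  "standard_brownian_motion M F W \<longleftrightarrow>
     filtered_prob_space M F \<and> continuous_adapted M F W \<and> (AE w in M. W 0 w = 0) \<and>
     (\<forall>s t. 0 \<le> s \<and> s < t \<longrightarrow>
        distributed M lborel (\<lambda>w. W t w - W s w)
          (\<lambda>x. ennreal (\<Prod>i\<in>UNIV. normal_density 0 (sqrt (t - s)) (x $ i))) \<and>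
        prob_space.indep_set M (sets (F s))
          (sets (vimage_algebra (space M) (\<lambda>w. W t w - W s w) borel)))"

definition converges_in_prob ::
  "'w measure \<Rightarrow> (nat \<Rightarrow> 'w \<Rightarrow> real) \<Rightarrow> ('w \<Rightarrow> real) \<Rightarrow> bool" where
  "converges_in_prob M X Y \<longleftrightarrow>
     (\<forall>n. X n \<in> borel_measurable M) \<and> Y \<in> borel_measurable M \<and>
     (\<forall>\<delta>>0. (\<lambda>n. measure M {w \<in> space M. \<bar>X n w - Y w\<bar> > \<delta>}) \<longlonglongrightarrow> 0)"

text \<open>A simple integrand on \<open>[0, t]\<close> takes the bounded, \<open>F (\<tau> i)\<close>-measurable value \<open>\<xi> i\<close> on the
  interval from \<open>\<tau> i\<close> (excluded) to \<open>\<tau> (i + 1)\<close> (included), for \<open>i < n\<close>.\<close>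

definition simple_integrand ::
  "'w measure \<Rightarrow> (real \<Rightarrow> 'w measure) \<Rightarrow> real \<Rightarrow> nat \<Rightarrow> (nat \<Rightarrow> real) \<Rightarrow> (nat \<Rightarrow> 'w \<Rightarrow> real) \<Rightarrow> bool" where
  "simple_integrand M F t n \<tau> \<xi> \<longleftrightarrow>
     \<tau> 0 = 0 \<and> \<tau> n = t \<and>
     (\<forall>i<n. \<tau> i \<le> \<tau> (Suc i) \<and> \<xi> i \<in> borel_measurable (F (\<tau> i)) \<and> bounded (\<xi> i ` space M))"

definition simple_process ::
  "nat \<Rightarrow> (nat \<Rightarrow> real) \<Rightarrow> (nat \<Rightarrow> 'w \<Rightarrow> real) \<Rightarrow> real \<Rightarrow> 'w \<Rightarrow> real" where
  "simple_process n \<tau> \<xi> s w = (\<Sum>i<n. \<xi> i w * indicator {\<tau> i <.. \<tau> (Suc i)} s)"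

definition simple_integral ::
  "nat \<Rightarrow> (nat \<Rightarrow> real) \<Rightarrow> (nat \<Rightarrow> 'w \<Rightarrow> real) \<Rightarrow> (real \<Rightarrow> 'w \<Rightarrow> real) \<Rightarrow> 'w \<Rightarrow> real" where
  "simple_integral n \<tau> \<xi> \<beta> w = (\<Sum>i<n. \<xi> i w * (\<beta> (\<tau> (Suc i)) w - \<beta> (\<tau> i) w))"

text \<open>\<open>is_ito_integral M F \<beta> H t J\<close>: the random variable \<open>J\<close> is (a version of) the It\^o integral of
  the continuous adapted process \<open>H\<close> over \<open>[0, t]\<close> against the scalar Brownian motion \<open>\<beta>\<close>. It is
  determined by \<open>H\<close> only up to null sets, whence a relation. No square integrability of \<open>H\<close> in the
  probability variable is needed, since both limits are taken in probability.\<close>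

definition is_ito_integral ::
  "'w measure \<Rightarrow> (real \<Rightarrow> 'w measure) \<Rightarrow> (real \<Rightarrow> 'w \<Rightarrow> real) \<Rightarrow> (real \<Rightarrow> 'w \<Rightarrow> real) \<Rightarrow>
    real \<Rightarrow> ('w \<Rightarrow> real) \<Rightarrow> bool" where
  "is_ito_integral M F \<beta> H t J \<longleftrightarrow>
     continuous_adapted M F H \<and>
     (\<exists>n \<tau> \<xi>.
        (\<forall>k. simple_integrand M F t (n k) (\<tau> k) (\<xi> k)) \<and>
        converges_in_prob M
          (\<lambda>k w. integral {0..t} (\<lambda>s. (simple_process (n k) (\<tau> k) (\<xi> k) s w - H s w)\<^sup>2)) (\<lambda>w. 0) \<and>
        converges_in_prob M (\<lambda>k. simple_integral (n k) (\<tau> k) (\<xi> k) \<beta>) J)"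


section \<open>The stochastic system and its Lyapunov exponent\<close>

text \<open>\<open>\<psi>\<close> is the velocity of \<open>\<phi>\<close>, and \<open>J l t\<close> is the It\^o integral of \<open>\<phi>\<close> over \<open>[0, t]\<close> against
  the \<open>l\<close>-th component of \<open>W\<close>. Adaptedness makes the initial values \<open>F 0\<close>-measurable (for instance
  deterministic), hence independent of \<open>W\<close>.\<close>

definition is_solution ::
  "'w measure \<Rightarrow> (real \<Rightarrow> 'w measure) \<Rightarrow> (real \<Rightarrow> 'w \<Rightarrow> real^'m) \<Rightarrow>
    real^'d^'d \<Rightarrow> real^'m^'d \<Rightarrow> real^'d \<Rightarrow> real^'m \<Rightarrow> real \<Rightarrow> real \<Rightarrow> real \<Rightarrow>
    (real \<Rightarrow> 'w \<Rightarrow> real^'d) \<Rightarrow> (real \<Rightarrow> 'w \<Rightarrow> real) \<Rightarrow> (real \<Rightarrow> 'w \<Rightarrow> real) \<Rightarrow> bool" where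
  "is_solution M F W A B a \<gamma> \<kappa> \<zeta> \<epsilon> v \<phi> \<psi> \<longleftrightarrow>
     continuous_adapted M F v \<and> continuous_adapted M F \<phi> \<and> continuous_adapted M F \<psi> \<and>
     (\<forall>t\<ge>0. AE w in M.
        v t w = v 0 w + integral {0..t} (\<lambda>s. A *v v s w) + B *v (W t w - W 0 w)) \<and>
     (\<forall>t\<ge>0. AE w in M. \<phi> t w = \<phi> 0 w + integral {0..t} (\<lambda>s. \<psi> s w)) \<and>
     (\<exists>J. \<forall>t\<ge>0.
        (\<forall>l. is_ito_integral M F (\<lambda>s w. W s w $ l) \<phi> t (J l t)) \<and>
        (AE w in M.
           \<psi> t w = \<psi> 0 w
             + integral {0..t} (\<lambda>s. - 2 * \<epsilon>\<^sup>2 * \<zeta> * \<psi> s w - (\<kappa>\<^sup>2 - \<epsilon> * (a \<bullet> v s w)) * \<phi> s w)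
             + (\<Sum>l\<in>UNIV. \<epsilon> * \<gamma> $ l * J l t w)))"

text \<open>The existential conjunct rules out that a number is a Lyapunov exponent vacuously.\<close>

definition is_lyapunov_exponent ::
  "'w measure \<Rightarrow> (real \<Rightarrow> 'w measure) \<Rightarrow> (real \<Rightarrow> 'w \<Rightarrow> real^'m) \<Rightarrow>
    real^'d^'d \<Rightarrow> real^'m^'d \<Rightarrow> real^'d \<Rightarrow> real^'m \<Rightarrow> real \<Rightarrow> real \<Rightarrow> real \<Rightarrow> real \<Rightarrow> bool" where
  "is_lyapunov_exponent M F W A B a \<gamma> \<kappa> \<zeta> \<epsilon> \<Lambda> \<longleftrightarrow>
     (\<exists>v \<phi> \<psi>. is_solution M F W A B a \<gamma> \<kappa> \<zeta> \<epsilon> v \<phi> \<psi> \<and> (AE w in M. (\<phi> 0 w, \<psi> 0 w) \<noteq> (0, 0))) \<and>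
     (\<forall>v \<phi> \<psi>. is_solution M F W A B a \<gamma> \<kappa> \<zeta> \<epsilon> v \<phi> \<psi> \<and> (AE w in M. (\<phi> 0 w, \<psi> 0 w) \<noteq> (0, 0)) \<longrightarrow>
        (AE w in M. ((\<lambda>t. ln (norm (\<phi> t w, \<psi> t w)) / t) \<longlongrightarrow> \<Lambda>) at_top))"

end

theory Submission
  imports Defs "HOL-Computational_Algebra.Fundamental_Theorem_Algebra"
begin

text \<open>Since the exponent is the same for all solutions, it suffices to study one of them. An auxiliary
  process \<open>z\<close> with \<open>dz = - z dt + \<langle>\<gamma>, dW\<rangle>\<close> turns the oscillator into a random ODE for
  \<open>y = \<phi>' - (\<epsilon> z - \<epsilon>\<^sup>2 \<zeta>) \<phi> + \<i> \<kappa> \<phi>\<close>, which is solved path by path, and the It\^o integral of \<open>\<phi>\<close> is obtained by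
  integration by parts. Then \<open>E = cnj y / y\<close> is a unimodular fast angle, \<open>E' = - 2 \<i> \<kappa> E + O(\<epsilon>)\<close>, and
  the logarithmic derivative of \<open>|y|\<close> is \<open>- \<epsilon>\<^sup>2 \<zeta>\<close> plus the real part of \<open>E\<close> times a polynomial in the
  Ornstein--Uhlenbeck process \<open>u = (v, z)\<close>. Dynkin's formula for \<open>E ^ n\<close> times a monomial in \<open>u\<close>,
  combined with the invertibility of the operators \<open>L - \<i> n \<omega>\<close> on polynomials, where \<open>L\<close> is the
  generator of \<open>u\<close> and \<open>\<omega> = 2 \<kappa>\<close>, shows that the mean of \<open>ln |y(T)| / T\<close> is
  \<open>\<epsilon>\<^sup>2 (- \<zeta> + \<lambda>\<^sub>2) + O(\<epsilon>\<^sup>4 + 1 / T)\<close>. Uniform integrability identifies its limit with the exponent.\<close>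

section \<open>The matrix exponential of a stable matrix\<close>

text \<open>The error is \<open>\<epsilon> ^ 4\<close> and not \<open>\<epsilon> ^ 3\<close> because
  of a parity. At order \<open>\<epsilon>\<close> the perturbation \<open>H\<close> of the fast
  rotation is linear in \<open>u\<close>, so each use of Dynkin's formula gains a factor
  \<open>\<epsilon>\<close> and changes the degree in \<open>u\<close> by one. Means of
  \<open>E ^ n\<close> times an odd monomial are thus of order \<open>\<epsilon>\<close>, and times
  an even one of order \<open>\<epsilon>\<^sup>2\<close> if \<open>n \<noteq> 0\<close>; the even
  case \<open>n = 0\<close>, the covariance of \<open>u\<close>, gives the coefficient of
  \<open>\<epsilon>\<^sup>2\<close>. All estimates are for finite \<open>T\<close> with an error
  \<open>1 / T\<close> uniform in \<open>\<epsilon>\<close>; at the end \<open>T\<close> tends to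
  infinity at fixed \<open>\<epsilon>\<close>. Stochastic calculus is reduced to two devices:
  freezing the terminal value of \<open>W\<close> turns Dynkin's formula into the fundamental
  theorem of calculus plus independence of increments, and the paths of \<open>\<phi>\<close> are of
  class C1, so its Ito integral is a Riemann-Stieltjes limit. Sixth moments of \<open>u\<close>
  suffice because the terms of the generator have degree at most five. The decay rate 1 of
  \<open>z\<close> is a free choice: it enters through the cross covariance of \<open>v\<close> and
  \<open>z\<close> and cancels in the final formula.\<close>

lemma matrix_power_Suc: "matrix_power A (Suc k) = A ** matrix_power A k"
  by (simp add: matrix_power_def)

lemma matrix_power_Suc2: "matrix_power A (Suc k) = matrix_power A k ** A"
proof (induction k)
  case 0
  then show ?case by (simp add: matrix_power_def)
next
  case (Suc k)
  then show ?case by (metis matrix_mul_assoc matrix_power_Suc)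
qed

lemma matrix_power_scaleR:
  fixes t :: real
  shows "matrix_power (t *\<^sub>R A) k = t ^ k *\<^sub>R matrix_power A k"
proof (induction k)
  case 0
  then show ?case by (simp add: matrix_power_def)
next
  case (Suc k)
  then show ?case
    by (simp add: matrix_power_Suc vec_eq_iff matrix_matrix_mult_def sum_distrib_left mult_ac)
qed

lemma matrix_power_transpose: "matrix_power (transpose A) k = transpose (matrix_power A k)"
proof (induction k)
  case 0
  then show ?case by (simp add: matrix_power_def transpose_mat)
next
  case (Suc k)
  then show ?case by (metis matrix_transpose_mul matrix_power_Suc matrix_power_Suc2)
qed

text \<open>The sum of all absolute entries is submultiplicative enough to compare each entry of the
  exponential series with a scalar exponential series.\<close>

lemma abs_matrix_power_le:
  fixes A :: "real^'n^'n"
  shows "\<bar>matrix_power A k $ i $ j\<bar> \<le> (\<Sum>i\<in>UNIV. \<Sum>j\<in>UNIV. \<bar>A $ i $ j\<bar>) ^ k"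
proof (induction k arbitrary: i j)
  case 0
  then show ?case by (simp add: matrix_power_def mat_def)
next
  case (Suc k)
  let ?K = "\<Sum>i\<in>UNIV. \<Sum>j\<in>UNIV. \<bar>A $ i $ j\<bar>"
  have row: "(\<Sum>l\<in>UNIV. \<bar>A $ i $ l\<bar>) \<le> ?K"
    by (rule member_le_sum[of i UNIV "\<lambda>i. \<Sum>l\<in>UNIV. \<bar>A $ i $ l\<bar>"]) (auto intro: sum_nonneg)
  have "\<bar>matrix_power A (Suc k) $ i $ j\<bar> \<le> (\<Sum>l\<in>UNIV. \<bar>A $ i $ l * matrix_power A k $ l $ j\<bar>)"
    by (simp add: matrix_power_Suc matrix_matrix_mult_def)
  also have "\<dots> \<le> (\<Sum>l\<in>UNIV. \<bar>A $ i $ l\<bar> * ?K ^ k)"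
    by (intro sum_mono) (simp add: abs_mult mult_left_mono Suc)
  also have "\<dots> \<le> ?K * ?K ^ k"
    unfolding sum_distrib_right[symmetric]
    by (intro mult_right_mono row zero_le_power sum_nonneg) auto
  finally show ?case by simp
qed

text \<open>Read entrywise, the matrix series becomes a real power series in \<open>t\<close>, so
  that scalar results on sums and termwise derivatives apply to every entry.\<close>

lemma sums_matrix_exp:
  fixes A :: "real^'n^'n"
  shows "(\<lambda>k. matrix_power A k $ i $ j / fact k * t ^ k) sums matrix_exp (t *\<^sub>R A) $ i $ j"
proof -
  define c where "c i j k = matrix_power A k $ i $ j / fact k" for i j k
  let ?K = "\<Sum>i\<in>UNIV. \<Sum>j\<in>UNIV. \<bar>A $ i $ j\<bar>"
  have summ: "summable (\<lambda>k. c i j k * t ^ k)" for i j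
  proof (rule summable_comparison_test)
    show "summable (\<lambda>k. inverse (fact k) * (?K * \<bar>t\<bar>) ^ k)"
      using summable_exp[of "?K * \<bar>t\<bar>"] by simp
    show "\<exists>N. \<forall>n\<ge>N. norm (c i j n * t ^ n) \<le> inverse (fact n) * (?K * \<bar>t\<bar>) ^ n"
      using abs_matrix_power_le[of A]
      by (intro exI[of _ 0])
         (auto simp: c_def abs_mult power_mult_distrib power_abs field_simps intro!: mult_left_mono)
  qed
  have "(\<lambda>k. (1 / fact k) *\<^sub>R matrix_power (t *\<^sub>R A) k) sums (\<chi> i j. \<Sum>k. c i j k * t ^ k)"
    unfolding sums_def
  proof (intro vec_tendstoI)
    fix i j
    show "(\<lambda>n. (\<Sum>k<n. (1 / fact k) *\<^sub>R matrix_power (t *\<^sub>R A) k) $ i $ j) \<longlonglongrightarrow> (\<chi> i j. \<Sum>k. c i j k * t ^ k) $ i $ j"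
      using summable_LIMSEQ[OF summ[of i j]]
      by (simp add: matrix_power_scaleR c_def mult.commute)
  qed
  then have "matrix_exp (t *\<^sub>R A) = (\<chi> i j. \<Sum>k. c i j k * t ^ k)"
    unfolding matrix_exp_def by (rule sums_unique[symmetric])
  with summable_sums[OF summ[of i j]] show ?thesis by (simp add: c_def)
qed

lemma matrix_exp_0 [simp]: "matrix_exp 0 = mat 1"
proof -
  have "matrix_exp (0 *\<^sub>R A) $ i $ j = (mat 1 :: real^'n^'n) $ i $ j" for A :: "real^'n^'n" and i j
    using sums_unique[OF sums_matrix_exp[of A i j 0]]
    by (subst (asm) suminf_finite[of "{0}"]) (auto simp: matrix_power_def)
  then show ?thesis by (metis (no_types) scaleR_zero_left vec_eq_iff)
qed

lemma matrix_exp_transpose: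
  fixes t :: real
  shows "matrix_exp (t *\<^sub>R transpose A) = transpose (matrix_exp (t *\<^sub>R A))"
proof -
  have "matrix_exp (t *\<^sub>R transpose A) $ i $ j = matrix_exp (t *\<^sub>R A) $ j $ i" for i j
  proof (rule sums_unique2)
    show "(\<lambda>k. matrix_power A k $ j $ i / fact k * t ^ k) sums matrix_exp (t *\<^sub>R transpose A) $ i $ j"
      using sums_matrix_exp[of "transpose A" i j t] unfolding matrix_power_transpose
      by (simp add: transpose_def)
  qed (rule sums_matrix_exp)
  then show ?thesis by (simp add: vec_eq_iff transpose_def)
qed

text \<open>Termwise differentiation shifts the power of \<open>A\<close> by one. Splitting off the
  extra factor on the left or on the right yields the two forms of the derivative that
  follow.\<close>

lemma has_field_derivative_matrix_exp_aux:
  fixes A :: "real^'n^'n"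
  shows "((\<lambda>t. matrix_exp (t *\<^sub>R A) $ i $ j) has_field_derivative
     (\<Sum>n. matrix_power A (Suc n) $ i $ j / fact n * t ^ n)) (at t)"
proof -
  define c where "c k = matrix_power A k $ i $ j / fact k" for k
  have eq: "matrix_exp (t *\<^sub>R A) $ i $ j = (\<Sum>n. c n * t ^ n)" for t
    using sums_unique[OF sums_matrix_exp[of A i j t]] by (simp add: c_def)
  have "((\<lambda>t. \<Sum>n. c n * t ^ n) has_field_derivative (\<Sum>n. diffs c n * t ^ n)) (at t)"
    by (rule termdiffs_strong_converges_everywhere)
      (use sums_matrix_exp[of A i j] in \<open>auto simp: c_def sums_iff\<close>)
  moreover have "diffs c n = matrix_power A (Suc n) $ i $ j / fact n" for n
    by (simp add: diffs_def c_def field_simps del: of_nat_Suc)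
  ultimately show ?thesis by (simp add: eq)
qed

lemma has_field_derivative_matrix_exp:
  "((\<lambda>t. matrix_exp (t *\<^sub>R A) $ i $ j) has_field_derivative
     (\<Sum>l\<in>UNIV. A $ i $ l * matrix_exp (t *\<^sub>R A) $ l $ j)) (at t)"
proof -
  have "(\<lambda>n. \<Sum>l\<in>UNIV. A $ i $ l * (matrix_power A n $ l $ j / fact n * t ^ n)) sums
      (\<Sum>l\<in>UNIV. A $ i $ l * matrix_exp (t *\<^sub>R A) $ l $ j)"
    by (intro sums_sum sums_mult sums_matrix_exp)
  then have "(\<Sum>n. matrix_power A (Suc n) $ i $ j / fact n * t ^ n) =
      (\<Sum>l\<in>UNIV. A $ i $ l * matrix_exp (t *\<^sub>R A) $ l $ j)"
    by (simp add: sums_iff matrix_power_Suc matrix_matrix_mult_def sum_divide_distrib sum_distrib_right mult.assoc)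
  with has_field_derivative_matrix_exp_aux[of A i j t] show ?thesis by simp
qed

lemma has_field_derivative_matrix_exp2:
  "((\<lambda>t. matrix_exp (t *\<^sub>R A) $ i $ j) has_field_derivative
     (\<Sum>l\<in>UNIV. matrix_exp (t *\<^sub>R A) $ i $ l * A $ l $ j)) (at t)"
proof -
  have "(\<lambda>n. \<Sum>l\<in>UNIV. (matrix_power A n $ i $ l / fact n * t ^ n) * A $ l $ j) sums
      (\<Sum>l\<in>UNIV. matrix_exp (t *\<^sub>R A) $ i $ l * A $ l $ j)"
    by (intro sums_sum sums_mult2 sums_matrix_exp)
  then have "(\<Sum>n. matrix_power A (Suc n) $ i $ j / fact n * t ^ n) =
      (\<Sum>l\<in>UNIV. matrix_exp (t *\<^sub>R A) $ i $ l * A $ l $ j)"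
    by (simp add: sums_iff matrix_power_Suc2 matrix_matrix_mult_def sum_divide_distrib sum_distrib_left mult_ac)
  with has_field_derivative_matrix_exp_aux[of A i j t] show ?thesis by simp
qed

text \<open>Horner evaluation of the vector p(A) x. Polynomials act on one vector at a time, since
  an annihilator of a single vector already controls the trajectory that starts there.\<close>

definition poly_mat :: "real^'n^'n \<Rightarrow> complex poly \<Rightarrow> complex^'n \<Rightarrow> complex^'n" where
  "poly_mat A p x = fold_coeffs (\<lambda>c y. c *s x + map_matrix complex_of_real A *v y) p 0"

lemma poly_mat_0 [simp]: "poly_mat A 0 x = 0"
  by (simp add: poly_mat_def)

lemma poly_mat_pCons [simp]:
  "poly_mat A (pCons c p) x = c *s x + map_matrix complex_of_real A *v poly_mat A p x"
  by (cases "c = 0 \<and> p = 0") (auto simp: poly_mat_def)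

lemma poly_mat_add: "poly_mat A (p + q) x = poly_mat A p x + poly_mat A q x"
  by (induction p q rule: poly_induct2)
     (auto simp: matrix_vector_right_distrib vector_sadd_rdistrib)

lemma poly_mat_smult: "poly_mat A (smult c p) x = c *s poly_mat A p x"
  by (induction p) (auto simp: matrix_vector_mult_scaleR vector_ssub_ldistrib vec.scale_right_distrib vec.scale vector_smult_assoc)

lemma poly_mat_sum: "poly_mat A (\<Sum>i\<in>I. p i) x = (\<Sum>i\<in>I. poly_mat A (p i) x)"
  by (induction I rule: infinite_finite_induct) (auto simp: poly_mat_add)

lemma poly_mat_linear_factor:
  "poly_mat A ([:-z, 1:] * q) x =
     map_matrix complex_of_real A *v poly_mat A q x - z *s poly_mat A q x"
proof -
  have "[:-z, 1:] * q = pCons 0 q + smult (- z) q" by simp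
  then show ?thesis
    by (simp only: poly_mat_add poly_mat_smult poly_mat_pCons vec.scale_zero_left add_0_left vec.scale_minus_left diff_conv_add_uminus)
qed

lemma poly_mat_linear_factor2:
  "poly_mat A ([:-z, 1:] * q) x = poly_mat A q (map_matrix complex_of_real A *v x - z *s x)"
proof -
  have "poly_mat A q (map_matrix complex_of_real A *v x - z *s x) =
      map_matrix complex_of_real A *v poly_mat A q x - z *s poly_mat A q x"
  proof (induction q)
    case 0
    then show ?case by simp
  next
    case (pCons c q)
    show ?case
      by (simp add: pCons.IH vec.scale_right_diff_distrib vec.scale_right_distrib vec.add vec.diff
          vec.scale mult.commute)
  qed
  then show ?thesis by (simp only: poly_mat_linear_factor)
qed

text \<open>The iterates of \<open>x\<close> under \<open>A\<close> up to exponent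
  \<open>CARD('n)\<close> are one too many to be independent, and a linear dependence is an
  annihilating polynomial. A repeated iterate would be invisible to dependence of the set of
  iterates, hence the separate case, where a difference of two monomials annihilates.\<close>

lemma annihilating_poly:
  fixes A :: "real^'n^'n" and x :: "complex^'n"
  obtains p where "p \<noteq> 0" "poly_mat A p x = 0"
proof -
  define f where "f i = ((*v) (map_matrix complex_of_real A) ^^ i) x" for i
  have pm: "poly_mat A (monom c i) x = c *s f i" for c i
    by (induction i) (auto simp: monom_Suc f_def monom_0 vec.scale)
  show ?thesis
  proof (cases "inj_on f {..CARD('n)}")
    case False
    then obtain i j where ij: "i \<noteq> j" "f i = f j" by (auto simp: inj_on_def)
    have "monom 1 i + monom (-1) j \<noteq> (0 :: complex poly)"
      using ij by (auto simp: poly_eq_iff)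
    moreover have "poly_mat A (monom 1 i + monom (-1) j) x = 0"
      using ij by (simp add: poly_mat_add pm)
    ultimately show ?thesis by (rule that)
  next
    case True
    have "vec.dependent (f ` {..CARD('n)})"
    proof (rule ccontr)
      assume "\<not> vec.dependent (f ` {..CARD('n)})"
      then have "card (f ` {..CARD('n)}) \<le> CARD('n)"
        using vec.independent_card_le_dim[of "f ` {..CARD('n)}" UNIV] unfolding vec_dim_card by blast
      then show False using True by (simp add: card_image)
    qed
    then obtain u where u: "(\<Sum>v\<in>f ` {..CARD('n)}. u v *s v) = 0" "\<exists>v\<in>f ` {..CARD('n)}. u v \<noteq> 0"
      by (auto simp: vec.dependent_finite)
    define p where "p = (\<Sum>i\<le>CARD('n). monom (u (f i)) i)"
    have coeff: "coeff p i = (if i \<le> CARD('n) then u (f i) else 0)" for i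
      by (simp add: p_def coeff_sum)
    obtain i where "i \<le> CARD('n)" "u (f i) \<noteq> 0" using u(2) by auto
    with coeff[of i] have "p \<noteq> 0" by auto
    moreover have "poly_mat A p x = 0"
      using u(1) True by (simp add: p_def poly_mat_sum pm sum.reindex)
    ultimately show ?thesis by (rule that)
  qed
qed

text \<open>The integrating factor \<open>exp (- z t)\<close> removes the homogeneous part. What
  remains grows at most like \<open>exp ((\<nu> - \<mu>') t)\<close>, and multiplying back by
  \<open>exp (- \<nu> t)\<close> leaves the rate \<open>\<mu>'\<close>.\<close>

lemma exp_decay_linear_ode:
  fixes f g :: "real \<Rightarrow> complex"
  assumes f: "\<And>t. (f has_vector_derivative z * f t + g t) (at t)"
    and g: "\<And>t. t \<ge> 0 \<Longrightarrow> norm (g t) \<le> C * exp (- \<mu> * t)"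
    and z: "Re z < 0" and \<mu>: "\<mu> > 0"
  shows "\<exists>C' \<mu>'. \<mu>' > 0 \<and> (\<forall>t\<ge>0. norm (f t) \<le> C' * exp (- \<mu>' * t))"
proof -
  define \<nu> where "\<nu> = - Re z"
  \<comment> \<open>Halving \<open>\<nu>\<close> keeps \<open>\<nu> - \<mu>'\<close> positive, so
    that the resonance \<open>\<mu> = \<nu>\<close>, which brings a factor \<open>t\<close>, is no
    special case.\<close>
  define \<mu>' where "\<mu>' = min \<mu> (\<nu> / 2)"
  have \<mu>': "\<mu>' > 0" "\<mu>' \<le> \<mu>" "\<mu>' < \<nu>" using z \<mu> by (auto simp: \<mu>'_def \<nu>_def)
  have C: "C \<ge> 0" using g[of 0] by (simp add: order.trans[OF norm_ge_zero])
  define h where "h t = exp (- z * of_real t) * f t" for t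
  define \<phi> where "\<phi> t = C / (\<nu> - \<mu>') * exp ((\<nu> - \<mu>') * t)" for t
  have ne: "norm (exp (- z * of_real t)) = exp (\<nu> * t)" for t
    by (simp add: norm_exp_eq_Re \<nu>_def)
  have h': "(h has_vector_derivative exp (- z * of_real t) * g t) (at t)" for t
    unfolding h_def
    by (rule has_vector_derivative_eq_rhs[OF has_vector_derivative_mult[OF
          field_vector_diff_chain_at[of "\<lambda>t. - z * of_real t" "- z" t exp, unfolded o_def] f]])
       (auto intro!: derivative_eq_intros simp: algebra_simps)
  have \<phi>': "(\<phi> has_vector_derivative C * exp ((\<nu> - \<mu>') * t)) (at t)" for t
    unfolding \<phi>_def has_real_derivative_iff_has_vector_derivative[symmetric]
    using \<mu>' by (auto intro!: derivative_eq_intros)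
  have "norm (f t) \<le> (norm (f 0) + C / (\<nu> - \<mu>')) * exp (- \<mu>' * t)" if t: "t \<ge> 0" for t
  proof -
    have "norm (h t - h 0) \<le> \<phi> t - \<phi> 0"
    proof (cases "t = 0")
      case False
      show ?thesis
      proof (rule differentiable_bound_general)
        show "0 < t" using t False by simp
        show "continuous_on {0..t} h" "continuous_on {0..t} \<phi>"
          using h' \<phi>' by (meson has_vector_derivative_continuous continuous_at_imp_continuous_on)+
        fix x assume x: "0 < x" "x < t"
        show "(h has_vector_derivative exp (- z * of_real x) * g x) (at x)" by (rule h')
        show "(\<phi> has_vector_derivative C * exp ((\<nu> - \<mu>') * x)) (at x)" by (rule \<phi>')
        have "norm (exp (- z * of_real x) * g x) \<le> exp (\<nu> * x) * (C * exp (- \<mu> * x))"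
          unfolding norm_mult ne using g[of x] x by (intro mult_left_mono) auto
        also have "\<dots> \<le> exp (\<nu> * x) * (C * exp (- \<mu>' * x))"
          using \<mu>' x C by (intro mult_left_mono) auto
        also have "\<dots> = C * exp ((\<nu> - \<mu>') * x)" by (simp add: algebra_simps exp_diff exp_minus divide_inverse)
        finally show "norm (exp (- z * of_real x) * g x) \<le> C * exp ((\<nu> - \<mu>') * x)" .
      qed
    qed simp
    also have "\<dots> \<le> C / (\<nu> - \<mu>') * exp ((\<nu> - \<mu>') * t)"
      using C \<mu>' by (simp add: \<phi>_def)
    finally have "norm (h t) \<le> norm (f 0) + C / (\<nu> - \<mu>') * exp ((\<nu> - \<mu>') * t)"
      using norm_triangle_ineq2[of "h t" "h 0"] by (simp add: h_def)
    moreover have "norm (h t) = exp (\<nu> * t) * norm (f t)" 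
      by (simp only: h_def norm_mult ne)
    ultimately have "norm (f t) \<le> exp (- \<nu> * t) * (norm (f 0) + C / (\<nu> - \<mu>') * exp ((\<nu> - \<mu>') * t))"
      by (simp add: exp_minus field_simps)
    also have "\<dots> = norm (f 0) * exp (- \<nu> * t) + C / (\<nu> - \<mu>') * exp (- \<mu>' * t)"
      by (simp add: algebra_simps exp_diff exp_minus divide_inverse exp_add)
    also have "norm (f 0) * exp (- \<nu> * t) \<le> norm (f 0) * exp (- \<mu>' * t)"
      using \<mu>' t by (intro mult_left_mono) (auto intro: mult_right_mono)
    finally show ?thesis by (simp add: algebra_simps)
  qed
  with \<mu>' show ?thesis by blast
qed

abbreviation cexp_mat :: "real^'n^'n \<Rightarrow> real \<Rightarrow> complex^'n \<Rightarrow> complex^'n" where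
  "cexp_mat A t x \<equiv> map_matrix complex_of_real (matrix_exp (t *\<^sub>R A)) *v x"

lemma has_vector_derivative_cexp_mat:
  "((\<lambda>t. cexp_mat A t x $ j) has_vector_derivative
     cexp_mat A t (map_matrix complex_of_real A *v x) $ j) (at t)"
proof -
  have "((\<lambda>t. \<Sum>l\<in>UNIV. of_real (matrix_exp (t *\<^sub>R A) $ j $ l) * x $ l) has_vector_derivative
      (\<Sum>l\<in>UNIV. of_real (\<Sum>k\<in>UNIV. matrix_exp (t *\<^sub>R A) $ j $ k * A $ k $ l) * x $ l)) (at t)"
    by (intro has_vector_derivative_sum has_vector_derivative_mult_left has_vector_derivative_of_real
        has_field_derivative_matrix_exp2)
  also have "(\<Sum>l\<in>UNIV. of_real (\<Sum>k\<in>UNIV. matrix_exp (t *\<^sub>R A) $ j $ k * A $ k $ l) * x $ l) =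
      (\<Sum>k\<in>UNIV. \<Sum>l\<in>UNIV. of_real (matrix_exp (t *\<^sub>R A) $ j $ k) * (of_real (A $ k $ l) * x $ l))"
    by (subst sum.swap) (simp add: sum_distrib_right mult.assoc)
  finally show ?thesis
    by (simp add: matrix_vector_mult_def map_matrix_def sum_distrib_left)
qed

text \<open>Induction on the degree, splitting off a root \<open>z\<close> with cofactor
  \<open>q\<close>. If q(A) x = 0, the induction hypothesis applies to \<open>x\<close>. Otherwise
  q(A) x is an eigenvector for \<open>z\<close>, so \<open>Re z < 0\<close>; as \<open>q\<close>
  annihilates y = A x - z x, the trajectory of \<open>x\<close> solves a scalar equation with rate
  \<open>z\<close> and the decaying trajectory of y as forcing. This takes the place of the Jordan
  form.\<close>

lemma poly_mat_decay:
  fixes A :: "real^'n^'n"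
  assumes stable: "\<And>z. complex_eigenvalue A z \<Longrightarrow> Re z < 0"
  assumes "p \<noteq> 0" "poly_mat A p x = 0"
  shows "\<exists>C \<mu>. \<mu> > 0 \<and> (\<forall>t\<ge>0. norm (cexp_mat A t x $ j) \<le> C * exp (- \<mu> * t))"
  using assms(2,3)
proof (induction "degree p" arbitrary: p x rule: less_induct)
  case less
  show ?case
  proof (cases "degree p = 0")
    case True
    then obtain c where "p = [:c:]" by (rule degree_eq_zeroE)
    with less.prems have "x = 0" by (auto simp: vec.scale_eq_0_iff)
    then show ?thesis by (auto intro!: exI[of _ 0] exI[of _ 1])
  next
    case False
    then have "\<exists>z. poly p z = 0"
      using fundamental_theorem_of_algebra[of p] by (simp add: constant_degree)
    then obtain z q where p: "p = [:-z, 1:] * q" by (auto simp: poly_eq_0_iff_dvd dvd_def)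
    with less.prems have q: "q \<noteq> 0" by auto
    then have deg: "degree q < degree p" by (simp add: p degree_mult_eq del: mult_pCons_left)
    show ?thesis
    proof (cases "poly_mat A q x = 0")
      case True
      with less.hyps[OF deg q] show ?thesis by blast
    next
      case False
      let ?y = "map_matrix complex_of_real A *v x - z *s x"
      have "map_matrix complex_of_real A *v poly_mat A q x = z *s poly_mat A q x"
        using less.prems(2) unfolding p poly_mat_linear_factor by simp
      with False have "complex_eigenvalue A z" unfolding complex_eigenvalue_def by blast
      then have z: "Re z < 0" by (rule stable)
      have "poly_mat A q ?y = 0"
        using less.prems(2) unfolding p poly_mat_linear_factor2 .
      with less.hyps[OF deg q] obtain C \<mu>
        where C: "\<mu> > 0" "\<forall>t\<ge>0. norm (cexp_mat A t ?y $ j) \<le> C * exp (- \<mu> * t)" by blast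
      show ?thesis
      proof (rule exp_decay_linear_ode[OF _ _ z C(1)])
        show "norm (cexp_mat A t ?y $ j) \<le> C * exp (- \<mu> * t)" if "t \<ge> 0" for t
          using C(2) that by blast
        show "((\<lambda>t. cexp_mat A t x $ j) has_vector_derivative
            z * cexp_mat A t x $ j + cexp_mat A t ?y $ j) (at t)" for t
          using has_vector_derivative_cexp_mat[of A x j t]
          by (simp add: vec.diff vec.scale)
      qed
    qed
  qed
qed

lemma exp_decay_uniform:
  fixes f :: "'i::finite \<Rightarrow> real \<Rightarrow> real"
  assumes "\<And>i. \<exists>C \<mu>. \<mu> > 0 \<and> (\<forall>t\<ge>0. f i t \<le> C * exp (- \<mu> * t))"
  shows "\<exists>C \<mu>. C > 0 \<and> \<mu> > 0 \<and> (\<forall>i. \<forall>t\<ge>0. f i t \<le> C * exp (- \<mu> * t))"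
proof -
  obtain C \<mu> where C: "\<And>i. \<mu> i > 0" "\<And>i t. t \<ge> 0 \<Longrightarrow> f i t \<le> C i * exp (- \<mu> i * t)"
    using assms by metis
  define C' where "C' = Max (range (\<lambda>i. \<bar>C i\<bar>)) + 1"
  define \<mu>' where "\<mu>' = Min (range \<mu>)"
  have C': "\<bar>C i\<bar> \<le> C'" for i unfolding C'_def by (intro add_increasing2 Max_ge) auto
  have "C' > 0" unfolding C'_def by (rule add_nonneg_pos[OF order.trans[OF abs_ge_zero Max_ge]]) auto
  moreover have "\<mu>' > 0" unfolding \<mu>'_def by (subst Min_gr_iff) (auto simp: C)
  moreover have "f i t \<le> C' * exp (- \<mu>' * t)" if t: "t \<ge> 0" for i t
  proof -
    have "\<mu>' \<le> \<mu> i" unfolding \<mu>'_def by (intro Min_le) auto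
    have "f i t \<le> C i * exp (- \<mu> i * t)" by (rule C(2)[OF t])
    also have "\<dots> \<le> C' * exp (- \<mu>' * t)"
      using \<open>\<mu>' \<le> \<mu> i\<close> t C'[of i] \<open>C' > 0\<close> by (intro mult_mono) (auto intro: mult_right_mono)
    finally show ?thesis .
  qed
  ultimately show ?thesis by blast
qed

text \<open>Decay of the trajectories from the unit vectors \<open>axis j 1\<close> is decay of the
  columns of the exponential.\<close>

lemma matrix_exp_decay:
  fixes A :: "real^'n^'n"
  assumes stable: "\<And>z. complex_eigenvalue A z \<Longrightarrow> Re z < 0"
  shows "\<exists>C \<mu>. C > 0 \<and> \<mu> > 0 \<and> (\<forall>i j. \<forall>t\<ge>0. \<bar>matrix_exp (t *\<^sub>R A) $ i $ j\<bar> \<le> C * exp (- \<mu> * t))"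
proof -
  have "\<exists>C \<mu>. \<mu> > 0 \<and> (\<forall>t\<ge>0. (case ij of (i, j) \<Rightarrow> \<bar>matrix_exp (t *\<^sub>R A) $ i $ j\<bar>) \<le> C * exp (- \<mu> * t))"
    for ij :: "'n \<times> 'n"
  proof -
    obtain i j where ij: "ij = (i, j)" by force
    obtain p where "p \<noteq> 0" "poly_mat A p (axis j 1) = 0" by (rule annihilating_poly)
    from poly_mat_decay[OF stable this, of i] show ?thesis
      by (simp add: ij matrix_vector_mult_def axis_def if_distrib cong: if_cong)
  qed
  from exp_decay_uniform[of "\<lambda>ij t. case ij of (i, j) \<Rightarrow> \<bar>matrix_exp (t *\<^sub>R A) $ i $ j\<bar>", OF this]
  show ?thesis by (auto split: prod.splits)
qed

text \<open>The exponential bound makes \<open>f\<close> absolutely integrable, so by dominated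
  convergence the half-line integral is the limit of the integrals over \<open>[0, k]\<close>, where
  the ordinary fundamental theorem applies.\<close>

lemma has_integral_improper_FTC:
  fixes f :: "real \<Rightarrow> real"
  assumes F: "\<And>t. t \<ge> 0 \<Longrightarrow> (F has_field_derivative f t) (at t)"
    and cont: "continuous_on {0..} f"
    and bound: "\<And>t. t \<ge> 0 \<Longrightarrow> \<bar>f t\<bar> \<le> C * exp (- \<mu> * t)" and \<mu>: "\<mu> > 0"
    and lim: "(F \<longlongrightarrow> L) at_top"
  shows "(f has_integral (L - F 0)) {0..}"
proof -
  have g: "((\<lambda>t. C * exp (- \<mu> * t)) has_integral C * (exp (- \<mu> * 0) / \<mu>)) {0..}"
    by (intro has_integral_mult_right has_integral_exp_minus_to_infinity \<mu>)
  have ai: "f absolutely_integrable_on {0..}"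
  proof (rule measurable_bounded_by_integrable_imp_absolutely_integrable)
    show "f \<in> borel_measurable (lebesgue_on {0..})"
      by (rule continuous_imp_measurable_on_sets_lebesgue[OF cont]) auto
  qed (use g bound in \<open>auto simp: integrable_on_def\<close>)
  have lim1: "((\<lambda>k. integral {0..real k} f) \<longlonglongrightarrow> integral {0..} f)"
  proof -
    have "(\<lambda>k. integral {0..} (\<lambda>t. if t \<in> {0..real k} then f t else 0)) \<longlonglongrightarrow> integral {0..} f"
    proof (rule dominated_convergence(2)[where h="\<lambda>t. C * exp (- \<mu> * t)"])
      show "(\<lambda>t. if t \<in> {0..real k} then f t else 0) integrable_on {0..}" for k
      proof -
        have "f integrable_on {0..real k}"
          by (intro integrable_continuous_interval continuous_on_subset[OF cont]) auto
        then show ?thesis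
          by (subst integrable_restrict_Int) (auto simp: Int_absorb1 subset_eq Int_absorb2)
      qed
      show "(\<lambda>t. C * exp (- \<mu> * t)) integrable_on {0..}" using g by blast
      show "norm (if t \<in> {0..real k} then f t else 0) \<le> C * exp (- \<mu> * t)" if "t \<in> {0..}" for k t
        using bound[of t] that by (auto intro: order.trans[OF abs_ge_zero])
      show "(\<lambda>k. if t \<in> {0..real k} then f t else 0) \<longlonglongrightarrow> f t" if "t \<in> {0..}" for t
      proof (rule tendsto_eventually)
        have "\<forall>\<^sub>F k in sequentially. t \<le> real k"
          using filterlim_real_sequentially by (simp add: filterlim_at_top)
        then show "\<forall>\<^sub>F k in sequentially. (if t \<in> {0..real k} then f t else 0) = f t"
          by eventually_elim (use that in auto)
      qed
    qed
    moreover have "integral {0..} (\<lambda>t. if t \<in> {0..real k} then f t else 0) = integral {0..real k} f" for k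
      by (subst integral_restrict_Int) (auto intro!: arg_cong[where f="\<lambda>S. integral S f"])
    ultimately show ?thesis by simp
  qed
  have FTC: "integral {0..real k} f = F (real k) - F 0" for k
    by (intro integral_unique fundamental_theorem_of_calculus)
       (auto intro!: has_field_derivative_at_within[OF F] simp: has_real_derivative_iff_has_vector_derivative[symmetric])
  have "(\<lambda>k. F (real k) - F 0) \<longlonglongrightarrow> L - F 0"
    using filterlim_compose[OF lim filterlim_real_sequentially] by (intro tendsto_diff tendsto_const)
  with lim1 have "integral {0..} f = L - F 0"
    unfolding FTC by (rule LIMSEQ_unique)
  moreover have "f integrable_on {0..}" using ai by (simp add: absolutely_integrable_on_def)
  ultimately show ?thesis by (simp add: has_integral_iff)
qed

section \<open>Resolvents and the Lyapunov equation\<close>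

text \<open>\<open>G\<close> is the semigroup of the matrix \<open>a\<close>, asked for only through
  its equation, its initial value and its decay. In this form the property passes to Kronecker sums
  without any identity between matrix exponentials; coefficient functions on a finite type allow
  pairs as indices.\<close>

definition decaying :: "('x::finite \<Rightarrow> 'x \<Rightarrow> real) \<Rightarrow> bool" where
  "decaying a \<longleftrightarrow> (\<exists>G C \<mu>. \<mu> > 0 \<and> (\<forall>x y. G x y 0 = of_bool (x = y)) \<and>
     (\<forall>x y t. (G x y has_field_derivative (\<Sum>z\<in>UNIV. G x z t * a z y)) (at t)) \<and>
     (\<forall>x y. \<forall>t\<ge>0. \<bar>G x y t\<bar> \<le> C * exp (- \<mu> * t)))"

lemma decaying_matrix:
  assumes "\<And>z. complex_eigenvalue A z \<Longrightarrow> Re z < 0"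
  shows "decaying (\<lambda>i j. A $ i $ j)"
proof -
  obtain C \<mu> where "\<mu> > 0" "\<forall>i j. \<forall>t\<ge>0. \<bar>matrix_exp (t *\<^sub>R A) $ i $ j\<bar> \<le> C * exp (- \<mu> * t)"
    using matrix_exp_decay[OF assms] by blast
  then show ?thesis
    unfolding decaying_def
    by (intro exI[of _ "\<lambda>i j t. matrix_exp (t *\<^sub>R A) $ i $ j"] exI[of _ C] exI[of _ \<mu>])
       (auto intro!: has_field_derivative_matrix_exp2 simp: mat_def)
qed

section \<open>Kronecker sums and their decay\<close>

lemma sum_of_bool_left: "(\<Sum>z\<in>(UNIV::'a::finite set). of_bool (x = z) * f z) = (f x :: 'b::semiring_1)"
  by (simp add: of_bool_def if_distrib[of "\<lambda>a. a * _"] cong: if_cong)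

lemma sum_of_bool_right: "(\<Sum>z\<in>(UNIV::'a::finite set). f z * of_bool (z = x)) = (f x :: 'b::semiring_1)"
  by (simp add: of_bool_def if_distrib[of "\<lambda>a. _ * a"] cong: if_cong)

lemma sum_UNIV_prod:
  "(\<Sum>z\<in>(UNIV::('a::finite \<times> 'b::finite) set). f z) = (\<Sum>i\<in>UNIV. \<Sum>j\<in>UNIV. f (i, j))"
  unfolding UNIV_Times_UNIV[symmetric] by (simp add: sum.cartesian_product split_def)

text \<open>The operator \<open>a \<otimes> 1 + 1 \<otimes> b\<close>. Iterated with the drift
  matrix of \<open>u\<close>, it is the action of the drift on products of components of
  \<open>u\<close>.\<close>

definition kronecker_sum ::
  "('x \<Rightarrow> 'x \<Rightarrow> real) \<Rightarrow> ('y \<Rightarrow> 'y \<Rightarrow> real) \<Rightarrow> 'x \<times> 'y \<Rightarrow> 'x \<times> 'y \<Rightarrow> real" where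
  "kronecker_sum a b p q = a (fst p) (fst q) * of_bool (snd p = snd q) + of_bool (fst p = fst q) * b (snd p) (snd q)"

text \<open>The semigroup of a Kronecker sum is the product of the two semigroups: Leibniz's rule
  gives its equation, and the rates add up.\<close>

lemma decaying_kronecker_sum:
  fixes a :: "'x::finite \<Rightarrow> 'x \<Rightarrow> real" and b :: "'y::finite \<Rightarrow> 'y \<Rightarrow> real"
  assumes "decaying a" "decaying b"
  shows "decaying (kronecker_sum a b)"
proof -
  obtain G C \<mu> where G: "\<mu> > 0" "\<And>x y. G x y 0 = of_bool (x = y)"
    "\<And>x y t. (G x y has_field_derivative (\<Sum>z\<in>UNIV. G x z t * a z y)) (at t)"
    "\<And>x y t. t \<ge> 0 \<Longrightarrow> \<bar>G x y t\<bar> \<le> C * exp (- \<mu> * t)"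
    using assms(1) unfolding decaying_def by blast
  obtain H D \<nu> where H: "\<nu> > 0" "\<And>x y. H x y 0 = of_bool (x = y)"
    "\<And>x y t. (H x y has_field_derivative (\<Sum>z\<in>UNIV. H x z t * b z y)) (at t)"
    "\<And>x y t. t \<ge> 0 \<Longrightarrow> \<bar>H x y t\<bar> \<le> D * exp (- \<nu> * t)"
    using assms(2) unfolding decaying_def by blast
  define K where "K p q t = G (fst p) (fst q) t * H (snd p) (snd q) t" for p q t
  have 1: "K p q 0 = of_bool (p = q)" for p q
    by (auto simp: K_def G(2) H(2) prod_eq_iff)
  have 2: "(K p q has_field_derivative (\<Sum>z\<in>UNIV. K p z t * kronecker_sum a b z q)) (at t)" for p q t
  proof -
    obtain i j k l where pq: "p = (i, j)" "q = (k, l)" by force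
    have "(\<Sum>z\<in>UNIV. K p z t * kronecker_sum a b z q) =
        (\<Sum>x\<in>UNIV. \<Sum>y\<in>UNIV. (G i x t * a x k * H j y t) * of_bool (y = l)) +
        (\<Sum>x\<in>UNIV. (G i x t * of_bool (x = k)) * (\<Sum>y\<in>UNIV. H j y t * b y l))"
      by (simp add: sum_UNIV_prod K_def kronecker_sum_def pq algebra_simps sum.distrib sum_distrib_left)
    also have "\<dots> = (\<Sum>x\<in>UNIV. G i x t * a x k) * H j l t + G i k t * (\<Sum>y\<in>UNIV. H j y t * b y l)"
      by (simp only: sum_of_bool_right sum_distrib_right[symmetric])
    finally show ?thesis
      unfolding K_def pq fst_conv snd_conv
      by (auto intro!: derivative_eq_intros G(3) H(3))
  qed
  have 3: "\<bar>K p q t\<bar> \<le> (C * D) * exp (- (\<mu> + \<nu>) * t)" if "t \<ge> 0" for p q t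
  proof -
    have "\<bar>K p q t\<bar> \<le> (C * exp (- \<mu> * t)) * (D * exp (- \<nu> * t))"
      unfolding K_def abs_mult by (intro mult_mono' G(4) H(4) that abs_ge_zero)
    also have "\<dots> = (C * D) * exp (- (\<mu> + \<nu>) * t)"
      by (simp add: algebra_simps exp_add[symmetric])
    finally show ?thesis .
  qed
  show ?thesis
    unfolding decaying_def
    by (intro exI[of _ K] exI[of _ "C * D"] exI[of _ "\<mu> + \<nu>"]) (use 1 2 3 G(1) H(1) in auto)
qed

lemma tendsto_exp_decay:
  fixes C \<mu> :: real
  assumes "\<mu> > 0"
  shows "((\<lambda>t. C * exp (- \<mu> * t)) \<longlongrightarrow> 0) at_top"
proof -
  have "filterlim (\<lambda>t. \<mu> * t) at_top at_top"
    by (intro filterlim_tendsto_pos_mult_at_top[OF tendsto_const assms] filterlim_ident)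
  then have "filterlim (\<lambda>t. - \<mu> * t) at_bot at_top"
    by (simp add: filterlim_uminus_at_bot)
  then have "((\<lambda>t. C * exp (- \<mu> * t)) \<longlongrightarrow> C * 0) at_top"
    by (intro tendsto_mult tendsto_const filterlim_compose[OF exp_at_bot])
  then show ?thesis by simp
qed

text \<open>The solution is minus the integral over the half-line of
  \<open>exp (- \<i> \<omega> t)\<close> times the semigroup applied to \<open>r\<close>. The
  oscillating factor has modulus one, so a single constant serves all \<open>\<omega>\<close>, hence
  all harmonics of the angle.\<close>

lemma decaying_bound:
  fixes a :: "'x::finite \<Rightarrow> 'x \<Rightarrow> real"
  assumes "decaying a"
  shows "\<exists>C\<ge>0. \<forall>(F :: 'x \<Rightarrow> complex) \<omega> r K.
    (\<forall>y. (\<Sum>z\<in>UNIV. of_real (a y z) * F z) - \<i> * of_real \<omega> * F y = r y) \<longrightarrow>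
    (\<forall>y. norm (r y) \<le> K) \<longrightarrow> (\<forall>x. norm (F x) \<le> C * K)"
proof -
  obtain G C \<mu> where G: "\<mu> > 0" "\<And>x y. G x y 0 = of_bool (x = y)"
    "\<And>x y t. (G x y has_field_derivative (\<Sum>z\<in>UNIV. G x z t * a z y)) (at t)"
    "\<And>x y t. t \<ge> 0 \<Longrightarrow> \<bar>G x y t\<bar> \<le> C * exp (- \<mu> * t)"
    using assms unfolding decaying_def by blast
  have C: "C \<ge> 0" using G(4)[of 0] by (metis abs_ge_zero exp_zero mult_zero_right mult.right_neutral order.trans order_refl)
  let ?N = "real CARD('x)"
  have "norm (F x) \<le> (?N * C / \<mu>) * K"
    if eq: "\<forall>y. (\<Sum>z\<in>UNIV. of_real (a y z) * F z) - \<i> * of_real \<omega> * F y = r y"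
      and r: "\<forall>y. norm (r y) \<le> K" for F :: "'x \<Rightarrow> complex" and \<omega> r K x
  proof -
    have K: "K \<ge> 0" using r[rule_format, of x] by (rule order.trans[OF norm_ge_zero])
    define e where "e t = exp (- \<i> * of_real \<omega> * of_real t)" for t
    have ne: "norm (e t) = 1" for t by (simp add: e_def norm_exp_eq_Re)
    have e': "(e has_vector_derivative - \<i> * of_real \<omega> * e t) (at t)" for t
      unfolding e_def
      by (rule has_vector_derivative_eq_rhs[OF field_vector_diff_chain_at[of "\<lambda>t. - \<i> * of_real \<omega> * of_real t"
           "- \<i> * of_real \<omega>" t exp, unfolded o_def]])
         (auto intro!: derivative_eq_intros)
    \<comment> \<open>\<open>\<Phi>\<close> starts at \<open>F x\<close> and tends to 0, while the
      equation for \<open>F\<close> turns its derivative into the semigroup applied to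
      \<open>r\<close>; so \<open>norm (F x)\<close> is bounded by the integral of the exponential
      bound.\<close>
    define \<Phi> where "\<Phi> t = e t * (\<Sum>y\<in>UNIV. of_real (G x y t) * F y)" for t
    have \<Phi>': "(\<Phi> has_vector_derivative e t * (\<Sum>y\<in>UNIV. of_real (G x y t) * r y)) (at t)" for t
    proof -
      have "(\<Phi> has_vector_derivative e t * (\<Sum>y\<in>UNIV. of_real (\<Sum>z\<in>UNIV. G x z t * a z y) * F y) +
          - \<i> * of_real \<omega> * e t * (\<Sum>y\<in>UNIV. of_real (G x y t) * F y)) (at t)"
        unfolding \<Phi>_def
        by (intro has_vector_derivative_mult e' has_vector_derivative_sum has_vector_derivative_mult_left
            has_vector_derivative_of_real G(3))
      also have "(\<Sum>y\<in>UNIV. of_real (\<Sum>z\<in>UNIV. G x z t * a z y) * F y) =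
          (\<Sum>z\<in>UNIV. of_real (G x z t) * (\<Sum>y\<in>UNIV. of_real (a z y) * F y))"
        by (simp add: sum_distrib_right sum_distrib_left mult.assoc) (rule sum.swap)
      also have "e t * \<dots> + - \<i> * of_real \<omega> * e t * (\<Sum>y\<in>UNIV. of_real (G x y t) * F y) =
          e t * (\<Sum>z\<in>UNIV. of_real (G x z t) * ((\<Sum>y\<in>UNIV. of_real (a z y) * F y) - \<i> * of_real \<omega> * F z))"
        by (simp add: right_diff_distrib sum_subtractf sum_distrib_left sum_negf mult_ac)
      also have "\<dots> = e t * (\<Sum>y\<in>UNIV. of_real (G x y t) * r y)" by (simp add: eq)
      finally show ?thesis .
    qed
    define \<phi> where "\<phi> t = - (?N * C * K / \<mu>) * exp (- \<mu> * t)" for t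
    have \<phi>': "(\<phi> has_vector_derivative ?N * C * K * exp (- \<mu> * t)) (at t)" for t
      unfolding \<phi>_def has_real_derivative_iff_has_vector_derivative[symmetric]
      using G(1) by (auto intro!: derivative_eq_intros)
    have bd: "norm (\<Phi> t - \<Phi> 0) \<le> ?N * C * K / \<mu>" if t: "t > 0" for t
    proof -
      have "norm (\<Phi> t - \<Phi> 0) \<le> \<phi> t - \<phi> 0"
      proof (rule differentiable_bound_general[OF t])
        show "continuous_on {0..t} \<Phi>" "continuous_on {0..t} \<phi>"
          using \<Phi>' \<phi>' by (meson has_vector_derivative_continuous continuous_at_imp_continuous_on)+
        fix s assume s: "0 < s" "s < t"
        show "(\<Phi> has_vector_derivative e s * (\<Sum>y\<in>UNIV. of_real (G x y s) * r y)) (at s)" by (rule \<Phi>')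
        show "(\<phi> has_vector_derivative ?N * C * K * exp (- \<mu> * s)) (at s)" by (rule \<phi>')
        have "norm (e s * (\<Sum>y\<in>UNIV. of_real (G x y s) * r y)) \<le> (\<Sum>y\<in>(UNIV::'x set). (C * exp (- \<mu> * s)) * K)"
          unfolding norm_mult ne mult_1 using s r G(4) C
          by (intro sum_norm_le) (auto simp: norm_mult intro!: mult_mono)
        then show "norm (e s * (\<Sum>y\<in>UNIV. of_real (G x y s) * r y)) \<le> ?N * C * K * exp (- \<mu> * s)"
          by (simp add: mult_ac)
      qed
      also have "\<dots> \<le> ?N * C * K / \<mu>"
        using C K G(1) by (simp add: \<phi>_def)
      finally show ?thesis .
    qed

    have "(\<Phi> \<longlongrightarrow> 0) at_top"
    proof (rule Lim_null_comparison)
      show "\<forall>\<^sub>F t in at_top. norm (\<Phi> t) \<le> (\<Sum>y\<in>UNIV. (C * exp (- \<mu> * t)) * norm (F y))"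
        using eventually_ge_at_top[of 0]
      proof eventually_elim
        case (elim t)
        then show ?case unfolding \<Phi>_def norm_mult ne mult_1 using G(4) C
          by (intro sum_norm_le) (auto simp: norm_mult intro!: mult_right_mono)
      qed
      have "((\<lambda>t. \<Sum>y\<in>UNIV. (C * exp (- \<mu> * t)) * norm (F y)) \<longlongrightarrow> (\<Sum>y\<in>(UNIV::'x set). 0 * norm (F y))) at_top"
        by (intro tendsto_sum tendsto_mult tendsto_const tendsto_exp_decay G(1))
      then show "((\<lambda>t. \<Sum>y\<in>UNIV. (C * exp (- \<mu> * t)) * norm (F y)) \<longlongrightarrow> 0) at_top" by simp
    qed
    then have "((\<lambda>t. norm (\<Phi> t - \<Phi> 0)) \<longlongrightarrow> norm (0 - \<Phi> 0)) at_top"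
      by (intro tendsto_intros)
    moreover have "\<forall>\<^sub>F t in at_top. norm (\<Phi> t - \<Phi> 0) \<le> ?N * C * K / \<mu>"
      using eventually_gt_at_top[of 0] by eventually_elim (rule bd)
    ultimately have "norm (0 - \<Phi> 0) \<le> ?N * C * K / \<mu>"
      by (rule tendsto_upperbound) simp
    moreover have "\<Phi> 0 = F x"
      using sum_of_bool_left[of x F] by (simp add: \<Phi>_def e_def G(2) of_bool_def if_distrib cong: if_cong)
    ultimately show ?thesis by (simp add: mult_ac)
  qed
  moreover have "?N * C / \<mu> \<ge> 0" using C G(1) by simp
  ultimately show ?thesis by blast
qed

section \<open>Resolvent bounds for tensors of degree one, two and three, uniform in the
  frequency\<close>

context
  fixes A :: "real^'n^'n"
  assumes stable: "\<And>z. complex_eigenvalue A z \<Longrightarrow> Re z < 0"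
begin

lemma tensor_bound1:
  "\<exists>C\<ge>0. \<forall>(F :: 'n \<Rightarrow> complex) \<omega> r K.
    (\<forall>i. (\<Sum>l\<in>UNIV. of_real (A $ i $ l) * F l) - \<i> * of_real \<omega> * F i = r i) \<longrightarrow>
    (\<forall>i. norm (r i) \<le> K) \<longrightarrow> (\<forall>i. norm (F i) \<le> C * K)"
  by (rule decaying_bound[OF decaying_matrix[OF stable]])

text \<open>\<open>A\<close> acting on each index separately is the Kronecker sum of
  \<open>A\<close> with itself, after reading the two indices as one index of pair type.\<close>

lemma tensor_bound2:
  "\<exists>C\<ge>0. \<forall>(F :: 'n \<Rightarrow> 'n \<Rightarrow> complex) \<omega> r K.
    (\<forall>i j. (\<Sum>l\<in>UNIV. of_real (A $ i $ l) * F l j) + (\<Sum>l\<in>UNIV. of_real (A $ j $ l) * F i l)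
       - \<i> * of_real \<omega> * F i j = r i j) \<longrightarrow>
    (\<forall>i j. norm (r i j) \<le> K) \<longrightarrow> (\<forall>i j. norm (F i j) \<le> C * K)"
proof -
  let ?a = "\<lambda>i j. A $ i $ j"
  obtain C where "C \<ge> 0" and C: "\<forall>(F :: 'n \<times> 'n \<Rightarrow> complex) \<omega> r K.
    (\<forall>y. (\<Sum>z\<in>UNIV. of_real (kronecker_sum ?a ?a y z) * F z) - \<i> * of_real \<omega> * F y = r y) \<longrightarrow>
    (\<forall>y. norm (r y) \<le> K) \<longrightarrow> (\<forall>x. norm (F x) \<le> C * K)"
    using decaying_bound[OF decaying_kronecker_sum[OF decaying_matrix[OF stable] decaying_matrix[OF stable]]]
    by blast
  have "norm (F i j) \<le> C * K"
    if "\<forall>i j. (\<Sum>l\<in>UNIV. of_real (A $ i $ l) * F l j) + (\<Sum>l\<in>UNIV. of_real (A $ j $ l) * F i l)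
       - \<i> * of_real \<omega> * F i j = r i j" "\<forall>i j. norm (r i j) \<le> K"
    for F r and K \<omega> :: real and i j
  proof -
    have "norm ((case (i, j) of (i, j) \<Rightarrow> F i j)) \<le> C * K"
    proof (rule C[rule_format, of "\<lambda>(i, j). F i j" \<omega> "\<lambda>(i, j). r i j" K "(i, j)"])
      fix y :: "'n \<times> 'n"
      obtain i j where y: "y = (i, j)" by force
      have "(\<Sum>z\<in>UNIV. of_real (kronecker_sum ?a ?a y z) * (case z of (i, j) \<Rightarrow> F i j)) =
        (\<Sum>k\<in>UNIV. \<Sum>l\<in>UNIV. of_bool (j = l) * (of_real (A $ i $ k) * F k l)) +
        (\<Sum>k\<in>UNIV. of_bool (i = k) * (\<Sum>l\<in>UNIV. of_real (A $ j $ l) * F k l))"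
      proof -
        have pt: "of_real (kronecker_sum ?a ?a y (k, l)) * (case (k, l) of (i, j) \<Rightarrow> F i j) =
            of_bool (j = l) * (of_real (A $ i $ k) * F k l) + of_bool (i = k) * (of_real (A $ j $ l) * F k l)" for k l
          by (cases "j = l"; cases "i = k") (simp_all add: y kronecker_sum_def distrib_right)
        show ?thesis by (simp only: sum_UNIV_prod pt sum.distrib sum_distrib_left)
      qed
      also have "\<dots> = (\<Sum>l\<in>UNIV. of_real (A $ i $ l) * F l j) + (\<Sum>l\<in>UNIV. of_real (A $ j $ l) * F i l)"
        by (simp only: sum_of_bool_left)
      finally show "(\<Sum>z\<in>UNIV. of_real (kronecker_sum ?a ?a y z) * (case z of (i, j) \<Rightarrow> F i j))
        - \<i> * of_real \<omega> * (case y of (i, j) \<Rightarrow> F i j) = (case y of (i, j) \<Rightarrow> r i j)"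
        using that(1) by (simp add: y)
      show "norm (case y of (i, j) \<Rightarrow> r i j) \<le> K" using that(2) by (simp add: y)
    qed
    then show ?thesis by simp
  qed
  with \<open>C \<ge> 0\<close> show ?thesis by blast
qed

lemma tensor_bound3:
  "\<exists>C\<ge>0. \<forall>(F :: 'n \<Rightarrow> 'n \<Rightarrow> 'n \<Rightarrow> complex) \<omega> r K.
    (\<forall>i j k. (\<Sum>l\<in>UNIV. of_real (A $ i $ l) * F l j k) + (\<Sum>l\<in>UNIV. of_real (A $ j $ l) * F i l k)
       + (\<Sum>l\<in>UNIV. of_real (A $ k $ l) * F i j l) - \<i> * of_real \<omega> * F i j k = r i j k) \<longrightarrow>
    (\<forall>i j k. norm (r i j k) \<le> K) \<longrightarrow> (\<forall>i j k. norm (F i j k) \<le> C * K)"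
proof -
  let ?a = "\<lambda>i j. A $ i $ j"
  let ?b = "kronecker_sum ?a (kronecker_sum ?a ?a)"
  obtain C where "C \<ge> 0" and C: "\<forall>(F :: 'n \<times> 'n \<times> 'n \<Rightarrow> complex) \<omega> r K.
    (\<forall>y. (\<Sum>z\<in>UNIV. of_real (?b y z) * F z) - \<i> * of_real \<omega> * F y = r y) \<longrightarrow>
    (\<forall>y. norm (r y) \<le> K) \<longrightarrow> (\<forall>x. norm (F x) \<le> C * K)"
    using decaying_bound[OF decaying_kronecker_sum[OF decaying_matrix[OF stable]
        decaying_kronecker_sum[OF decaying_matrix[OF stable] decaying_matrix[OF stable]]]]
    by blast
  have "norm (F i j k) \<le> C * K"
    if "\<forall>i j k. (\<Sum>l\<in>UNIV. of_real (A $ i $ l) * F l j k) + (\<Sum>l\<in>UNIV. of_real (A $ j $ l) * F i l k)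
       + (\<Sum>l\<in>UNIV. of_real (A $ k $ l) * F i j l) - \<i> * of_real \<omega> * F i j k = r i j k"
      "\<forall>i j k. norm (r i j k) \<le> K"
    for F r and K \<omega> :: real and i j k
  proof -
    have "norm ((case (i, j, k) of (i, j, k) \<Rightarrow> F i j k)) \<le> C * K"
    proof (rule C[rule_format, of "\<lambda>(i, j, k). F i j k" \<omega> "\<lambda>(i, j, k). r i j k" K "(i, j, k)"])
      fix y :: "'n \<times> 'n \<times> 'n"
      obtain i j k where y: "y = (i, j, k)" by (metis prod_cases3)
      have "(\<Sum>z\<in>UNIV. of_real (?b y z) * (case z of (i, j, k) \<Rightarrow> F i j k)) =
        (\<Sum>p\<in>UNIV. \<Sum>q\<in>UNIV. of_bool (j = q) * (\<Sum>s\<in>UNIV. of_bool (k = s) * (of_real (A $ i $ p) * F p q s))) +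
        (\<Sum>p\<in>UNIV. of_bool (i = p) * (\<Sum>q\<in>UNIV. \<Sum>s\<in>UNIV. of_bool (k = s) * (of_real (A $ j $ q) * F p q s))) +
        (\<Sum>p\<in>UNIV. of_bool (i = p) * (\<Sum>q\<in>UNIV. of_bool (j = q) * (\<Sum>s\<in>UNIV. of_real (A $ k $ s) * F p q s)))"
      proof -
        have pt: "of_real (?b y (p, q, s)) * (case (p, q, s) of (i, j, k) \<Rightarrow> F i j k) =
            of_bool (j = q) * (of_bool (k = s) * (of_real (A $ i $ p) * F p q s)) +
            (of_bool (i = p) * (of_bool (k = s) * (of_real (A $ j $ q) * F p q s)) +
            of_bool (i = p) * (of_bool (j = q) * (of_real (A $ k $ s) * F p q s)))" for p q s
          by (cases "j = q"; cases "i = p"; cases "k = s") (simp_all add: y kronecker_sum_def distrib_right)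
        show ?thesis by (simp only: sum_UNIV_prod pt sum.distrib sum_distrib_left add.assoc)
      qed
      also have "\<dots> = (\<Sum>l\<in>UNIV. of_real (A $ i $ l) * F l j k) + (\<Sum>l\<in>UNIV. of_real (A $ j $ l) * F i l k)
       + (\<Sum>l\<in>UNIV. of_real (A $ k $ l) * F i j l)"
        by (simp only: sum_of_bool_left)
      finally show "(\<Sum>z\<in>UNIV. of_real (?b y z) * (case z of (i, j, k) \<Rightarrow> F i j k))
        - \<i> * of_real \<omega> * (case y of (i, j, k) \<Rightarrow> F i j k) = (case y of (i, j, k) \<Rightarrow> r i j k)"
        using that(1) by (simp add: y)
      show "norm (case y of (i, j, k) \<Rightarrow> r i j k) \<le> K" using that(2) by (simp add: y)
    qed
    then show ?thesis by simp
  qed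
  with \<open>C \<ge> 0\<close> show ?thesis by blast
qed

end

section \<open>The integrals behind \<open>S_hat\<close> and \<open>stationary_cov\<close>\<close>

lemma has_integral_matrixI:
  fixes f :: "real \<Rightarrow> real^'n^'m"
  assumes "\<And>i j. ((\<lambda>t. f t $ i $ j) has_integral y $ i $ j) S"
  shows "(f has_integral y) S"
proof (subst has_integral_componentwise_iff, intro ballI)
  fix b :: "real^'n^'m" assume "b \<in> Basis"
  then obtain i j where b: "b = axis i (axis j 1)" by (auto simp: Basis_vec_def)
  have "x \<bullet> b = x $ i $ j" for x :: "real^'n^'m"
    by (simp add: b inner_axis)
  then show "((\<lambda>x. f x \<bullet> b) has_integral y \<bullet> b) S" using assms[of i j] by simp
qed

lemma integrable_on_exp_decay:
  fixes f :: "real \<Rightarrow> real"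
  assumes cont: "continuous_on {0..} f"
    and bound: "\<And>t. t \<ge> 0 \<Longrightarrow> \<bar>f t\<bar> \<le> C * exp (- \<mu> * t)" and \<mu>: "\<mu> > 0"
  shows "f integrable_on {0..}"
proof -
  have g: "((\<lambda>t. C * exp (- \<mu> * t)) has_integral C * (exp (- \<mu> * 0) / \<mu>)) {0..}"
    by (intro has_integral_mult_right has_integral_exp_minus_to_infinity \<mu>)
  have "f absolutely_integrable_on {0..}"
  proof (rule measurable_bounded_by_integrable_imp_absolutely_integrable)
    show "f \<in> borel_measurable (lebesgue_on {0..})"
      by (rule continuous_imp_measurable_on_sets_lebesgue[OF cont]) auto
  qed (use g bound in \<open>auto simp: integrable_on_def\<close>)
  then show ?thesis by (simp add: absolutely_integrable_on_def)
qed

lemma exp_decay_tendsto_0: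
  fixes f :: "real \<Rightarrow> real"
  assumes bound: "\<And>t. t \<ge> 0 \<Longrightarrow> \<bar>f t\<bar> \<le> C * exp (- \<mu> * t)" and \<mu>: "\<mu> > 0"
  shows "(f \<longlongrightarrow> 0) at_top"
proof (rule Lim_null_comparison)
  show "\<forall>\<^sub>F t in at_top. norm (f t) \<le> C * exp (- \<mu> * t)"
    using eventually_ge_at_top[of 0] by eventually_elim (use bound in auto)
  show "((\<lambda>t. C * exp (- \<mu> * t)) \<longlongrightarrow> 0) at_top" by (rule tendsto_exp_decay[OF \<mu>])
qed

lemma continuous_on_matrix_exp_entry [continuous_intros]:
  "continuous_on S (\<lambda>t. matrix_exp (t *\<^sub>R A) $ i $ j)"
  using has_field_derivative_matrix_exp[of A i j]
  by (meson DERIV_isCont continuous_at_imp_continuous_on)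

text \<open>The witness is the row vector \<open>r\<close>, the integral of
  \<open>exp (- \<i> \<omega> t)\<close> times \<open>a\<close> applied to the exponential of
  \<open>t A\<close>. It is the resolvent at the imaginary frequency, and its real part is the
  cosine transform that defines \<open>S_hat\<close>. Cosine and sine parts are treated separately
  so that all integrals are real.\<close>

lemma S_hat_resolvent:
  fixes A :: "real^'n^'n" and a :: "real^'n"
  assumes stable: "\<And>z. complex_eigenvalue A z \<Longrightarrow> Re z < 0"
  shows "\<exists>r :: 'n \<Rightarrow> complex. (\<forall>k. Re (r k) = pi * (\<Sum>i\<in>UNIV. a $ i * S_hat A \<omega> $ i $ k)) \<and>
    (\<forall>k. (\<Sum>l\<in>UNIV. r l * of_real (A $ l $ k)) - \<i> * of_real \<omega> * r k = - of_real (a $ k))"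
proof -
  obtain C \<mu> where C: "C > 0" "\<mu> > 0"
    and dec: "\<And>i j t. t \<ge> 0 \<Longrightarrow> \<bar>matrix_exp (t *\<^sub>R A) $ i $ j\<bar> \<le> C * exp (- \<mu> * t)"
    using matrix_exp_decay[OF stable] by blast
  define c where "c i j = integral {0..} (\<lambda>t. cos (\<omega> * t) * matrix_exp (t *\<^sub>R A) $ i $ j)" for i j
  define s where "s i j = integral {0..} (\<lambda>t. sin (\<omega> * t) * matrix_exp (t *\<^sub>R A) $ i $ j)" for i j
  have bc: "\<bar>cos (\<omega> * t) * matrix_exp (t *\<^sub>R A) $ i $ j\<bar> \<le> C * exp (- \<mu> * t)"
    and bs: "\<bar>sin (\<omega> * t) * matrix_exp (t *\<^sub>R A) $ i $ j\<bar> \<le> C * exp (- \<mu> * t)" if "t \<ge> 0" for i j t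
    unfolding abs_mult using dec[OF that, of i j]
    by (auto intro: order.trans[OF mult_left_le_one_le])
  have hc: "((\<lambda>t. cos (\<omega> * t) * matrix_exp (t *\<^sub>R A) $ i $ j) has_integral c i j) {0..}" for i j
    unfolding c_def
    by (intro integrable_integral integrable_on_exp_decay[OF _ bc C(2)] continuous_intros)
  have hs: "((\<lambda>t. sin (\<omega> * t) * matrix_exp (t *\<^sub>R A) $ i $ j) has_integral s i j) {0..}" for i j
    unfolding s_def
    by (intro integrable_integral integrable_on_exp_decay[OF _ bs C(2)] continuous_intros)
  have "((\<lambda>t. cos (\<omega> * t) *\<^sub>R matrix_exp (t *\<^sub>R A)) has_integral (\<chi> i j. c i j)) {0..}"
    by (rule has_integral_matrixI) (use hc in simp)
  then have S: "S_hat A \<omega> = (1 / pi) *\<^sub>R (\<chi> i j. c i j)"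
    by (simp add: S_hat_def integral_unique)
  have bound: "\<bar>\<alpha> * x + \<beta> * (\<Sum>l\<in>UNIV. g l * A $ l $ k)\<bar> \<le> (\<bar>\<alpha>\<bar> * C + \<bar>\<beta>\<bar> * (\<Sum>l\<in>UNIV. C * \<bar>A $ l $ k\<bar>)) * exp (- \<mu> * t)"
    if "\<bar>x\<bar> \<le> C * exp (- \<mu> * t)" "\<And>l. \<bar>g l\<bar> \<le> C * exp (- \<mu> * t)"
    for \<alpha> \<beta> t k and x :: real and g :: "'n \<Rightarrow> real"
  proof -
    have "\<bar>\<Sum>l\<in>UNIV. g l * A $ l $ k\<bar> \<le> (\<Sum>l\<in>UNIV. (C * exp (- \<mu> * t)) * \<bar>A $ l $ k\<bar>)"
      by (intro order.trans[OF sum_abs sum_mono] order.trans[OF eq_refl[OF abs_mult] mult_right_mono] that abs_ge_zero)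
    moreover have "\<bar>\<alpha>\<bar> * \<bar>x\<bar> \<le> \<bar>\<alpha>\<bar> * (C * exp (- \<mu> * t))"
      by (intro mult_left_mono that) auto
    ultimately have "\<bar>\<alpha> * x\<bar> + \<bar>\<beta> * (\<Sum>l\<in>UNIV. g l * A $ l $ k)\<bar> \<le>
       \<bar>\<alpha>\<bar> * (C * exp (- \<mu> * t)) + \<bar>\<beta>\<bar> * (\<Sum>l\<in>UNIV. (C * exp (- \<mu> * t)) * \<bar>A $ l $ k\<bar>)"
      unfolding abs_mult by (simp add: add_mono mult_left_mono)
    also have "\<dots> = (\<bar>\<alpha>\<bar> * C + \<bar>\<beta>\<bar> * (\<Sum>l\<in>UNIV. C * \<bar>A $ l $ k\<bar>)) * exp (- \<mu> * t)"
      by (simp add: algebra_simps sum_distrib_left)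
    finally show ?thesis by (meson abs_triangle_ineq order.trans)
  qed
  \<comment> \<open>The derivative of \<open>cos (\<omega> t)\<close> times the exponential
    integrates to minus its value at 0, the identity matrix. The sine counterpart below vanishes at
    0.\<close>
  have eqc: "- \<omega> * s i k + 1 * (\<Sum>l\<in>UNIV. c i l * A $ l $ k) = - of_bool (i = k)" for i k
  proof -
    have "((\<lambda>t. - \<omega> * (sin (\<omega> * t) * matrix_exp (t *\<^sub>R A) $ i $ k) +
        1 * (\<Sum>l\<in>UNIV. (cos (\<omega> * t) * matrix_exp (t *\<^sub>R A) $ i $ l) * A $ l $ k)) has_integral
        (0 - cos (\<omega> * 0) * matrix_exp (0 *\<^sub>R A) $ i $ k)) {0..}"
    proof (rule has_integral_improper_FTC[OF _ _ bound[OF bs bc] C(2) exp_decay_tendsto_0[OF bc C(2)]])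
      show "((\<lambda>t. cos (\<omega> * t) * matrix_exp (t *\<^sub>R A) $ i $ k) has_field_derivative
        - \<omega> * (sin (\<omega> * t) * matrix_exp (t *\<^sub>R A) $ i $ k) +
        1 * (\<Sum>l\<in>UNIV. (cos (\<omega> * t) * matrix_exp (t *\<^sub>R A) $ i $ l) * A $ l $ k)) (at t)" for t
        by (auto intro!: derivative_eq_intros has_field_derivative_matrix_exp2 simp: sum_distrib_left mult_ac)
    qed (auto intro!: continuous_intros)
    moreover have "((\<lambda>t. - \<omega> * (sin (\<omega> * t) * matrix_exp (t *\<^sub>R A) $ i $ k) +
        1 * (\<Sum>l\<in>UNIV. (cos (\<omega> * t) * matrix_exp (t *\<^sub>R A) $ i $ l) * A $ l $ k)) has_integral
        - \<omega> * s i k + 1 * (\<Sum>l\<in>UNIV. c i l * A $ l $ k)) {0..}"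
      by (intro has_integral_add has_integral_mult_right has_integral_sum has_integral_mult_left hs hc) auto
    ultimately show ?thesis
      by (auto dest: has_integral_unique simp: mat_def)
  qed
  have eqs: "\<omega> * c i k + 1 * (\<Sum>l\<in>UNIV. s i l * A $ l $ k) = 0" for i k
  proof -
    have "((\<lambda>t. \<omega> * (cos (\<omega> * t) * matrix_exp (t *\<^sub>R A) $ i $ k) +
        1 * (\<Sum>l\<in>UNIV. (sin (\<omega> * t) * matrix_exp (t *\<^sub>R A) $ i $ l) * A $ l $ k)) has_integral
        (0 - sin (\<omega> * 0) * matrix_exp (0 *\<^sub>R A) $ i $ k)) {0..}"
    proof (rule has_integral_improper_FTC[OF _ _ bound[OF bc bs] C(2) exp_decay_tendsto_0[OF bs C(2)]])
      show "((\<lambda>t. sin (\<omega> * t) * matrix_exp (t *\<^sub>R A) $ i $ k) has_field_derivative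
        \<omega> * (cos (\<omega> * t) * matrix_exp (t *\<^sub>R A) $ i $ k) +
        1 * (\<Sum>l\<in>UNIV. (sin (\<omega> * t) * matrix_exp (t *\<^sub>R A) $ i $ l) * A $ l $ k)) (at t)" for t
        by (auto intro!: derivative_eq_intros has_field_derivative_matrix_exp2 simp: sum_distrib_left mult_ac)
    qed (auto intro!: continuous_intros)
    moreover have "((\<lambda>t. \<omega> * (cos (\<omega> * t) * matrix_exp (t *\<^sub>R A) $ i $ k) +
        1 * (\<Sum>l\<in>UNIV. (sin (\<omega> * t) * matrix_exp (t *\<^sub>R A) $ i $ l) * A $ l $ k)) has_integral
        \<omega> * c i k + 1 * (\<Sum>l\<in>UNIV. s i l * A $ l $ k)) {0..}"
      by (intro has_integral_add has_integral_mult_right has_integral_sum has_integral_mult_left hs hc) auto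
    ultimately show ?thesis
      by (auto dest: has_integral_unique simp: mat_def)
  qed
  define r where "r k = Complex (\<Sum>i\<in>UNIV. a $ i * c i k) (- (\<Sum>i\<in>UNIV. a $ i * s i k))" for k
  have "Re (r k) = pi * (\<Sum>i\<in>UNIV. a $ i * S_hat A \<omega> $ i $ k)" for k
    by (simp add: r_def S sum_distrib_left)
  moreover have "(\<Sum>l\<in>UNIV. r l * of_real (A $ l $ k)) - \<i> * of_real \<omega> * r k = - of_real (a $ k)" for k
  proof (rule complex_eqI)
    have "Re ((\<Sum>l\<in>UNIV. r l * of_real (A $ l $ k)) - \<i> * of_real \<omega> * r k) =
        (\<Sum>l\<in>UNIV. (\<Sum>i\<in>UNIV. a $ i * c i l) * A $ l $ k) - \<omega> * (\<Sum>i\<in>UNIV. a $ i * s i k)"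
      by (simp add: r_def)
    also have "(\<Sum>l\<in>UNIV. (\<Sum>i\<in>UNIV. a $ i * c i l) * A $ l $ k) = (\<Sum>i\<in>UNIV. a $ i * (\<Sum>l\<in>UNIV. c i l * A $ l $ k))"
      by (simp add: sum_distrib_left sum_distrib_right mult.assoc) (rule sum.swap)
    also have "\<dots> - \<omega> * (\<Sum>i\<in>UNIV. a $ i * s i k) = (\<Sum>i\<in>UNIV. a $ i * (- \<omega> * s i k + 1 * (\<Sum>l\<in>UNIV. c i l * A $ l $ k)))"
      by (simp add: algebra_simps sum.distrib sum_subtractf sum_distrib_left)
    also have "\<dots> = - (\<Sum>i\<in>UNIV. a $ i * of_bool (i = k))" by (simp only: eqc mult_minus_right sum_negf)
    finally show "Re ((\<Sum>l\<in>UNIV. r l * of_real (A $ l $ k)) - \<i> * of_real \<omega> * r k) = Re (- of_real (a $ k))"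
      by (simp only: sum_of_bool_right uminus_complex.sel Re_complex_of_real)
    have "Im ((\<Sum>l\<in>UNIV. r l * of_real (A $ l $ k)) - \<i> * of_real \<omega> * r k) =
        - (\<Sum>l\<in>UNIV. (\<Sum>i\<in>UNIV. a $ i * s i l) * A $ l $ k) - \<omega> * (\<Sum>i\<in>UNIV. a $ i * c i k)"
      by (simp add: r_def sum_negf)
    also have "(\<Sum>l\<in>UNIV. (\<Sum>i\<in>UNIV. a $ i * s i l) * A $ l $ k) = (\<Sum>i\<in>UNIV. a $ i * (\<Sum>l\<in>UNIV. s i l * A $ l $ k))"
      by (simp add: sum_distrib_left sum_distrib_right mult.assoc) (rule sum.swap)
    also have "- \<dots> - \<omega> * (\<Sum>i\<in>UNIV. a $ i * c i k) = - (\<Sum>i\<in>UNIV. a $ i * (\<omega> * c i k + 1 * (\<Sum>l\<in>UNIV. s i l * A $ l $ k)))"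
      by (simp add: algebra_simps sum.distrib sum_subtractf sum_distrib_left)
    finally show "Im ((\<Sum>l\<in>UNIV. r l * of_real (A $ l $ k)) - \<i> * of_real \<omega> * r k) = Im (- of_real (a $ k))"
      by (simp only: eqs mult_zero_right sum.neutral_const) simp
  qed
  ultimately show ?thesis by blast
qed

lemma matrix_sandwich_entry:
  fixes X :: "real^'k^'n" and Q :: "real^'l^'k" and Y :: "real^'l^'m"
  shows "(X ** Q ** transpose Y) $ i $ j = (\<Sum>k\<in>UNIV. \<Sum>l\<in>UNIV. Q $ k $ l * (X $ i $ k * Y $ j $ l))"
proof -
  have "(X ** Q ** transpose Y) $ i $ j = (\<Sum>l\<in>UNIV. \<Sum>k\<in>UNIV. Q $ k $ l * (X $ i $ k * Y $ j $ l))"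
    by (simp add: matrix_matrix_mult_def transpose_def sum_distrib_right sum_distrib_left mult_ac)
  then show ?thesis by (subst sum.swap)
qed

text \<open>The integrand \<open>f\<close> of the covariance satisfies f' = A f + f A^T with value B
  B^T at 0 and limit 0 at infinity; integrating this equation over the half-line gives the Lyapunov
  equation.\<close>

lemma stationary_cov_lyapunov:
  fixes A :: "real^'n^'n" and B :: "real^'m^'n"
  assumes stable: "\<And>z. complex_eigenvalue A z \<Longrightarrow> Re z < 0"
  shows "(\<Sum>l\<in>UNIV. A $ i $ l * stationary_cov A B $ l $ j) + (\<Sum>l\<in>UNIV. A $ j $ l * stationary_cov A B $ i $ l)
    + (B ** transpose B) $ i $ j = 0"
proof -
  obtain C \<mu> where C: "C > 0" "\<mu> > 0"
    and dec: "\<And>i j t. t \<ge> 0 \<Longrightarrow> \<bar>matrix_exp (t *\<^sub>R A) $ i $ j\<bar> \<le> C * exp (- \<mu> * t)"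
    using matrix_exp_decay[OF stable] by blast
  define Q where "Q = B ** transpose B"
  define f where "f i j t = (\<Sum>k\<in>UNIV. \<Sum>l\<in>UNIV. Q $ k $ l * (matrix_exp (t *\<^sub>R A) $ i $ k * matrix_exp (t *\<^sub>R A) $ j $ l))" for i j t
  define D where "D = (\<Sum>k\<in>UNIV. \<Sum>l\<in>UNIV. \<bar>Q $ k $ l\<bar> * C\<^sup>2)"
  have b: "\<bar>f i j t\<bar> \<le> D * exp (- (2 * \<mu>) * t)" if "t \<ge> 0" for i j t
  proof -
    have "\<bar>f i j t\<bar> \<le> (\<Sum>k\<in>UNIV. \<Sum>l\<in>UNIV. \<bar>Q $ k $ l\<bar> * ((C * exp (- \<mu> * t)) * (C * exp (- \<mu> * t))))"
      unfolding f_def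
      by (intro order.trans[OF sum_abs sum_mono] order.trans[OF sum_abs sum_mono] order.trans[OF eq_refl[OF abs_mult]]
          mult_left_mono order.trans[OF eq_refl[OF abs_mult] mult_mono'] dec that abs_ge_zero)
    also have "\<dots> = D * exp (- (2 * \<mu>) * t)"
      by (simp add: D_def sum_distrib_right sum_distrib_left power2_eq_square algebra_simps exp_add[symmetric])
    finally show ?thesis .
  qed
  have f': "(f i j has_field_derivative (\<Sum>l\<in>UNIV. A $ i $ l * f l j t) + (\<Sum>l\<in>UNIV. A $ j $ l * f i l t)) (at t)" for i j t
  proof -
    let ?S = "\<lambda>i j. matrix_exp (t *\<^sub>R A) $ i $ j"
    have "(f i j has_field_derivative (\<Sum>k\<in>UNIV. \<Sum>l\<in>UNIV. Q $ k $ l *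
       ((\<Sum>m\<in>UNIV. A $ i $ m * ?S m k) * ?S j l + (\<Sum>m\<in>UNIV. A $ j $ m * ?S m l) * ?S i k))) (at t)"
      unfolding f_def
      by (intro DERIV_sum DERIV_cmult DERIV_mult has_field_derivative_matrix_exp)
    also have "(\<Sum>k\<in>UNIV. \<Sum>l\<in>UNIV. Q $ k $ l *
       ((\<Sum>m\<in>UNIV. A $ i $ m * ?S m k) * ?S j l + (\<Sum>m\<in>UNIV. A $ j $ m * ?S m l) * ?S i k)) =
       (\<Sum>k\<in>UNIV. \<Sum>l\<in>UNIV. \<Sum>m\<in>UNIV. A $ i $ m * (Q $ k $ l * (?S m k * ?S j l))) +
       (\<Sum>k\<in>UNIV. \<Sum>l\<in>UNIV. \<Sum>m\<in>UNIV. A $ j $ m * (Q $ k $ l * (?S i k * ?S m l)))"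
      by (simp add: algebra_simps sum.distrib sum_distrib_left)
    also have "\<dots> = (\<Sum>m\<in>UNIV. A $ i $ m * f m j t) + (\<Sum>m\<in>UNIV. A $ j $ m * f i m t)"
    proof -
      have swap: "(\<Sum>k\<in>UNIV. \<Sum>l\<in>UNIV. \<Sum>m\<in>UNIV. h k l m) = (\<Sum>m\<in>UNIV. \<Sum>k\<in>UNIV. \<Sum>l\<in>UNIV. h k l m)"
        for h :: "'n \<Rightarrow> 'n \<Rightarrow> 'n \<Rightarrow> real"
        by (subst (2) sum.swap) (subst sum.swap, rule refl)
      show ?thesis unfolding f_def by (subst (1 2) swap) (simp add: sum_distrib_left)
    qed
    finally show ?thesis .
  qed
  have cont: "continuous_on S (f i j)" for S i j
    unfolding f_def by (intro continuous_intros)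
  define R where "R i j = integral {0..} (f i j)" for i j
  have h: "(f i j has_integral R i j) {0..}" for i j
    unfolding R_def
    by (intro integrable_integral integrable_on_exp_decay[OF cont b]) (use C in auto)
  have "((\<lambda>t. matrix_exp (t *\<^sub>R A) ** B ** transpose B ** matrix_exp (t *\<^sub>R transpose A)) has_integral (\<chi> i j. R i j)) {0..}"
  proof (rule has_integral_matrixI)
    fix i j
    have "(matrix_exp (t *\<^sub>R A) ** B ** transpose B ** matrix_exp (t *\<^sub>R transpose A)) $ i $ j = f i j t" for t
    proof -
      have "matrix_exp (t *\<^sub>R A) ** B ** transpose B ** matrix_exp (t *\<^sub>R transpose A) =
          (matrix_exp (t *\<^sub>R A) ** Q) ** transpose (matrix_exp (t *\<^sub>R A))"
        by (simp add: Q_def matrix_mul_assoc matrix_exp_transpose)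
      then show ?thesis by (simp add: f_def matrix_sandwich_entry)
    qed
    then show "((\<lambda>t. (matrix_exp (t *\<^sub>R A) ** B ** transpose B ** matrix_exp (t *\<^sub>R transpose A)) $ i $ j)
        has_integral (\<chi> i j. R i j) $ i $ j) {0..}" using h[of i j] by simp
  qed
  then have RR: "stationary_cov A B $ i $ j = R i j" for i j
    by (simp add: stationary_cov_def integral_unique)
  let ?f' = "\<lambda>t. (\<Sum>l\<in>UNIV. A $ i $ l * f l j t) + (\<Sum>l\<in>UNIV. A $ j $ l * f i l t)"
  have "(?f' has_integral (0 - f i j 0)) {0..}"
  proof (rule has_integral_improper_FTC)
    show "\<bar>?f' t\<bar> \<le> ((\<Sum>l\<in>UNIV. \<bar>A $ i $ l\<bar> * D) + (\<Sum>l\<in>UNIV. \<bar>A $ j $ l\<bar> * D)) * exp (- (2 * \<mu>) * t)"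
      if "t \<ge> 0" for t
      unfolding distrib_right sum_distrib_right mult.assoc
      by (intro order.trans[OF abs_triangle_ineq add_mono] order.trans[OF sum_abs sum_mono]
          order.trans[OF eq_refl[OF abs_mult] mult_left_mono] b that abs_ge_zero)
    show "(f i j \<longlongrightarrow> 0) at_top" by (rule exp_decay_tendsto_0[OF b]) (use C in auto)
  qed (use C in \<open>auto intro!: f' continuous_intros cont\<close>)
  moreover have "(?f' has_integral (\<Sum>l\<in>UNIV. A $ i $ l * R l j) + (\<Sum>l\<in>UNIV. A $ j $ l * R i l)) {0..}"
    by (intro has_integral_add has_integral_sum has_integral_mult_right h) auto
  ultimately have "(\<Sum>l\<in>UNIV. A $ i $ l * R l j) + (\<Sum>l\<in>UNIV. A $ j $ l * R i l) = - f i j 0"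
    by (auto dest: has_integral_unique)
  moreover have "f i j 0 = Q $ i $ j"
  proof -
    have "f i j 0 = (\<Sum>k\<in>UNIV. of_bool (i = k) * (\<Sum>l\<in>UNIV. of_bool (j = l) * Q $ k $ l))"
      by (simp add: f_def mat_def of_bool_def sum_distrib_left mult_ac)
    then show ?thesis by (simp only: sum_of_bool_left)
  qed
  ultimately show ?thesis by (simp add: RR Q_def)
qed

section \<open>Averaging of a fast angle\<close>

text \<open>Big-O uniform over a set of parameters: one constant for all \<open>p\<close>. No limit
  is taken, so that \<open>\<epsilon>\<close> and \<open>T\<close> can be varied
  independently.\<close>

definition dominated :: "'p set \<Rightarrow> ('p \<Rightarrow> complex) \<Rightarrow> ('p \<Rightarrow> real) \<Rightarrow> bool" where
  "dominated P f g \<longleftrightarrow> (\<exists>C\<ge>0. \<forall>p\<in>P. norm (f p) \<le> C * g p)"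

lemma dominatedI: "C \<ge> 0 \<Longrightarrow> (\<And>p. p \<in> P \<Longrightarrow> norm (f p) \<le> C * g p) \<Longrightarrow> dominated P f g"
  by (auto simp: dominated_def)

lemma dominated_cong: "dominated P f g \<Longrightarrow> (\<And>p. p \<in> P \<Longrightarrow> f' p = f p) \<Longrightarrow> dominated P f' g"
  by (auto simp: dominated_def)

lemma dominated_mono:
  assumes "dominated P f g" "c \<ge> 0" "\<And>p. p \<in> P \<Longrightarrow> g p \<le> c * h p"
  shows "dominated P f h"
proof -
  obtain C where C: "C \<ge> 0" "\<And>p. p \<in> P \<Longrightarrow> norm (f p) \<le> C * g p"
    using assms(1) by (auto simp: dominated_def)
  show ?thesis
  proof (rule dominatedI)
    show "C * c \<ge> 0" using C assms by simp
    show "norm (f p) \<le> C * c * h p" if "p \<in> P" for p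
      using C(2)[OF that] mult_left_mono[OF assms(3)[OF that] C(1)] by (simp add: mult.assoc)
  qed
qed

lemma dominated_add:
  assumes "dominated P f g" "dominated P f' g"
  shows "dominated P (\<lambda>p. f p + f' p) g"
proof -
  obtain C C' where C: "C \<ge> 0" "\<And>p. p \<in> P \<Longrightarrow> norm (f p) \<le> C * g p"
    and C': "C' \<ge> 0" "\<And>p. p \<in> P \<Longrightarrow> norm (f' p) \<le> C' * g p"
    using assms by (auto simp: dominated_def)
  show ?thesis
  proof (rule dominatedI)
    show "C + C' \<ge> 0" using C C' by simp
    show "norm (f p + f' p) \<le> (C + C') * g p" if "p \<in> P" for p
      using norm_triangle_mono[OF C(2)[OF that] C'(2)[OF that]] by (simp add: distrib_right)
  qed
qed

lemma dominated_cmult: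
  assumes "dominated P f g"
  shows "dominated P (\<lambda>p. c * f p) g"
proof -
  obtain C where C: "C \<ge> 0" "\<And>p. p \<in> P \<Longrightarrow> norm (f p) \<le> C * g p"
    using assms by (auto simp: dominated_def)
  show ?thesis
  proof (rule dominatedI)
    show "norm c * C \<ge> 0" using C by simp
    show "norm (c * f p) \<le> norm c * C * g p" if "p \<in> P" for p
      using mult_left_mono[OF C(2)[OF that], of "norm c"] by (simp add: norm_mult mult.assoc)
  qed
qed

lemma dominated_uminus: "dominated P f g \<Longrightarrow> dominated P (\<lambda>p. - f p) g"
  by (simp add: dominated_def)

lemma dominated_diff: "dominated P f g \<Longrightarrow> dominated P f' g \<Longrightarrow> dominated P (\<lambda>p. f p - f' p) g"
  using dominated_add[of P f g "\<lambda>p. - f' p"] dominated_uminus[of P f' g] by simp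

lemma dominated_sum:
  assumes "finite I" "\<And>i. i \<in> I \<Longrightarrow> dominated P (f i) g"
  shows "dominated P (\<lambda>p. \<Sum>i\<in>I. f i p) g"
  using assms
proof (induction I rule: finite_induct)
  case empty
  show ?case by (rule dominatedI[of 0]) auto
qed (auto intro!: dominated_add)

lemma dominated_mult_real:
  assumes "dominated P f g" "\<And>p. p \<in> P \<Longrightarrow> r p \<ge> 0"
  shows "dominated P (\<lambda>p. of_real (r p) * f p) (\<lambda>p. r p * g p)"
proof -
  obtain C where C: "C \<ge> 0" "\<And>p. p \<in> P \<Longrightarrow> norm (f p) \<le> C * g p"
    using assms by (auto simp: dominated_def)
  show ?thesis
  proof (rule dominatedI[OF C(1)])
    show "norm (of_real (r p) * f p) \<le> C * (r p * g p)" if "p \<in> P" for p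
      using mult_left_mono[OF C(2)[OF that] assms(2)[OF that]] assms(2)[OF that]
      by (simp add: norm_mult mult_ac)
  qed
qed

text \<open>The resolvent bounds ask for one bound on all entries of the right-hand side; finiteness
  of the index type provides it.\<close>

lemma dominated_choice:
  fixes f :: "'i::finite \<Rightarrow> 'p \<Rightarrow> complex"
  assumes "\<And>i. dominated P (f i) g" "\<And>p. p \<in> P \<Longrightarrow> g p \<ge> 0"
  shows "\<exists>C\<ge>0. \<forall>p\<in>P. \<forall>i. norm (f i p) \<le> C * g p"
proof -
  have "\<forall>i. \<exists>C\<ge>0. \<forall>p\<in>P. norm (f i p) \<le> C * g p" using assms(1) by (auto simp: dominated_def)
  then obtain C where C: "\<And>i. C i \<ge> 0" "\<And>i p. p \<in> P \<Longrightarrow> norm (f i p) \<le> C i * g p" by metis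
  have "norm (f i p) \<le> (\<Sum>i\<in>UNIV. C i) * g p" if "p \<in> P" for i p
    using C(2)[OF that, of i] mult_right_mono[OF member_le_sum[of i UNIV C] assms(2)[OF that]] C(1) by force
  moreover have "(\<Sum>i\<in>UNIV. C i) \<ge> 0" using C(1) by (simp add: sum_nonneg)
  ultimately show ?thesis by blast
qed

text \<open>In the application, \<open>u\<close> is an Ornstein--Uhlenbeck process with drift \<open>A u\<close> and covariance \<open>\<sigma>\<close>,
  \<open>E' = - \<i> \<omega> E + H\<close> is a fast angle perturbed by \<open>u\<close>, \<open>\<mu> p\<close> averages over chance and over the times
  up to \<open>T\<close>, and \<open>\<delta> p = 1 / T\<close>.\<close>

locale averaging =
  fixes A :: "real^'n^'n" and \<sigma> :: "'n \<Rightarrow> 'n \<Rightarrow> real" and \<omega> :: real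
    and c :: "nat \<Rightarrow> 'n \<Rightarrow> complex" and d :: "nat \<Rightarrow> 'n \<Rightarrow> 'n \<Rightarrow> complex" and e :: "nat \<Rightarrow> complex"
    and P :: "'p set" and \<mu> :: "'p \<Rightarrow> 'z measure" and E :: "'p \<Rightarrow> 'z \<Rightarrow> complex"
    and u :: "'p \<Rightarrow> 'n \<Rightarrow> 'z \<Rightarrow> real" and \<epsilon> \<delta> :: "'p \<Rightarrow> real" and K :: real
  assumes stable: "\<And>z. complex_eigenvalue A z \<Longrightarrow> Re z < 0"
    and \<omega>: "\<omega> > 0"
    and E_meas: "\<And>p. p \<in> P \<Longrightarrow> E p \<in> borel_measurable (\<mu> p)"
    and u_meas: "\<And>p i. p \<in> P \<Longrightarrow> u p i \<in> borel_measurable (\<mu> p)"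
    and E_norm: "\<And>p x. p \<in> P \<Longrightarrow> x \<in> space (\<mu> p) \<Longrightarrow> norm (E p x) \<le> 1"
    and S6: "\<And>p. p \<in> P \<Longrightarrow> integrable (\<mu> p) (\<lambda>x. (1 + (\<Sum>i\<in>UNIV. \<bar>u p i x\<bar>)) ^ 6)"
      "\<And>p. p \<in> P \<Longrightarrow> (\<integral>x. (1 + (\<Sum>i\<in>UNIV. \<bar>u p i x\<bar>)) ^ 6 \<partial>\<mu> p) \<le> K"
    and \<epsilon>: "\<And>p. p \<in> P \<Longrightarrow> 0 \<le> \<epsilon> p" "\<And>p. p \<in> P \<Longrightarrow> \<epsilon> p \<le> 1"
    and \<delta>: "\<And>p. p \<in> P \<Longrightarrow> 0 \<le> \<delta> p"
    and K0: "K \<ge> 0"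
begin

definition S :: "'p \<Rightarrow> 'z \<Rightarrow> real" where "S p x = 1 + (\<Sum>i\<in>UNIV. \<bar>u p i x\<bar>)"

definition H :: "'p \<Rightarrow> 'z \<Rightarrow> complex" where
  "H p x = (\<Sum>q<3. E p x ^ q * (of_real (\<epsilon> p) * (\<Sum>k\<in>UNIV. c q k * of_real (u p k x))
     + of_real (\<epsilon> p ^ 2) * (\<Sum>k\<in>UNIV. \<Sum>l\<in>UNIV. d q k l * of_real (u p k x * u p l x)) + of_real (\<epsilon> p ^ 4) * e q))"

definition J :: "nat \<Rightarrow> ('p \<Rightarrow> 'z \<Rightarrow> real) \<Rightarrow> 'p \<Rightarrow> complex" where
  "J n f p = (\<integral>x. E p x ^ n * of_real (f p x) \<partial>\<mu> p)"

definition JH :: "nat \<Rightarrow> ('p \<Rightarrow> 'z \<Rightarrow> real) \<Rightarrow> 'p \<Rightarrow> complex" where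
  "JH n f p = (\<integral>x. E p x ^ n * H p x * of_real (f p x) \<partial>\<mu> p)"

text \<open>\<open>m\<close> counts degrees in \<open>u\<close>. With six moments at hand,
  \<open>J\<close> tolerates degree six and \<open>JH\<close> degree four, since \<open>H\<close> is
  quadratic in \<open>u\<close>.\<close>

definition admissible :: "nat \<Rightarrow> ('p \<Rightarrow> 'z \<Rightarrow> real) \<Rightarrow> bool" where
  "admissible m f \<longleftrightarrow> (\<forall>p\<in>P. f p \<in> borel_measurable (\<mu> p) \<and> (\<forall>x\<in>space (\<mu> p). \<bar>f p x\<bar> \<le> S p x ^ m))"

lemma S1: "1 \<le> S p x"
  by (simp add: S_def sum_nonneg)

lemma u_le_S: "\<bar>u p i x\<bar> \<le> S p x"
  using member_le_sum[of i UNIV "\<lambda>i. \<bar>u p i x\<bar>"] by (simp add: S_def)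

lemma admissible_1: "admissible 0 (\<lambda>p x. 1)"
  by (simp add: admissible_def)

lemma admissible_mult:
  assumes "admissible m f"
  shows "admissible (Suc m) (\<lambda>p x. u p i x * f p x)"
  unfolding admissible_def
proof (intro ballI conjI)
  fix p assume p: "p \<in> P"
  then show "(\<lambda>x. u p i x * f p x) \<in> borel_measurable (\<mu> p)"
    using assms u_meas[OF p] by (auto simp: admissible_def)
  fix x assume "x \<in> space (\<mu> p)"
  then show "\<bar>u p i x * f p x\<bar> \<le> S p x ^ Suc m"
    using assms p u_le_S[of p i x] by (auto simp: admissible_def abs_mult intro!: mult_mono')
qed

lemma integrable_J:
  assumes f: "admissible m f" "m \<le> 6" and p: "p \<in> P"
  shows "integrable (\<mu> p) (\<lambda>x. E p x ^ n * of_real (f p x))" "norm (J n f p) \<le> K"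
proof -
  have le: "norm (E p x ^ n * of_real (f p x)) \<le> S p x ^ 6" if "x \<in> space (\<mu> p)" for x
  proof -
    have "norm (E p x ^ n * of_real (f p x)) \<le> 1 * S p x ^ m"
      unfolding norm_mult norm_power norm_of_real using f(1) p that
      by (intro mult_mono' power_le_one E_norm) (auto simp: admissible_def)
    also have "\<dots> \<le> S p x ^ 6" using power_increasing[OF f(2) S1] by simp
    finally show ?thesis .
  qed
  have meas: "(\<lambda>x. E p x ^ n * of_real (f p x)) \<in> borel_measurable (\<mu> p)"
    using E_meas[OF p] f(1) p by (auto simp: admissible_def)
  have S6': "integrable (\<mu> p) (\<lambda>x. S p x ^ 6)" "(\<integral>x. S p x ^ 6 \<partial>\<mu> p) \<le> K"
    using S6[OF p] by (simp_all add: S_def)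
  show i: "integrable (\<mu> p) (\<lambda>x. E p x ^ n * of_real (f p x))"
    by (rule Bochner_Integration.integrable_bound[OF S6'(1) meas], rule AE_I2)
       (use le S1 in \<open>auto intro: order.trans[OF _ abs_ge_self]\<close>)
  have "norm (J n f p) \<le> (\<integral>x. norm (E p x ^ n * of_real (f p x)) \<partial>\<mu> p)"
    unfolding J_def by (rule integral_norm_bound)
  also have "\<dots> \<le> (\<integral>x. S p x ^ 6 \<partial>\<mu> p)"
    by (rule integral_mono'[OF S6'(1)]) (use le S1 in \<open>auto intro: order.trans[OF zero_le_one]\<close>)
  finally show "norm (J n f p) \<le> K" using S6'(2) by simp
qed

lemma dominated_J: "admissible m f \<Longrightarrow> m \<le> 6 \<Longrightarrow> dominated P (J n f) (\<lambda>p. 1)"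
  by (rule dominatedI[OF K0]) (use integrable_J(2) in auto)

lemma JH_expand:
  assumes f: "admissible m f" "m \<le> 4" and p: "p \<in> P"
  shows "integrable (\<mu> p) (\<lambda>x. E p x ^ n * H p x * of_real (f p x))"
    and "JH n f p = (\<Sum>q<3. of_real (\<epsilon> p) * (\<Sum>k\<in>UNIV. c q k * J (n + q) (\<lambda>p x. u p k x * f p x) p)
      + of_real (\<epsilon> p ^ 2) * (\<Sum>k\<in>UNIV. \<Sum>l\<in>UNIV. d q k l * J (n + q) (\<lambda>p x. u p k x * (u p l x * f p x)) p)
      + of_real (\<epsilon> p ^ 4) * (e q * J (n + q) f p))"
proof -
  have i: "integrable (\<mu> p) (\<lambda>x. E p x ^ (n + q) * of_real (f p x))"
    "integrable (\<mu> p) (\<lambda>x. E p x ^ (n + q) * of_real (u p k x * f p x))"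
    "integrable (\<mu> p) (\<lambda>x. E p x ^ (n + q) * of_real (u p k x * (u p l x * f p x)))" for q k l
    using integrable_J(1)[OF f(1) _ p] integrable_J(1)[OF admissible_mult[OF f(1)] _ p]
      integrable_J(1)[OF admissible_mult[OF admissible_mult[OF f(1)]] _ p] f(2) by simp_all
  have eq: "E p x ^ n * H p x * of_real (f p x) =
    (\<Sum>q<3. of_real (\<epsilon> p) * (\<Sum>k\<in>UNIV. c q k * (E p x ^ (n + q) * of_real (u p k x * f p x)))
      + of_real (\<epsilon> p ^ 2) * (\<Sum>k\<in>UNIV. \<Sum>l\<in>UNIV. d q k l * (E p x ^ (n + q) * of_real (u p k x * (u p l x * f p x))))
      + of_real (\<epsilon> p ^ 4) * (e q * (E p x ^ (n + q) * of_real (f p x))))" for x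
    unfolding H_def sum_distrib_left sum_distrib_right
    by (intro sum.cong refl) (simp add: power_add sum_distrib_left algebra_simps)
  show "integrable (\<mu> p) (\<lambda>x. E p x ^ n * H p x * of_real (f p x))"
    unfolding eq by (intro Bochner_Integration.integrable_sum Bochner_Integration.integrable_add integrable_mult_right i)
  show "JH n f p = (\<Sum>q<3. of_real (\<epsilon> p) * (\<Sum>k\<in>UNIV. c q k * J (n + q) (\<lambda>p x. u p k x * f p x) p)
      + of_real (\<epsilon> p ^ 2) * (\<Sum>k\<in>UNIV. \<Sum>l\<in>UNIV. d q k l * J (n + q) (\<lambda>p x. u p k x * (u p l x * f p x)) p)
      + of_real (\<epsilon> p ^ 4) * (e q * J (n + q) f p))"
    unfolding JH_def eq J_def
    by (rule has_bochner_integral_integral_eq)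
       (intro has_bochner_integral_sum has_bochner_integral_add has_bochner_integral_mult_right has_bochner_integral_integrable i)
qed

text \<open>Only the part of \<open>H\<close> of order \<open>\<epsilon>\<close> calls for
  information \<open>g\<close> on the means with one more factor \<open>u\<close>; the parts of
  order \<open>\<epsilon>\<^sup>2\<close> and \<open>\<epsilon> ^ 4\<close> are absorbed by bounded
  moments.\<close>

lemma dominated_JH:
  assumes f: "admissible m f" "m \<le> 4"
    and g1: "\<And>q k. q < 3 \<Longrightarrow> dominated P (J (n + q) (\<lambda>p x. u p k x * f p x)) g"
    and h1: "\<And>p. p \<in> P \<Longrightarrow> \<epsilon> p * g p \<le> Ch * h p" and h2: "\<And>p. p \<in> P \<Longrightarrow> \<epsilon> p ^ 2 \<le> Ch * h p" and Ch: "Ch \<ge> 0"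
  shows "dominated P (JH n f) h"
proof (rule dominated_cong[OF _ JH_expand(2)[OF f]])
  have e4: "\<epsilon> p ^ 4 \<le> Ch * h p" if "p \<in> P" for p
  proof -
    have "\<epsilon> p ^ 4 \<le> \<epsilon> p ^ 2" by (rule power_decreasing) (use \<epsilon>[OF that] in auto)
    with h2[OF that] show ?thesis by simp
  qed
  show "dominated P (\<lambda>p. \<Sum>q<3. of_real (\<epsilon> p) * (\<Sum>k\<in>UNIV. c q k * J (n + q) (\<lambda>p x. u p k x * f p x) p)
      + of_real (\<epsilon> p ^ 2) * (\<Sum>k\<in>UNIV. \<Sum>l\<in>UNIV. d q k l * J (n + q) (\<lambda>p x. u p k x * (u p l x * f p x)) p)
      + of_real (\<epsilon> p ^ 4) * (e q * J (n + q) f p)) h"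
  proof (intro dominated_sum dominated_add finite_lessThan)
    fix q assume "q \<in> {..<3::nat}"
    then have q: "q < 3" by simp
    show "dominated P (\<lambda>p. of_real (\<epsilon> p) * (\<Sum>k\<in>UNIV. c q k * J (n + q) (\<lambda>p x. u p k x * f p x) p)) h"
      by (rule dominated_mono[OF dominated_mult_real[where g=g] Ch h1])
         (auto intro!: dominated_sum dominated_cmult g1 q \<epsilon>)
    have "dominated P (\<lambda>p. of_real (\<epsilon> p ^ 2) * (\<Sum>k\<in>UNIV. \<Sum>l\<in>UNIV. d q k l * J (n + q) (\<lambda>p x. u p k x * (u p l x * f p x)) p)) (\<lambda>p. \<epsilon> p ^ 2 * 1)"
      by (intro dominated_mult_real dominated_sum dominated_cmult dominated_J[OF admissible_mult[OF admissible_mult[OF f(1)]]])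
         (use f(2) in auto)
    then show "dominated P (\<lambda>p. of_real (\<epsilon> p ^ 2) * (\<Sum>k\<in>UNIV. \<Sum>l\<in>UNIV. d q k l * J (n + q) (\<lambda>p x. u p k x * (u p l x * f p x)) p)) h"
      by (rule dominated_mono[OF _ Ch]) (use h2 in simp)
    have "dominated P (\<lambda>p. of_real (\<epsilon> p ^ 4) * (e q * J (n + q) f p)) (\<lambda>p. \<epsilon> p ^ 4 * 1)"
      by (intro dominated_mult_real dominated_cmult dominated_J[OF f(1)]) (use f(2) in auto)
    then show "dominated P (\<lambda>p. of_real (\<epsilon> p ^ 4) * (e q * J (n + q) f p)) h"
      by (rule dominated_mono[OF _ Ch]) (use e4 in simp)
  qed
qed

end

text \<open>Dynkin's formula for \<open>E ^ n\<close> times a monomial of degree at most three in \<open>u\<close>: the mean of the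
  generator is the increment over \<open>[0, T]\<close> divided by \<open>T\<close>.\<close>

locale averaging_dynkin = averaging +
  assumes D0: "\<And>n. dominated P (\<lambda>p. of_nat n * (JH (n - 1) (\<lambda>p x. 1) p - \<i> * of_real \<omega> * J n (\<lambda>p x. 1) p)) \<delta>"
    and D1: "\<And>n i. dominated P (\<lambda>p. of_nat n * (JH (n - 1) (\<lambda>p x. u p i x * 1) p - \<i> * of_real \<omega> * J n (\<lambda>p x. u p i x * 1) p)
      + (\<Sum>l\<in>UNIV. of_real (A $ i $ l) * J n (\<lambda>p x. u p l x * 1) p)) \<delta>"
    and D2: "\<And>n i j. dominated P (\<lambda>p. of_nat n * (JH (n - 1) (\<lambda>p x. u p i x * (u p j x * 1)) p
        - \<i> * of_real \<omega> * J n (\<lambda>p x. u p i x * (u p j x * 1)) p)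
      + ((\<Sum>l\<in>UNIV. of_real (A $ i $ l) * J n (\<lambda>p x. u p l x * (u p j x * 1)) p)
      + (\<Sum>l\<in>UNIV. of_real (A $ j $ l) * J n (\<lambda>p x. u p i x * (u p l x * 1)) p)
      + of_real (\<sigma> i j) * J n (\<lambda>p x. 1) p)) \<delta>"
    and D3: "\<And>n i j k. dominated P (\<lambda>p. of_nat n * (JH (n - 1) (\<lambda>p x. u p i x * (u p j x * (u p k x * 1))) p
        - \<i> * of_real \<omega> * J n (\<lambda>p x. u p i x * (u p j x * (u p k x * 1))) p)
      + ((\<Sum>l\<in>UNIV. of_real (A $ i $ l) * J n (\<lambda>p x. u p l x * (u p j x * (u p k x * 1))) p)
      + (\<Sum>l\<in>UNIV. of_real (A $ j $ l) * J n (\<lambda>p x. u p i x * (u p l x * (u p k x * 1))) p)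
      + (\<Sum>l\<in>UNIV. of_real (A $ k $ l) * J n (\<lambda>p x. u p i x * (u p j x * (u p l x * 1))) p)
      + (of_real (\<sigma> i j) * J n (\<lambda>p x. u p k x * 1) p + of_real (\<sigma> i k) * J n (\<lambda>p x. u p j x * 1) p
      + of_real (\<sigma> j k) * J n (\<lambda>p x. u p i x * 1) p))) \<delta>"
begin

section \<open>Sizes of the means of \<open>E ^ n\<close> times monomials in
  \<open>u\<close>\<close>

abbreviation "J0 n \<equiv> J n (\<lambda>p x. 1)"
abbreviation "J1 n i \<equiv> J n (\<lambda>p x. u p i x * 1)"
abbreviation "J2 n i j \<equiv> J n (\<lambda>p x. u p i x * (u p j x * 1))"
abbreviation "J3 n i j k \<equiv> J n (\<lambda>p x. u p i x * (u p j x * (u p k x * 1)))"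
abbreviation "g1 p \<equiv> \<epsilon> p + \<delta> p"
abbreviation "g2 p \<equiv> \<epsilon> p ^ 2 + \<delta> p"

text \<open>Building the monomials from the constant 1 leaves the trailing factor \<open>* 1\<close>
  that the abbreviations carry.\<close>

lemmas adm = admissible_mult[OF admissible_1] admissible_mult[OF admissible_mult[OF admissible_1]]
  admissible_mult[OF admissible_mult[OF admissible_mult[OF admissible_1]]]
  admissible_mult[OF admissible_mult[OF admissible_mult[OF admissible_mult[OF admissible_1]]]]

lemma g1_nonneg: "p \<in> P \<Longrightarrow> g1 p \<ge> 0"
  using \<epsilon> \<delta> by simp

lemma g2_nonneg: "p \<in> P \<Longrightarrow> g2 p \<ge> 0"
  using \<delta> by simp

lemma dominated_\<delta>_g1: "dominated P f \<delta> \<Longrightarrow> dominated P f g1"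
  by (rule dominated_mono[of P f \<delta> 1]) (use \<epsilon> in auto)

lemma dominated_\<delta>_g2: "dominated P f \<delta> \<Longrightarrow> dominated P f g2"
  by (rule dominated_mono[of P f \<delta> 1]) auto

lemma JH_g1:
  assumes "admissible m f" "m \<le> 4"
  shows "dominated P (JH n f) g1"
proof (rule dominated_JH[OF assms, where g="\<lambda>_. 1" and Ch=1])
  show "dominated P (J (n + q) (\<lambda>p x. u p k x * f p x)) (\<lambda>_. 1)" for q k
    using dominated_J[OF admissible_mult[OF assms(1)]] assms(2) by simp
  show "\<epsilon> p ^ 2 \<le> 1 * g1 p" if "p \<in> P" for p
    using \<epsilon>[OF that] \<delta>[OF that] power_decreasing[of 1 2 "\<epsilon> p"] by simp
qed (use \<delta> in auto)

text \<open>The factor \<open>\<epsilon>\<close> of the linear part of \<open>H\<close> improves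
  \<open>g1\<close> to \<open>g2\<close>, as \<open>\<epsilon> (\<epsilon> + \<delta>) \<le>
  \<epsilon>\<^sup>2 + \<delta>\<close> for \<open>\<epsilon> \<le> 1\<close>.\<close>

lemma JH_g2:
  assumes f: "admissible m f" "m \<le> 4"
    and 1: "\<And>q k. q < 3 \<Longrightarrow> dominated P (J (n + q) (\<lambda>p x. u p k x * f p x)) g1"
  shows "dominated P (JH n f) g2"
proof (rule dominated_JH[OF f 1, where Ch=1])
  show "\<epsilon> p * g1 p \<le> 1 * g2 p" if "p \<in> P" for p
    using \<epsilon>[OF that] \<delta>[OF that] mult_right_mono[OF \<epsilon>(2)[OF that] \<delta>[OF that]]
    by (simp add: distrib_left power2_eq_square)
qed (use \<delta> in auto)

text \<open>Dynkin's relation is a linear system for the vector of the \<open>J1 n i\<close> with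
  operator \<open>A - \<i> n \<omega>\<close> and right-hand side of order
  \<open>\<epsilon> + \<delta>\<close>; the resolvent bound inverts it.\<close>

lemma b1: "dominated P (J1 n i) g1"
proof -
  let ?r = "\<lambda>i p. (of_nat n * (JH (n - 1) (\<lambda>p x. u p i x * 1) p - \<i> * of_real \<omega> * J1 n i p)
      + (\<Sum>l\<in>UNIV. of_real (A $ i $ l) * J1 n l p)) - of_nat n * JH (n - 1) (\<lambda>p x. u p i x * 1) p"
  have "dominated P (?r i) g1" for i
    by (intro dominated_diff dominated_\<delta>_g1[OF D1] dominated_cmult JH_g1[OF adm(1)]) auto
  from dominated_choice[of P ?r g1, OF this g1_nonneg] obtain C
    where C: "C \<ge> 0" "\<forall>p\<in>P. \<forall>i. norm (?r i p) \<le> C * g1 p" by blast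
  obtain B where B: "B \<ge> 0" and tb: "\<forall>(F :: 'a \<Rightarrow> complex) \<omega> r K.
    (\<forall>i. (\<Sum>l\<in>UNIV. of_real (A $ i $ l) * F l) - \<i> * of_real \<omega> * F i = r i) \<longrightarrow>
    (\<forall>i. norm (r i) \<le> K) \<longrightarrow> (\<forall>i. norm (F i) \<le> B * K)"
    using tensor_bound1[OF stable] by blast
  show ?thesis
  proof (rule dominatedI[of "B * C"])
    fix p assume p: "p \<in> P"
    have "norm (J1 n i p) \<le> B * (C * g1 p)"
      by (rule tb[rule_format, where F="\<lambda>i. J1 n i p" and r="\<lambda>i. ?r i p" and \<omega>="real n * \<omega>"])
         (use C p in \<open>auto simp: algebra_simps\<close>)
    then show "norm (J1 n i p) \<le> B * C * g1 p" by (simp add: mult.assoc)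
  qed (use B C in auto)
qed

text \<open>For the constant monomial the operator is multiplication by
  \<open>- \<i> n \<omega>\<close>, invertible exactly when \<open>n \<noteq> 0\<close>; the
  perturbation involves only means of degree one, which \<open>b1\<close> makes small.\<close>

lemma b2:
  assumes n: "n \<noteq> 0"
  shows "dominated P (J0 n) g2"
proof -
  have "dominated P (JH (n - 1) (\<lambda>p x. 1)) g2"
    by (rule JH_g2[OF admissible_1]) (simp, rule b1)
  then have "dominated P (\<lambda>p. (- 1 / (\<i> * of_real \<omega> * of_nat n)) * (of_nat n * (JH (n - 1) (\<lambda>p x. 1) p - \<i> * of_real \<omega> * J0 n p)
      - of_nat n * JH (n - 1) (\<lambda>p x. 1) p)) g2"
    by (intro dominated_cmult dominated_diff dominated_\<delta>_g2[OF D0])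
  then show ?thesis
    by (rule dominated_cong) (use n \<omega> in \<open>auto simp: field_simps\<close>)
qed

text \<open>As in \<open>b1\<close>, one level higher: the Ito corrections lower the degree by two
  and land on \<open>J1\<close>, already of order \<open>g1\<close>.\<close>

lemma b3: "dominated P (J3 n i j k) g1"
proof -
  let ?r = "\<lambda>i j k p. (of_nat n * (JH (n - 1) (\<lambda>p x. u p i x * (u p j x * (u p k x * 1))) p - \<i> * of_real \<omega> * J3 n i j k p)
      + ((\<Sum>l\<in>UNIV. of_real (A $ i $ l) * J3 n l j k p) + (\<Sum>l\<in>UNIV. of_real (A $ j $ l) * J3 n i l k p)
      + (\<Sum>l\<in>UNIV. of_real (A $ k $ l) * J3 n i j l p)
      + (of_real (\<sigma> i j) * J1 n k p + of_real (\<sigma> i k) * J1 n j p + of_real (\<sigma> j k) * J1 n i p)))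
      - of_nat n * JH (n - 1) (\<lambda>p x. u p i x * (u p j x * (u p k x * 1))) p
      - (of_real (\<sigma> i j) * J1 n k p + of_real (\<sigma> i k) * J1 n j p + of_real (\<sigma> j k) * J1 n i p)"
  have "dominated P (?r i j k) g1" for i j k
    by (intro dominated_diff dominated_\<delta>_g1[OF D3] dominated_cmult dominated_add JH_g1[OF adm(3)] b1) auto
  then have "dominated P (case x of (i, j, k) \<Rightarrow> ?r i j k) g1" for x by (auto split: prod.split)
  from dominated_choice[of P "\<lambda>x. case x of (i, j, k) \<Rightarrow> ?r i j k" g1, OF this g1_nonneg] obtain C
    where C: "C \<ge> 0" "\<forall>p\<in>P. \<forall>x. norm ((case x of (i, j, k) \<Rightarrow> ?r i j k) p) \<le> C * g1 p" by blast
  have C': "norm (?r i j k p) \<le> C * g1 p" if "p \<in> P" for i j k p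
    using C(2)[rule_format, OF that, of "(i, j, k)"] by simp
  obtain B where B: "B \<ge> 0" and tb: "\<forall>(F :: 'a \<Rightarrow> 'a \<Rightarrow> 'a \<Rightarrow> complex) \<omega> r K.
    (\<forall>i j k. (\<Sum>l\<in>UNIV. of_real (A $ i $ l) * F l j k) + (\<Sum>l\<in>UNIV. of_real (A $ j $ l) * F i l k)
       + (\<Sum>l\<in>UNIV. of_real (A $ k $ l) * F i j l) - \<i> * of_real \<omega> * F i j k = r i j k) \<longrightarrow>
    (\<forall>i j k. norm (r i j k) \<le> K) \<longrightarrow> (\<forall>i j k. norm (F i j k) \<le> B * K)"
    using tensor_bound3[OF stable] by blast
  show ?thesis
  proof (rule dominatedI[of "B * C"])
    fix p assume p: "p \<in> P"
    have "norm (J3 n i j k p) \<le> B * (C * g1 p)"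
    proof (rule tb[rule_format, where F="\<lambda>i j k. J3 n i j k p" and r="\<lambda>i j k. ?r i j k p" and \<omega>="real n * \<omega>"])
      show "norm (?r i j k p) \<le> C * g1 p" for i j k by (rule C'[OF p])
    qed (simp add: algebra_simps)
    then show "norm (J3 n i j k p) \<le> B * C * g1 p" by (simp add: mult.assoc)
  qed (use B C in auto)
qed

lemma tensor2_J2:
  assumes "\<And>i j. dominated P (\<lambda>p. (\<Sum>l\<in>UNIV. of_real (A $ i $ l) * F l j p) + (\<Sum>l\<in>UNIV. of_real (A $ j $ l) * F i l p)
       - \<i> * of_real \<nu> * F i j p) g" "\<And>p. p \<in> P \<Longrightarrow> g p \<ge> 0"
  shows "dominated P (F i j) g"
proof -
  let ?r = "\<lambda>i j p. (\<Sum>l\<in>UNIV. of_real (A $ i $ l) * F l j p) + (\<Sum>l\<in>UNIV. of_real (A $ j $ l) * F i l p) - \<i> * of_real \<nu> * F i j p"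
  have "dominated P (case x of (i, j) \<Rightarrow> ?r i j) g" for x using assms(1) by (auto split: prod.split)
  from dominated_choice[of P "\<lambda>x. case x of (i, j) \<Rightarrow> ?r i j" g, OF this assms(2)] obtain C
    where C: "C \<ge> 0" "\<forall>p\<in>P. \<forall>x. norm ((case x of (i, j) \<Rightarrow> ?r i j) p) \<le> C * g p" by blast
  have C': "norm (?r i j p) \<le> C * g p" if "p \<in> P" for i j p
    using C(2)[rule_format, OF that, of "(i, j)"] by simp
  obtain B where B: "B \<ge> 0" and tb: "\<forall>(F :: 'a \<Rightarrow> 'a \<Rightarrow> complex) \<omega> r K.
    (\<forall>i j. (\<Sum>l\<in>UNIV. of_real (A $ i $ l) * F l j) + (\<Sum>l\<in>UNIV. of_real (A $ j $ l) * F i l)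
       - \<i> * of_real \<omega> * F i j = r i j) \<longrightarrow>
    (\<forall>i j. norm (r i j) \<le> K) \<longrightarrow> (\<forall>i j. norm (F i j) \<le> B * K)"
    using tensor_bound2[OF stable] by blast
  show ?thesis
  proof (rule dominatedI[of "B * C"])
    fix p assume p: "p \<in> P"
    have "norm (F i j p) \<le> B * (C * g p)"
    proof (rule tb[rule_format, where F="\<lambda>i j. F i j p" and r="\<lambda>i j. ?r i j p" and \<omega>=\<nu>])
      show "norm (?r i j p) \<le> C * g p" for i j by (rule C'[OF p])
    qed simp
    then show "norm (F i j p) \<le> B * C * g p" by (simp add: mult.assoc)
  qed (use B C in auto)
qed

text \<open>The perturbation involves \<open>J3\<close> at order \<open>\<epsilon>\<close> and the
  Ito correction is a multiple of \<open>J0 n\<close>, so \<open>b3\<close> and \<open>b2\<close>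
  give the order \<open>g2\<close>. The latter is why \<open>n = 0\<close> is excluded.\<close>

lemma b4:
  assumes n: "n \<noteq> 0"
  shows "dominated P (J2 n i j) g2"
proof (rule tensor2_J2[where \<nu>="real n * \<omega>" and F="\<lambda>i j. J2 n i j", OF _ g2_nonneg])
  fix i j
  have "dominated P (JH (n - 1) (\<lambda>p x. u p i x * (u p j x * 1))) g2"
    by (rule JH_g2[OF adm(2)]) (simp, rule b3)
  then have "dominated P (\<lambda>p. (of_nat n * (JH (n - 1) (\<lambda>p x. u p i x * (u p j x * 1)) p - \<i> * of_real \<omega> * J2 n i j p)
      + ((\<Sum>l\<in>UNIV. of_real (A $ i $ l) * J2 n l j p) + (\<Sum>l\<in>UNIV. of_real (A $ j $ l) * J2 n i l p)
      + of_real (\<sigma> i j) * J0 n p)) - of_nat n * JH (n - 1) (\<lambda>p x. u p i x * (u p j x * 1)) p - of_real (\<sigma> i j) * J0 n p) g2"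
    by (intro dominated_diff dominated_\<delta>_g2[OF D2] dominated_cmult b2 n)
  then show "dominated P (\<lambda>p. (\<Sum>l\<in>UNIV. of_real (A $ i $ l) * J2 n l j p) + (\<Sum>l\<in>UNIV. of_real (A $ j $ l) * J2 n i l p)
       - \<i> * of_real (real n * \<omega>) * J2 n i j p) g2"
    by (rule dominated_cong) (simp add: algebra_simps)
qed

text \<open>At \<open>n = 0\<close> the factor \<open>of_nat n\<close> removes the angle from
  Dynkin's relation: the second moments satisfy the Lyapunov equation up to \<open>\<delta>\<close>,
  and \<open>R\<close> satisfies it exactly, so their difference is a solution with right-hand side
  of size \<open>\<delta>\<close>.\<close>

lemma b5:
  assumes R: "\<And>i j. (\<Sum>l\<in>UNIV. A $ i $ l * R l j) + (\<Sum>l\<in>UNIV. A $ j $ l * R i l) + \<sigma> i j = 0"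
    and prob: "\<And>p. p \<in> P \<Longrightarrow> J0 0 p = 1"
  shows "dominated P (\<lambda>p. J2 0 i j p - of_real (R i j)) \<delta>"
proof (rule tensor2_J2[where \<nu>=0 and F="\<lambda>i j p. J2 0 i j p - of_real (R i j)", OF _ \<delta>])
  fix i j
  have "dominated P (\<lambda>p. (\<Sum>l\<in>UNIV. of_real (A $ i $ l) * J2 0 l j p) + (\<Sum>l\<in>UNIV. of_real (A $ j $ l) * J2 0 i l p)
      + of_real (\<sigma> i j) * J0 0 p) \<delta>"
    using D2[of 0 i j] by simp
  then show "dominated P (\<lambda>p. (\<Sum>l\<in>UNIV. of_real (A $ i $ l) * (J2 0 l j p - of_real (R l j))) +
      (\<Sum>l\<in>UNIV. of_real (A $ j $ l) * (J2 0 i l p - of_real (R i l))) - \<i> * of_real 0 * (J2 0 i j p - of_real (R i j))) \<delta>"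
  proof (rule dominated_cong)
    fix p assume p: "p \<in> P"
    have "of_real (\<sigma> i j) = - (\<Sum>l\<in>UNIV. of_real (A $ i $ l) * of_real (R l j)) - (\<Sum>l\<in>UNIV. of_real (A $ j $ l) * of_real (R i l) :: complex)"
      using R[of i j] unfolding of_real_mult[symmetric] of_real_sum[symmetric] of_real_minus[symmetric] of_real_diff[symmetric] of_real_eq_iff
      by linarith
    then show "(\<Sum>l\<in>UNIV. of_real (A $ i $ l) * (J2 0 l j p - of_real (R l j))) +
      (\<Sum>l\<in>UNIV. of_real (A $ j $ l) * (J2 0 i l p - of_real (R i l))) - \<i> * of_real 0 * (J2 0 i j p - of_real (R i j)) =
      (\<Sum>l\<in>UNIV. of_real (A $ i $ l) * J2 0 l j p) + (\<Sum>l\<in>UNIV. of_real (A $ j $ l) * J2 0 i l p) + of_real (\<sigma> i j) * J0 0 p"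
      by (simp add: right_diff_distrib sum_subtractf prob[OF p])
  qed
qed

text \<open>By \<open>b1\<close> the linear term is of order \<open>\<epsilon>\<^sup>2\<close>, the
  order at which a coefficient is wanted, so it has to be computed and not only bounded. Its value
  comes from the part of \<open>H\<close> free of \<open>E\<close>, whose product with the corrector
  is averaged by the covariance \<open>R\<close>. The quadratic term carries one factor
  \<open>E\<close> and is of order \<open>\<epsilon>\<^sup>2 g2\<close>.\<close>

theorem averaged_drift:
  assumes R: "\<And>i j. (\<Sum>l\<in>UNIV. A $ i $ l * R l j) + (\<Sum>l\<in>UNIV. A $ j $ l * R i l) + \<sigma> i j = 0"
    and prob: "\<And>p. p \<in> P \<Longrightarrow> J0 0 p = 1"
    and m: "\<And>k. (\<Sum>l\<in>UNIV. m l * of_real (A $ l $ k)) - \<i> * of_real \<omega> * m k = - ll k"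
  shows "dominated P (\<lambda>p. of_real (\<epsilon> p) * (\<Sum>k\<in>UNIV. ll k * J1 1 k p) + of_real (\<epsilon> p ^ 2) * (\<Sum>k\<in>UNIV. \<Sum>l\<in>UNIV. b k l * J2 1 k l p)
     - of_real (\<epsilon> p ^ 2) * (\<Sum>k\<in>UNIV. \<Sum>i\<in>UNIV. c 0 k * m i * of_real (R k i))) (\<lambda>p. \<epsilon> p ^ 4 + \<delta> p)"
proof -
  let ?h = "\<lambda>p. \<epsilon> p ^ 4 + \<delta> p"
  have e\<delta>: "\<epsilon> p ^ n * \<delta> p \<le> \<delta> p" if "p \<in> P" for p n
    using \<delta>[OF that] \<epsilon>[OF that] by (intro mult_left_le_one_le) (auto intro: power_le_one)
  have h\<delta>: "dominated P (\<lambda>p. of_real (\<epsilon> p ^ n) * f p) ?h" if "dominated P f \<delta>" for f n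
    by (rule dominated_mono[OF dominated_mult_real[OF that], where c=1]) (use \<epsilon> e\<delta> in \<open>auto intro: order.trans add_increasing\<close>)
  have hg2: "dominated P (\<lambda>p. of_real (\<epsilon> p ^ 2) * f p) ?h" if "dominated P f g2" for f
    by (rule dominated_mono[OF dominated_mult_real[OF that], where c=1])
       (use \<epsilon> e\<delta>[of _ 2] in \<open>auto simp: distrib_left power_add[symmetric]\<close>)
  have hg1: "dominated P (\<lambda>p. of_real (\<epsilon> p ^ 3) * f p) ?h" if "dominated P f g1" for f
    by (rule dominated_mono[OF dominated_mult_real[OF that], where c=1])
       (use \<epsilon> e\<delta>[of _ 3] in \<open>auto simp: distrib_left power_add[symmetric] power_Suc2[symmetric]\<close>)
  have hg0: "dominated P (\<lambda>p. of_real (\<epsilon> p ^ 5) * f p) ?h" if "dominated P f (\<lambda>p. 1)" for f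
  proof (rule dominated_mono[OF dominated_mult_real[OF that], where c=1])
    show "\<epsilon> p ^ 5 * 1 \<le> 1 * ?h p" if "p \<in> P" for p
      using \<epsilon>[OF that] \<delta>[OF that] power_decreasing[of 4 5 "\<epsilon> p"] by simp
  qed (use \<epsilon> in auto)
  text \<open>The resolvent \<open>m\<close> is the first corrector: Dynkin's formula for \<open>E m(u)\<close> trades the mean of
    \<open>E ll(u)\<close> for the mean of \<open>H m(u)\<close>, which is of order \<open>\<epsilon>\<close>.\<close>
  have 1: "dominated P (\<lambda>p. (\<Sum>i\<in>UNIV. m i * JH 0 (\<lambda>p x. u p i x * 1) p) - (\<Sum>k\<in>UNIV. ll k * J1 1 k p)) \<delta>"
  proof (rule dominated_cong)
    show "dominated P (\<lambda>p. \<Sum>i\<in>UNIV. m i * (of_nat 1 * (JH (1 - 1) (\<lambda>p x. u p i x * 1) p - \<i> * of_real \<omega> * J1 1 i p)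
      + (\<Sum>l\<in>UNIV. of_real (A $ i $ l) * J1 1 l p))) \<delta>"
      by (intro dominated_sum dominated_cmult D1) auto
    fix p
    have "(\<Sum>k\<in>UNIV. ll k * J1 1 k p) = - (\<Sum>k\<in>UNIV. (\<Sum>l\<in>UNIV. m l * of_real (A $ l $ k)) * J1 1 k p) + (\<Sum>k\<in>UNIV. \<i> * of_real \<omega> * m k * J1 1 k p)"
    proof -
      have "ll k = - (\<Sum>l\<in>UNIV. m l * of_real (A $ l $ k)) + \<i> * of_real \<omega> * m k" for k
        using m[of k] by (simp add: algebra_simps add_eq_0_iff)
      then show ?thesis by (simp add: distrib_right sum.distrib sum_negf sum_subtractf left_diff_distrib)
    qed
    also have "(\<Sum>k\<in>UNIV. (\<Sum>l\<in>UNIV. m l * of_real (A $ l $ k)) * J1 1 k p) = (\<Sum>l\<in>UNIV. m l * (\<Sum>k\<in>UNIV. of_real (A $ l $ k) * J1 1 k p))"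
      by (simp add: sum_distrib_left sum_distrib_right mult.assoc) (rule sum.swap)
    finally show "(\<Sum>i\<in>UNIV. m i * JH 0 (\<lambda>p x. u p i x * 1) p) - (\<Sum>k\<in>UNIV. ll k * J1 1 k p) =
      (\<Sum>i\<in>UNIV. m i * (of_nat 1 * (JH (1 - 1) (\<lambda>p x. u p i x * 1) p - \<i> * of_real \<omega> * J1 1 i p)
      + (\<Sum>l\<in>UNIV. of_real (A $ i $ l) * J1 1 l p)))"
      by (simp add: algebra_simps sum.distrib sum_subtractf)
  qed
  \<comment> \<open>The summand \<open>q = 0\<close> at order \<open>\<epsilon>\<^sup>2\<close>
    gives the covariance up to \<open>\<delta>\<close>; \<open>q = 1, 2\<close> are second moments
    with a nonzero harmonic, of size \<open>g2\<close>; the quadratic part of \<open>H\<close> meets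
    \<open>u\<close> in \<open>J3\<close>, of size \<open>g1\<close>, at order
    \<open>\<epsilon> ^ 3\<close>. This is where the parity turns the error into
    \<open>\<epsilon> ^ 4\<close>.\<close>
  have 2: "dominated P (\<lambda>p. of_real (\<epsilon> p) * JH 0 (\<lambda>p x. u p i x * 1) p - of_real (\<epsilon> p ^ 2) * (\<Sum>k\<in>UNIV. c 0 k * of_real (R k i))) ?h" for i
  proof (rule dominated_cong)
    show "dominated P (\<lambda>p. of_real (\<epsilon> p ^ 2) * (\<Sum>k\<in>UNIV. c 0 k * (J2 0 k i p - of_real (R k i)))
      + (of_real (\<epsilon> p ^ 2) * (\<Sum>k\<in>UNIV. c 1 k * J2 1 k i p) + (of_real (\<epsilon> p ^ 2) * (\<Sum>k\<in>UNIV. c 2 k * J2 2 k i p)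
      + (of_real (\<epsilon> p ^ 3) * (\<Sum>q<3. \<Sum>k\<in>UNIV. \<Sum>l\<in>UNIV. d q k l * J3 (0 + q) k l i p) + of_real (\<epsilon> p ^ 5) * (\<Sum>q<3. e q * J1 (0 + q) i p))))) ?h"
      by (intro dominated_add h\<delta> hg2 hg1 hg0 dominated_sum dominated_cmult b5 b4 b3 R prob dominated_J[OF adm(1)]) auto
    fix p assume p: "p \<in> P"
    show "of_real (\<epsilon> p) * JH 0 (\<lambda>p x. u p i x * 1) p - of_real (\<epsilon> p ^ 2) * (\<Sum>k\<in>UNIV. c 0 k * of_real (R k i)) =
      of_real (\<epsilon> p ^ 2) * (\<Sum>k\<in>UNIV. c 0 k * (J2 0 k i p - of_real (R k i)))
      + (of_real (\<epsilon> p ^ 2) * (\<Sum>k\<in>UNIV. c 1 k * J2 1 k i p) + (of_real (\<epsilon> p ^ 2) * (\<Sum>k\<in>UNIV. c 2 k * J2 2 k i p)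
      + (of_real (\<epsilon> p ^ 3) * (\<Sum>q<3. \<Sum>k\<in>UNIV. \<Sum>l\<in>UNIV. d q k l * J3 (0 + q) k l i p) + of_real (\<epsilon> p ^ 5) * (\<Sum>q<3. e q * J1 (0 + q) i p))))"
    proof -
      have alg: "z * (\<Sum>q<3. z * X q + z ^ 2 * Y q + z ^ 4 * Z q) - z ^ 2 * r =
          z ^ 2 * (X 0 - r) + (z ^ 2 * X 1 + (z ^ 2 * X 2 + (z ^ 3 * (\<Sum>q<3. Y q) + z ^ 5 * (\<Sum>q<3. Z q))))"
        for z r :: complex and X Y Z :: "nat \<Rightarrow> complex"
        by (simp add: eval_nat_numeral algebra_simps)
      have "of_real (\<epsilon> p) * JH 0 (\<lambda>p x. u p i x * 1) p = of_real (\<epsilon> p) * (\<Sum>q<3. of_real (\<epsilon> p) * (\<Sum>k\<in>UNIV. c q k * J2 (0 + q) k i p)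
        + of_real (\<epsilon> p) ^ 2 * (\<Sum>k\<in>UNIV. \<Sum>l\<in>UNIV. d q k l * J3 (0 + q) k l i p) + of_real (\<epsilon> p) ^ 4 * (e q * J1 (0 + q) i p))"
        by (subst JH_expand(2)[OF adm(1) _ p]) simp_all
      then show ?thesis
        by (simp only: alg of_real_power) (simp add: right_diff_distrib sum_subtractf numeral_2_eq_2)
    qed
  qed
  have 3: "dominated P (\<lambda>p. of_real (\<epsilon> p) * ((\<Sum>i\<in>UNIV. m i * JH 0 (\<lambda>p x. u p i x * 1) p) - (\<Sum>k\<in>UNIV. ll k * J1 1 k p))) ?h"
    using h\<delta>[OF 1, of 1] by simp
  have 4: "dominated P (\<lambda>p. of_real (\<epsilon> p ^ 2) * (\<Sum>k\<in>UNIV. \<Sum>l\<in>UNIV. b k l * J2 1 k l p)) ?h"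
    by (intro hg2 dominated_sum dominated_cmult b4) auto
  have "dominated P (\<lambda>p. (\<Sum>i\<in>UNIV. m i * (of_real (\<epsilon> p) * JH 0 (\<lambda>p x. u p i x * 1) p - of_real (\<epsilon> p ^ 2) * (\<Sum>k\<in>UNIV. c 0 k * of_real (R k i))))
     - of_real (\<epsilon> p) * ((\<Sum>i\<in>UNIV. m i * JH 0 (\<lambda>p x. u p i x * 1) p) - (\<Sum>k\<in>UNIV. ll k * J1 1 k p))
     + of_real (\<epsilon> p ^ 2) * (\<Sum>k\<in>UNIV. \<Sum>l\<in>UNIV. b k l * J2 1 k l p)) ?h"
    by (intro dominated_add dominated_diff dominated_sum dominated_cmult 2 3 4) auto
  then show ?thesis
  proof (rule dominated_cong)
    fix p
    have sw: "(\<Sum>k\<in>UNIV. \<Sum>i\<in>UNIV. c 0 k * m i * of_real (R k i)) = (\<Sum>i\<in>UNIV. m i * (\<Sum>k\<in>UNIV. c 0 k * of_real (R k i)))"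
      by (subst sum.swap) (simp add: sum_distrib_left mult_ac)
    show "of_real (\<epsilon> p) * (\<Sum>k\<in>UNIV. ll k * J1 1 k p) + of_real (\<epsilon> p ^ 2) * (\<Sum>k\<in>UNIV. \<Sum>l\<in>UNIV. b k l * J2 1 k l p)
     - of_real (\<epsilon> p ^ 2) * (\<Sum>k\<in>UNIV. \<Sum>i\<in>UNIV. c 0 k * m i * of_real (R k i)) =
     (\<Sum>i\<in>UNIV. m i * (of_real (\<epsilon> p) * JH 0 (\<lambda>p x. u p i x * 1) p - of_real (\<epsilon> p ^ 2) * (\<Sum>k\<in>UNIV. c 0 k * of_real (R k i))))
     - of_real (\<epsilon> p) * ((\<Sum>i\<in>UNIV. m i * JH 0 (\<lambda>p x. u p i x * 1) p) - (\<Sum>k\<in>UNIV. ll k * J1 1 k p))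
     + of_real (\<epsilon> p ^ 2) * (\<Sum>k\<in>UNIV. \<Sum>l\<in>UNIV. b k l * J2 1 k l p)"
      unfolding sw by (simp add: right_diff_distrib sum_subtractf sum_distrib_left mult_ac)
  qed
qed

end

section \<open>Increments of Brownian motion\<close>

text \<open>Lebesgue measure on \<open>real^'n\<close> is the image of a product measure indexed by
  \<open>Basis\<close>. The proof only transports the factors from coordinates \<open>i\<close> to
  basis vectors \<open>axis i 1\<close> through \<open>g\<close> and applies Fubini.\<close>

lemma has_bochner_integral_lborel_prod:
  fixes f :: "'n::finite \<Rightarrow> real \<Rightarrow> real"
  assumes f: "\<And>i. has_bochner_integral lborel (f i) (c i)"
  shows "has_bochner_integral lborel (\<lambda>x::real^'n. \<Prod>i\<in>UNIV. f i (x $ i)) (\<Prod>i\<in>UNIV. c i)"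
proof -
  define g where "g b = f (SOME i. b = axis i 1)" for b :: "real^'n"
  have g: "g (axis i 1) = f i" for i
    unfolding g_def by (rule arg_cong[where f=f], rule some_equality) (auto simp: axis_eq_axis)
  have B: "(Basis :: (real^'n) set) = (\<lambda>i. axis i 1) ` UNIV"
    by (auto simp: Basis_vec_def)
  have inj: "inj (\<lambda>i. axis i (1::real) :: real^'n)" by (auto simp: inj_on_def axis_eq_axis)
  have ig: "integrable lborel (g b)" if "b \<in> Basis" for b :: "real^'n"
    using that f by (auto simp: B g has_bochner_integral_iff)
  have [measurable]: "f i \<in> borel_measurable borel" for i
    using f[of i] by (auto dest: has_bochner_integral_integrable borel_measurable_integrable)
  interpret product_sigma_finite "\<lambda>b::real^'n. lborel :: real measure" ..
  have eq: "(\<Prod>i\<in>UNIV. f i ((\<Sum>b\<in>Basis. x b *\<^sub>R b) $ i)) = (\<Prod>b\<in>Basis. g b (x b))" for x :: "real^'n \<Rightarrow> real"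
  proof -
    have "(\<Sum>b\<in>Basis. x b *\<^sub>R b) $ i = x (axis i 1)" for i
    proof -
      have ax: "(axis j (1::real) :: real^'n) $ i = of_bool (j = i)" for j by (auto simp: axis_def)
      have "(\<Sum>b\<in>Basis. x b *\<^sub>R b) $ i = (\<Sum>j\<in>UNIV. x (axis j 1) * (axis j (1::real) :: real^'n) $ i)"
        by (simp add: B sum.reindex[OF inj])
      also have "\<dots> = (\<Sum>j\<in>UNIV. if j = i then x (axis j 1) else 0)"
        unfolding ax by (intro sum.cong) auto
      finally show ?thesis by simp
    qed
    then show ?thesis by (simp add: B prod.reindex[OF inj] g)
  qed
  have "integrable (\<Pi>\<^sub>M b\<in>Basis. lborel) (\<lambda>x. \<Prod>b\<in>(Basis::(real^'n) set). g b (x b))"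
    by (rule product_integrable_prod) (auto intro: ig)
  moreover have "(\<integral>x. (\<Prod>b\<in>(Basis::(real^'n) set). g b (x b)) \<partial>(\<Pi>\<^sub>M b\<in>Basis. lborel)) = (\<Prod>i\<in>UNIV. c i)"
    using f by (subst product_integral_prod)
      (auto intro!: ig simp: B prod.reindex[OF inj] g has_bochner_integral_iff)
  ultimately show ?thesis
    unfolding has_bochner_integral_iff
    by (subst (1 2) lborel_eq) (simp add: integrable_distr_eq integral_distr eq del: sum_component)
qed

text \<open>The moment of order \<open>k\<close> of the centred normal law with variance
  \<open>h\<close>.\<close>

definition normal_mom :: "real \<Rightarrow> nat \<Rightarrow> real" where
  "normal_mom h k = (if even k then fact k / ((2 / h) ^ (k div 2) * fact (k div 2)) else 0)"

lemma has_bochner_integral_normal_mom: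
  assumes "h > 0"
  shows "has_bochner_integral lborel (\<lambda>x. normal_density 0 (sqrt h) x * x ^ k) (normal_mom h k)"
proof (cases "even k")
  case True
  then obtain j where j: "k = 2 * j" by (auto elim: evenE)
  show ?thesis using normal_moment_even[of "sqrt h" 0 j] assms
    by (simp add: j normal_mom_def)
next
  case False
  then obtain j where j: "k = 2 * j + 1" by (auto elim: oddE)
  show ?thesis using normal_moment_odd[of "sqrt h" 0 j] assms
    by (simp add: j normal_mom_def)
qed

lemma normal_mom_0 [simp]: "normal_mom h 0 = 1"
  by (simp add: normal_mom_def)

lemma normal_mom_2: "normal_mom h 2 = h"
  by (simp add: normal_mom_def fact_numeral)

lemma normal_mom_6: "normal_mom h 6 = 15 * h ^ 3"
  by (simp add: normal_mom_def fact_numeral power_divide)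

lemma normal_mom_odd: "odd k \<Longrightarrow> normal_mom h k = 0"
  by (simp add: normal_mom_def)

text \<open>Every summand is at most the largest one, whose sixth power is one of the terms on the
  right.\<close>

lemma pow6_sum_le:
  fixes x :: "'n::finite \<Rightarrow> real"
  assumes "\<And>i. x i \<ge> 0"
  shows "(\<Sum>i\<in>UNIV. x i) ^ 6 \<le> real CARD('n) ^ 6 * (\<Sum>i\<in>UNIV. x i ^ 6)"
proof -
  obtain j where j: "\<And>i. x i \<le> x j"
  proof -
    have "Max (range x) \<in> range x" by (rule Max_in) auto
    then show ?thesis using that Max_ge[of "range x"] by (metis finite_class.finite_UNIV finite_imageI rangeE rangeI)
  qed
  have "(\<Sum>i\<in>UNIV. x i) \<le> (\<Sum>i\<in>(UNIV::'n set). x j)" by (intro sum_mono j)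
  then have "(\<Sum>i\<in>UNIV. x i) ^ 6 \<le> (real CARD('n) * x j) ^ 6"
    by (intro power_mono) (auto intro: sum_nonneg assms)
  also have "\<dots> \<le> real CARD('n) ^ 6 * (\<Sum>i\<in>UNIV. x i ^ 6)"
    unfolding power_mult_distrib by (intro mult_left_mono member_le_sum) (auto simp: assms)
  finally show ?thesis .
qed

locale brownian =
  fixes M :: "'w measure" and F :: "real \<Rightarrow> 'w measure" and W :: "real \<Rightarrow> 'w \<Rightarrow> real^'m"
  assumes bm: "standard_brownian_motion M F W"
begin

sublocale prob_space M
  using bm by (simp add: standard_brownian_motion_def filtered_prob_space_def)

lemma space_F [simp]: "space (F t) = space M"
  using bm by (simp add: standard_brownian_motion_def filtered_prob_space_def filtration_def)

lemma sets_F_mono: "s \<le> t \<Longrightarrow> sets (F s) \<subseteq> sets (F t)"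
  using bm by (simp add: standard_brownian_motion_def filtered_prob_space_def filtration_def)

lemma sets_F_subset: "sets (F t) \<subseteq> sets M"
  using bm by (simp add: standard_brownian_motion_def filtered_prob_space_def subalgebra_def)

lemma measurable_F_mono: "X \<in> measurable (F s) N \<Longrightarrow> s \<le> t \<Longrightarrow> X \<in> measurable (F t) N"
  using sets_F_mono[of s t] by (auto simp: measurable_def)

lemma measurable_F_imp: "X \<in> measurable (F s) N \<Longrightarrow> X \<in> measurable M N"
  using sets_F_subset[of s] by (auto simp: measurable_def)

lemma W_adapted: "continuous_adapted M F W"
  using bm by (simp add: standard_brownian_motion_def)

lemma measurable_W: "t \<ge> 0 \<Longrightarrow> W t \<in> borel_measurable (F t)"
  using W_adapted by (simp add: continuous_adapted_def)

lemma measurable_increment: "0 \<le> s \<Longrightarrow> s \<le> t \<Longrightarrow> (\<lambda>w. W t w - W s w) \<in> borel_measurable M"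
  using measurable_W[of s] measurable_W[of t] by (intro borel_measurable_diff measurable_F_imp) auto

lemma increment_moments:
  assumes "0 \<le> s" "s < t"
  shows "has_bochner_integral M (\<lambda>w. \<Prod>l\<in>UNIV. ((W t w - W s w) $ l) ^ n l) (\<Prod>l\<in>UNIV. normal_mom (t - s) (n l))"
proof -
  have D: "distributed M lborel (\<lambda>w. W t w - W s w)
      (\<lambda>x. ennreal (\<Prod>i\<in>UNIV. normal_density 0 (sqrt (t - s)) (x $ i)))"
    using bm assms by (simp add: standard_brownian_motion_def)
  have h: "has_bochner_integral lborel (\<lambda>x::real^'m. \<Prod>i\<in>UNIV. (normal_density 0 (sqrt (t - s)) (x $ i) * x $ i ^ n i))
     (\<Prod>l\<in>UNIV. normal_mom (t - s) (n l))"
    using assms by (intro has_bochner_integral_lborel_prod has_bochner_integral_normal_mom) auto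
  have g: "(\<lambda>x::real^'m. \<Prod>l\<in>UNIV. (x $ l) ^ n l) \<in> borel_measurable lborel"
    by (intro borel_measurable_prod borel_measurable_power) (auto intro!: borel_measurable_continuous_onI continuous_intros)
  have nn: "0 \<le> (\<Prod>i\<in>UNIV. normal_density 0 (sqrt (t - s)) (x $ i))" for x :: "real^'m"
    by (intro prod_nonneg) auto
  show ?thesis
    using h distributed_integral[OF D g nn] distributed_integrable[OF D g nn]
    by (simp add: has_bochner_integral_iff prod.distrib)
qed

text \<open>Independence is assumed of sigma-algebras. The one generated by \<open>Z\<close> lies in
  \<open>F s\<close>, the one generated by \<open>g\<close> of the increment lies in that of the
  increment, so the two variables are independent and the mean of the product factors.\<close>

lemma increment_independent:
  fixes Z :: "'w \<Rightarrow> complex" and g :: "real^'m \<Rightarrow> real"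
  assumes st: "0 \<le> s" "s < t" and Z: "Z \<in> borel_measurable (F s)" "integrable M Z"
    and g: "g \<in> borel_measurable borel" "integrable M (\<lambda>w. g (W t w - W s w))"
  shows "has_bochner_integral M (\<lambda>w. Z w * of_real (g (W t w - W s w)))
    ((\<integral>w. Z w \<partial>M) * of_real (\<integral>w. g (W t w - W s w) \<partial>M))"
proof -
  let ?D = "\<lambda>w. W t w - W s w"
  have ind: "indep_set (sets (F s)) (sets (vimage_algebra (space M) ?D borel))"
    using bm st by (simp add: standard_brownian_motion_def)
  have D: "random_variable borel ?D" using st by (intro measurable_increment) auto
  let ?Y = "\<lambda>w. complex_of_real (g (?D w))"
  have Y: "?Y \<in> borel_measurable (vimage_algebra (space M) ?D borel)"
    using g(1) by (intro measurable_compose[OF measurable_vimage_algebra1, where N=borel]) auto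
  have iv: "indep_var borel Z borel ?Y"
    unfolding indep_var_eq
  proof (intro conjI)
    show "random_variable borel Z" using Z by auto
    show "random_variable borel ?Y" using g(2) by auto
    have "{Z -` A \<inter> space M |A. A \<in> sets borel} \<subseteq> sets (F s)"
      using Z(1) by (auto dest: measurable_sets)
    then have 1: "sigma_sets (space M) {Z -` A \<inter> space M |A. A \<in> sets borel} \<subseteq> sets (F s)"
      using sets.sigma_sets_subset[of _ "F s"] by simp
    have "{?Y -` A \<inter> space M |A. A \<in> sets borel} \<subseteq> sets (vimage_algebra (space M) ?D borel)"
      using measurable_sets[OF Y] by auto
    then have 2: "sigma_sets (space M) {?Y -` A \<inter> space M |A. A \<in> sets borel} \<subseteq> sets (vimage_algebra (space M) ?D borel)"
      using sets.sigma_sets_subset[of _ "vimage_algebra (space M) ?D borel"] by simp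
    show "indep_set (sigma_sets (space M) {Z -` A \<inter> space M |A. A \<in> sets borel})
     (sigma_sets (space M) {?Y -` A \<inter> space M |A. A \<in> sets borel})"
      using ind 1 2 unfolding indep_sets2_eq by blast
  qed
  show ?thesis
    unfolding has_bochner_integral_iff
    using indep_var_lebesgue_integral[OF iv] indep_var_integrable[OF iv] Z(2) g(2) by simp
qed

lemma increment_norm_pow6:
  "\<exists>C\<ge>0. \<forall>s t. 0 \<le> s \<longrightarrow> s \<le> t \<longrightarrow> integrable M (\<lambda>w. norm (W t w - W s w) ^ 6) \<and>
     (\<integral>w. norm (W t w - W s w) ^ 6 \<partial>M) \<le> C * (t - s) ^ 3"
proof -
  let ?N = "real CARD('m)"
  \<comment> \<open>15 is the sixth moment of the standard normal law; the powers of
    \<open>?N\<close> come from passing from the norm to the coordinates.\<close>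
  let ?C = "?N ^ 6 * (?N * 15)"
  have "integrable M (\<lambda>w. norm (W t w - W s w) ^ 6) \<and>
     (\<integral>w. norm (W t w - W s w) ^ 6 \<partial>M) \<le> ?C * (t - s) ^ 3" if st: "0 \<le> s" "s \<le> t" for s t
  proof (cases "s = t")
    case False
    with st have "s < t" by simp
    have "has_bochner_integral M (\<lambda>w. ((W t w - W s w) $ l) ^ 6) (15 * (t - s) ^ 3)" for l
    proof -
      have "(\<Prod>k\<in>UNIV. ((W t w - W s w) $ k) ^ (if k = l then 6 else 0)) = ((W t w - W s w) $ l) ^ 6" for w
        by (subst prod.remove[of _ l]) (auto intro!: prod.neutral)
      moreover have "(\<Prod>k\<in>UNIV. normal_mom (t - s) (if k = l then 6 else 0)) = 15 * (t - s) ^ 3"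
        by (subst prod.remove[of _ l]) (auto intro!: prod.neutral simp: normal_mom_6)
      ultimately show ?thesis
        using increment_moments[OF st(1) \<open>s < t\<close>, of "\<lambda>k. if k = l then 6 else 0"] by simp
    qed
    then have h: "has_bochner_integral M (\<lambda>w. ?N ^ 6 * (\<Sum>l\<in>UNIV. ((W t w - W s w) $ l) ^ 6))
        (?N ^ 6 * (\<Sum>l\<in>(UNIV::'m set). 15 * (t - s) ^ 3))"
      by (intro has_bochner_integral_mult_right has_bochner_integral_sum)
    have le: "norm (W t w - W s w) ^ 6 \<le> ?N ^ 6 * (\<Sum>l\<in>UNIV. ((W t w - W s w) $ l) ^ 6)" for w
    proof -
      have "norm (W t w - W s w) ^ 6 \<le> (\<Sum>l\<in>UNIV. \<bar>(W t w - W s w) $ l\<bar>) ^ 6"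
        by (intro power_mono norm_le_l1_cart) auto
      also have "\<dots> \<le> ?N ^ 6 * (\<Sum>l\<in>UNIV. \<bar>(W t w - W s w) $ l\<bar> ^ 6)" by (rule pow6_sum_le) simp
      finally show ?thesis by (simp add: power_even_abs)
    qed
    have ih: "integrable M (\<lambda>w. ?N ^ 6 * (\<Sum>l\<in>UNIV. ((W t w - W s w) $ l) ^ 6))"
      using h by (simp add: has_bochner_integral_iff)
    have i: "integrable M (\<lambda>w. norm (W t w - W s w) ^ 6)"
      by (rule Bochner_Integration.integrable_bound[OF ih])
         (use measurable_increment[OF st] order.trans[OF le abs_ge_self] in \<open>auto intro!: borel_measurable_power borel_measurable_norm\<close>)
    have "(\<integral>w. norm (W t w - W s w) ^ 6 \<partial>M) \<le> ?N ^ 6 * (\<Sum>l\<in>(UNIV::'m set). 15 * (t - s) ^ 3)"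
      unfolding has_bochner_integral_integral_eq[OF h, symmetric]
      by (intro integral_mono i ih le)
    with i show ?thesis by simp
  qed simp
  then show ?thesis by (intro exI[of _ ?C]) auto
qed

text \<open>A monomial is encoded by its exponents, sums of indicators
  \<open>of_bool (l = i)\<close>; the product of the coordinate moments vanishes as soon as one
  exponent is odd.\<close>

lemma increment_monomial:
  assumes "0 \<le> s" "s \<le> t"
  shows "has_bochner_integral M (\<lambda>w. (W t w - W s w) $ i) 0"
    and "has_bochner_integral M (\<lambda>w. (W t w - W s w) $ i * (W t w - W s w) $ j) ((t - s) * of_bool (i = j))"
    and "has_bochner_integral M (\<lambda>w. (W t w - W s w) $ i * (W t w - W s w) $ j * (W t w - W s w) $ k) 0"
proof -
  have p: "(\<Prod>l\<in>UNIV. (x $ l) ^ of_bool (l = i)) = x $ i" for x :: "real^'m" and i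
    by (subst prod.remove[of _ i]) (auto intro!: prod.neutral)
  have "has_bochner_integral M (\<lambda>w. (W t w - W s w) $ i) 0 \<and>
    has_bochner_integral M (\<lambda>w. (W t w - W s w) $ i * (W t w - W s w) $ j) ((t - s) * of_bool (i = j)) \<and>
    has_bochner_integral M (\<lambda>w. (W t w - W s w) $ i * (W t w - W s w) $ j * (W t w - W s w) $ k) 0"
  proof (cases "s = t")
    case False
    with assms have st: "0 \<le> s" "s < t" by auto
    have odd: "(\<Prod>l\<in>UNIV. normal_mom (t - s) (n l)) = 0" if "odd (n l)" for n :: "'m \<Rightarrow> nat" and l
      using normal_mom_odd[OF that] by (intro prod_zero) auto
    have 1: "(\<Prod>l\<in>UNIV. normal_mom (t - s) (of_bool (l = i))) = 0"
      by (rule odd[of _ i]) simp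
    have 2: "(\<Prod>l\<in>UNIV. normal_mom (t - s) (of_bool (l = i) + of_bool (l = j))) = (t - s) * of_bool (i = j)"
    proof (cases "i = j")
      case True
      then show ?thesis
        using normal_mom_2[of "t - s"]
        by (subst prod.remove[of _ i]) (auto intro!: prod.neutral simp: numeral_2_eq_2)
    next
      case False
      then show ?thesis using odd[of "\<lambda>l. of_bool (l = i) + of_bool (l = j)" i] by simp
    qed
    \<comment> \<open>The three exponents sum to an odd number, so whatever coincidences occur among
      \<open>i\<close>, \<open>j\<close>, \<open>k\<close>, some exponent is odd.\<close>
    have 3: "(\<Prod>l\<in>UNIV. normal_mom (t - s) (of_bool (l = i) + of_bool (l = j) + of_bool (l = k))) = 0"
    proof -
      let ?n = "\<lambda>l::'m. of_bool (l = i) + of_bool (l = j) + of_bool (l = k) :: nat"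
      have "(\<Sum>l\<in>UNIV. ?n l) = 3" by (simp add: sum.distrib)
      moreover have "even (\<Sum>l\<in>UNIV. ?n l)" if "\<And>l. even (?n l)" by (rule dvd_sum) (use that in blast)
      ultimately obtain l where "odd (?n l)" by (metis odd_numeral)
      then show ?thesis by (rule odd)
    qed
    show ?thesis
      using increment_moments[OF st, of "\<lambda>l. of_bool (l = i)"]
        increment_moments[OF st, of "\<lambda>l. of_bool (l = i) + of_bool (l = j)"]
        increment_moments[OF st, of "\<lambda>l. of_bool (l = i) + of_bool (l = j) + of_bool (l = k)"]
      unfolding 1 2 3 power_add prod.distrib p by blast
  qed (simp add: has_bochner_integral_zero)
  then show "has_bochner_integral M (\<lambda>w. (W t w - W s w) $ i) 0"
    and "has_bochner_integral M (\<lambda>w. (W t w - W s w) $ i * (W t w - W s w) $ j) ((t - s) * of_bool (i = j))"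
    and "has_bochner_integral M (\<lambda>w. (W t w - W s w) $ i * (W t w - W s w) $ j * (W t w - W s w) $ k) 0"
    by auto
qed

lemma increment_inner:
  assumes "0 \<le> s" "s \<le> t"
  shows "has_bochner_integral M (\<lambda>w. b \<bullet> (W t w - W s w)) 0"
    and "has_bochner_integral M (\<lambda>w. (b \<bullet> (W t w - W s w)) * (c \<bullet> (W t w - W s w))) ((t - s) * (b \<bullet> c))"
    and "has_bochner_integral M (\<lambda>w. (b \<bullet> (W t w - W s w)) * (c \<bullet> (W t w - W s w)) * (d \<bullet> (W t w - W s w))) 0"
proof -
  let ?D = "\<lambda>w. W t w - W s w"
  have "has_bochner_integral M (\<lambda>w. \<Sum>i\<in>UNIV. b $ i * ?D w $ i) (\<Sum>i\<in>UNIV. b $ i * 0)"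
    by (intro has_bochner_integral_sum has_bochner_integral_mult_right increment_monomial assms)
  then show "has_bochner_integral M (\<lambda>w. b \<bullet> ?D w) 0" by (simp add: inner_vec_def)
  have "has_bochner_integral M (\<lambda>w. \<Sum>i\<in>UNIV. \<Sum>j\<in>UNIV. (b $ i * c $ j) * (?D w $ i * ?D w $ j))
     (\<Sum>i\<in>UNIV. \<Sum>j\<in>UNIV. (b $ i * c $ j) * ((t - s) * of_bool (i = j)))"
    by (intro has_bochner_integral_sum has_bochner_integral_mult_right increment_monomial assms)
  moreover have "(\<Sum>i\<in>UNIV. \<Sum>j\<in>UNIV. (b $ i * c $ j) * ((t - s) * of_bool (i = j))) = (t - s) * (b \<bullet> c)"
    by (simp add: inner_vec_def sum_distrib_left of_bool_def if_distrib mult_ac cong: if_cong)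
  moreover have "(\<Sum>i\<in>UNIV. \<Sum>j\<in>UNIV. (b $ i * c $ j) * (?D w $ i * ?D w $ j)) = (b \<bullet> ?D w) * (c \<bullet> ?D w)" for w
    by (simp add: inner_vec_def sum_product mult_ac)
  ultimately show "has_bochner_integral M (\<lambda>w. (b \<bullet> ?D w) * (c \<bullet> ?D w)) ((t - s) * (b \<bullet> c))" by simp
  have "has_bochner_integral M (\<lambda>w. \<Sum>i\<in>UNIV. \<Sum>j\<in>UNIV. \<Sum>k\<in>UNIV. (b $ i * c $ j * d $ k) * (?D w $ i * ?D w $ j * ?D w $ k))
     (\<Sum>i\<in>UNIV. \<Sum>j\<in>UNIV. \<Sum>k\<in>UNIV. (b $ i * c $ j * d $ k) * 0)"
    by (intro has_bochner_integral_sum has_bochner_integral_mult_right increment_monomial assms)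
  moreover have "(\<Sum>i\<in>UNIV. \<Sum>j\<in>UNIV. \<Sum>k\<in>UNIV. (b $ i * c $ j * d $ k) * (?D w $ i * ?D w $ j * ?D w $ k)) =
      (b \<bullet> ?D w) * (c \<bullet> ?D w) * (d \<bullet> ?D w)" for w
  proof -
    have "(b \<bullet> ?D w) * (c \<bullet> ?D w) * (d \<bullet> ?D w) = (\<Sum>i\<in>UNIV. \<Sum>j\<in>UNIV. (b $ i * ?D w $ i) * (c $ j * ?D w $ j)) * (\<Sum>k\<in>UNIV. d $ k * ?D w $ k)"
      by (simp only: inner_vec_def sum_product inner_real_def)
    also have "\<dots> = (\<Sum>i\<in>UNIV. \<Sum>j\<in>UNIV. \<Sum>k\<in>UNIV. (b $ i * c $ j * d $ k) * (?D w $ i * ?D w $ j * ?D w $ k))"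
      unfolding sum_distrib_right unfolding sum_distrib_left by (intro sum.cong refl) (simp add: mult_ac)
    finally show ?thesis ..
  qed
  ultimately show "has_bochner_integral M (\<lambda>w. (b \<bullet> ?D w) * (c \<bullet> ?D w) * (d \<bullet> ?D w)) 0" by simp
qed

text \<open>The condition on \<open>g 0\<close> covers the degenerate increment
  \<open>s = t\<close>, for which no density is available and the variable is identically 0.\<close>

lemma increment_orthogonal:
  fixes Z :: "'w \<Rightarrow> complex" and g :: "real^'m \<Rightarrow> real"
  assumes st: "0 \<le> s" "s \<le> t" and Z: "Z \<in> borel_measurable (F s)" "integrable M Z"
    and g: "g \<in> borel_measurable borel" "has_bochner_integral M (\<lambda>w. g (W t w - W s w)) 0" "s = t \<Longrightarrow> g 0 = 0"
  shows "has_bochner_integral M (\<lambda>w. Z w * of_real (g (W t w - W s w))) 0"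
proof (cases "s = t")
  case False
  with st have "s < t" by simp
  from increment_independent[OF st(1) this Z g(1)] g(2) show ?thesis
    by (simp add: has_bochner_integral_iff)
qed (use g(3) in \<open>simp add: has_bochner_integral_zero\<close>)

end

section \<open>Continuous adapted processes\<close>

text \<open>The process sampled at the grid point to the left of \<open>s\<close> takes countably
  many time values, hence is jointly measurable; continuity makes it converge to the process as the
  mesh tends to 0.\<close>

lemma measurable_pair_of_continuous:
  fixes Y :: "real \<Rightarrow> 'w \<Rightarrow> 'b::{metric_space}"
  assumes Y: "\<And>s. Y s \<in> borel_measurable N"
    and cont: "\<And>w. w \<in> space N \<Longrightarrow> continuous_on UNIV (\<lambda>s. Y s w)"
  shows "(\<lambda>(s, w). Y s w) \<in> borel_measurable (borel \<Otimes>\<^sub>M N)"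
proof (rule borel_measurable_LIMSEQ_metric)
  fix n
  show "(\<lambda>x. Y (real_of_int \<lfloor>real (Suc n) * fst x\<rfloor> / real (Suc n)) (snd x)) \<in> borel_measurable (borel \<Otimes>\<^sub>M N)"
  proof (rule measurable_compose_countable[where f="\<lambda>i x. Y (real_of_int i / real (Suc n)) (snd x)"])
    show "(\<lambda>x. Y (real_of_int i / real (Suc n)) (snd x)) \<in> borel_measurable (borel \<Otimes>\<^sub>M N)" for i
      by (rule measurable_compose[OF measurable_snd Y])
    show "(\<lambda>x. \<lfloor>real (Suc n) * fst x\<rfloor>) \<in> borel \<Otimes>\<^sub>M N \<rightarrow>\<^sub>M count_space UNIV"
      by measurable
  qed
next
  fix x :: "real \<times> 'w" assume "x \<in> space (borel \<Otimes>\<^sub>M N)"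
  then obtain s w where x: "x = (s, w)" "w \<in> space N" by (auto simp: space_pair_measure)
  have "(\<lambda>n. real_of_int \<lfloor>real (Suc n) * s\<rfloor> / real (Suc n)) \<longlonglongrightarrow> s"
  proof (rule LIMSEQ_I)
    fix r :: real assume "r > 0"
    then obtain n0 where n0: "inverse (real (Suc n0)) < r" using reals_Archimedean by blast
    have "norm (real_of_int \<lfloor>real (Suc n) * s\<rfloor> / real (Suc n) - s) < r" if "n \<ge> n0" for n
    proof -
      have "\<bar>real_of_int \<lfloor>real (Suc n) * s\<rfloor> - real (Suc n) * s\<bar> \<le> 1" by linarith
      then have "\<bar>real_of_int \<lfloor>real (Suc n) * s\<rfloor> - real (Suc n) * s\<bar> / real (Suc n) \<le> 1 / real (Suc n)"
        by (intro divide_right_mono) auto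
      moreover have "\<bar>real_of_int \<lfloor>real (Suc n) * s\<rfloor> - real (Suc n) * s\<bar> / real (Suc n) =
          \<bar>(real_of_int \<lfloor>real (Suc n) * s\<rfloor> - real (Suc n) * s) / real (Suc n)\<bar>"
        unfolding abs_divide abs_of_nat ..
      moreover have "(real_of_int \<lfloor>real (Suc n) * s\<rfloor> - real (Suc n) * s) / real (Suc n) =
          real_of_int \<lfloor>real (Suc n) * s\<rfloor> / real (Suc n) - s"
        by (simp add: diff_divide_distrib del: of_nat_Suc)
      ultimately have "\<bar>real_of_int \<lfloor>real (Suc n) * s\<rfloor> / real (Suc n) - s\<bar> \<le> 1 / real (Suc n)"
        by metis
      also have "\<dots> \<le> inverse (real (Suc n0))" using that by (simp add: field_simps)
      finally show ?thesis using n0 by simp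
    qed
    then show "\<exists>n0. \<forall>n\<ge>n0. norm (real_of_int \<lfloor>real (Suc n) * s\<rfloor> / real (Suc n) - s) < r" by blast
  qed
  then have "(\<lambda>n. Y (real_of_int \<lfloor>real (Suc n) * s\<rfloor> / real (Suc n)) w) \<longlonglongrightarrow> Y s w"
    using cont[OF x(2)] by (intro continuous_on_tendsto_compose[of UNIV "\<lambda>s. Y s w"]) auto
  then show "(\<lambda>n. Y (real_of_int \<lfloor>real (Suc n) * fst x\<rfloor> / real (Suc n)) (snd x)) \<longlonglongrightarrow> (case x of (s, w) \<Rightarrow> Y s w)"
    by (simp add: x)
qed

lemma continuous_on_halfline:
  fixes f :: "real \<Rightarrow> 'b::topological_space"
  assumes "\<And>b. b \<ge> 0 \<Longrightarrow> continuous_on {0..b} f"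
  shows "continuous_on {0..} f"
  unfolding continuous_on_eq_continuous_within
proof
  fix x :: real assume x: "x \<in> {0..}"
  have "continuous (at x within {0..x + 1}) f"
    using assms[of "x + 1"] x by (auto simp: continuous_on_eq_continuous_within)
  moreover have "at x within {0..x + 1} = at x within {0..}"
    by (rule at_within_nhd[of _ "{..<x + 1}"]) auto
  ultimately show "continuous (at x within {0..}) f" by (simp add: continuous_within)
qed

section \<open>Closure properties of continuous adapted processes and pathwise equations\<close>

context brownian
begin

lemma continuous_adaptedD:
  assumes "continuous_adapted M F X"
  shows "t \<ge> 0 \<Longrightarrow> X t \<in> borel_measurable (F t)"
    and "w \<in> space M \<Longrightarrow> continuous_on {0..} (\<lambda>t. X t w)"
  using assms by (auto simp: continuous_adapted_def)

lemma continuous_adapted_measurable: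
  "continuous_adapted M F X \<Longrightarrow> t \<ge> 0 \<Longrightarrow> X t \<in> borel_measurable M"
  using continuous_adaptedD(1) measurable_F_imp by blast

text \<open>Clamping the time extends the paths continuously to the whole line. Clamping it at
  \<open>t\<close> as well keeps every value measurable for \<open>F t\<close>: this is progressive
  measurability.\<close>

lemma continuous_adapted_joint:
  fixes X :: "real \<Rightarrow> 'w \<Rightarrow> 'b::metric_space"
  assumes X: "continuous_adapted M F X"
  shows "(\<lambda>(s, w). X (max 0 s) w) \<in> borel_measurable (borel \<Otimes>\<^sub>M M)"
    and "t \<ge> 0 \<Longrightarrow> (\<lambda>(s, w). X (max 0 (min s t)) w) \<in> borel_measurable (borel \<Otimes>\<^sub>M F t)"
proof -
  show "(\<lambda>(s, w). X (max 0 s) w) \<in> borel_measurable (borel \<Otimes>\<^sub>M M)"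
  proof (rule measurable_pair_of_continuous)
    show "X (max 0 s) \<in> borel_measurable M" for s by (rule continuous_adapted_measurable[OF X]) simp
    show "continuous_on UNIV (\<lambda>s. X (max 0 s) w)" if "w \<in> space M" for w
      by (rule continuous_on_compose2[OF continuous_adaptedD(2)[OF X that]]) (auto intro!: continuous_intros)
  qed
  show "(\<lambda>(s, w). X (max 0 (min s t)) w) \<in> borel_measurable (borel \<Otimes>\<^sub>M F t)" if "t \<ge> 0"
  proof (rule measurable_pair_of_continuous)
    show "X (max 0 (min s t)) \<in> borel_measurable (F t)" for s
      by (rule measurable_F_mono[OF continuous_adaptedD(1)[OF X]]) (use that in auto)
    show "continuous_on UNIV (\<lambda>s. X (max 0 (min s t)) w)" if "w \<in> space (F t)" for w
      by (rule continuous_on_compose2[OF continuous_adaptedD(2)[OF X]]) (use that in \<open>auto intro!: continuous_intros\<close>)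
  qed
qed

lemma continuous_adapted_compose:
  assumes X: "continuous_adapted M F X" and g: "continuous_on UNIV g"
  shows "continuous_adapted M F (\<lambda>t w. g (X t w))"
  unfolding continuous_adapted_def
proof (intro conjI allI impI ballI)
  show "(\<lambda>w. g (X t w)) \<in> borel_measurable (F t)" if "t \<ge> 0" for t
    by (rule measurable_compose[OF continuous_adaptedD(1)[OF X that] borel_measurable_continuous_onI[OF g]])
  show "continuous_on {0..} (\<lambda>t. g (X t w))" if "w \<in> space M" for w
    by (rule continuous_on_compose2[OF g continuous_adaptedD(2)[OF X that]]) auto
qed

lemma continuous_adapted_Pair:
  fixes X :: "real \<Rightarrow> 'w \<Rightarrow> 'b::second_countable_topology" and Y :: "real \<Rightarrow> 'w \<Rightarrow> 'c::second_countable_topology"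
  assumes X: "continuous_adapted M F X" and Y: "continuous_adapted M F Y"
  shows "continuous_adapted M F (\<lambda>t w. (X t w, Y t w))"
  using assms unfolding continuous_adapted_def
  by (auto intro!: borel_measurable_Pair continuous_on_Pair)

lemma continuous_adapted_compose2:
  fixes X :: "real \<Rightarrow> 'w \<Rightarrow> 'b::second_countable_topology" and Y :: "real \<Rightarrow> 'w \<Rightarrow> 'c::second_countable_topology"
  assumes X: "continuous_adapted M F X" and Y: "continuous_adapted M F Y" and g: "continuous_on UNIV (\<lambda>(x, y). g x y)"
  shows "continuous_adapted M F (\<lambda>t w. g (X t w) (Y t w))"
  using continuous_adapted_compose[OF continuous_adapted_Pair[OF X Y] g] by simp

lemma continuous_adapted_const: "continuous_adapted M F (\<lambda>t w. c)"
  by (simp add: continuous_adapted_def)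

lemma continuous_adapted_add:
  fixes X Y :: "real \<Rightarrow> 'w \<Rightarrow> 'b::{real_normed_vector, second_countable_topology}"
  shows "continuous_adapted M F X \<Longrightarrow> continuous_adapted M F Y \<Longrightarrow> continuous_adapted M F (\<lambda>t w. X t w + Y t w)"
  by (rule continuous_adapted_compose2) (auto simp: split_def intro!: continuous_intros)

lemma continuous_adapted_diff:
  fixes X Y :: "real \<Rightarrow> 'w \<Rightarrow> 'b::{real_normed_vector, second_countable_topology}"
  shows "continuous_adapted M F X \<Longrightarrow> continuous_adapted M F Y \<Longrightarrow> continuous_adapted M F (\<lambda>t w. X t w - Y t w)"
  by (rule continuous_adapted_compose2) (auto simp: split_def intro!: continuous_intros)

lemma continuous_adapted_mult:
  fixes X Y :: "real \<Rightarrow> 'w \<Rightarrow> 'b::{real_normed_algebra, second_countable_topology}"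
  shows "continuous_adapted M F X \<Longrightarrow> continuous_adapted M F Y \<Longrightarrow> continuous_adapted M F (\<lambda>t w. X t w * Y t w)"
  by (rule continuous_adapted_compose2) (auto simp: split_def intro!: continuous_intros)

lemma continuous_adapted_sum:
  fixes X :: "'i \<Rightarrow> real \<Rightarrow> 'w \<Rightarrow> 'b::{real_normed_vector, second_countable_topology}"
  assumes "\<And>i. i \<in> I \<Longrightarrow> continuous_adapted M F (X i)"
  shows "continuous_adapted M F (\<lambda>t w. \<Sum>i\<in>I. X i t w)"
  using assms
  by (induction I rule: infinite_finite_induct) (auto intro!: continuous_adapted_add continuous_adapted_const)

text \<open>Adaptedness of a time integral rests on progressive measurability: on
  \<open>[0, t]\<close> the integrand agrees with its clamped version, measurable for
  \<open>F t\<close> jointly with time.\<close>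

lemma continuous_adapted_integral:
  fixes X :: "real \<Rightarrow> 'w \<Rightarrow> 'b::euclidean_space"
  assumes X: "continuous_adapted M F X"
  shows "continuous_adapted M F (\<lambda>t w. integral {0..t} (\<lambda>s. X s w))"
  unfolding continuous_adapted_def
proof (intro conjI allI impI ballI)
  fix t :: real assume t: "t \<ge> 0"
  have "(\<lambda>(w, s). indicator {0..t} s *\<^sub>R X (max 0 (min s t)) w) \<in> borel_measurable (F t \<Otimes>\<^sub>M lborel)"
  proof -
    have "(\<lambda>p. X (max 0 (min (snd p) t)) (fst p)) \<in> borel_measurable (F t \<Otimes>\<^sub>M borel)"
      using measurable_compose[OF measurable_pair_swap' continuous_adapted_joint(2)[OF X t]]
      by (simp add: split_def)
    then show ?thesis
      by (subst measurable_cong_sets[OF sets_pair_measure_cong[OF refl sets_lborel] refl]) (simp add: split_def)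
  qed
  then have "(\<lambda>w. \<integral>s. indicator {0..t} s *\<^sub>R X (max 0 (min s t)) w \<partial>lborel) \<in> borel_measurable (F t)"
    by (rule lborel.borel_measurable_lebesgue_integral)
  moreover have "(\<integral>s. indicator {0..t} s *\<^sub>R X (max 0 (min s t)) w \<partial>lborel) = integral {0..t} (\<lambda>s. X s w)"
    if "w \<in> space M" for w
  proof -
    have "(\<integral>s. indicator {0..t} s *\<^sub>R X (max 0 (min s t)) w \<partial>lborel) = (LINT s:{0..t}|lborel. X s w)"
      unfolding set_lebesgue_integral_def by (intro Bochner_Integration.integral_cong) (auto simp: indicator_def)
    also have "\<dots> = integral {0..t} (\<lambda>s. X s w)"
      by (intro set_borel_integral_eq_integral borel_integrable_atLeastAtMost'
          continuous_on_subset[OF continuous_adaptedD(2)[OF X that]]) auto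
    finally show ?thesis .
  qed
  ultimately show "(\<lambda>w. integral {0..t} (\<lambda>s. X s w)) \<in> borel_measurable (F t)"
    by (subst measurable_cong[where g="\<lambda>w. \<integral>s. indicator {0..t} s *\<^sub>R X (max 0 (min s t)) w \<partial>lborel"]) auto
next
  fix w assume w: "w \<in> space M"
  show "continuous_on {0..} (\<lambda>t. integral {0..t} (\<lambda>s. X s w))"
    by (intro continuous_on_halfline indefinite_integral_continuous_1 integrable_continuous_real
        continuous_on_subset[OF continuous_adaptedD(2)[OF X w]]) auto
qed

text \<open>The equation is solved separately on each path, with a Lipschitz constant that may
  depend on the path and the horizon. Adaptedness survives because every Picard iterate is adapted
  and the limit is pointwise.\<close>

lemma picard_solution:
  fixes G :: "real \<Rightarrow> 'w \<Rightarrow> 'b::euclidean_space \<Rightarrow> 'b"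
  assumes adapted: "\<And>X. continuous_adapted M F X \<Longrightarrow> continuous_adapted M F (\<lambda>s w. G s w (X s w))"
    and lip: "\<And>w T. w \<in> space M \<Longrightarrow> T \<ge> 0 \<Longrightarrow>
      \<exists>L\<ge>0. \<forall>s\<in>{0..T}. \<forall>x y. norm (G s w x - G s w y) \<le> L * norm (x - y)"
  shows "\<exists>X. continuous_adapted M F X \<and>
    (\<forall>w\<in>space M. \<forall>t\<ge>0. X t w = x0 + integral {0..t} (\<lambda>s. G s w (X s w)))"
proof -
  define P where "P = rec_nat (\<lambda>t w. x0) (\<lambda>_ Q t w. x0 + integral {0..t} (\<lambda>s. G s w (Q s w)))"
  have P0: "P 0 t w = x0" and PS: "P (Suc n) t w = x0 + integral {0..t} (\<lambda>s. G s w (P n s w))" for n t w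
    by (simp_all add: P_def)
  have Pad: "continuous_adapted M F (P n)" for n
  proof (induction n)
    case 0
    show ?case unfolding P0[abs_def] by (simp add: continuous_adapted_def P0)
  next
    case (Suc n)
    have "continuous_adapted M F (\<lambda>t w. x0 + integral {0..t} (\<lambda>s. G s w (P n s w)))"
      by (intro continuous_adapted_add continuous_adapted_const continuous_adapted_integral adapted Suc)
    moreover have "P (Suc n) = (\<lambda>t w. x0 + integral {0..t} (\<lambda>s. G s w (P n s w)))" by (intro ext PS)
    ultimately show ?case by simp
  qed
  have GP: "continuous_on {0..t} (\<lambda>s. G s w (P n s w))" if "w \<in> space M" for w t n
    by (rule continuous_on_subset[OF continuous_adaptedD(2)[OF adapted[OF Pad] that]]) auto
  have unif: "\<exists>Y. uniform_limit {0..T} (\<lambda>n t. P n t w) Y sequentially" if w: "w \<in> space M" and T: "T \<ge> 0" for w T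
  proof -
    obtain L where L: "L \<ge> 0" "\<And>s x y. s \<in> {0..T} \<Longrightarrow> norm (G s w x - G s w y) \<le> L * norm (x - y)"
      using lip[OF w T] by blast
    have "compact ((\<lambda>t. P 1 t w - P 0 t w) ` {0..T})"
      by (intro compact_continuous_image continuous_on_diff compact_Icc
          continuous_on_subset[OF continuous_adaptedD(2)[OF Pad w]]) auto
    then obtain B where B: "B > 0" "\<And>t. t \<in> {0..T} \<Longrightarrow> norm (P 1 t w - P 0 t w) \<le> B"
      by (auto dest!: compact_imp_bounded simp: bounded_pos)
    \<comment> \<open>The factorial comes from integrating the power of \<open>t\<close> once more
      at each iteration; it makes the series of differences summable for every Lipschitz
      constant.\<close>
    have est: "norm (P (Suc n) t w - P n t w) \<le> B * (L * t) ^ n / fact n" if "t \<in> {0..T}" for n t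
      using that
    proof (induction n arbitrary: t)
      case 0
      then show ?case using B(2) by simp
    next
      case (Suc n)
      let ?d = "\<lambda>s. G s w (P (Suc n) s w) - G s w (P n s w)"
      have "P (Suc (Suc n)) t w - P (Suc n) t w = integral {0..t} ?d"
        unfolding PS[of "Suc n"] PS[of n t]
        by (simp add: Henstock_Kurzweil_Integration.integral_diff[OF integrable_continuous_real[OF GP] integrable_continuous_real[OF GP]] w)
      also have "norm \<dots> \<le> integral {0..t} (\<lambda>s. B * L ^ Suc n / fact n * s ^ n)"
      proof (rule integral_norm_bound_integral)
        show "?d integrable_on {0..t}" by (intro integrable_continuous_real continuous_on_diff GP w)
        show "(\<lambda>s. B * L ^ Suc n / fact n * s ^ n) integrable_on {0..t}"
          by (intro integrable_continuous_real continuous_intros)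
        fix s assume s: "s \<in> {0..t}"
        then have s': "s \<in> {0..T}" using Suc.prems by auto
        have "norm (?d s) \<le> L * norm (P (Suc n) s w - P n s w)" by (rule L(2)[OF s'])
        also have "\<dots> \<le> L * (B * (L * s) ^ n / fact n)" by (intro mult_left_mono Suc.IH s' L(1))
        also have "\<dots> = B * L ^ Suc n / fact n * s ^ n" by (simp add: power_mult_distrib)
        finally show "norm (?d s) \<le> B * L ^ Suc n / fact n * s ^ n" .
      qed
      also have "integral {0..t} (\<lambda>s. B * L ^ Suc n / fact n * s ^ n) =
         B * L ^ Suc n / fact n * (t ^ Suc n / real (Suc n)) - B * L ^ Suc n / fact n * (0 ^ Suc n / real (Suc n))"
      proof (rule integral_unique)
        show "((\<lambda>s. B * L ^ Suc n / fact n * s ^ n) has_integral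
         (B * L ^ Suc n / fact n * (t ^ Suc n / real (Suc n)) - B * L ^ Suc n / fact n * (0 ^ Suc n / real (Suc n)))) {0..t}"
        using Suc.prems
        by (intro fundamental_theorem_of_calculus)
           (auto intro!: derivative_eq_intros simp: has_real_derivative_iff_has_vector_derivative[symmetric] simp del: of_nat_Suc power_Suc)
      qed
      also have "\<dots> = B * (L * t) ^ Suc n / fact (Suc n)"
        by (simp add: power_mult_distrib field_simps del: of_nat_Suc)
      finally show ?case .
    qed
    have "uniform_limit {0..T} (\<lambda>n t. \<Sum>i<n. P (Suc i) t w - P i t w) (\<lambda>t. suminf (\<lambda>i. P (Suc i) t w - P i t w)) sequentially"
    proof (rule Weierstrass_m_test)
      show "norm (P (Suc n) t w - P n t w) \<le> B * (inverse (fact n) * (L * T) ^ n)" if "t \<in> {0..T}" for n t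
      proof -
        have "B * (L * t) ^ n / fact n \<le> B * (inverse (fact n) * (L * T) ^ n)"
          using that B(1) L(1) by (simp add: divide_inverse mult_ac) (intro mult_left_mono power_mono, auto)
        with est[OF that, of n] show ?thesis by linarith
      qed
      show "summable (\<lambda>n. B * (inverse (fact n) * (L * T) ^ n))"
        by (intro summable_mult summable_exp)
    qed
    then have "uniform_limit {0..T} (\<lambda>n t. P 0 t w + (\<Sum>i<n. P (Suc i) t w - P i t w))
        (\<lambda>t. P 0 t w + suminf (\<lambda>i. P (Suc i) t w - P i t w)) sequentially"
      by (intro uniform_limit_add uniform_limit_const)
    moreover have "P 0 t w + (\<Sum>i<n. P (Suc i) t w - P i t w) = P n t w" for n t
      by (simp add: sum_lessThan_telescope[of "\<lambda>i. P i t w"])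
    ultimately show ?thesis by auto
  qed
  \<comment> \<open>Uniform limits are available on each \<open>[0, T]\<close> separately; the
    pointwise limit is one process that agrees with all of them.\<close>
  define X where "X t w = lim (\<lambda>n. P n t w)" for t w
  have lim: "(\<lambda>n. P n t w) \<longlonglongrightarrow> X t w" if w: "w \<in> space M" and t: "t \<ge> 0" for t w
  proof -
    obtain Y where "uniform_limit {0..t} (\<lambda>n t. P n t w) Y sequentially" using unif[OF w t] by blast
    then have "(\<lambda>n. P n t w) \<longlonglongrightarrow> Y t" by (rule tendsto_uniform_limitI) (use t in auto)
    then show ?thesis unfolding X_def by (simp add: limI)
  qed
  have ulim: "uniform_limit {0..T} (\<lambda>n t. P n t w) (\<lambda>t. X t w) sequentially" if w: "w \<in> space M" and T: "T \<ge> 0" for w T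
  proof -
    obtain Y where Y: "uniform_limit {0..T} (\<lambda>n t. P n t w) Y sequentially" using unif[OF w T] by blast
    have "Y t = X t w" if "t \<in> {0..T}" for t
      using LIMSEQ_unique[OF tendsto_uniform_limitI[OF Y that] lim[OF w]] that by simp
    then show ?thesis using Y by (auto simp: uniform_limit_iff)
  qed
  have Xad: "continuous_adapted M F X"
    unfolding continuous_adapted_def
  proof (intro conjI allI impI ballI)
    show "X t \<in> borel_measurable (F t)" if "t \<ge> 0" for t
      by (rule borel_measurable_LIMSEQ_metric[of "\<lambda>n. P n t"])
         (use continuous_adaptedD(1)[OF Pad that] lim that in auto)
    show "continuous_on {0..} (\<lambda>t. X t w)" if w: "w \<in> space M" for w
    proof (rule continuous_on_halfline)
      fix b :: real assume "b \<ge> 0"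
      show "continuous_on {0..b} (\<lambda>t. X t w)"
        by (rule uniform_limit_theorem[OF _ ulim[OF w \<open>b \<ge> 0\<close>]])
           (auto intro!: always_eventually continuous_on_subset[OF continuous_adaptedD(2)[OF Pad w]])
    qed
  qed
  have "X t w = x0 + integral {0..t} (\<lambda>s. G s w (X s w))" if w: "w \<in> space M" and t: "t \<ge> 0" for t w
  proof -
    obtain L where L: "L \<ge> 0" "\<And>s x y. s \<in> {0..t} \<Longrightarrow> norm (G s w x - G s w y) \<le> L * norm (x - y)"
      using lip[OF w t] by blast
    have GX: "continuous_on {0..t} (\<lambda>s. G s w (X s w))"
      by (rule continuous_on_subset[OF continuous_adaptedD(2)[OF adapted[OF Xad] w]]) auto
    have "(\<lambda>n. integral {0..t} (\<lambda>s. G s w (P n s w))) \<longlonglongrightarrow> integral {0..t} (\<lambda>s. G s w (X s w))"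
    proof (rule LIMSEQ_I)
      fix r :: real assume r: "r > 0"
      define e where "e = r / (L * t + 1)"
      have e: "e > 0" using r L(1) t by (simp add: e_def add_nonneg_pos)
      have "\<forall>\<^sub>F n in sequentially. \<forall>s\<in>{0..t}. dist (P n s w) (X s w) < e"
        using ulim[OF w t] e by (auto simp: uniform_limit_iff)
      then have "\<forall>\<^sub>F n in sequentially. norm (integral {0..t} (\<lambda>s. G s w (P n s w)) - integral {0..t} (\<lambda>s. G s w (X s w))) < r"
      proof eventually_elim
        case (elim n)
        have "integral {0..t} (\<lambda>s. G s w (P n s w)) - integral {0..t} (\<lambda>s. G s w (X s w)) =
            integral {0..t} (\<lambda>s. G s w (P n s w) - G s w (X s w))"
          by (simp add: Henstock_Kurzweil_Integration.integral_diff[OF integrable_continuous_real[OF GP] integrable_continuous_real[OF GX]] w)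
        also have "norm \<dots> \<le> (L * e) * (t - 0)"
        proof (rule integral_bound[OF t continuous_on_diff[OF GP[OF w] GX]])
          fix s assume s: "s \<in> {0..t}"
          have "norm (P n s w - X s w) \<le> e" using elim s by (auto simp: dist_norm intro: less_imp_le)
          then show "norm (G s w (P n s w) - G s w (X s w)) \<le> L * e"
            using L(2)[OF s, of "P n s w" "X s w"] L(1) by (meson mult_left_mono order.trans)
        qed
        also have "\<dots> < r"
        proof -
          have "(L * e) * t = r * (L * t) / (L * t + 1)" by (simp add: e_def)
          also have "\<dots> < r" using r L(1) t by (subst pos_divide_less_eq) (auto simp: add_pos_nonneg algebra_simps)
          finally show ?thesis by simp
        qed
        finally show ?case .
      qed
      then show "\<exists>n0. \<forall>n\<ge>n0. norm (integral {0..t} (\<lambda>s. G s w (P n s w)) - integral {0..t} (\<lambda>s. G s w (X s w))) < r"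
        by (simp add: eventually_sequentially)
    qed
    then have "(\<lambda>n. P (Suc n) t w) \<longlonglongrightarrow> x0 + integral {0..t} (\<lambda>s. G s w (X s w))"
      unfolding PS by (intro tendsto_add tendsto_const)
    moreover have "(\<lambda>n. P (Suc n) t w) \<longlonglongrightarrow> X t w" by (rule LIMSEQ_Suc[OF lim[OF w t]])
    ultimately show ?thesis by (rule LIMSEQ_unique[rotated])
  qed
  with Xad show ?thesis by blast
qed

end

section \<open>It\^o integrals of differentiable integrands\<close>

lemma integral_sum_partition:
  fixes f :: "real \<Rightarrow> 'b::banach"
  assumes "\<And>i. i < n \<Longrightarrow> \<tau> i \<le> \<tau> (Suc i)" "continuous_on {\<tau> 0..\<tau> n} f"
  shows "integral {\<tau> 0..\<tau> n} f = (\<Sum>i<n. integral {\<tau> i..\<tau> (Suc i)} f)"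
  using assms
proof (induction n)
  case (Suc n)
  have "\<tau> 0 \<le> \<tau> m" if "m \<le> n" for m
    using that
  proof (induction m)
    case (Suc m)
    then show ?case using Suc.prems Suc.IH \<open>\<And>i. i < Suc n \<Longrightarrow> \<tau> i \<le> \<tau> (Suc i)\<close>[of m] by simp
  qed simp
  then have le: "\<tau> 0 \<le> \<tau> n" "\<tau> n \<le> \<tau> (Suc n)" using Suc.prems(1)[of n] by auto
  have "continuous_on {\<tau> 0..\<tau> n} f" by (rule continuous_on_subset[OF Suc.prems(2)]) (use le in auto)
  with Suc show ?case
    using Henstock_Kurzweil_Integration.integral_combine[OF le integrable_continuous_real[OF Suc.prems(2)]]
    by simp
qed simp

lemma summation_by_parts:
  fixes a b :: "nat \<Rightarrow> real"
  shows "(\<Sum>i<n. a i * (b (Suc i) - b i)) = a n * b n - a 0 * b 0 - (\<Sum>i<n. b (Suc i) * (a (Suc i) - a i))"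
  by (induction n) (auto simp: algebra_simps)

text \<open>The path \<open>\<beta>\<close> is merely continuous, so summation by parts moves the
  increments onto \<open>\<phi>\<close>, which has the density \<open>\<psi>\<close>. The error is
  then governed by the modulus of continuity of \<open>\<beta>\<close>.\<close>

lemma riemann_stieltjes_by_parts:
  fixes \<phi> \<psi> \<beta> :: "real \<Rightarrow> real"
  assumes t: "t \<ge> 0" and \<psi>: "continuous_on {0..t} \<psi>" and \<beta>: "continuous_on {0..t} \<beta>"
    and \<phi>: "\<And>s. s \<in> {0..t} \<Longrightarrow> \<phi> s = \<phi> 0 + integral {0..s} \<psi>"
  defines "\<tau> \<equiv> \<lambda>k i. real i * t / real (Suc k)"
  shows "(\<lambda>k. \<Sum>i<Suc k. \<phi> (\<tau> k i) * (\<beta> (\<tau> k (Suc i)) - \<beta> (\<tau> k i)))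
    \<longlonglongrightarrow> \<phi> t * \<beta> t - \<phi> 0 * \<beta> 0 - integral {0..t} (\<lambda>s. \<psi> s * \<beta> s)"
proof (rule LIMSEQ_I)
  fix r :: real assume r: "r > 0"
  have "bounded (\<psi> ` {0..t})" by (intro compact_imp_bounded compact_continuous_image \<psi>) auto
  then obtain B where B: "B > 0" "\<And>s. s \<in> {0..t} \<Longrightarrow> \<bar>\<psi> s\<bar> \<le> B" by (auto simp: bounded_pos)
  \<comment> \<open>Chosen so that \<open>B * e * t < r\<close>; the summand 1 takes care of
    \<open>t = 0\<close>.\<close>
  define e where "e = r / (B * (t + 1))"
  have e: "e > 0" using r B t by (simp add: e_def)
  have "uniformly_continuous_on {0..t} \<beta>" by (intro compact_uniformly_continuous \<beta>) auto
  then obtain d where d: "d > 0" "\<And>x y. x \<in> {0..t} \<Longrightarrow> y \<in> {0..t} \<Longrightarrow> \<bar>x - y\<bar> < d \<Longrightarrow> \<bar>\<beta> x - \<beta> y\<bar> < e"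
    using e unfolding uniformly_continuous_on_def dist_real_def by (metis abs_minus_commute)
  obtain k0 where k0: "t / d < real k0" using reals_Archimedean2 by blast
  have "norm ((\<Sum>i<Suc k. \<phi> (\<tau> k i) * (\<beta> (\<tau> k (Suc i)) - \<beta> (\<tau> k i))) -
    (\<phi> t * \<beta> t - \<phi> 0 * \<beta> 0 - integral {0..t} (\<lambda>s. \<psi> s * \<beta> s))) < r" if k: "k \<ge> k0" for k
  proof -
    have mesh: "\<tau> k (Suc i) - \<tau> k i = t / real (Suc k)" for i
      by (simp add: \<tau>_def diff_divide_distrib[symmetric] left_diff_distrib[symmetric])
    have mono: "\<tau> k i \<le> \<tau> k (Suc i)" for i using mesh[of i] t by (metis diff_ge_0_iff_ge divide_nonneg_nonneg of_nat_0_le_iff)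
    have \<tau>0: "\<tau> k 0 = 0" and \<tau>n: "\<tau> k (Suc k) = t" by (simp_all add: \<tau>_def del: of_nat_Suc)
    have in_t: "\<tau> k i \<in> {0..t}" if "i \<le> Suc k" for i
    proof -
      have "real i * t \<le> real (Suc k) * t" by (intro mult_right_mono) (use that t in auto)
      then show ?thesis using t by (simp add: \<tau>_def field_simps del: of_nat_Suc)
    qed
    have small: "t / real (Suc k) < d"
    proof -
      have "t < real k0 * d" using k0 d by (simp add: field_simps)
      also have "\<dots> \<le> real (Suc k) * d" using k d by (intro mult_right_mono) auto
      finally show ?thesis by (simp add: field_simps del: of_nat_Suc)
    qed
    have cont: "continuous_on {\<tau> k i..\<tau> k (Suc i)} \<psi>" "continuous_on {\<tau> k i..\<tau> k (Suc i)} \<beta>" if "i < Suc k" for i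
      using in_t[of i] in_t[of "Suc i"] that by (auto intro!: continuous_on_subset[OF \<psi>] continuous_on_subset[OF \<beta>])
    have incr: "\<phi> (\<tau> k (Suc i)) - \<phi> (\<tau> k i) = integral {\<tau> k i..\<tau> k (Suc i)} \<psi>" if i: "i < Suc k" for i
    proof -
      have le: "0 \<le> \<tau> k i" "\<tau> k (Suc i) \<le> t" using in_t[of i] in_t[of "Suc i"] i by auto
      have "\<psi> integrable_on {0..\<tau> k (Suc i)}"
        by (intro integrable_continuous_real continuous_on_subset[OF \<psi>]) (use le in auto)
      from Henstock_Kurzweil_Integration.integral_combine[OF le(1) mono this]
      show ?thesis using \<phi>[of "\<tau> k i"] \<phi>[of "\<tau> k (Suc i)"] in_t[of i] in_t[of "Suc i"] i by simp
    qed
    have part: "integral {0..t} (\<lambda>s. \<psi> s * \<beta> s) = (\<Sum>i<Suc k. integral {\<tau> k i..\<tau> k (Suc i)} (\<lambda>s. \<psi> s * \<beta> s))"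
      using integral_sum_partition[of "Suc k" "\<tau> k" "\<lambda>s. \<psi> s * \<beta> s"] mono \<psi> \<beta>
      unfolding \<tau>0 \<tau>n by (simp add: continuous_on_mult)
    have "(\<Sum>i<Suc k. \<phi> (\<tau> k i) * (\<beta> (\<tau> k (Suc i)) - \<beta> (\<tau> k i))) - (\<phi> t * \<beta> t - \<phi> 0 * \<beta> 0 - integral {0..t} (\<lambda>s. \<psi> s * \<beta> s))
      = integral {0..t} (\<lambda>s. \<psi> s * \<beta> s) - (\<Sum>i<Suc k. \<beta> (\<tau> k (Suc i)) * (\<phi> (\<tau> k (Suc i)) - \<phi> (\<tau> k i)))"
      using summation_by_parts[where n="Suc k" and a="\<lambda>i. \<phi> (\<tau> k i)" and b="\<lambda>i. \<beta> (\<tau> k i)"]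
      unfolding \<tau>0 \<tau>n by simp
    also have "\<dots> =
        (\<Sum>i<Suc k. integral {\<tau> k i..\<tau> k (Suc i)} (\<lambda>s. \<psi> s * (\<beta> s - \<beta> (\<tau> k (Suc i)))))"
      unfolding part sum_subtractf[symmetric]
    proof (intro sum.cong refl)
      fix i assume "i \<in> {..<Suc k}"
      then have i: "i < Suc k" by simp
      have "integral {\<tau> k i..\<tau> k (Suc i)} (\<lambda>s. \<psi> s * \<beta> s - \<beta> (\<tau> k (Suc i)) * \<psi> s) =
        integral {\<tau> k i..\<tau> k (Suc i)} (\<lambda>s. \<psi> s * \<beta> s) - integral {\<tau> k i..\<tau> k (Suc i)} (\<lambda>s. \<beta> (\<tau> k (Suc i)) * \<psi> s)"
        by (intro Henstock_Kurzweil_Integration.integral_diff integrable_continuous_real continuous_intros cont[OF i])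
      then show "integral {\<tau> k i..\<tau> k (Suc i)} (\<lambda>s. \<psi> s * \<beta> s) - \<beta> (\<tau> k (Suc i)) * (\<phi> (\<tau> k (Suc i)) - \<phi> (\<tau> k i)) =
         integral {\<tau> k i..\<tau> k (Suc i)} (\<lambda>s. \<psi> s * (\<beta> s - \<beta> (\<tau> k (Suc i))))"
        by (simp add: incr[OF i] algebra_simps)
    qed
    also have "norm \<dots> \<le> (\<Sum>i<Suc k. (B * e) * (t / real (Suc k)))"
    proof (rule sum_norm_le)
      fix i assume "i \<in> {..<Suc k}"
      then have i: "i < Suc k" by simp
      show "norm (integral {\<tau> k i..\<tau> k (Suc i)} (\<lambda>s. \<psi> s * (\<beta> s - \<beta> (\<tau> k (Suc i))))) \<le> (B * e) * (t / real (Suc k))"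
        unfolding mesh[of i, symmetric]
      proof (rule integral_bound[OF mono])
        fix s assume s: "s \<in> {\<tau> k i..\<tau> k (Suc i)}"
        then have s': "s \<in> {0..t}" using in_t[of i] in_t[of "Suc i"] i by auto
        have "\<bar>s - \<tau> k (Suc i)\<bar> < d" using s mesh[of i] small by auto
        then have "\<bar>\<beta> s - \<beta> (\<tau> k (Suc i))\<bar> < e" using d(2)[OF s' in_t[of "Suc i"]] i by auto
        then show "norm (\<psi> s * (\<beta> s - \<beta> (\<tau> k (Suc i)))) \<le> B * e"
          using B s' by (auto simp: abs_mult intro!: mult_mono)
      qed (intro continuous_intros cont[OF i])
    qed
    also have "\<dots> = B * e * t" by (simp del: of_nat_Suc)
    also have "\<dots> < r"
    proof -
      have "B * e * t = r * t / (t + 1)" using B by (simp add: e_def)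
      also have "\<dots> < r" using r t by (simp add: field_simps)
      finally show ?thesis .
    qed
    finally show ?thesis .
  qed
  then show "\<exists>k0. \<forall>k\<ge>k0. norm ((\<Sum>i<Suc k. \<phi> (\<tau> k i) * (\<beta> (\<tau> k (Suc i)) - \<beta> (\<tau> k i))) -
    (\<phi> t * \<beta> t - \<phi> 0 * \<beta> 0 - integral {0..t} (\<lambda>s. \<psi> s * \<beta> s))) < r" by blast
qed

lemma simple_process_at:
  assumes i: "i < n" and \<tau>: "\<And>i. i < n \<Longrightarrow> \<tau> i \<le> \<tau> (Suc i)" and s: "\<tau> i < s" "s \<le> \<tau> (Suc i)"
  shows "simple_process n \<tau> \<xi> s w = \<xi> i w"
proof -
  have mono: "\<tau> j \<le> \<tau> k" if "j \<le> k" "k \<le> n" for j k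
    using that
  proof (induction k)
    case (Suc k)
    then show ?case using \<tau>[of k] by (cases "j = Suc k") auto
  qed simp
  have "indicator {\<tau> j<..\<tau> (Suc j)} s = (0::real)" if "j \<in> {..<n} - {i}" for j
  proof (cases "j < i")
    case True
    then show ?thesis using mono[of "Suc j" i] i s by auto
  next
    case False
    then show ?thesis using mono[of "Suc i" j] that s by auto
  qed
  then have "(\<Sum>j\<in>{..<n} - {i}. \<xi> j w * indicator {\<tau> j<..\<tau> (Suc j)} s) = 0" by (intro sum.neutral) auto
  moreover have "simple_process n \<tau> \<xi> s w =
      \<xi> i w * indicator {\<tau> i<..\<tau> (Suc i)} s + (\<Sum>j\<in>{..<n} - {i}. \<xi> j w * indicator {\<tau> j<..\<tau> (Suc j)} s)"
    unfolding simple_process_def by (rule sum.remove) (use i in auto)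
  ultimately show ?thesis using s by simp
qed

section \<open>The Ito integral of an integrand of class C1, computed path by path\<close>

context brownian
begin

text \<open>On every path the indicator of a deviation larger than \<open>\<delta>\<close> is
  eventually 0, and dominated convergence turns this into convergence of probabilities.\<close>

lemma converges_in_prob_pointwise:
  assumes X: "\<And>n. X n \<in> borel_measurable M" and Y: "Y \<in> borel_measurable M"
    and lim: "\<And>w. w \<in> space M \<Longrightarrow> (\<lambda>n. X n w) \<longlonglongrightarrow> Y w"
  shows "converges_in_prob M X Y"
  unfolding converges_in_prob_def
proof (intro conjI allI impI X Y)
  fix \<delta> :: real assume \<delta>: "\<delta> > 0"
  let ?A = "\<lambda>n. {w \<in> space M. \<bar>X n w - Y w\<bar> > \<delta>}"
  have A [measurable]: "?A n \<in> sets M" for n using X Y by measurable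
  have "(\<lambda>n. \<integral>w. indicator (?A n) w \<partial>M) \<longlonglongrightarrow> (\<integral>w. (0::real) \<partial>M)"
  proof (rule integral_dominated_convergence[where w="\<lambda>_. 1"])
    show "AE w in M. (\<lambda>n. indicator (?A n) w :: real) \<longlonglongrightarrow> 0"
    proof (rule AE_I2)
      fix w assume w: "w \<in> space M"
      have "\<forall>\<^sub>F n in sequentially. dist (X n w) (Y w) < \<delta>" using lim[OF w] \<delta> by (rule tendstoD)
      then have "\<forall>\<^sub>F n in sequentially. indicator (?A n) w = (0::real)"
        by eventually_elim (auto simp: dist_real_def)
      then show "(\<lambda>n. indicator (?A n) w :: real) \<longlonglongrightarrow> 0" by (rule tendsto_eventually)
    qed
  qed (auto simp: indicator_def)
  then show "(\<lambda>n. measure M (?A n)) \<longlonglongrightarrow> 0" by simp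
qed

lemma measurable_pathwise_integral:
  fixes f :: "real \<Rightarrow> 'w \<Rightarrow> real"
  assumes f: "(\<lambda>(s, w). f s w) \<in> borel_measurable (borel \<Otimes>\<^sub>M M)"
    and bd: "\<And>w. w \<in> space M \<Longrightarrow> \<exists>B. \<forall>s\<in>{0..t}. \<bar>f s w\<bar> \<le> B"
  shows "(\<lambda>w. integral {0..t} (\<lambda>s. f s w)) \<in> borel_measurable M"
proof -
  have f': "(\<lambda>p. f (snd p) (fst p)) \<in> borel_measurable (M \<Otimes>\<^sub>M borel)"
    using measurable_compose[OF measurable_pair_swap' f] by (simp add: split_def)
  have "(\<lambda>(w, s). indicator {0..t} s *\<^sub>R f s w) \<in> borel_measurable (M \<Otimes>\<^sub>M lborel)"
    by (subst measurable_cong_sets[OF sets_pair_measure_cong[OF refl sets_lborel] refl]) (use f' in \<open>simp add: split_def\<close>)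
  then have "(\<lambda>w. \<integral>s. indicator {0..t} s *\<^sub>R f s w \<partial>lborel) \<in> borel_measurable M"
    by (rule lborel.borel_measurable_lebesgue_integral)
  moreover have "(\<integral>s. indicator {0..t} s *\<^sub>R f s w \<partial>lborel) = integral {0..t} (\<lambda>s. f s w)"
    if w: "w \<in> space M" for w
  proof -
    obtain B where B: "\<forall>s\<in>{0..t}. \<bar>f s w\<bar> \<le> B" using bd[OF w] by blast
    have "(\<lambda>s. f s w) \<in> borel_measurable borel"
      using measurable_compose[OF measurable_Pair2'[OF w] f] by simp
    then have "set_integrable lborel {0..t} (\<lambda>s. f s w)"
      unfolding set_integrable_def by (intro integrableI_bounded_set_indicator[where B=B]) (use B in \<open>auto intro!: AE_I2 simp: emeasure_lborel_Icc_eq\<close>)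
    from set_borel_integral_eq_integral(2)[OF this] show ?thesis by (simp add: set_lebesgue_integral_def)
  qed
  ultimately show ?thesis
    by (subst measurable_cong[where g="\<lambda>w. \<integral>s. indicator {0..t} s *\<^sub>R f s w \<partial>lborel"]) auto
qed

text \<open>An integrand with paths of class C1 has no covariation with \<open>\<beta>\<close>, so
  the classical formula of integration by parts holds. The left-endpoint step processes on
  equidistant grids approximate on every path, whence both limits in probability.\<close>

lemma is_ito_integral_by_parts:
  fixes \<phi> \<psi> \<beta> :: "real \<Rightarrow> 'w \<Rightarrow> real"
  assumes ad\<phi>: "continuous_adapted M F \<phi>" and ad\<psi>: "continuous_adapted M F \<psi>" and ad\<beta>: "continuous_adapted M F \<beta>"
    and \<phi>: "\<And>s w. w \<in> space M \<Longrightarrow> s \<ge> 0 \<Longrightarrow> \<phi> s w = \<phi> 0 w + integral {0..s} (\<lambda>r. \<psi> r w)" and t: "t \<ge> 0"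
  shows "is_ito_integral M F \<beta> \<phi> t (\<lambda>w. \<phi> t w * \<beta> t w - \<phi> 0 w * \<beta> 0 w - integral {0..t} (\<lambda>s. \<psi> s w * \<beta> s w))"
proof -
  define \<tau> where "\<tau> k i = real i * t / real (Suc k)" for k i
  \<comment> \<open>A simple integrand has to be bounded uniformly over the sample space, hence the
    truncation at \<open>k\<close>; on a given path it is inactive for large
    \<open>k\<close>.\<close>
  define \<xi> where "\<xi> k i w = max (- real k) (min (real k) (\<phi> (\<tau> k i) w))" for k i w
  let ?J = "\<lambda>w. \<phi> t w * \<beta> t w - \<phi> 0 w * \<beta> 0 w - integral {0..t} (\<lambda>s. \<psi> s w * \<beta> s w)"
  have \<tau>0: "\<tau> k 0 = 0" and \<tau>n: "\<tau> k (Suc k) = t" and \<tau>nn: "\<tau> k i \<ge> 0" for k i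
    using t by (simp_all add: \<tau>_def del: of_nat_Suc)
  have mono: "\<tau> k i \<le> \<tau> k (Suc i)" for k i
    using t by (simp add: \<tau>_def divide_right_mono mult_right_mono)
  have le_t: "\<tau> k i \<le> t" if "i \<le> Suc k" for k i
  proof -
    have "real i * t \<le> real (Suc k) * t" by (intro mult_right_mono) (use that t in auto)
    then show ?thesis by (simp add: \<tau>_def field_simps del: of_nat_Suc)
  qed
  have m\<phi>: "\<phi> s \<in> borel_measurable (F s)" if "s \<ge> 0" for s by (rule continuous_adaptedD(1)[OF ad\<phi> that])
  have m\<xi>: "\<xi> k i \<in> borel_measurable (F (\<tau> k i))" for k i
    unfolding \<xi>_def[abs_def] using m\<phi>[OF \<tau>nn[of k i]] by measurable
  have m\<xi>M: "\<xi> k i \<in> borel_measurable M" for k i by (rule measurable_F_imp[OF m\<xi>])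
  have bounded\<phi>: "\<exists>B>0. \<forall>s\<in>{0..t}. \<bar>\<phi> s w\<bar> \<le> B" if "w \<in> space M" for w
  proof -
    have "bounded ((\<lambda>s. \<phi> s w) ` {0..t})"
      by (intro compact_imp_bounded compact_continuous_image continuous_on_subset[OF continuous_adaptedD(2)[OF ad\<phi> that]]) auto
    then show ?thesis by (auto simp: bounded_pos)
  qed
  have \<xi>\<phi>: "\<forall>\<^sub>F k in sequentially. \<forall>i\<le>Suc k. \<xi> k i w = \<phi> (\<tau> k i) w" if w: "w \<in> space M" for w
  proof -
    obtain B where B: "B > 0" "\<forall>s\<in>{0..t}. \<bar>\<phi> s w\<bar> \<le> B" using bounded\<phi>[OF w] by blast
    have "\<forall>\<^sub>F k in sequentially. B \<le> real k" using filterlim_real_sequentially by (simp add: filterlim_at_top)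
    then show ?thesis
    proof eventually_elim
      case (elim k)
      show ?case
      proof (intro allI impI)
        fix i assume "i \<le> Suc k"
        then have "\<bar>\<phi> (\<tau> k i) w\<bar> \<le> B" using B(2) \<tau>nn le_t by auto
        then show "\<xi> k i w = \<phi> (\<tau> k i) w" using elim by (auto simp: \<xi>_def)
      qed
    qed
  qed
  have \<xi>k: "\<bar>\<xi> k i w\<bar> \<le> real k" for k i w by (auto simp: \<xi>_def)
  have simple: "simple_integrand M F t (Suc k) (\<tau> k) (\<xi> k)" for k
    unfolding simple_integrand_def using \<tau>0 \<tau>n mono m\<xi> \<xi>k
    by (auto simp: bounded_iff intro!: exI[of _ "real k"])
  let ?D = "\<lambda>k s w. simple_process (Suc k) (\<tau> k) (\<xi> k) s w - \<phi> s w"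
  have conv1: "converges_in_prob M (\<lambda>k w. integral {0..t} (\<lambda>s. (?D k s w)\<^sup>2)) (\<lambda>w. 0)"
  proof (rule converges_in_prob_pointwise)
    fix k
    have "(\<lambda>w. integral {0..t} (\<lambda>s. (simple_process (Suc k) (\<tau> k) (\<xi> k) s w - \<phi> (max 0 s) w)\<^sup>2)) \<in> borel_measurable M"
    proof (rule measurable_pathwise_integral)
      have "(\<lambda>p. simple_process (Suc k) (\<tau> k) (\<xi> k) (fst p) (snd p) - \<phi> (max 0 (fst p)) (snd p)) \<in> borel_measurable (borel \<Otimes>\<^sub>M M)"
        unfolding simple_process_def
      proof (intro borel_measurable_diff borel_measurable_sum borel_measurable_times)
        show "(\<lambda>p. \<xi> k i (snd p)) \<in> borel_measurable (borel \<Otimes>\<^sub>M M)" for i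
          by (rule measurable_compose[OF measurable_snd m\<xi>M])
        show "(\<lambda>p. indicator {\<tau> k i<..\<tau> k (Suc i)} (fst p)) \<in> borel_measurable (borel \<Otimes>\<^sub>M M)" for i
          by measurable
        show "(\<lambda>p. \<phi> (max 0 (fst p)) (snd p)) \<in> borel_measurable (borel \<Otimes>\<^sub>M M)"
          using continuous_adapted_joint(1)[OF ad\<phi>] by (simp add: split_def)
      qed
      then show "(\<lambda>(s, w). (simple_process (Suc k) (\<tau> k) (\<xi> k) s w - \<phi> (max 0 s) w)\<^sup>2) \<in> borel_measurable (borel \<Otimes>\<^sub>M M)"
        by (simp add: split_def)
      fix w assume "w \<in> space M"
      then obtain B where B: "\<forall>s\<in>{0..t}. \<bar>\<phi> s w\<bar> \<le> B" using bounded\<phi> by blast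
      show "\<exists>B. \<forall>s\<in>{0..t}. \<bar>(simple_process (Suc k) (\<tau> k) (\<xi> k) s w - \<phi> (max 0 s) w)\<^sup>2\<bar> \<le> B"
      proof (intro exI ballI)
        fix s assume s: "s \<in> {0..t}"
        have "\<bar>simple_process (Suc k) (\<tau> k) (\<xi> k) s w\<bar> \<le> (\<Sum>i<Suc k. real k)"
          unfolding simple_process_def
        proof (rule order.trans[OF sum_abs sum_mono])
          show "\<bar>\<xi> k i w * indicator {\<tau> k i<..\<tau> k (Suc i)} s\<bar> \<le> real k" for i
            using \<xi>k[of k i w] by (auto simp: indicator_def)
        qed
        moreover have "\<bar>\<phi> (max 0 s) w\<bar> \<le> B" using B s by (auto simp: max_def)
        ultimately have "\<bar>simple_process (Suc k) (\<tau> k) (\<xi> k) s w - \<phi> (max 0 s) w\<bar> \<le> (\<Sum>i<Suc k. real k) + B" by linarith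
        then show "\<bar>(simple_process (Suc k) (\<tau> k) (\<xi> k) s w - \<phi> (max 0 s) w)\<^sup>2\<bar> \<le> ((\<Sum>i<Suc k. real k) + B)\<^sup>2"
          unfolding abs_power2 by (subst power2_abs[symmetric]) (intro power_mono, auto)
      qed
    qed
    moreover have "integral {0..t} (\<lambda>s. (simple_process (Suc k) (\<tau> k) (\<xi> k) s w - \<phi> (max 0 s) w)\<^sup>2) =
        integral {0..t} (\<lambda>s. (?D k s w)\<^sup>2)" for w
      by (intro Henstock_Kurzweil_Integration.integral_cong) (auto simp: max_def)
    ultimately show "(\<lambda>w. integral {0..t} (\<lambda>s. (?D k s w)\<^sup>2)) \<in> borel_measurable M" by simp
  next
    fix w assume w: "w \<in> space M"
    show "(\<lambda>k. integral {0..t} (\<lambda>s. (?D k s w)\<^sup>2)) \<longlonglongrightarrow> 0"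
    proof (rule LIMSEQ_I)
      fix r :: real assume r: "r > 0"
      define e where "e = sqrt (r / (t + 1))"
      have e: "e > 0" "e\<^sup>2 * t < r"
      proof -
        show "e > 0" using r t by (simp add: e_def)
        have "e\<^sup>2 = r / (t + 1)" using r t by (simp add: e_def)
        then have "e\<^sup>2 * t = r * t / (t + 1)" by simp
        also have "\<dots> < r" using r t by (simp add: field_simps)
        finally show "e\<^sup>2 * t < r" .
      qed
      have c\<phi>: "continuous_on {0..t} (\<lambda>s. \<phi> s w)" by (rule continuous_on_subset[OF continuous_adaptedD(2)[OF ad\<phi> w]]) auto
      have "uniformly_continuous_on {0..t} (\<lambda>s. \<phi> s w)" by (intro compact_uniformly_continuous c\<phi>) auto
      then obtain d where d: "d > 0" "\<And>x y. x \<in> {0..t} \<Longrightarrow> y \<in> {0..t} \<Longrightarrow> \<bar>x - y\<bar> < d \<Longrightarrow> \<bar>\<phi> x w - \<phi> y w\<bar> < e"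
        using e(1) unfolding uniformly_continuous_on_def dist_real_def by (metis abs_minus_commute)
      have "\<forall>\<^sub>F k in sequentially. t / d < real k"
        using filterlim_real_sequentially by (simp add: filterlim_at_top_dense)
      with \<xi>\<phi>[OF w] have "\<forall>\<^sub>F k in sequentially. norm (integral {0..t} (\<lambda>s. (?D k s w)\<^sup>2) - 0) < r"
      proof eventually_elim
        case (elim k)
        have small: "t / real (Suc k) < d"
        proof -
          have "t < real k * d" using elim(2) d by (simp add: field_simps)
          also have "\<dots> \<le> real (Suc k) * d" using d by (intro mult_right_mono) auto
          finally show ?thesis by (simp add: field_simps del: of_nat_Suc)
        qed
        \<comment> \<open>The half-open intervals of the grid leave out \<open>s = 0\<close>, where
          the simple process vanishes; this single point is discarded as a null set below.\<close>
        have pt: "(?D k s w)\<^sup>2 \<le> e\<^sup>2" if s: "s \<in> {0<..t}" for s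
        proof -
          have "\<exists>i. s \<le> \<tau> k i" using s \<tau>n[of k] by (metis greaterThanAtMost_iff)
          define j where "j = (LEAST i. s \<le> \<tau> k i)"
          have j: "s \<le> \<tau> k j" unfolding j_def by (rule LeastI_ex) fact
          have "j \<le> Suc k" unfolding j_def by (rule Least_le) (use s \<tau>n[of k] in auto)
          have "j \<noteq> 0" using j \<tau>0[of k] s by (metis greaterThanAtMost_iff not_le)
          then obtain i where i: "j = Suc i" by (cases j) auto
          have "\<tau> k i < s" using not_less_Least[of i "\<lambda>i. s \<le> \<tau> k i"] i by (simp add: j_def[symmetric])
          have "i < Suc k" using i \<open>j \<le> Suc k\<close> by simp
          have "simple_process (Suc k) (\<tau> k) (\<xi> k) s w = \<xi> k i w"
            by (rule simple_process_at[OF \<open>i < Suc k\<close> mono \<open>\<tau> k i < s\<close>]) (use j i in simp)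
          also have "\<dots> = \<phi> (\<tau> k i) w" using elim(1) \<open>i < Suc k\<close> by simp
          finally have "?D k s w = \<phi> (\<tau> k i) w - \<phi> s w" by simp
          moreover have "\<bar>\<tau> k i - s\<bar> < d"
          proof -
            have "\<tau> k (Suc i) - \<tau> k i = t / real (Suc k)"
              by (simp add: \<tau>_def diff_divide_distrib[symmetric] left_diff_distrib[symmetric])
            then show ?thesis using \<open>\<tau> k i < s\<close> j i small by auto
          qed
          ultimately have "\<bar>?D k s w\<bar> < e"
            using d(2)[of "\<tau> k i" s] \<tau>nn[of k i] le_t[of i k] \<open>i < Suc k\<close> s by auto
          then show ?thesis by (metis abs_ge_zero less_imp_le power2_abs power_mono)
        qed
        have "integral {0..t} (\<lambda>s. (?D k s w)\<^sup>2) \<le> e\<^sup>2 * t"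
        \<comment> \<open>For a non-integrable function \<open>integral\<close> is 0, which
          satisfies the bound trivially.\<close>
        proof (cases "(\<lambda>s. (?D k s w)\<^sup>2) integrable_on {0..t}")
          case True
          have eq: "integral {0..t} (\<lambda>s. (?D k s w)\<^sup>2) = integral {0..t} (\<lambda>s. if s = 0 then 0 else (?D k s w)\<^sup>2)"
            by (rule integral_spike[of "{0}"]) auto
          have int: "(\<lambda>s. if s = 0 then 0 else (?D k s w)\<^sup>2) integrable_on {0..t}"
            by (rule integrable_spike[OF True, of "{0}"]) auto
          have "integral {0..t} (\<lambda>s. if s = 0 then 0 else (?D k s w)\<^sup>2) \<le> integral {0..t} (\<lambda>s. e\<^sup>2)"
            by (rule integral_le[OF int]) (use pt in auto)
          then show ?thesis using eq t by (simp add: mult.commute)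
        qed (use t in \<open>simp add: not_integrable_integral\<close>)
        moreover have "integral {0..t} (\<lambda>s. (?D k s w)\<^sup>2) \<ge> 0"
          by (cases "(\<lambda>s. (?D k s w)\<^sup>2) integrable_on {0..t}")
             (auto simp: not_integrable_integral intro: Henstock_Kurzweil_Integration.integral_nonneg)
        ultimately show ?case using e(2) by simp
      qed
      then show "\<exists>n0. \<forall>k\<ge>n0. norm (integral {0..t} (\<lambda>s. (?D k s w)\<^sup>2) - 0) < r"
        by (simp add: eventually_sequentially)
    qed
  qed auto
  have conv2: "converges_in_prob M (\<lambda>k. simple_integral (Suc k) (\<tau> k) (\<xi> k) \<beta>) ?J"
  proof (rule converges_in_prob_pointwise)
    show "simple_integral (Suc k) (\<tau> k) (\<xi> k) \<beta> \<in> borel_measurable M" for k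
      unfolding simple_integral_def[abs_def]
      by (intro borel_measurable_sum borel_measurable_times borel_measurable_diff m\<xi>M
          continuous_adapted_measurable[OF ad\<beta> \<tau>nn])
    have [measurable]: "\<beta> t \<in> borel_measurable M" "\<beta> 0 \<in> borel_measurable M"
      "\<phi> t \<in> borel_measurable M" "\<phi> 0 \<in> borel_measurable M"
      "(\<lambda>w. integral {0..t} (\<lambda>s. \<psi> s w * \<beta> s w)) \<in> borel_measurable M"
      using continuous_adapted_measurable[OF ad\<beta>] continuous_adapted_measurable[OF ad\<phi>] t
        continuous_adapted_measurable[OF continuous_adapted_integral[OF continuous_adapted_mult[OF ad\<psi> ad\<beta>]] t]
      by auto
    show "?J \<in> borel_measurable M" by measurable
    fix w assume w: "w \<in> space M"
    have "(\<lambda>k. \<Sum>i<Suc k. \<phi> (\<tau> k i) w * (\<beta> (\<tau> k (Suc i)) w - \<beta> (\<tau> k i) w)) \<longlonglongrightarrow> ?J w"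
      unfolding \<tau>_def
    proof (rule riemann_stieltjes_by_parts[OF t])
      show "continuous_on {0..t} (\<lambda>s. \<psi> s w)" "continuous_on {0..t} (\<lambda>s. \<beta> s w)"
        by (rule continuous_on_subset[OF continuous_adaptedD(2)[OF ad\<psi> w]] continuous_on_subset[OF continuous_adaptedD(2)[OF ad\<beta> w]], auto)+
      show "\<phi> s w = \<phi> 0 w + integral {0..s} (\<lambda>r. \<psi> r w)" if "s \<in> {0..t}" for s
        by (rule \<phi>[OF w]) (use that in auto)
    qed
    moreover have "\<forall>\<^sub>F k in sequentially. (\<Sum>i<Suc k. \<phi> (\<tau> k i) w * (\<beta> (\<tau> k (Suc i)) w - \<beta> (\<tau> k i) w)) =
        simple_integral (Suc k) (\<tau> k) (\<xi> k) \<beta> w"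
      using \<xi>\<phi>[OF w]
    proof eventually_elim
      case (elim k)
      then show ?case unfolding simple_integral_def by (intro sum.cong) auto
    qed
    ultimately show "(\<lambda>k. simple_integral (Suc k) (\<tau> k) (\<xi> k) \<beta> w) \<longlonglongrightarrow> ?J w"
      by (rule Lim_transform_eventually)
  qed
  show ?thesis
    unfolding is_ito_integral_def
    by (intro conjI ad\<phi> exI[of _ Suc] exI[of _ \<tau>] exI[of _ \<xi>] allI simple conv1 conv2)
qed

end

section \<open>Dynkin's formula\<close>

abbreviation time_measure :: "real \<Rightarrow> real measure" where
  "time_measure T \<equiv> restrict_space lborel {0..T}"

lemma finite_measure_time: "finite_measure (time_measure T)"
  by standard (simp add: space_restrict_space emeasure_restrict_space emeasure_lborel_Icc_eq)

lemma add_pow6_le: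
  fixes x y :: real
  assumes "x \<ge> 0" "y \<ge> 0"
  shows "(x + y) ^ 6 \<le> 64 * (x ^ 6 + y ^ 6)"
proof -
  have "(x + y) ^ 6 \<le> (2 * max x y) ^ 6" using assms by (intro power_mono) auto
  also have "\<dots> = 64 * max x y ^ 6" by (simp add: power_mult_distrib)
  also have "max x y ^ 6 \<le> x ^ 6 + y ^ 6" by (auto simp: max_def)
  finally show ?thesis by simp
qed

context brownian
begin

lemma continuous_adapted_joint_restrict:
  fixes X :: "real \<Rightarrow> 'w \<Rightarrow> 'b::metric_space"
  assumes X: "continuous_adapted M F X"
  shows "(\<lambda>p. X (fst p) (snd p)) \<in> borel_measurable (time_measure T \<Otimes>\<^sub>M M)"
proof -
  have id: "(\<lambda>p. p) \<in> time_measure T \<Otimes>\<^sub>M M \<rightarrow>\<^sub>M borel \<Otimes>\<^sub>M M"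
  proof -
    have "(\<lambda>s. s) \<in> time_measure T \<rightarrow>\<^sub>M borel"
      by (rule measurable_restrict_space1) simp
    then have "(\<lambda>p. (fst p, snd p)) \<in> time_measure T \<Otimes>\<^sub>M M \<rightarrow>\<^sub>M borel \<Otimes>\<^sub>M M"
      by (intro measurable_Pair measurable_compose[OF measurable_fst] measurable_snd)
    then show ?thesis by simp
  qed
  have "(\<lambda>p. X (max 0 (fst p)) (snd p)) \<in> borel_measurable (time_measure T \<Otimes>\<^sub>M M)"
    using measurable_compose[OF id continuous_adapted_joint(1)[OF X]] by (simp add: split_def)
  then show ?thesis
    by (subst measurable_cong[where g="\<lambda>p. X (max 0 (fst p)) (snd p)"])
       (auto simp: space_pair_measure space_restrict_space max_def)
qed

lemma has_vector_derivative_primitive: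
  fixes Z :: "real \<Rightarrow> 'b::euclidean_space"
  assumes w: "w \<in> space M" and ad: "continuous_adapted M F Z'"
    and Z: "\<And>s. s \<ge> 0 \<Longrightarrow> Z s = z + integral {0..s} (\<lambda>r. Z' r w)" and s: "s \<in> {0..T}"
  shows "(Z has_vector_derivative Z' s w) (at s within {0..T})"
proof -
  have "continuous_on {0..T} (\<lambda>r. Z' r w)"
    by (rule continuous_on_subset[OF continuous_adaptedD(2)[OF ad w]]) auto
  then have "((\<lambda>s. z + integral {0..s} (\<lambda>r. Z' r w)) has_vector_derivative 0 + Z' s w) (at s within {0..T})"
    by (intro has_vector_derivative_add has_vector_derivative_const integral_has_vector_derivative s)
  then show ?thesis
    using has_vector_derivative_transform[OF s, of Z "\<lambda>s. z + integral {0..s} (\<lambda>r. Z' r w)"] Z by simp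
qed

lemma integrable_time_space:
  fixes f :: "real \<times> 'w \<Rightarrow> 'b::{banach, second_countable_topology}"
  assumes f: "f \<in> borel_measurable (time_measure T \<Otimes>\<^sub>M M)"
    and D: "\<And>s. s \<in> {0..T} \<Longrightarrow> integrable M (D s)" "\<And>s. s \<in> {0..T} \<Longrightarrow> (\<integral>w. D s w \<partial>M) \<le> K"
    and le: "\<And>s w. s \<in> {0..T} \<Longrightarrow> w \<in> space M \<Longrightarrow> norm (f (s, w)) \<le> D s w"
  shows "integrable (time_measure T \<Otimes>\<^sub>M M) f"
proof (rule integrableI_bounded[OF f])
  interpret T: finite_measure "time_measure T" by (rule finite_measure_time)
  have "(\<integral>\<^sup>+p. norm (f p) \<partial>(time_measure T \<Otimes>\<^sub>M M)) = (\<integral>\<^sup>+s. \<integral>\<^sup>+w. norm (f (s, w)) \<partial>M \<partial>time_measure T)"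
    by (subst nn_integral_fst[symmetric]) (use f in auto)
  also have "\<dots> \<le> (\<integral>\<^sup>+s. ennreal K \<partial>time_measure T)"
  proof (rule nn_integral_mono)
    fix s assume "s \<in> space (time_measure T)"
    then have s: "s \<in> {0..T}" by (simp add: space_restrict_space)
    have "(\<integral>\<^sup>+w. norm (f (s, w)) \<partial>M) \<le> (\<integral>\<^sup>+w. ennreal (D s w) \<partial>M)"
      by (intro nn_integral_mono ennreal_leI le s)
    also have "\<dots> = ennreal (\<integral>w. D s w \<partial>M)"
      by (rule nn_integral_eq_integral[OF D(1)[OF s]]) (intro AE_I2 order.trans[OF norm_ge_zero le[OF s]])
    also have "\<dots> \<le> ennreal K" by (intro ennreal_leI D(2) s)
    finally show "(\<integral>\<^sup>+w. norm (f (s, w)) \<partial>M) \<le> ennreal K" .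
  qed
  also have "\<dots> < \<infinity>"
    by (simp add: emeasure_restrict_space emeasure_lborel_Icc_eq space_restrict_space ennreal_mult_less_top)
  finally show "(\<integral>\<^sup>+p. norm (f p) \<partial>(time_measure T \<Otimes>\<^sub>M M)) < \<infinity>" .
qed

end

text \<open>\<open>C\<close> stands for a power of the angle, of class C1 and bounded by 1, and the
  \<open>Xi\<close> for components of \<open>u\<close>; shorter products are padded with the
  constant 1, whose drift and noise vanish. The weight \<open>L\<close> bounds everything by degree:
  two for \<open>C'\<close>, one for each \<open>Xi\<close> and each drift, so the generator has
  degree at most five.\<close>

locale dynkin = brownian M F W for M :: "'w measure" and F and W :: "real \<Rightarrow> 'w \<Rightarrow> real^'m" +
  fixes C C' :: "real \<Rightarrow> 'w \<Rightarrow> complex" and X1 X2 X3 a1 a2 a3 L :: "real \<Rightarrow> 'w \<Rightarrow> real"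
    and b1 b2 b3 :: "real^'m" and T K :: real
  assumes ad: "continuous_adapted M F C" "continuous_adapted M F C'"
      "continuous_adapted M F X1" "continuous_adapted M F X2" "continuous_adapted M F X3"
      "continuous_adapted M F a1" "continuous_adapted M F a2" "continuous_adapted M F a3"
    and C: "\<And>s w. w \<in> space M \<Longrightarrow> s \<ge> 0 \<Longrightarrow> C s w = C 0 w + integral {0..s} (\<lambda>r. C' r w)"
    and X: "\<And>s w. w \<in> space M \<Longrightarrow> s \<ge> 0 \<Longrightarrow> X1 s w = X1 0 w + integral {0..s} (\<lambda>r. a1 r w) + b1 \<bullet> (W s w - W 0 w)"
      "\<And>s w. w \<in> space M \<Longrightarrow> s \<ge> 0 \<Longrightarrow> X2 s w = X2 0 w + integral {0..s} (\<lambda>r. a2 r w) + b2 \<bullet> (W s w - W 0 w)"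
      "\<And>s w. w \<in> space M \<Longrightarrow> s \<ge> 0 \<Longrightarrow> X3 s w = X3 0 w + integral {0..s} (\<lambda>r. a3 r w) + b3 \<bullet> (W s w - W 0 w)"
    and L1: "\<And>s w. 1 \<le> L s w"
    and C_le: "\<And>s w. w \<in> space M \<Longrightarrow> s \<ge> 0 \<Longrightarrow> norm (C s w) \<le> 1"
    and C'_le: "\<And>s w. w \<in> space M \<Longrightarrow> s \<ge> 0 \<Longrightarrow> norm (C' s w) \<le> (L s w)\<^sup>2"
    and X_le: "\<And>s w. w \<in> space M \<Longrightarrow> s \<ge> 0 \<Longrightarrow> \<bar>X1 s w\<bar> \<le> L s w"
      "\<And>s w. w \<in> space M \<Longrightarrow> s \<ge> 0 \<Longrightarrow> \<bar>X2 s w\<bar> \<le> L s w" "\<And>s w. w \<in> space M \<Longrightarrow> s \<ge> 0 \<Longrightarrow> \<bar>X3 s w\<bar> \<le> L s w"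
    and a_le: "\<And>s w. w \<in> space M \<Longrightarrow> s \<ge> 0 \<Longrightarrow> \<bar>a1 s w\<bar> \<le> L s w"
      "\<And>s w. w \<in> space M \<Longrightarrow> s \<ge> 0 \<Longrightarrow> \<bar>a2 s w\<bar> \<le> L s w" "\<And>s w. w \<in> space M \<Longrightarrow> s \<ge> 0 \<Longrightarrow> \<bar>a3 s w\<bar> \<le> L s w"
    and T: "T \<ge> 0"
    and L6: "\<And>s. s \<in> {0..T} \<Longrightarrow> integrable M (\<lambda>w. L s w ^ 6)" "\<And>s. s \<in> {0..T} \<Longrightarrow> (\<integral>w. L s w ^ 6 \<partial>M) \<le> K"
begin

text \<open>With \<open>W T\<close> frozen, \<open>X\<^sub>i s + b\<^sub>i \<bullet> (W T - W s)\<close> is a path of class \<open>C\<^sup>1\<close> in \<open>s\<close>, so that Dynkin's formula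
  follows from the fundamental theorem of calculus. The subtracted terms in \<open>P2\<close> and \<open>P3\<close> compensate the
  mean of the products of the remaining increments, which are independent of \<open>F s\<close>.\<close>

definition \<Theta> :: "real^'m \<Rightarrow> real \<Rightarrow> 'w \<Rightarrow> real" where
  "\<Theta> b s w = b \<bullet> (W T w - W s w)"

definition P3 :: "real \<Rightarrow> 'w \<Rightarrow> real" where
  "P3 s w = (X1 s w + \<Theta> b1 s w) * (X2 s w + \<Theta> b2 s w) * (X3 s w + \<Theta> b3 s w)
     - (T - s) * ((b1 \<bullet> b2) * (X3 s w + \<Theta> b3 s w) + (b1 \<bullet> b3) * (X2 s w + \<Theta> b2 s w) + (b2 \<bullet> b3) * (X1 s w + \<Theta> b1 s w))"

definition P2 :: "(real \<Rightarrow> 'w \<Rightarrow> real) \<Rightarrow> real^'m \<Rightarrow> (real \<Rightarrow> 'w \<Rightarrow> real) \<Rightarrow> real^'m \<Rightarrow> real \<Rightarrow> 'w \<Rightarrow> real" where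
  "P2 X b Y c s w = (X s w + \<Theta> b s w) * (Y s w + \<Theta> c s w) - (T - s) * (b \<bullet> c)"

lemma L0: "0 \<le> L s w"
  using L1[of s w] by simp

lemma L_power_mono: "m \<le> n \<Longrightarrow> L s w ^ m \<le> L s w ^ n"
  by (rule power_increasing[OF _ L1])

lemma integrable_L_bound:
  fixes Z :: "'w \<Rightarrow> complex"
  assumes s: "s \<in> {0..T}" and Z: "Z \<in> borel_measurable (F s)" "\<And>w. w \<in> space M \<Longrightarrow> norm (Z w) \<le> L s w ^ 6"
  shows "integrable M Z"
proof (rule Bochner_Integration.integrable_bound[OF L6(1)[OF s] measurable_F_imp[OF Z(1)]])
  show "AE w in M. norm (Z w) \<le> norm (L s w ^ 6)"
    by (rule AE_I2) (use Z(2) L0 in auto)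
qed

lemma orth:
  fixes Z :: "'w \<Rightarrow> complex" and g :: "real^'m \<Rightarrow> real"
  assumes s: "s \<in> {0..T}" and Z: "Z \<in> borel_measurable (F s)" "\<And>w. w \<in> space M \<Longrightarrow> norm (Z w) \<le> L s w ^ 6"
    and g: "g \<in> borel_measurable borel" "has_bochner_integral M (\<lambda>w. g (W T w - W s w)) 0" "s = T \<Longrightarrow> g 0 = 0"
  shows "has_bochner_integral M (\<lambda>w. Z w * of_real (g (W T w - W s w))) 0"
  by (rule increment_orthogonal) (use s in \<open>auto intro!: Z g integrable_L_bound\<close>)

lemma orth1:
  fixes Z :: "'w \<Rightarrow> complex"
  assumes s: "s \<in> {0..T}" and Z: "Z \<in> borel_measurable (F s)" "\<And>w. w \<in> space M \<Longrightarrow> norm (Z w) \<le> L s w ^ 6"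
  shows "has_bochner_integral M (\<lambda>w. Z w * of_real (\<Theta> b s w)) 0"
  unfolding \<Theta>_def
  by (rule orth[OF s Z]) (use s in \<open>auto intro!: increment_inner borel_measurable_continuous_onI continuous_intros\<close>)

lemma orth2:
  fixes Z :: "'w \<Rightarrow> complex"
  assumes s: "s \<in> {0..T}" and Z: "Z \<in> borel_measurable (F s)" "\<And>w. w \<in> space M \<Longrightarrow> norm (Z w) \<le> L s w ^ 6"
  shows "has_bochner_integral M (\<lambda>w. Z w * of_real (\<Theta> b s w * \<Theta> c s w - (T - s) * (b \<bullet> c))) 0"
  unfolding \<Theta>_def
proof (rule orth[OF s Z, where g="\<lambda>x. (b \<bullet> x) * (c \<bullet> x) - (T - s) * (b \<bullet> c)"])
  have "has_bochner_integral M (\<lambda>w. (b \<bullet> (W T w - W s w)) * (c \<bullet> (W T w - W s w)) - (T - s) * (b \<bullet> c))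
      ((T - s) * (b \<bullet> c) - (T - s) * (b \<bullet> c))"
    by (intro has_bochner_integral_diff increment_inner) (use s in \<open>auto simp: has_bochner_integral_iff prob_space\<close>)
  then show "has_bochner_integral M (\<lambda>w. (b \<bullet> (W T w - W s w)) * (c \<bullet> (W T w - W s w)) - (T - s) * (b \<bullet> c)) 0"
    by simp
qed (auto intro!: borel_measurable_continuous_onI continuous_intros)

text \<open>The polynomial in the increment is the Wick-ordered cubic. Odd moments of the increment
  vanish, so both its cubic and its linear part are centred.\<close>

lemma orth3:
  fixes Z :: "'w \<Rightarrow> complex"
  assumes s: "s \<in> {0..T}" and Z: "Z \<in> borel_measurable (F s)" "\<And>w. w \<in> space M \<Longrightarrow> norm (Z w) \<le> L s w ^ 6"
  shows "has_bochner_integral M (\<lambda>w. Z w * of_real (\<Theta> b1 s w * \<Theta> b2 s w * \<Theta> b3 s w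
    - (T - s) * ((b1 \<bullet> b2) * \<Theta> b3 s w + (b1 \<bullet> b3) * \<Theta> b2 s w + (b2 \<bullet> b3) * \<Theta> b1 s w))) 0"
  unfolding \<Theta>_def
proof (rule orth[OF s Z, where g="\<lambda>x. (b1 \<bullet> x) * (b2 \<bullet> x) * (b3 \<bullet> x)
    - (T - s) * ((b1 \<bullet> b2) * (b3 \<bullet> x) + (b1 \<bullet> b3) * (b2 \<bullet> x) + (b2 \<bullet> b3) * (b1 \<bullet> x))"])
  have "has_bochner_integral M (\<lambda>w. (b1 \<bullet> (W T w - W s w)) * (b2 \<bullet> (W T w - W s w)) * (b3 \<bullet> (W T w - W s w)) -
      (T - s) * ((b1 \<bullet> b2) * (b3 \<bullet> (W T w - W s w)) + (b1 \<bullet> b3) * (b2 \<bullet> (W T w - W s w)) + (b2 \<bullet> b3) * (b1 \<bullet> (W T w - W s w))))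
      (0 - (T - s) * ((b1 \<bullet> b2) * 0 + (b1 \<bullet> b3) * 0 + (b2 \<bullet> b3) * 0))"
    by (intro has_bochner_integral_diff has_bochner_integral_add has_bochner_integral_mult_right increment_inner)
       (use s in auto)
  then show "has_bochner_integral M (\<lambda>w. (b1 \<bullet> (W T w - W s w)) * (b2 \<bullet> (W T w - W s w)) * (b3 \<bullet> (W T w - W s w)) -
      (T - s) * ((b1 \<bullet> b2) * (b3 \<bullet> (W T w - W s w)) + (b1 \<bullet> b3) * (b2 \<bullet> (W T w - W s w)) + (b2 \<bullet> b3) * (b1 \<bullet> (W T w - W s w)))) 0"
    by simp
qed (auto intro!: borel_measurable_continuous_onI continuous_intros)

lemma norm_mult_le:
  fixes z :: complex
  assumes "norm z \<le> a" "\<bar>x\<bar> \<le> b"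
  shows "norm (z * of_real x) \<le> a * b"
  unfolding norm_mult norm_of_real by (intro mult_mono' assms) auto

lemma L_times: "L s w ^ m * L s w = L s w ^ Suc m"
  by (simp add: mult.commute)

text \<open>The first of three lemmas of one pattern: multiplied by a factor measurable for
  \<open>F s\<close>, a frozen expression has the same mean as without the remaining increments,
  because every extra term is such a factor times a centred polynomial in the increment.\<close>

lemma expectation1:
  fixes Z :: "'w \<Rightarrow> complex"
  assumes s: "s \<in> {0..T}" and Z: "Z \<in> borel_measurable (F s)" "\<And>w. w \<in> space M \<Longrightarrow> norm (Z w) \<le> (L s w)\<^sup>2"
    and X: "X s \<in> borel_measurable (F s)" "\<And>w. w \<in> space M \<Longrightarrow> \<bar>X s w\<bar> \<le> L s w"
  shows "has_bochner_integral M (\<lambda>w. Z w * of_real (X s w + \<Theta> b s w)) (\<integral>w. Z w * of_real (X s w) \<partial>M)"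
proof -
  have m: "(\<lambda>w. Z w * of_real (X s w)) \<in> borel_measurable (F s)" using Z(1) X(1) by measurable
  have b0: "norm (Z w) \<le> L s w ^ 6" if "w \<in> space M" for w
    using order.trans[OF Z(2)[OF that] L_power_mono[of 2 6]] by simp
  have b1: "norm (Z w * of_real (X s w)) \<le> L s w ^ 6" if "w \<in> space M" for w
    using norm_mult_le[OF Z(2)[OF that] X(2)[OF that]] L_power_mono[of 3 6 s w] unfolding L_times by simp
  have "has_bochner_integral M (\<lambda>w. Z w * of_real (X s w) + Z w * of_real (\<Theta> b s w)) ((\<integral>w. Z w * of_real (X s w) \<partial>M) + 0)"
    by (intro has_bochner_integral_add has_bochner_integral_integrable integrable_L_bound[OF s] orth1[OF s] m Z b0 b1)
  then show ?thesis by (simp add: distrib_left)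
qed

lemma expectation2:
  fixes Z :: "'w \<Rightarrow> complex"
  assumes s: "s \<in> {0..T}" and Z: "Z \<in> borel_measurable (F s)" "\<And>w. w \<in> space M \<Longrightarrow> norm (Z w) \<le> (L s w)\<^sup>2"
    and X: "X s \<in> borel_measurable (F s)" "\<And>w. w \<in> space M \<Longrightarrow> \<bar>X s w\<bar> \<le> L s w"
    and Y: "Y s \<in> borel_measurable (F s)" "\<And>w. w \<in> space M \<Longrightarrow> \<bar>Y s w\<bar> \<le> L s w"
  shows "has_bochner_integral M (\<lambda>w. Z w * of_real (P2 X b Y c s w)) (\<integral>w. Z w * of_real (X s w) * of_real (Y s w) \<partial>M)"
proof -
  have m: "(\<lambda>w. Z w * of_real (X s w)) \<in> borel_measurable (F s)"
    "(\<lambda>w. Z w * of_real (Y s w)) \<in> borel_measurable (F s)"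
    "(\<lambda>w. Z w * of_real (X s w) * of_real (Y s w)) \<in> borel_measurable (F s)" using Z(1) X(1) Y(1) by measurable
  have b0: "norm (Z w) \<le> L s w ^ 6" if "w \<in> space M" for w
    using order.trans[OF Z(2)[OF that] L_power_mono[of 2 6]] by simp
  have b1: "norm (Z w * of_real (X s w)) \<le> L s w ^ 6" if "w \<in> space M" for w
    using norm_mult_le[OF Z(2)[OF that] X(2)[OF that]] L_power_mono[of 3 6 s w] unfolding L_times by simp
  have b2: "norm (Z w * of_real (Y s w)) \<le> L s w ^ 6" if "w \<in> space M" for w
    using norm_mult_le[OF Z(2)[OF that] Y(2)[OF that]] L_power_mono[of 3 6 s w] unfolding L_times by simp
  have b3: "norm (Z w * of_real (X s w) * of_real (Y s w)) \<le> L s w ^ 6" if "w \<in> space M" for w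
    using norm_mult_le[OF norm_mult_le[OF Z(2)[OF that] X(2)[OF that]] Y(2)[OF that]] L_power_mono[of 4 6 s w]
    unfolding L_times by simp
  have "has_bochner_integral M (\<lambda>w. Z w * of_real (X s w) * of_real (Y s w) + (Z w * of_real (X s w) * of_real (\<Theta> c s w)
     + (Z w * of_real (Y s w) * of_real (\<Theta> b s w) + Z w * of_real (\<Theta> b s w * \<Theta> c s w - (T - s) * (b \<bullet> c)))))
     ((\<integral>w. Z w * of_real (X s w) * of_real (Y s w) \<partial>M) + (0 + (0 + 0)))"
    by (intro has_bochner_integral_add has_bochner_integral_integrable integrable_L_bound[OF s] orth1[OF s] orth2[OF s]
        m Z b0 b1 b2 b3)
  moreover have "Z w * of_real (X s w) * of_real (Y s w) + (Z w * of_real (X s w) * of_real (\<Theta> c s w)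
     + (Z w * of_real (Y s w) * of_real (\<Theta> b s w) + Z w * of_real (\<Theta> b s w * \<Theta> c s w - (T - s) * (b \<bullet> c))))
     = Z w * of_real (P2 X b Y c s w)" for w
    by (simp add: P2_def algebra_simps)
  ultimately show ?thesis by simp
qed

text \<open>Expanding \<open>P3\<close> gives eight terms: the plain product, three linear, three
  compensated quadratic and one compensated cubic polynomial in the remaining increment. The
  compensators in \<open>P3\<close> are exactly those that centre the last four.\<close>

lemma expectation3:
  fixes Z :: "'w \<Rightarrow> complex"
  assumes s: "s \<in> {0..T}" and Z: "Z \<in> borel_measurable (F s)" "\<And>w. w \<in> space M \<Longrightarrow> norm (Z w) \<le> (L s w)\<^sup>2"
  shows "has_bochner_integral M (\<lambda>w. Z w * of_real (P3 s w))
    (\<integral>w. Z w * of_real (X1 s w) * of_real (X2 s w) * of_real (X3 s w) \<partial>M)"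
proof -
  have s0: "s \<ge> 0" using s by simp
  have [measurable]: "X1 s \<in> borel_measurable (F s)" "X2 s \<in> borel_measurable (F s)" "X3 s \<in> borel_measurable (F s)"
    by (rule continuous_adaptedD(1)[OF _ s0], rule ad)+
  have mX: "(\<lambda>w. Z w * of_real (X1 s w)) \<in> borel_measurable (F s)"
    "(\<lambda>w. Z w * of_real (X2 s w)) \<in> borel_measurable (F s)"
    "(\<lambda>w. Z w * of_real (X3 s w)) \<in> borel_measurable (F s)"
    "(\<lambda>w. Z w * of_real (X1 s w) * of_real (X2 s w)) \<in> borel_measurable (F s)"
    "(\<lambda>w. Z w * of_real (X1 s w) * of_real (X3 s w)) \<in> borel_measurable (F s)"
    "(\<lambda>w. Z w * of_real (X2 s w) * of_real (X3 s w)) \<in> borel_measurable (F s)"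
    "(\<lambda>w. Z w * of_real (X1 s w) * of_real (X2 s w) * of_real (X3 s w)) \<in> borel_measurable (F s)"
    using Z(1) by measurable
  have b0: "norm (Z w) \<le> L s w ^ 6" if "w \<in> space M" for w
    using order.trans[OF Z(2)[OF that] L_power_mono[of 2 6]] by simp
  note x = X_le[OF _ s0]
  have b1: "norm (Z w * of_real (X1 s w)) \<le> L s w ^ 6" "norm (Z w * of_real (X2 s w)) \<le> L s w ^ 6"
    "norm (Z w * of_real (X3 s w)) \<le> L s w ^ 6" if "w \<in> space M" for w
    using norm_mult_le[OF Z(2)[OF that] x(1)[OF that]] norm_mult_le[OF Z(2)[OF that] x(2)[OF that]]
      norm_mult_le[OF Z(2)[OF that] x(3)[OF that]] L_power_mono[of 3 6 s w] unfolding L_times by simp_all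
  have b2: "norm (Z w * of_real (X1 s w) * of_real (X2 s w)) \<le> L s w ^ 6"
    "norm (Z w * of_real (X1 s w) * of_real (X3 s w)) \<le> L s w ^ 6"
    "norm (Z w * of_real (X2 s w) * of_real (X3 s w)) \<le> L s w ^ 6" if "w \<in> space M" for w
    using norm_mult_le[OF norm_mult_le[OF Z(2)[OF that] x(1)[OF that]] x(2)[OF that]]
      norm_mult_le[OF norm_mult_le[OF Z(2)[OF that] x(1)[OF that]] x(3)[OF that]]
      norm_mult_le[OF norm_mult_le[OF Z(2)[OF that] x(2)[OF that]] x(3)[OF that]] L_power_mono[of 4 6 s w]
    unfolding L_times by simp_all
  have b3: "norm (Z w * of_real (X1 s w) * of_real (X2 s w) * of_real (X3 s w)) \<le> L s w ^ 6" if "w \<in> space M" for w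
    using norm_mult_le[OF norm_mult_le[OF norm_mult_le[OF Z(2)[OF that] x(1)[OF that]] x(2)[OF that]] x(3)[OF that]]
      L_power_mono[of 5 6 s w] unfolding L_times by simp
  have "has_bochner_integral M (\<lambda>w. Z w * of_real (X1 s w) * of_real (X2 s w) * of_real (X3 s w) +
     (Z w * of_real (X1 s w) * of_real (X2 s w) * of_real (\<Theta> b3 s w) +
     (Z w * of_real (X1 s w) * of_real (X3 s w) * of_real (\<Theta> b2 s w) +
     (Z w * of_real (X2 s w) * of_real (X3 s w) * of_real (\<Theta> b1 s w) +
     (Z w * of_real (X1 s w) * of_real (\<Theta> b2 s w * \<Theta> b3 s w - (T - s) * (b2 \<bullet> b3)) +
     (Z w * of_real (X2 s w) * of_real (\<Theta> b1 s w * \<Theta> b3 s w - (T - s) * (b1 \<bullet> b3)) +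
     (Z w * of_real (X3 s w) * of_real (\<Theta> b1 s w * \<Theta> b2 s w - (T - s) * (b1 \<bullet> b2)) +
     Z w * of_real (\<Theta> b1 s w * \<Theta> b2 s w * \<Theta> b3 s w
    - (T - s) * ((b1 \<bullet> b2) * \<Theta> b3 s w + (b1 \<bullet> b3) * \<Theta> b2 s w + (b2 \<bullet> b3) * \<Theta> b1 s w)))))))))
     ((\<integral>w. Z w * of_real (X1 s w) * of_real (X2 s w) * of_real (X3 s w) \<partial>M) + (0 + (0 + (0 + (0 + (0 + (0 + 0)))))))"
    by (intro has_bochner_integral_add has_bochner_integral_integrable integrable_L_bound[OF s] orth1[OF s] orth2[OF s]
        orth3[OF s] mX Z b0 b1 b2 b3)
  moreover have "Z w * of_real (X1 s w) * of_real (X2 s w) * of_real (X3 s w) +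
     (Z w * of_real (X1 s w) * of_real (X2 s w) * of_real (\<Theta> b3 s w) +
     (Z w * of_real (X1 s w) * of_real (X3 s w) * of_real (\<Theta> b2 s w) +
     (Z w * of_real (X2 s w) * of_real (X3 s w) * of_real (\<Theta> b1 s w) +
     (Z w * of_real (X1 s w) * of_real (\<Theta> b2 s w * \<Theta> b3 s w - (T - s) * (b2 \<bullet> b3)) +
     (Z w * of_real (X2 s w) * of_real (\<Theta> b1 s w * \<Theta> b3 s w - (T - s) * (b1 \<bullet> b3)) +
     (Z w * of_real (X3 s w) * of_real (\<Theta> b1 s w * \<Theta> b2 s w - (T - s) * (b1 \<bullet> b2)) +
     Z w * of_real (\<Theta> b1 s w * \<Theta> b2 s w * \<Theta> b3 s w
    - (T - s) * ((b1 \<bullet> b2) * \<Theta> b3 s w + (b1 \<bullet> b3) * \<Theta> b2 s w + (b2 \<bullet> b3) * \<Theta> b1 s w)))))))) =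
     Z w * of_real (P3 s w)" for w
    by (simp add: P3_def algebra_simps)
  ultimately show ?thesis by simp
qed

text \<open>The drift that Ito's formula assigns to \<open>C X1 X2 X3\<close>.\<close>

definition generator_term :: "real \<Rightarrow> 'w \<Rightarrow> complex" where
  "generator_term s w =
     C' s w * of_real (X1 s w) * of_real (X2 s w) * of_real (X3 s w) +
     (C s w * of_real (a1 s w) * of_real (X2 s w) * of_real (X3 s w) +
     (C s w * of_real (a2 s w) * of_real (X1 s w) * of_real (X3 s w) +
     (C s w * of_real (a3 s w) * of_real (X1 s w) * of_real (X2 s w) +
     (of_real (b1 \<bullet> b2) * (C s w * of_real (X3 s w)) +
     (of_real (b1 \<bullet> b3) * (C s w * of_real (X2 s w)) +
      of_real (b2 \<bullet> b3) * (C s w * of_real (X1 s w)))))))"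

text \<open>The derivative in \<open>s\<close> of \<open>C s * P3 s\<close> along a path with
  \<open>W T\<close> held fixed. Differentiating the compensator \<open>T - s\<close> is what
  produces the second-order terms of Ito's formula.\<close>

definition frozen_derivative :: "real \<Rightarrow> 'w \<Rightarrow> complex" where
  "frozen_derivative s w =
     C' s w * of_real (P3 s w) +
     (C s w * of_real (a1 s w) * of_real (P2 X2 b2 X3 b3 s w) +
     (C s w * of_real (a2 s w) * of_real (P2 X1 b1 X3 b3 s w) +
     (C s w * of_real (a3 s w) * of_real (P2 X1 b1 X2 b2 s w) +
     (of_real (b1 \<bullet> b2) * (C s w * of_real (X3 s w + \<Theta> b3 s w)) +
     (of_real (b1 \<bullet> b3) * (C s w * of_real (X2 s w + \<Theta> b2 s w)) +
      of_real (b2 \<bullet> b3) * (C s w * of_real (X1 s w + \<Theta> b1 s w)))))))"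

text \<open>At a fixed time each summand is a factor measurable for \<open>F s\<close> times a
  frozen product of lower degree, so the expectation lemmas turn \<open>P3\<close>,
  \<open>P2\<close> and the linear terms back into plain products.\<close>

lemma has_bochner_integral_frozen:
  assumes s: "s \<in> {0..T}"
  shows "has_bochner_integral M (frozen_derivative s) (\<integral>w. generator_term s w \<partial>M)"
proof -
  have s0: "s \<ge> 0" using s by simp
  have [measurable]: "C s \<in> borel_measurable (F s)" "C' s \<in> borel_measurable (F s)"
    "X1 s \<in> borel_measurable (F s)" "X2 s \<in> borel_measurable (F s)" "X3 s \<in> borel_measurable (F s)"
    "a1 s \<in> borel_measurable (F s)" "a2 s \<in> borel_measurable (F s)" "a3 s \<in> borel_measurable (F s)"
    by (rule continuous_adaptedD(1)[OF _ s0], rule ad)+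
  note x = X_le[OF _ s0] and a = a_le[OF _ s0] and c = C_le[OF _ s0] and c' = C'_le[OF _ s0]
  have m: "X1 s \<in> borel_measurable (F s)" "X2 s \<in> borel_measurable (F s)" "X3 s \<in> borel_measurable (F s)" by measurable
  have mZ: "C s \<in> borel_measurable (F s)" "C' s \<in> borel_measurable (F s)"
    "(\<lambda>w. C s w * of_real (a1 s w)) \<in> borel_measurable (F s)"
    "(\<lambda>w. C s w * of_real (a2 s w)) \<in> borel_measurable (F s)"
    "(\<lambda>w. C s w * of_real (a3 s w)) \<in> borel_measurable (F s)" by measurable
  have bC: "norm (C s w) \<le> (L s w)\<^sup>2" if "w \<in> space M" for w
    using c[OF that] one_le_power[OF L1[of s w], of 2] by linarith
  have bCa: "norm (C s w * of_real (a1 s w)) \<le> (L s w)\<^sup>2"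
    "norm (C s w * of_real (a2 s w)) \<le> (L s w)\<^sup>2"
    "norm (C s w * of_real (a3 s w)) \<le> (L s w)\<^sup>2" if "w \<in> space M" for w
    using norm_mult_le[OF c[OF that] a(1)[OF that]] norm_mult_le[OF c[OF that] a(2)[OF that]]
      norm_mult_le[OF c[OF that] a(3)[OF that]] L_power_mono[of 1 2 s w] by simp_all
  have i1: "integrable M (\<lambda>w. Z w * of_real (X w))"
    if "Z \<in> borel_measurable (F s)" "\<And>w. w \<in> space M \<Longrightarrow> norm (Z w) \<le> (L s w)\<^sup>2"
      "X \<in> borel_measurable (F s)" "\<And>w. w \<in> space M \<Longrightarrow> \<bar>X w\<bar> \<le> L s w" for Z :: "'w \<Rightarrow> complex" and X
  proof (rule integrable_L_bound[OF s])
    show "(\<lambda>w. Z w * of_real (X w)) \<in> borel_measurable (F s)" using that by measurable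
    show "norm (Z w * of_real (X w)) \<le> L s w ^ 6" if "w \<in> space M" for w
      using norm_mult_le[OF \<open>\<And>w. w \<in> space M \<Longrightarrow> norm (Z w) \<le> (L s w)\<^sup>2\<close> \<open>\<And>w. w \<in> space M \<Longrightarrow> \<bar>X w\<bar> \<le> L s w\<close>, OF that that]
        L_power_mono[of 3 6 s w] unfolding L_times by simp
  qed
  have i2: "integrable M (\<lambda>w. Z w * of_real (X w) * of_real (Y w))"
    if "Z \<in> borel_measurable (F s)" "\<And>w. w \<in> space M \<Longrightarrow> norm (Z w) \<le> (L s w)\<^sup>2"
      "X \<in> borel_measurable (F s)" "\<And>w. w \<in> space M \<Longrightarrow> \<bar>X w\<bar> \<le> L s w"
      "Y \<in> borel_measurable (F s)" "\<And>w. w \<in> space M \<Longrightarrow> \<bar>Y w\<bar> \<le> L s w" for Z :: "'w \<Rightarrow> complex" and X Y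
  proof (rule integrable_L_bound[OF s])
    show "(\<lambda>w. Z w * of_real (X w) * of_real (Y w)) \<in> borel_measurable (F s)" using that by measurable
    show "norm (Z w * of_real (X w) * of_real (Y w)) \<le> L s w ^ 6" if "w \<in> space M" for w
      using norm_mult_le[OF norm_mult_le[OF \<open>\<And>w. w \<in> space M \<Longrightarrow> norm (Z w) \<le> (L s w)\<^sup>2\<close> \<open>\<And>w. w \<in> space M \<Longrightarrow> \<bar>X w\<bar> \<le> L s w\<close>]
          \<open>\<And>w. w \<in> space M \<Longrightarrow> \<bar>Y w\<bar> \<le> L s w\<close>, OF that that that] L_power_mono[of 4 6 s w] unfolding L_times by simp
  qed
  have i3: "integrable M (\<lambda>w. C' s w * of_real (X1 s w) * of_real (X2 s w) * of_real (X3 s w))"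
  proof (rule integrable_L_bound[OF s])
    show "(\<lambda>w. C' s w * of_real (X1 s w) * of_real (X2 s w) * of_real (X3 s w)) \<in> borel_measurable (F s)" by measurable
    show "norm (C' s w * of_real (X1 s w) * of_real (X2 s w) * of_real (X3 s w)) \<le> L s w ^ 6" if "w \<in> space M" for w
      using norm_mult_le[OF norm_mult_le[OF norm_mult_le[OF c'[OF that] x(1)[OF that]] x(2)[OF that]] x(3)[OF that]]
        L_power_mono[of 5 6 s w] unfolding L_times by simp
  qed
  have "(\<integral>w. generator_term s w \<partial>M) =
     (\<integral>w. C' s w * of_real (X1 s w) * of_real (X2 s w) * of_real (X3 s w) \<partial>M) +
     ((\<integral>w. C s w * of_real (a1 s w) * of_real (X2 s w) * of_real (X3 s w) \<partial>M) +
     ((\<integral>w. C s w * of_real (a2 s w) * of_real (X1 s w) * of_real (X3 s w) \<partial>M) +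
     ((\<integral>w. C s w * of_real (a3 s w) * of_real (X1 s w) * of_real (X2 s w) \<partial>M) +
     (of_real (b1 \<bullet> b2) * (\<integral>w. C s w * of_real (X3 s w) \<partial>M) +
     (of_real (b1 \<bullet> b3) * (\<integral>w. C s w * of_real (X2 s w) \<partial>M) +
      of_real (b2 \<bullet> b3) * (\<integral>w. C s w * of_real (X1 s w) \<partial>M))))))"
    unfolding generator_term_def
    apply (rule has_bochner_integral_integral_eq)
    apply (intro has_bochner_integral_add has_bochner_integral_mult_right has_bochner_integral_integrable)
    apply (rule i3 i2[OF mZ(3) bCa(1) m(2) x(2) m(3) x(3)] i2[OF mZ(4) bCa(2) m(1) x(1) m(3) x(3)]
        i2[OF mZ(5) bCa(3) m(1) x(1) m(2) x(2)] i1[OF mZ(1) bC m(1) x(1)] i1[OF mZ(1) bC m(2) x(2)] i1[OF mZ(1) bC m(3) x(3)];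
        assumption)+
    done
  moreover have "has_bochner_integral M (frozen_derivative s) ((\<integral>w. C' s w * of_real (X1 s w) * of_real (X2 s w) * of_real (X3 s w) \<partial>M) +
     ((\<integral>w. C s w * of_real (a1 s w) * of_real (X2 s w) * of_real (X3 s w) \<partial>M) +
     ((\<integral>w. C s w * of_real (a2 s w) * of_real (X1 s w) * of_real (X3 s w) \<partial>M) +
     ((\<integral>w. C s w * of_real (a3 s w) * of_real (X1 s w) * of_real (X2 s w) \<partial>M) +
     (of_real (b1 \<bullet> b2) * (\<integral>w. C s w * of_real (X3 s w) \<partial>M) +
     (of_real (b1 \<bullet> b3) * (\<integral>w. C s w * of_real (X2 s w) \<partial>M) +
      of_real (b2 \<bullet> b3) * (\<integral>w. C s w * of_real (X1 s w) \<partial>M)))))))"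
    unfolding frozen_derivative_def[abs_def]
    apply (intro has_bochner_integral_add has_bochner_integral_mult_right)
    apply (rule expectation3[OF s mZ(2) c'] expectation2[where X=X2 and Y=X3, OF s mZ(3) bCa(1) m(2) x(2) m(3) x(3)]
        expectation2[where X=X1 and Y=X3, OF s mZ(4) bCa(2) m(1) x(1) m(3) x(3)]
        expectation2[where X=X1 and Y=X2, OF s mZ(5) bCa(3) m(1) x(1) m(2) x(2)] expectation1[where X=X1, OF s mZ(1) bC m(1) x(1)]
        expectation1[where X=X2, OF s mZ(1) bC m(2) x(2)] expectation1[where X=X3, OF s mZ(1) bC m(3) x(3)]; assumption)+
    done
  ultimately show ?thesis by simp
qed

definition B0 :: real where "B0 = norm b1 + norm b2 + norm b3"

text \<open>The analogue of \<open>L\<close> for frozen quantities: the remaining increment, which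
  looks into the future of \<open>s\<close>, has to be added. Its sixth moment is bounded as
  well.\<close>

definition R :: "real \<Rightarrow> 'w \<Rightarrow> real" where "R s w = L s w + B0 * norm (W T w - W s w)"

lemma B0_nonneg: "B0 \<ge> 0"
  by (simp add: B0_def)

lemma L_le_R: "L s w \<le> R s w"
  using B0_nonneg by (simp add: R_def)

lemma R1: "1 \<le> R s w"
  using L1 L_le_R order.trans by blast

lemma \<Theta>_le: "b \<in> {b1, b2, b3} \<Longrightarrow> \<bar>\<Theta> b s w\<bar> \<le> B0 * norm (W T w - W s w)"
  unfolding \<Theta>_def
  by (rule order.trans[OF Cauchy_Schwarz_ineq2]) (auto simp: B0_def intro!: mult_right_mono)

lemma X\<Theta>_le: "b \<in> {b1, b2, b3} \<Longrightarrow> \<bar>X s w\<bar> \<le> L s w \<Longrightarrow> \<bar>X s w + \<Theta> b s w\<bar> \<le> R s w"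
  using \<Theta>_le[of b s w] by (simp add: R_def)

lemma inner_le: "b \<in> {b1, b2, b3} \<Longrightarrow> c \<in> {b1, b2, b3} \<Longrightarrow> \<bar>b \<bullet> c\<bar> \<le> B0\<^sup>2"
  unfolding power2_eq_square
  by (rule order.trans[OF Cauchy_Schwarz_ineq2]) (auto simp: B0_def intro!: mult_mono)

lemma P2_le:
  assumes "s \<in> {0..T}" "b \<in> {b1, b2, b3}" "c \<in> {b1, b2, b3}" "\<bar>X s w\<bar> \<le> L s w" "\<bar>Y s w\<bar> \<le> L s w"
  shows "\<bar>P2 X b Y c s w\<bar> \<le> (1 + T * B0\<^sup>2) * (R s w)\<^sup>2"
proof -
  have "\<bar>(X s w + \<Theta> b s w) * (Y s w + \<Theta> c s w)\<bar> \<le> R s w * R s w"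
    unfolding abs_mult using assms by (intro mult_mono' X\<Theta>_le) auto
  moreover have "\<bar>(T - s) * (b \<bullet> c)\<bar> \<le> T * B0\<^sup>2"
    unfolding abs_mult using assms by (intro mult_mono' inner_le) auto
  moreover have "T * B0\<^sup>2 \<le> T * B0\<^sup>2 * (R s w)\<^sup>2"
    using T R1[of s w] mult_left_mono[OF one_le_power[OF R1[of s w], of 2], of "T * B0\<^sup>2"] by simp
  ultimately show ?thesis by (simp add: P2_def algebra_simps power2_eq_square abs_le_iff)
qed

lemma P3_le:
  assumes s: "s \<in> {0..T}" and w: "w \<in> space M"
  shows "\<bar>P3 s w\<bar> \<le> (1 + 3 * T * B0\<^sup>2) * (R s w) ^ 3"
proof -
  have x: "\<bar>X1 s w + \<Theta> b1 s w\<bar> \<le> R s w" "\<bar>X2 s w + \<Theta> b2 s w\<bar> \<le> R s w" "\<bar>X3 s w + \<Theta> b3 s w\<bar> \<le> R s w"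
    using X_le[OF w] s by (auto intro!: X\<Theta>_le)
  have "\<bar>(X1 s w + \<Theta> b1 s w) * (X2 s w + \<Theta> b2 s w) * (X3 s w + \<Theta> b3 s w)\<bar> \<le> R s w * R s w * R s w"
    unfolding abs_mult using x by (intro mult_mono') auto
  moreover have "\<bar>(T - s) * ((b1 \<bullet> b2) * (X3 s w + \<Theta> b3 s w) + (b1 \<bullet> b3) * (X2 s w + \<Theta> b2 s w) + (b2 \<bullet> b3) * (X1 s w + \<Theta> b1 s w))\<bar>
     \<le> T * (B0\<^sup>2 * R s w + B0\<^sup>2 * R s w + B0\<^sup>2 * R s w)"
    unfolding abs_mult using s x
    by (intro mult_mono' order.trans[OF abs_triangle_ineq] add_mono) (auto simp: abs_mult intro!: mult_mono' inner_le)
  moreover have "T * (B0\<^sup>2 * R s w + B0\<^sup>2 * R s w + B0\<^sup>2 * R s w) \<le> 3 * T * B0\<^sup>2 * (R s w) ^ 3"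
  proof -
    have "R s w \<le> R s w ^ 3" using power_increasing[of 1 3 "R s w"] R1 by simp
    then have "(3 * T * B0\<^sup>2) * R s w \<le> (3 * T * B0\<^sup>2) * R s w ^ 3" using T by (intro mult_left_mono) auto
    then show ?thesis by (simp add: algebra_simps)
  qed
  ultimately show ?thesis
    unfolding P3_def by (simp add: algebra_simps power3_eq_cube abs_le_iff)
qed

text \<open>One constant for each of the seven summands of \<open>frozen_derivative\<close>: one
  with \<open>P3\<close>, three with \<open>P2\<close>, three linear.\<close>

definition c0 :: real where "c0 = (1 + 3 * T * B0\<^sup>2) + 3 * (1 + T * B0\<^sup>2) + 3 * B0\<^sup>2"

lemma norm_frozen_le:
  assumes s: "s \<in> {0..T}" and w: "w \<in> space M"
  shows "norm (frozen_derivative s w) \<le> c0 * R s w ^ 6"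
proof -
  have s0: "s \<ge> 0" using s by simp
  note x = X_le[OF w s0] and a = a_le[OF w s0] and c = C_le[OF w s0] and c' = C'_le[OF w s0]
  have R0: "R s w \<ge> 0" using R1[of s w] by simp
  have LR: "(L s w)\<^sup>2 \<le> (R s w)\<^sup>2" using L_le_R[of s w] L0[of s w] by (intro power_mono)
  have p: "R s w ^ m \<le> R s w ^ 6" if "m \<le> 6" for m using that R1 by (intro power_increasing) auto
  have t1: "norm (C' s w * of_real (P3 s w)) \<le> (1 + 3 * T * B0\<^sup>2) * R s w ^ 6"
  proof -
    have "norm (C' s w * of_real (P3 s w)) \<le> (R s w)\<^sup>2 * ((1 + 3 * T * B0\<^sup>2) * (R s w) ^ 3)"
      by (rule norm_mult_le[OF order.trans[OF c' LR] P3_le[OF s w]])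
    also have "\<dots> = (1 + 3 * T * B0\<^sup>2) * R s w ^ 5" by (simp add: eval_nat_numeral)
    also have "\<dots> \<le> (1 + 3 * T * B0\<^sup>2) * R s w ^ 6" using T by (intro mult_left_mono p) auto
    finally show ?thesis .
  qed
  have t2: "norm (C s w * of_real ai * of_real q) \<le> (1 + T * B0\<^sup>2) * R s w ^ 6"
    if "\<bar>ai\<bar> \<le> L s w" "\<bar>q\<bar> \<le> (1 + T * B0\<^sup>2) * (R s w)\<^sup>2" for ai q
  proof -
    have "norm (C s w * of_real ai * of_real q) \<le> 1 * R s w * ((1 + T * B0\<^sup>2) * (R s w)\<^sup>2)"
      by (intro norm_mult_le c that order.trans[OF _ L_le_R])
    also have "\<dots> = (1 + T * B0\<^sup>2) * R s w ^ 3" by (simp add: eval_nat_numeral)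
    also have "\<dots> \<le> (1 + T * B0\<^sup>2) * R s w ^ 6" using T by (intro mult_left_mono p) auto
    finally show ?thesis .
  qed
  have t3: "norm (of_real bb * (C s w * of_real q)) \<le> B0\<^sup>2 * R s w ^ 6"
    if "\<bar>bb\<bar> \<le> B0\<^sup>2" "\<bar>q\<bar> \<le> R s w" for bb q
  proof -
    have "norm (of_real bb * (C s w * of_real q)) \<le> B0\<^sup>2 * (1 * R s w)"
      unfolding norm_mult[of "of_real bb"] norm_of_real by (intro mult_mono' that norm_mult_le c) auto
    also have "\<dots> \<le> B0\<^sup>2 * R s w ^ 6" using p[of 1] by (intro mult_left_mono) auto
    finally show ?thesis .
  qed
  have "norm (frozen_derivative s w) \<le> (1 + 3 * T * B0\<^sup>2) * R s w ^ 6 + ((1 + T * B0\<^sup>2) * R s w ^ 6 +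
    ((1 + T * B0\<^sup>2) * R s w ^ 6 + ((1 + T * B0\<^sup>2) * R s w ^ 6 + (B0\<^sup>2 * R s w ^ 6 + (B0\<^sup>2 * R s w ^ 6 + B0\<^sup>2 * R s w ^ 6)))))"
    unfolding frozen_derivative_def
    by (intro order.trans[OF norm_triangle_ineq] add_mono t1 t2 t3 P2_le s a x inner_le X\<Theta>_le) auto
  then show ?thesis by (simp add: c0_def algebra_simps)
qed

lemma norm_generator_le:
  assumes s: "s \<in> {0..T}" and w: "w \<in> space M"
  shows "norm (generator_term s w) \<le> (4 + 3 * B0\<^sup>2) * L s w ^ 6"
proof -
  have s0: "s \<ge> 0" using s by simp
  note x = X_le[OF w s0] and a = a_le[OF w s0] and c = C_le[OF w s0] and c' = C'_le[OF w s0]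
  have t1: "norm (C' s w * of_real (X1 s w) * of_real (X2 s w) * of_real (X3 s w)) \<le> L s w ^ 6"
    using norm_mult_le[OF norm_mult_le[OF norm_mult_le[OF c' x(1)] x(2)] x(3)]
        L_power_mono[of 5 6 s w] unfolding L_times by simp
  have t2: "norm (C s w * of_real p * of_real q * of_real r) \<le> L s w ^ 6"
    if "\<bar>p\<bar> \<le> L s w" "\<bar>q\<bar> \<le> L s w" "\<bar>r\<bar> \<le> L s w" for p q r
    using norm_mult_le[OF norm_mult_le[OF norm_mult_le[OF c that(1)] that(2)] that(3)]
        L_power_mono[of 3 6 s w] by (simp add: eval_nat_numeral)
  have t3: "norm (of_real bb * (C s w * of_real q)) \<le> B0\<^sup>2 * L s w ^ 6"
    if "\<bar>bb\<bar> \<le> B0\<^sup>2" "\<bar>q\<bar> \<le> L s w" for bb q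
  proof -
    have "norm (of_real bb * (C s w * of_real q)) \<le> B0\<^sup>2 * (1 * L s w)"
      unfolding norm_mult[of "of_real bb"] norm_of_real by (intro mult_mono' that norm_mult_le c) auto
    also have "\<dots> \<le> B0\<^sup>2 * L s w ^ 6" using L_power_mono[of 1 6 s w] by (intro mult_left_mono) auto
    finally show ?thesis .
  qed
  have "norm (generator_term s w) \<le> L s w ^ 6 + (L s w ^ 6 +
    (L s w ^ 6 + (L s w ^ 6 + (B0\<^sup>2 * L s w ^ 6 + (B0\<^sup>2 * L s w ^ 6 + B0\<^sup>2 * L s w ^ 6)))))"
    unfolding generator_term_def
    by (intro order.trans[OF norm_triangle_ineq] add_mono t1 t2 t3 a x inner_le) auto
  then show ?thesis by (simp add: algebra_simps)
qed

lemma measurable_frozen: "(\<lambda>p. frozen_derivative (fst p) (snd p)) \<in> borel_measurable (time_measure T \<Otimes>\<^sub>M M)"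
  and measurable_generator: "(\<lambda>p. generator_term (fst p) (snd p)) \<in> borel_measurable (time_measure T \<Otimes>\<^sub>M M)"
proof -
  note j = ad[THEN continuous_adapted_joint_restrict[where T=T]] continuous_adapted_joint_restrict[OF W_adapted, where T=T]
  have [measurable]: "(\<lambda>p. W T (snd p)) \<in> borel_measurable (time_measure T \<Otimes>\<^sub>M M)"
    by (rule measurable_compose[OF measurable_snd continuous_adapted_measurable[OF W_adapted T]])
  have [measurable]: "(\<lambda>p. fst p) \<in> borel_measurable (time_measure T \<Otimes>\<^sub>M M)"
    by (rule measurable_compose[OF measurable_fst]) (auto intro: measurable_restrict_space1)
  note [measurable] = j
  have [measurable]: "(\<lambda>p. \<Theta> b (fst p) (snd p)) \<in> borel_measurable (time_measure T \<Otimes>\<^sub>M M)" for b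
    unfolding \<Theta>_def by measurable
  show "(\<lambda>p. generator_term (fst p) (snd p)) \<in> borel_measurable (time_measure T \<Otimes>\<^sub>M M)"
    unfolding generator_term_def by measurable
  show "(\<lambda>p. frozen_derivative (fst p) (snd p)) \<in> borel_measurable (time_measure T \<Otimes>\<^sub>M M)"
    unfolding frozen_derivative_def P3_def P2_def by measurable
qed

lemma integrable_generator: "integrable (time_measure T \<Otimes>\<^sub>M M) (\<lambda>p. generator_term (fst p) (snd p))"
proof (rule integrable_time_space[OF measurable_generator, where D="\<lambda>s w. (4 + 3 * B0\<^sup>2) * L s w ^ 6" and K="(4 + 3 * B0\<^sup>2) * K"])
  show "(\<integral>w. (4 + 3 * B0\<^sup>2) * L s w ^ 6 \<partial>M) \<le> (4 + 3 * B0\<^sup>2) * K" if "s \<in> {0..T}" for s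
    unfolding integral_mult_right_zero by (intro mult_left_mono L6 that) auto
qed (use L6(1) norm_generator_le in auto)

lemma integrable_frozen: "integrable (time_measure T \<Otimes>\<^sub>M M) (\<lambda>p. frozen_derivative (fst p) (snd p))"
proof -
  obtain D where D: "D \<ge> 0" "\<And>s t. 0 \<le> s \<Longrightarrow> s \<le> t \<Longrightarrow> integrable M (\<lambda>w. norm (W t w - W s w) ^ 6)"
     "\<And>s t. 0 \<le> s \<Longrightarrow> s \<le> t \<Longrightarrow> (\<integral>w. norm (W t w - W s w) ^ 6 \<partial>M) \<le> D * (t - s) ^ 3"
    using increment_norm_pow6 by blast
  have c0: "c0 \<ge> 0" using T by (simp add: c0_def)
  let ?D = "\<lambda>s w. c0 * (64 * (L s w ^ 6 + B0 ^ 6 * norm (W T w - W s w) ^ 6))"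
  show ?thesis
  proof (rule integrable_time_space[OF measurable_frozen, where D="?D" and K="c0 * (64 * (K + B0 ^ 6 * (D * T ^ 3)))"])
    fix s assume s: "s \<in> {0..T}"
    show "integrable M (?D s)" using L6(1)[OF s] D(2)[of s T] s by auto
    have "(\<integral>w. ?D s w \<partial>M) = c0 * (64 * ((\<integral>w. L s w ^ 6 \<partial>M) + B0 ^ 6 * (\<integral>w. norm (W T w - W s w) ^ 6 \<partial>M)))"
      using L6(1)[OF s] D(2)[of s T] s by simp
    also have "\<dots> \<le> c0 * (64 * (K + B0 ^ 6 * (D * T ^ 3)))"
    proof (intro mult_left_mono add_mono L6(2) s c0)
      have "(\<integral>w. norm (W T w - W s w) ^ 6 \<partial>M) \<le> D * (T - s) ^ 3" by (rule D(3)) (use s in auto)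
      also have "\<dots> \<le> D * T ^ 3" using s D(1) by (intro mult_left_mono power_mono) auto
      finally show "(\<integral>w. norm (W T w - W s w) ^ 6 \<partial>M) \<le> D * T ^ 3" .
    qed auto
    finally show "(\<integral>w. ?D s w \<partial>M) \<le> c0 * (64 * (K + B0 ^ 6 * (D * T ^ 3)))" .
    fix w assume w: "w \<in> space M"
    have "norm (frozen_derivative s w) \<le> c0 * R s w ^ 6" by (rule norm_frozen_le[OF s w])
    also have "\<dots> \<le> ?D s w"
      using add_pow6_le[of "L s w" "B0 * norm (W T w - W s w)"] L0[of s w] B0_nonneg c0
      by (intro mult_left_mono) (auto simp: R_def power_mult_distrib)
    finally show "norm (frozen_derivative (fst (s, w)) (snd (s, w))) \<le> ?D s w" by simp
  qed
qed

lemma frozen_FTC: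
  assumes w: "w \<in> space M"
  shows "(\<integral>s. frozen_derivative s w \<partial>time_measure T) = C T w * of_real (P3 T w) - C 0 w * of_real (P3 0 w)"
proof -
  have cont: "continuous_on {0..T} (\<lambda>s. Z s w)" if "continuous_adapted M F Z" for Z :: "real \<Rightarrow> 'w \<Rightarrow> 'b::topological_space"
    by (rule continuous_on_subset[OF continuous_adaptedD(2)[OF that w]]) auto
  have cont\<Theta>: "continuous_on {0..T} (\<lambda>s. \<Theta> b s w)" for b
    unfolding \<Theta>_def by (intro continuous_intros cont W_adapted)
  have dX: "((\<lambda>s. X s w + \<Theta> b s w) has_vector_derivative a s w) (at s within {0..T})"
    if X: "\<And>s w. w \<in> space M \<Longrightarrow> s \<ge> 0 \<Longrightarrow> X s w = X 0 w + integral {0..s} (\<lambda>r. a r w) + b \<bullet> (W s w - W 0 w)"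
      and ad: "continuous_adapted M F a" and s: "s \<in> {0..T}" for X a b s
  proof (rule has_vector_derivative_primitive[OF w, where z="X 0 w + b \<bullet> (W T w - W 0 w)"])
    show "X s w + \<Theta> b s w = X 0 w + b \<bullet> (W T w - W 0 w) + integral {0..s} (\<lambda>r. a r w)" if "s \<ge> 0" for s
      using X[OF w that] by (simp add: \<Theta>_def inner_diff_right)
  qed (use ad s in auto)
  have "((\<lambda>s. C s w * of_real (P3 s w)) has_vector_derivative frozen_derivative s w) (at s within {0..T})"
    if s: "s \<in> {0..T}" for s
  proof -
    have dC: "((\<lambda>s. C s w) has_vector_derivative C' s w) (at s within {0..T})"
      by (rule has_vector_derivative_primitive[OF w ad(2) C[OF w] s])
    note x1 = dX[OF X(1) ad(6) s] and x2 = dX[OF X(2) ad(7) s] and x3 = dX[OF X(3) ad(8) s]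
    have "((\<lambda>s. C s w * of_real (P3 s w)) has_vector_derivative
       C s w * of_real ((((X1 s w + \<Theta> b1 s w) * (X2 s w + \<Theta> b2 s w)) * a3 s w
         + ((X1 s w + \<Theta> b1 s w) * a2 s w + a1 s w * (X2 s w + \<Theta> b2 s w)) * (X3 s w + \<Theta> b3 s w))
         - ((T - s) * ((b1 \<bullet> b2) * a3 s w + (b1 \<bullet> b3) * a2 s w + (b2 \<bullet> b3) * a1 s w)
           + (0 - 1) * ((b1 \<bullet> b2) * (X3 s w + \<Theta> b3 s w) + (b1 \<bullet> b3) * (X2 s w + \<Theta> b2 s w) + (b2 \<bullet> b3) * (X1 s w + \<Theta> b1 s w))))
       + C' s w * of_real (P3 s w)) (at s within {0..T})"
      unfolding P3_def
      by (intro has_vector_derivative_mult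
          has_vector_derivative_of_real[OF has_real_derivative_iff_has_vector_derivative[THEN iffD2]] has_vector_derivative_diff
          has_vector_derivative_add has_vector_derivative_mult_right x1 x2 x3 has_vector_derivative_const
          has_vector_derivative_id dC)
    then show ?thesis
      by (rule has_vector_derivative_eq_rhs) (simp add: frozen_derivative_def P2_def algebra_simps)
  qed
  moreover have "continuous_on {0..T} (\<lambda>s. frozen_derivative s w)"
    unfolding frozen_derivative_def P3_def P2_def by (intro continuous_intros cont\<Theta> cont ad)
  ultimately show ?thesis
    using integral_FTC_Icc[OF T, of "\<lambda>s. C s w * of_real (P3 s w)" "\<lambda>s. frozen_derivative s w"]
    by (subst integral_restrict_space) auto
qed

theorem dynkin_formula:
  "(\<integral>p. generator_term (fst p) (snd p) \<partial>(time_measure T \<Otimes>\<^sub>M M)) =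
    (\<integral>w. C T w * of_real (X1 T w) * of_real (X2 T w) * of_real (X3 T w) \<partial>M)
    - (\<integral>w. C 0 w * of_real (X1 0 w) * of_real (X2 0 w) * of_real (X3 0 w) \<partial>M)"
proof -
  interpret T: finite_measure "time_measure T" by (rule finite_measure_time)
  interpret P: pair_sigma_finite "time_measure T" M ..
  have CP: "has_bochner_integral M (\<lambda>w. C s w * of_real (P3 s w))
    (\<integral>w. C s w * of_real (X1 s w) * of_real (X2 s w) * of_real (X3 s w) \<partial>M)" if s: "s \<in> {0..T}" for s
  proof (rule expectation3[OF s])
    show "C s \<in> borel_measurable (F s)" by (rule continuous_adaptedD(1)[OF ad(1)]) (use s in auto)
    show "norm (C s w) \<le> (L s w)\<^sup>2" if "w \<in> space M" for w
      using C_le[OF that, of s] s one_le_power[OF L1[of s w], of 2] by auto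
  qed
  have "(\<integral>p. generator_term (fst p) (snd p) \<partial>(time_measure T \<Otimes>\<^sub>M M)) = (\<integral>s. \<integral>w. generator_term s w \<partial>M \<partial>time_measure T)"
    using P.integral_fst'[OF integrable_generator] by simp
  also have "\<dots> = (\<integral>s. \<integral>w. frozen_derivative s w \<partial>M \<partial>time_measure T)"
    by (rule Bochner_Integration.integral_cong[OF refl])
       (auto simp: space_restrict_space has_bochner_integral_integral_eq[OF has_bochner_integral_frozen])
  also have "\<dots> = (\<integral>w. \<integral>s. frozen_derivative s w \<partial>time_measure T \<partial>M)"
    by (rule P.Fubini_integral[symmetric]) (use integrable_frozen in \<open>simp add: split_def\<close>)
  also have "\<dots> = (\<integral>w. C T w * of_real (P3 T w) - C 0 w * of_real (P3 0 w) \<partial>M)"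
    by (intro Bochner_Integration.integral_cong refl frozen_FTC)
  also have "\<dots> = (\<integral>w. C T w * of_real (X1 T w) * of_real (X2 T w) * of_real (X3 T w) \<partial>M)
    - (\<integral>w. C 0 w * of_real (X1 0 w) * of_real (X2 0 w) * of_real (X3 0 w) \<partial>M)"
    using CP[of T] CP[of 0] T by (auto simp: has_bochner_integral_iff)
  finally show ?thesis .
qed

end

section \<open>The Ornstein--Uhlenbeck process\<close>

lemma integral_exp_backward_le:
  fixes t :: real
  assumes "\<mu> > 0" "t \<ge> 0"
  shows "((\<lambda>s. exp (- \<mu> * (t - s))) has_integral (1 - exp (- \<mu> * t)) / \<mu>) {0..t}"
proof -
  have "((\<lambda>s. exp (- \<mu> * (t - s))) has_integral (exp (- \<mu> * (t - t)) / \<mu> - exp (- \<mu> * (t - 0)) / \<mu>)) {0..t}"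
    using assms
    by (intro fundamental_theorem_of_calculus)
       (auto intro!: derivative_eq_intros simp: has_real_derivative_iff_has_vector_derivative[symmetric])
  then show ?thesis by (simp add: diff_divide_distrib)
qed

lemma integrable_time:
  fixes f :: "real \<Rightarrow> 'b::euclidean_space"
  assumes "continuous_on {0..t} f"
  shows "integrable (time_measure t) f"
  using borel_integrable_atLeastAtMost'[OF assms]
  by (subst integrable_restrict_space) (auto simp: set_integrable_def)

lemma lebesgue_integral_time:
  fixes f :: "real \<Rightarrow> 'b::euclidean_space"
  assumes "continuous_on {0..t} f"
  shows "(\<integral>s. f s \<partial>time_measure t) = integral {0..t} f"
  using set_borel_integral_eq_integral(2)[OF borel_integrable_atLeastAtMost'[OF assms]]
  by (subst integral_restrict_space) (auto simp: set_lebesgue_integral_def)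

text \<open>Convexity of the sixth power in the form of a tangent inequality, certified by an
  explicit factorisation with positive coefficients.\<close>

lemma power6_tangent:
  fixes y m :: real
  assumes "y \<ge> 0" "m \<ge> 0"
  shows "y ^ 6 \<ge> m ^ 6 + 6 * m ^ 5 * (y - m)"
proof -
  have "y ^ 6 - m ^ 6 - 6 * m ^ 5 * (y - m) = (y - m)\<^sup>2 * (y ^ 4 + 2 * y ^ 3 * m + 3 * y\<^sup>2 * m\<^sup>2 + 4 * y * m ^ 3 + 5 * m ^ 4)"
    by (simp add: power_numeral_reduce algebra_simps)
  also have "\<dots> \<ge> 0" using assms by simp
  finally show ?thesis by simp
qed

text \<open>Jensen's inequality for an unnormalised weight: the tangent inequality at the weighted
  mean \<open>m = Q / I\<close>, integrated against \<open>k\<close>; the linear term drops out. The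
  factor \<open>B ^ 5\<close> restores the normalisation.\<close>

lemma integral_pow6_jensen:
  fixes k f :: "real \<Rightarrow> real"
  assumes k: "continuous_on {0..t} k" "\<And>s. s \<in> {0..t} \<Longrightarrow> k s \<ge> 0" "integral {0..t} k \<le> B"
    and f: "continuous_on {0..t} f" "\<And>s. s \<in> {0..t} \<Longrightarrow> f s \<ge> 0"
  shows "(integral {0..t} (\<lambda>s. k s * f s)) ^ 6 \<le> B ^ 5 * integral {0..t} (\<lambda>s. k s * f s ^ 6)"
proof -
  define I where "I = integral {0..t} k"
  define Q where "Q = integral {0..t} (\<lambda>s. k s * f s)"
  have ik: "k integrable_on {0..t}" and ikf: "(\<lambda>s. k s * f s) integrable_on {0..t}"
    and ikf6: "(\<lambda>s. k s * f s ^ 6) integrable_on {0..t}"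
    by (intro integrable_continuous_real continuous_intros k f)+
  have I0: "I \<ge> 0" unfolding I_def by (rule Henstock_Kurzweil_Integration.integral_nonneg[OF ik k(2)])
  have Q0: "Q \<ge> 0" unfolding Q_def by (rule Henstock_Kurzweil_Integration.integral_nonneg[OF ikf]) (use k f in auto)
  have Q6: "integral {0..t} (\<lambda>s. k s * f s ^ 6) \<ge> 0"
    by (rule Henstock_Kurzweil_Integration.integral_nonneg[OF ikf6]) (use k f in auto)
  have "Q ^ 6 \<le> I ^ 5 * integral {0..t} (\<lambda>s. k s * f s ^ 6)"
  proof (cases "I = 0")
    \<comment> \<open>With no total weight there is no mean; but \<open>f\<close> is bounded on the
      compact interval, so \<open>Q\<close> vanishes too.\<close>
    case True
    have "bounded (f ` {0..t})" by (intro compact_imp_bounded compact_continuous_image f) auto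
    then obtain C where C: "\<forall>s\<in>{0..t}. \<bar>f s\<bar> \<le> C" by (auto simp: bounded_iff)
    have "Q \<le> integral {0..t} (\<lambda>s. C * k s)"
      unfolding Q_def
    proof (rule integral_le[OF ikf])
      show "(\<lambda>s. C * k s) integrable_on {0..t}" using ik by (rule integrable_on_mult_right)
      fix s assume s: "s \<in> {0..t}"
      have "f s \<le> C" using C s by (meson abs_le_D1)
      then show "k s * f s \<le> C * k s" using mult_left_mono[OF _ k(2)[OF s]] by (simp add: mult.commute)
    qed
    then have "Q = 0" using True Q0 by (simp add: I_def)
    then show ?thesis using True by simp
  next
    case False
    with I0 have I: "I > 0" by simp
    define m where "m = Q / I"
    have m0: "m \<ge> 0" using Q0 I by (simp add: m_def)
    have "integral {0..t} (\<lambda>s. m ^ 6 * k s + 6 * m ^ 5 * (k s * f s - m * k s)) \<le> integral {0..t} (\<lambda>s. k s * f s ^ 6)"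
    proof (rule integral_le[OF _ ikf6])
      show "(\<lambda>s. m ^ 6 * k s + 6 * m ^ 5 * (k s * f s - m * k s)) integrable_on {0..t}"
        by (intro integrable_continuous_real continuous_intros k f)
      show "m ^ 6 * k s + 6 * m ^ 5 * (k s * f s - m * k s) \<le> k s * f s ^ 6" if "s \<in> {0..t}" for s
        using mult_left_mono[OF power6_tangent[OF f(2)[OF that] m0] k(2)[OF that]] by (simp add: algebra_simps)
    qed
    also have "integral {0..t} (\<lambda>s. m ^ 6 * k s + 6 * m ^ 5 * (k s * f s - m * k s)) = m ^ 6 * I + 6 * m ^ 5 * (Q - m * I)"
      unfolding I_def Q_def using ik ikf
      by (simp add: Henstock_Kurzweil_Integration.integral_add Henstock_Kurzweil_Integration.integral_diff
          integrable_diff integrable_on_mult_right)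
    also have "\<dots> = m ^ 6 * I" using I by (simp add: m_def)
    finally have "m ^ 6 * I \<le> integral {0..t} (\<lambda>s. k s * f s ^ 6)" .
    then have "I ^ 5 * (m ^ 6 * I) \<le> I ^ 5 * integral {0..t} (\<lambda>s. k s * f s ^ 6)"
      using I by (intro mult_left_mono) auto
    moreover have "I ^ 5 * (m ^ 6 * I) = Q ^ 6"
      using I by (simp add: m_def power_divide eval_nat_numeral)
    ultimately show ?thesis by simp
  qed
  also have "\<dots> \<le> B ^ 5 * integral {0..t} (\<lambda>s. k s * f s ^ 6)"
    using k(3) I0 Q6 by (intro mult_right_mono power_mono) (auto simp: I_def)
  finally show ?thesis by (simp add: Q_def)
qed

text \<open>The sixth moment of an increment grows like the cube of its length; half of the
  exponential rate pays for this growth. The constant is the cube of 6, from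
  \<open>x \<le> exp x\<close> at \<open>x = \<mu> r / 6\<close>.\<close>

lemma cube_exp_le:
  fixes \<mu> r :: real
  assumes "\<mu> > 0" "r \<ge> 0"
  shows "r ^ 3 * exp (- \<mu> * r) \<le> 216 / \<mu> ^ 3 * exp (- (\<mu> / 2) * r)"
proof -
  have "(\<mu> * r / 6) ^ 3 \<le> exp (\<mu> * r / 6) ^ 3"
  proof (intro power_mono)
    show "\<mu> * r / 6 \<le> exp (\<mu> * r / 6)" using exp_ge_add_one_self[of "\<mu> * r / 6"] by linarith
  qed (use assms in simp)
  also have "\<dots> = exp (\<mu> * r / 2)" by (simp add: exp_of_nat_mult[symmetric])
  finally have "r ^ 3 \<le> 216 / \<mu> ^ 3 * exp (\<mu> * r / 2)"
    using assms by (simp add: field_simps)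
  then have "r ^ 3 * exp (- \<mu> * r) \<le> 216 / \<mu> ^ 3 * exp (\<mu> * r / 2) * exp (- \<mu> * r)"
    by (intro mult_right_mono) auto
  also have "\<dots> = 216 / \<mu> ^ 3 * exp (- (\<mu> / 2) * r)"
    by (simp add: exp_add[symmetric] mult.assoc)
  finally show ?thesis .
qed

section \<open>Construction of the Ornstein-Uhlenbeck process started at 0\<close>

context brownian
begin

lemma continuous_adapted_increment: "continuous_adapted M F (\<lambda>s w. W s w - W 0 w)"
  unfolding continuous_adapted_def
proof (intro conjI allI impI ballI)
  show "(\<lambda>w. W t w - W 0 w) \<in> borel_measurable (F t)" if "t \<ge> 0" for t
    using measurable_W[OF that] measurable_F_mono[OF measurable_W[of 0] that] by simp
  show "continuous_on {0..} (\<lambda>t. W t w - W 0 w)" if "w \<in> space M" for w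
    by (intro continuous_intros continuous_adaptedD(2)[OF W_adapted that])
qed

text \<open>The noise is additive, so the difference \<open>U\<close> of the process and its noise
  \<open>N\<close> solves the ordinary equation U' = A (U + N) on each path.\<close>

lemma ornstein_uhlenbeck_exists:
  fixes A :: "real^'n^'n" and \<beta> :: "'n \<Rightarrow> real^'m"
  shows "\<exists>u. continuous_adapted M F u \<and> (\<forall>w\<in>space M. \<forall>t\<ge>0. \<forall>i.
    u t w $ i = integral {0..t} (\<lambda>s. \<Sum>l\<in>UNIV. A $ i $ l * u s w $ l) + \<beta> i \<bullet> (W t w - W 0 w))"
proof -
  define N where "N s w = (\<chi> i. \<beta> i \<bullet> (W s w - W 0 w))" for s w
  have N: "continuous_adapted M F N"
    unfolding N_def[abs_def]
    by (rule continuous_adapted_compose[OF continuous_adapted_increment, where g="\<lambda>x. \<chi> i. \<beta> i \<bullet> x"])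
       (intro continuous_intros)
  have lin: "bounded_linear ((*v) A)" by (rule matrix_vector_mul_bounded_linear)
  obtain L where L: "\<And>x. norm (A *v x) \<le> norm x * L" "L > 0" using bounded_linear.pos_bounded[OF lin] by blast
  have cA: "continuous_on UNIV ((*v) A)" by (rule linear_continuous_on[OF lin])
  obtain U where U: "continuous_adapted M F U" "\<forall>w\<in>space M. \<forall>t\<ge>0. U t w = 0 + integral {0..t} (\<lambda>s. A *v (U s w + N s w))"
  proof (rule exE[OF picard_solution[of "\<lambda>s w x. A *v (x + N s w)" 0]])
    show "continuous_adapted M F (\<lambda>s w. A *v (X s w + N s w))" if "continuous_adapted M F X" for X
      by (rule continuous_adapted_compose[OF continuous_adapted_add[OF that N] cA])
    show "\<exists>L\<ge>0. \<forall>s\<in>{0..T}. \<forall>x y. norm (A *v (x + N s w) - A *v (y + N s w)) \<le> L * norm (x - y)" for w T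
    proof (intro exI[of _ L] conjI ballI allI)
      show "norm (A *v (x + N s w) - A *v (y + N s w)) \<le> L * norm (x - y)" for s x y
        using L(1)[of "x - y"] by (simp add: matrix_vector_mult_diff_distrib[symmetric] mult.commute)
    qed (use L in simp)
  qed blast
  define u where "u t w = U t w + N t w" for t w
  have u: "continuous_adapted M F u" unfolding u_def[abs_def] by (intro continuous_adapted_add U N)
  have "u t w $ i = integral {0..t} (\<lambda>s. \<Sum>l\<in>UNIV. A $ i $ l * u s w $ l) + \<beta> i \<bullet> (W t w - W 0 w)"
    if w: "w \<in> space M" and t: "t \<ge> 0" for w t i
  proof -
    have int: "(\<lambda>s. A *v u s w) integrable_on {0..t}"
      by (intro integrable_continuous_real continuous_on_subset[OF continuous_adaptedD(2)[OF continuous_adapted_compose[OF u cA] w]]) auto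
    have "U t w = integral {0..t} (\<lambda>s. A *v u s w)" using U(2) w t by (simp add: u_def)
    then have "U t w $ i = integral {0..t} (\<lambda>s. (A *v u s w) $ i)"
      by (simp add: integral_component_eq_cart[OF int])
    then show ?thesis by (simp add: u_def N_def matrix_vector_mult_def)
  qed
  with u show ?thesis by blast
qed

end

locale ou_process = brownian M F W for M :: "'w measure" and F and W :: "real \<Rightarrow> 'w \<Rightarrow> real^'m" +
  fixes A :: "real^'n^'n" and \<beta> :: "'n \<Rightarrow> real^'m" and u :: "real \<Rightarrow> 'w \<Rightarrow> real^'n"
  assumes stable: "\<And>z. complex_eigenvalue A z \<Longrightarrow> Re z < 0"
    and u_adapted: "continuous_adapted M F u"
    and u_eq: "\<And>w t i. w \<in> space M \<Longrightarrow> t \<ge> 0 \<Longrightarrow>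
      u t w $ i = integral {0..t} (\<lambda>s. \<Sum>l\<in>UNIV. A $ i $ l * u s w $ l) + \<beta> i \<bullet> (W t w - W 0 w)"
begin

lemma u_component_adapted: "continuous_adapted M F (\<lambda>t w. u t w $ i)"
  by (rule continuous_adapted_compose[OF u_adapted]) (intro continuous_intros)

text \<open>Variation of constants with the noise integrated by parts against \<open>W s - W t\<close> instead of \<open>W s\<close>:
  this keeps the bound uniform in \<open>t\<close>.\<close>

lemma u_bound:
  "\<exists>C \<mu>. C > 0 \<and> \<mu> > 0 \<and> (\<forall>w\<in>space M. \<forall>t\<ge>0. \<forall>i. \<bar>u t w $ i\<bar> \<le>
    C * exp (- \<mu> * t) * norm (W t w - W 0 w) + integral {0..t} (\<lambda>s. C * exp (- \<mu> * (t - s)) * norm (W t w - W s w)))"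
proof -
  obtain C \<mu> where C: "C > 0" "\<mu> > 0" "\<And>i j t. t \<ge> 0 \<Longrightarrow> \<bar>matrix_exp (t *\<^sub>R A) $ i $ j\<bar> \<le> C * exp (- \<mu> * t)"
    using matrix_exp_decay[OF stable] by blast
  define B1 where "B1 = (\<Sum>j\<in>UNIV. norm (\<beta> j))"
  define B2 where "B2 = (\<Sum>j\<in>UNIV. \<Sum>l\<in>UNIV. \<bar>A $ j $ l\<bar> * norm (\<beta> l))"
  have B: "B1 \<ge> 0" "B2 \<ge> 0" by (simp_all add: B1_def B2_def sum_nonneg)
  define C1 where "C1 = C * (B1 + B2 + 1)"
  have C1: "C1 > 0" "C * B1 \<le> C1" "C * B2 \<le> C1"     using C(1) B mult_nonneg_nonneg[of C B1] mult_nonneg_nonneg[of C B2]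
    by (simp_all add: C1_def distrib_left add_nonneg_pos del: mult_nonneg_nonneg)
  have "\<bar>u t w $ i\<bar> \<le> C1 * exp (- \<mu> * t) * norm (W t w - W 0 w) +
      integral {0..t} (\<lambda>s. C1 * exp (- \<mu> * (t - s)) * norm (W t w - W s w))"
    if w: "w \<in> space M" and t: "t \<ge> 0" for w t i
  proof -
    let ?S = "\<lambda>r i j. matrix_exp (r *\<^sub>R A) $ i $ j"
    let ?v = "\<lambda>s l. u s w $ l - \<beta> l \<bullet> (W s w - W t w)"
    have cW: "continuous_on {0..t} (\<lambda>s. W s w)"
      by (rule continuous_on_subset[OF continuous_adaptedD(2)[OF W_adapted w]]) auto
    have ad: "continuous_adapted M F (\<lambda>s w. \<Sum>l\<in>UNIV. A $ j $ l * u s w $ l)" for j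
      by (intro continuous_adapted_sum continuous_adapted_mult continuous_adapted_const u_component_adapted)
    have v': "((\<lambda>s. ?v s j) has_vector_derivative (\<Sum>l\<in>UNIV. A $ j $ l * u s w $ l)) (at s within {0..t})"
      if s: "s \<in> {0..t}" for s j
    proof (rule has_vector_derivative_primitive[OF w ad _ s])
      show "?v s j = \<beta> j \<bullet> (W t w - W 0 w) + integral {0..s} (\<lambda>r. \<Sum>l\<in>UNIV. A $ j $ l * u r w $ l)" if "s \<ge> 0" for s
        using u_eq[OF w that, of j] by (simp add: inner_diff_right)
    qed
    \<comment> \<open>Interpolates along the flow: \<open>y t\<close> is \<open>u t\<close>, since
      the noise term of \<open>?v\<close> vanishes at \<open>s = t\<close>, and in the derivative
      all terms with \<open>u\<close> cancel, leaving only noise increments against a decaying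
      kernel.\<close>
    define y where "y s = (\<Sum>j\<in>UNIV. ?S (t - s) i j * ?v s j)" for s
    define y' where "y' s = (\<Sum>j\<in>UNIV. ?S (t - s) i j * (\<Sum>l\<in>UNIV. A $ j $ l * (\<beta> l \<bullet> (W s w - W t w))))" for s
    have S': "((\<lambda>s. ?S (t - s) i j) has_vector_derivative - (\<Sum>l\<in>UNIV. ?S (t - s) i l * A $ l $ j)) (at s within {0..t})" for s j
    proof -
      have "((\<lambda>s. ?S (t - s) i j) has_field_derivative (\<Sum>l\<in>UNIV. ?S (t - s) i l * A $ l $ j) * (- 1)) (at s)"
        by (rule DERIV_chain2[OF has_field_derivative_matrix_exp2]) (auto intro!: derivative_eq_intros)
      then show ?thesis
        by (auto simp: has_real_derivative_iff_has_vector_derivative[symmetric] intro: has_field_derivative_at_within)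
    qed
    have dy: "(y has_vector_derivative y' s) (at s within {0..t})" if s: "s \<in> {0..t}" for s
    proof -
      have "(y has_vector_derivative (\<Sum>j\<in>UNIV. ?S (t - s) i j * (\<Sum>l\<in>UNIV. A $ j $ l * u s w $ l) +
          - (\<Sum>l\<in>UNIV. ?S (t - s) i l * A $ l $ j) * ?v s j)) (at s within {0..t})"
        unfolding y_def by (intro has_vector_derivative_sum has_vector_derivative_mult S' v' s)
      also have "(\<Sum>j\<in>UNIV. ?S (t - s) i j * (\<Sum>l\<in>UNIV. A $ j $ l * u s w $ l) +
          - (\<Sum>l\<in>UNIV. ?S (t - s) i l * A $ l $ j) * ?v s j) =
          (\<Sum>j\<in>UNIV. ?S (t - s) i j * (\<Sum>l\<in>UNIV. A $ j $ l * u s w $ l)) -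
          (\<Sum>j\<in>UNIV. (\<Sum>l\<in>UNIV. ?S (t - s) i l * A $ l $ j) * ?v s j)"
        by (simp add: sum_subtractf)
      also have "(\<Sum>j\<in>UNIV. (\<Sum>l\<in>UNIV. ?S (t - s) i l * A $ l $ j) * ?v s j) =
          (\<Sum>l\<in>UNIV. ?S (t - s) i l * (\<Sum>j\<in>UNIV. A $ l $ j * ?v s j))"
        unfolding sum_distrib_left sum_distrib_right mult.assoc by (rule sum.swap)
      also have "(\<Sum>j\<in>UNIV. ?S (t - s) i j * (\<Sum>l\<in>UNIV. A $ j $ l * u s w $ l)) -
          (\<Sum>l\<in>UNIV. ?S (t - s) i l * (\<Sum>j\<in>UNIV. A $ l $ j * ?v s j)) = y' s"
        unfolding y'_def by (simp add: sum_subtractf[symmetric] right_diff_distrib[symmetric])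
      finally show ?thesis .
    qed
    have cy': "continuous_on {0..t} y'"
      unfolding y'_def
      by (intro continuous_intros cW continuous_on_compose2[OF continuous_on_matrix_exp_entry[of UNIV A]]) auto
    have "(y' has_integral y t - y 0) {0..t}" by (rule fundamental_theorem_of_calculus[OF t dy])
    then have yt: "y t = y 0 + integral {0..t} y'" by (simp add: integral_unique)
    have "y t = (\<Sum>j\<in>UNIV. of_bool (i = j) * ?v t j)" by (simp add: y_def mat_def of_bool_def)
    then have ut: "y t = u t w $ i" by (simp only: sum_of_bool_left) simp
    have "\<bar>y 0\<bar> \<le> (\<Sum>j\<in>UNIV. (C * exp (- \<mu> * t)) * (norm (\<beta> j) * norm (W t w - W 0 w)))"
    proof -
      have "?v 0 j = \<beta> j \<bullet> (W t w - W 0 w)" for j using u_eq[OF w order_refl, of j] by (simp add: inner_diff_right)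
      then have "y 0 = (\<Sum>j\<in>UNIV. ?S t i j * (\<beta> j \<bullet> (W t w - W 0 w)))" by (simp add: y_def)
      also have "\<bar>\<dots>\<bar> \<le> (\<Sum>j\<in>UNIV. (C * exp (- \<mu> * t)) * (norm (\<beta> j) * norm (W t w - W 0 w)))"
        by (intro order.trans[OF sum_abs sum_mono] order.trans[OF eq_refl[OF abs_mult] mult_mono'] C t Cauchy_Schwarz_ineq2) auto
      finally show ?thesis .
    qed
    also have "\<dots> = C * B1 * (exp (- \<mu> * t) * norm (W t w - W 0 w))"
      by (simp add: B1_def sum_distrib_left sum_distrib_right mult_ac)
    also have "\<dots> \<le> C1 * (exp (- \<mu> * t) * norm (W t w - W 0 w))"
      by (intro mult_right_mono C1) auto
    finally have b1: "\<bar>y 0\<bar> \<le> C1 * exp (- \<mu> * t) * norm (W t w - W 0 w)" by (simp add: mult.assoc)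
    have b2: "norm (integral {0..t} y') \<le> integral {0..t} (\<lambda>s. C1 * exp (- \<mu> * (t - s)) * norm (W t w - W s w))"
    proof (rule integral_norm_bound_integral)
      show "y' integrable_on {0..t}" by (rule integrable_continuous_real[OF cy'])
      show "(\<lambda>s. C1 * exp (- \<mu> * (t - s)) * norm (W t w - W s w)) integrable_on {0..t}"
        by (intro integrable_continuous_real continuous_intros cW)
      fix s assume s: "s \<in> {0..t}"
      have "\<bar>y' s\<bar> \<le> (\<Sum>j\<in>UNIV. (C * exp (- \<mu> * (t - s))) * (\<Sum>l\<in>UNIV. \<bar>A $ j $ l\<bar> * (norm (\<beta> l) * norm (W s w - W t w))))"
        unfolding y'_def
        by (intro order.trans[OF sum_abs sum_mono] order.trans[OF eq_refl[OF abs_mult] mult_mono'] C Cauchy_Schwarz_ineq2)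
           (use s in auto)
      also have "\<dots> = C * B2 * (exp (- \<mu> * (t - s)) * norm (W t w - W s w))"
        by (simp add: B2_def sum_distrib_left sum_distrib_right mult_ac norm_minus_commute)
      also have "\<dots> \<le> C1 * (exp (- \<mu> * (t - s)) * norm (W t w - W s w))"
        by (intro mult_right_mono C1) auto
      finally show "norm (y' s) \<le> C1 * exp (- \<mu> * (t - s)) * norm (W t w - W s w)" by (simp add: mult.assoc)
    qed
    show ?thesis using yt ut b1 b2 by simp
  qed
  with C1(1) C(2) show ?thesis by blast
qed

text \<open>The sixth power of the kernel integral in \<open>u_bound\<close> is handled by Jensen's
  inequality with the kernel as weight; the growth of the moments of the increments is absorbed by
  the decay, which makes the bound independent of \<open>t\<close>.\<close>

lemma u_moment:
  "\<exists>K\<ge>0. \<forall>t\<ge>0. integrable M (\<lambda>w. (1 + (\<Sum>i\<in>UNIV. \<bar>u t w $ i\<bar>)) ^ 6) \<and>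
     (\<integral>w. (1 + (\<Sum>i\<in>UNIV. \<bar>u t w $ i\<bar>)) ^ 6 \<partial>M) \<le> K"
proof -
  obtain C \<mu> where C: "C > 0" "\<mu> > 0" and ub: "\<And>w t i. w \<in> space M \<Longrightarrow> t \<ge> 0 \<Longrightarrow> \<bar>u t w $ i\<bar> \<le>
    C * exp (- \<mu> * t) * norm (W t w - W 0 w) + integral {0..t} (\<lambda>s. C * exp (- \<mu> * (t - s)) * norm (W t w - W s w))"
    using u_bound by blast
  obtain D where D: "D \<ge> 0" "\<And>s t. 0 \<le> s \<Longrightarrow> s \<le> t \<Longrightarrow> integrable M (\<lambda>w. norm (W t w - W s w) ^ 6)"
     "\<And>s t. 0 \<le> s \<Longrightarrow> s \<le> t \<Longrightarrow> (\<integral>w. norm (W t w - W s w) ^ 6 \<partial>M) \<le> D * (t - s) ^ 3"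
    using increment_norm_pow6 by blast
  define c where "c = 216 / \<mu> ^ 3"
  have c: "c \<ge> 0" using C by (simp add: c_def)
  define B where "B = C / \<mu>"
  have B: "B \<ge> 0" using C by (simp add: B_def)
  \<comment> \<open>The first summand bounds the boundary term of \<open>u_bound\<close>, the second
    the integral term, where \<open>2 / \<mu>\<close> bounds the integral of the halved exponential;
    64 comes from splitting the sixth power of a sum.\<close>
  define K1 where "K1 = 64 * (C ^ 6 * (D * c) + B ^ 5 * (C * (D * (c * (2 / \<mu>)))))"
  have K1: "K1 \<ge> 0" using C D c B by (simp add: K1_def)
  let ?n = "real CARD('n)"
  define K where "K = 64 * (1 + ?n ^ 6 * (?n * K1))"
  have meas: "(\<lambda>w. u t w $ i) \<in> borel_measurable M" if "t \<ge> 0" for t i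
    by (rule continuous_adapted_measurable[OF u_component_adapted that])
  have comp: "integrable M (\<lambda>w. \<bar>u t w $ i\<bar> ^ 6) \<and> (\<integral>w. \<bar>u t w $ i\<bar> ^ 6 \<partial>M) \<le> K1" if t: "t \<ge> 0" for t i
  proof -
    interpret T: finite_measure "time_measure t" by (rule finite_measure_time)
    interpret P: pair_sigma_finite "time_measure t" M ..
    define g where "g s w = C * exp (- \<mu> * (t - s)) * norm (W t w - W s w) ^ 6" for s w
    have Eg: "integrable M (g s)" "(\<integral>w. g s w \<partial>M) \<le> C * (D * (c * exp (- (\<mu> / 2) * (t - s))))" if s: "s \<in> {0..t}" for s
    proof -
      show "integrable M (g s)" unfolding g_def using D(2)[of s t] s by auto
      have "(\<integral>w. g s w \<partial>M) = C * exp (- \<mu> * (t - s)) * (\<integral>w. norm (W t w - W s w) ^ 6 \<partial>M)" by (simp add: g_def)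
      also have "\<dots> \<le> C * exp (- \<mu> * (t - s)) * (D * (t - s) ^ 3)" using D(3)[of s t] s C by (intro mult_left_mono) auto
      also have "\<dots> = C * (D * ((t - s) ^ 3 * exp (- \<mu> * (t - s))))" by simp
      also have "\<dots> \<le> C * (D * (c * exp (- (\<mu> / 2) * (t - s))))"
        using cube_exp_le[OF C(2), of "t - s"] s C D(1) unfolding c_def by (intro mult_left_mono) auto
      finally show "(\<integral>w. g s w \<partial>M) \<le> C * (D * (c * exp (- (\<mu> / 2) * (t - s))))" .
    qed
    have mg: "(\<lambda>p. g (fst p) (snd p)) \<in> borel_measurable (time_measure t \<Otimes>\<^sub>M M)"
    proof -
      note [measurable] = continuous_adapted_joint_restrict[OF W_adapted, where T=t]
      have [measurable]: "(\<lambda>p. W t (snd p)) \<in> borel_measurable (time_measure t \<Otimes>\<^sub>M M)"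
        by (rule measurable_compose[OF measurable_snd continuous_adapted_measurable[OF W_adapted t]])
      have [measurable]: "(\<lambda>p. fst p) \<in> borel_measurable (time_measure t \<Otimes>\<^sub>M M)"
        by (rule measurable_compose[OF measurable_fst]) (auto intro: measurable_restrict_space1)
      show ?thesis unfolding g_def by measurable
    qed
    have g0: "g s w \<ge> 0" for s w using C by (simp add: g_def)
    have ig: "integrable (time_measure t \<Otimes>\<^sub>M M) (\<lambda>p. g (fst p) (snd p))"
    proof (rule integrable_time_space[OF mg, where D=g and K="C * (D * c)"])
      fix s assume s: "s \<in> {0..t}"
      have "exp (- (\<mu> / 2) * (t - s)) \<le> 1" using C s by simp
      then have "C * (D * (c * exp (- (\<mu> / 2) * (t - s)))) \<le> C * (D * (c * 1))"
        using C D(1) c by (intro mult_left_mono) auto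
      with Eg(2)[OF s] show "(\<integral>w. g s w \<partial>M) \<le> C * (D * c)" by simp
    qed (use Eg(1) g0 in auto)
    have i2: "integrable M (\<lambda>w. \<integral>s. g s w \<partial>time_measure t)"
      using P.integrable_snd[of g] ig by (simp add: split_def)
    have E2: "(\<integral>w. (\<integral>s. g s w \<partial>time_measure t) \<partial>M) \<le> C * (D * (c * (2 / \<mu>)))"
    proof -
      have "(\<integral>w. (\<integral>s. g s w \<partial>time_measure t) \<partial>M) = (\<integral>s. (\<integral>w. g s w \<partial>M) \<partial>time_measure t)"
        using P.Fubini_integral[of g] ig by (simp add: split_def)
      also have "\<dots> \<le> (\<integral>s. C * (D * (c * exp (- (\<mu> / 2) * (t - s)))) \<partial>time_measure t)"
      proof (rule integral_mono')
        show "integrable (time_measure t) (\<lambda>s. C * (D * (c * exp (- (\<mu> / 2) * (t - s)))))"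
          by (intro integrable_time continuous_intros)
        show "(\<integral>w. g s w \<partial>M) \<le> C * (D * (c * exp (- (\<mu> / 2) * (t - s))))" if "s \<in> space (time_measure t)" for s
          by (rule Eg(2)) (use that in \<open>simp add: space_restrict_space\<close>)
        show "0 \<le> C * (D * (c * exp (- (\<mu> / 2) * (t - s))))" for s using C D(1) c by simp
      qed
      also have "\<dots> = integral {0..t} (\<lambda>s. C * (D * (c * exp (- (\<mu> / 2) * (t - s)))))"
        by (intro lebesgue_integral_time continuous_intros)
      also have "\<dots> = C * (D * (c * ((1 - exp (- (\<mu> / 2) * t)) / (\<mu> / 2))))"
        using integral_exp_backward_le[of "\<mu> / 2" t] C t
        by (intro integral_unique has_integral_mult_right) auto
      also have "\<dots> \<le> C * (D * (c * (1 / (\<mu> / 2))))"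
        using C D(1) c by (intro mult_left_mono divide_right_mono) auto
      finally show ?thesis by simp
    qed
    have le: "\<bar>u t w $ i\<bar> ^ 6 \<le> 64 * ((C * exp (- \<mu> * t)) ^ 6 * norm (W t w - W 0 w) ^ 6 + B ^ 5 * (\<integral>s. g s w \<partial>time_measure t))"
      if w: "w \<in> space M" for w
    proof -
      have cW: "continuous_on {0..t} (\<lambda>s. W s w)"
        by (rule continuous_on_subset[OF continuous_adaptedD(2)[OF W_adapted w]]) auto
      let ?I = "integral {0..t} (\<lambda>s. C * exp (- \<mu> * (t - s)) * norm (W t w - W s w))"
      have "?I ^ 6 \<le> B ^ 5 * integral {0..t} (\<lambda>s. C * exp (- \<mu> * (t - s)) * norm (W t w - W s w) ^ 6)"
      proof (rule integral_pow6_jensen)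
        have "integral {0..t} (\<lambda>s. C * exp (- \<mu> * (t - s))) = C * ((1 - exp (- \<mu> * t)) / \<mu>)"
          by (intro integral_unique has_integral_mult_right integral_exp_backward_le C t)
        also have "\<dots> \<le> C * (1 / \<mu>)" using C by (intro mult_left_mono divide_right_mono) auto
        finally show "integral {0..t} (\<lambda>s. C * exp (- \<mu> * (t - s))) \<le> B" by (simp add: B_def)
      qed (use C in \<open>auto intro!: continuous_intros cW\<close>)
      also have "integral {0..t} (\<lambda>s. C * exp (- \<mu> * (t - s)) * norm (W t w - W s w) ^ 6) = (\<integral>s. g s w \<partial>time_measure t)"
        unfolding g_def by (intro lebesgue_integral_time[symmetric] continuous_intros cW)
      finally have I6: "?I ^ 6 \<le> B ^ 5 * (\<integral>s. g s w \<partial>time_measure t)" .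
      have I0: "?I \<ge> 0"
        by (rule Henstock_Kurzweil_Integration.integral_nonneg)
           (use C in \<open>auto intro!: integrable_continuous_real continuous_intros cW\<close>)
      have "\<bar>u t w $ i\<bar> ^ 6 \<le> (C * exp (- \<mu> * t) * norm (W t w - W 0 w) + ?I) ^ 6"
        by (intro power_mono ub w t) auto
      also have "\<dots> \<le> 64 * ((C * exp (- \<mu> * t) * norm (W t w - W 0 w)) ^ 6 + ?I ^ 6)"
        by (rule add_pow6_le) (use C I0 in auto)
      also have "\<dots> \<le> 64 * ((C * exp (- \<mu> * t)) ^ 6 * norm (W t w - W 0 w) ^ 6 + B ^ 5 * (\<integral>s. g s w \<partial>time_measure t))"
        using I6 by (simp add: power_mult_distrib)
      finally show ?thesis .
    qed
    let ?R = "\<lambda>w. 64 * ((C * exp (- \<mu> * t)) ^ 6 * norm (W t w - W 0 w) ^ 6 + B ^ 5 * (\<integral>s. g s w \<partial>time_measure t))"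
    have iR: "integrable M ?R" using D(2)[of 0 t] t i2 by auto
    have i1: "integrable M (\<lambda>w. \<bar>u t w $ i\<bar> ^ 6)"
    proof (rule Bochner_Integration.integrable_bound[OF iR])
      show "(\<lambda>w. \<bar>u t w $ i\<bar> ^ 6) \<in> borel_measurable M" using meas[OF t] by measurable
      show "AE w in M. norm (\<bar>u t w $ i\<bar> ^ 6) \<le> norm (?R w)"
        by (rule AE_I2) (use order.trans[OF le abs_ge_self] in auto)
    qed
    have "(\<integral>w. \<bar>u t w $ i\<bar> ^ 6 \<partial>M) \<le> (\<integral>w. ?R w \<partial>M)" by (intro integral_mono i1 iR le)
    also have "\<dots> = 64 * ((C * exp (- \<mu> * t)) ^ 6 * (\<integral>w. norm (W t w - W 0 w) ^ 6 \<partial>M) + B ^ 5 * (\<integral>w. (\<integral>s. g s w \<partial>time_measure t) \<partial>M))"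
      using D(2)[of 0 t] t i2 by simp
    also have "\<dots> \<le> 64 * (C ^ 6 * (D * c) + B ^ 5 * (C * (D * (c * (2 / \<mu>)))))"
    proof (intro mult_left_mono add_mono E2)
      have "(C * exp (- \<mu> * t)) ^ 6 * (\<integral>w. norm (W t w - W 0 w) ^ 6 \<partial>M) \<le> (C * exp (- \<mu> * t)) ^ 6 * (D * t ^ 3)"
        using D(3)[of 0 t] t by (intro mult_left_mono) auto
      also have "\<dots> = C ^ 6 * (D * (t ^ 3 * exp (- \<mu> * t))) * exp (- \<mu> * t) ^ 5"
        by (simp add: power_mult_distrib eval_nat_numeral)
      also have "\<dots> \<le> C ^ 6 * (D * c) * 1"
      proof (intro mult_mono mult_left_mono)
        have "t ^ 3 * exp (- \<mu> * t) \<le> c * exp (- (\<mu> / 2) * t)" unfolding c_def by (rule cube_exp_le[OF C(2) t])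
        also have "\<dots> \<le> c * 1" using C t c by (intro mult_left_mono) auto
        finally show "t ^ 3 * exp (- \<mu> * t) \<le> c" by simp
        show "exp (- \<mu> * t) ^ 5 \<le> 1" using C t by (intro power_le_one) auto
      qed (use C D(1) c t in auto)
      finally show "(C * exp (- \<mu> * t)) ^ 6 * (\<integral>w. norm (W t w - W 0 w) ^ 6 \<partial>M) \<le> C ^ 6 * (D * c)" by simp
    qed (use B in auto)
    finally show ?thesis using i1 by (simp add: K1_def)
  qed
  have "integrable M (\<lambda>w. (1 + (\<Sum>i\<in>UNIV. \<bar>u t w $ i\<bar>)) ^ 6) \<and>
     (\<integral>w. (1 + (\<Sum>i\<in>UNIV. \<bar>u t w $ i\<bar>)) ^ 6 \<partial>M) \<le> K" if t: "t \<ge> 0" for t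
  proof -
    let ?R = "\<lambda>w. 64 * (1 + ?n ^ 6 * (\<Sum>i\<in>UNIV. \<bar>u t w $ i\<bar> ^ 6))"
    have le: "(1 + (\<Sum>i\<in>UNIV. \<bar>u t w $ i\<bar>)) ^ 6 \<le> ?R w" for w
    proof -
      have "(1 + (\<Sum>i\<in>UNIV. \<bar>u t w $ i\<bar>)) ^ 6 \<le> 64 * (1 ^ 6 + (\<Sum>i\<in>UNIV. \<bar>u t w $ i\<bar>) ^ 6)"
        by (rule add_pow6_le) (auto intro: sum_nonneg)
      also have "\<dots> \<le> ?R w" using pow6_sum_le[of "\<lambda>i. \<bar>u t w $ i\<bar>"] by simp
      finally show ?thesis .
    qed
    have iR: "integrable M ?R" using comp[OF t] by auto
    have i1: "integrable M (\<lambda>w. (1 + (\<Sum>i\<in>UNIV. \<bar>u t w $ i\<bar>)) ^ 6)"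
    proof (rule Bochner_Integration.integrable_bound[OF iR])
      show "(\<lambda>w. (1 + (\<Sum>i\<in>UNIV. \<bar>u t w $ i\<bar>)) ^ 6) \<in> borel_measurable M"
        using meas[OF t] by (intro borel_measurable_power borel_measurable_add borel_measurable_sum borel_measurable_abs) auto
      show "AE w in M. norm ((1 + (\<Sum>i\<in>UNIV. \<bar>u t w $ i\<bar>)) ^ 6) \<le> norm (?R w)"
        by (rule AE_I2) (use order.trans[OF le abs_ge_self] in \<open>auto simp: sum_nonneg abs_of_nonneg\<close>)
    qed
    have "(\<integral>w. (1 + (\<Sum>i\<in>UNIV. \<bar>u t w $ i\<bar>)) ^ 6 \<partial>M) \<le> (\<integral>w. ?R w \<partial>M)" by (intro integral_mono i1 iR le)
    also have "\<dots> = 64 * (1 + ?n ^ 6 * (\<Sum>i\<in>UNIV. (\<integral>w. \<bar>u t w $ i\<bar> ^ 6 \<partial>M)))"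
      using comp[OF t] by (simp add: prob_space)
    also have "\<dots> \<le> 64 * (1 + ?n ^ 6 * (\<Sum>i\<in>(UNIV::'n set). K1))"
      using comp[OF t] by (intro mult_left_mono add_left_mono sum_mono) auto
    finally show ?thesis using i1 by (simp add: K_def)
  qed
  moreover have "K \<ge> 0" using K1 by (simp add: K_def)
  ultimately show ?thesis by blast
qed

end

section \<open>The oscillator\<close>

locale oscillator = ou_process M F W A \<beta> u
  for M :: "'w measure" and F and W :: "real \<Rightarrow> 'w \<Rightarrow> real^'m" and A :: "real^'n^'n"
    and \<beta> :: "'n \<Rightarrow> real^'m" and u :: "real \<Rightarrow> 'w \<Rightarrow> real^'n" +
  fixes \<kappa> \<zeta> :: real and nz :: 'n and av :: "'n \<Rightarrow> real"
  assumes \<kappa>: "\<kappa> > 0"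
begin

text \<open>With the weights chosen at the end, \<open>al\<close> is the inner product of
  \<open>a\<close> and \<open>v\<close> plus \<open>z\<close>: the shear by
  \<open>\<epsilon> z\<close> replaces the white noise by the drift \<open>- z\<close> of
  \<open>z\<close>, which adds \<open>z\<close> to the real noise.\<close>

definition al :: "real \<Rightarrow> 'w \<Rightarrow> real" where
  "al s w = (\<Sum>i\<in>UNIV. av i * u s w $ i)"

text \<open>The coefficient of \<open>\<phi>\<close>, next to \<open>- \<kappa>\<^sup>2\<close>, in
  the equation of the sheared velocity. Eliminating the velocity in favour of the sheared one
  produces the product of \<open>\<epsilon> z + \<epsilon>\<^sup>2 \<zeta>\<close> and
  \<open>\<epsilon> z - \<epsilon>\<^sup>2 \<zeta>\<close>, whence the two last terms.\<close>

definition be :: "real \<Rightarrow> real \<Rightarrow> 'w \<Rightarrow> real" where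
  "be \<epsilon> s w = \<epsilon> * al s w - \<epsilon>\<^sup>2 * (u s w $ nz)\<^sup>2 + \<epsilon> ^ 4 * \<zeta>\<^sup>2"

text \<open>Any real linear equation in the plane reads y' = pc y + qc cnj y. The part of the shear
  with \<open>\<epsilon>\<^sup>2 \<zeta>\<close> makes the damping equal in both components, so that
  it sits in \<open>pc\<close> as a scalar; \<open>pc\<close> also carries the rotation, and
  \<open>qc\<close> the trace-free symmetric part.\<close>

definition pc :: "real \<Rightarrow> real \<Rightarrow> 'w \<Rightarrow> complex" where
  "pc \<epsilon> s w = Complex (- (\<epsilon>\<^sup>2 * \<zeta>)) (\<kappa> - be \<epsilon> s w / (2 * \<kappa>))"

definition qc :: "real \<Rightarrow> real \<Rightarrow> 'w \<Rightarrow> complex" where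
  "qc \<epsilon> s w = Complex (- (\<epsilon> * u s w $ nz)) (be \<epsilon> s w / (2 * \<kappa>))"

lemma al_adapted: "continuous_adapted M F al"
  unfolding al_def[abs_def]
  by (intro continuous_adapted_sum continuous_adapted_mult continuous_adapted_const u_component_adapted)

lemma be_adapted: "continuous_adapted M F (be \<epsilon>)"
  unfolding be_def[abs_def] power2_eq_square
  by (intro continuous_adapted_add continuous_adapted_diff continuous_adapted_mult continuous_adapted_const
      u_component_adapted al_adapted)

lemma pc_adapted: "continuous_adapted M F (pc \<epsilon>)"
proof -
  have "continuous_adapted M F (\<lambda>s w. (\<lambda>x. Complex (- (\<epsilon>\<^sup>2 * \<zeta>)) (\<kappa> - x / (2 * \<kappa>))) (be \<epsilon> s w))"
    by (rule continuous_adapted_compose[OF be_adapted]) (use \<kappa> in \<open>auto intro!: continuous_intros\<close>)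
  then show ?thesis by (simp add: pc_def[abs_def])
qed

lemma qc_adapted: "continuous_adapted M F (qc \<epsilon>)"
proof -
  have "continuous_adapted M F (\<lambda>s w. (\<lambda>x y. Complex (- (\<epsilon> * y)) (x / (2 * \<kappa>))) (be \<epsilon> s w) (u s w $ nz))"
    by (rule continuous_adapted_compose2[OF be_adapted u_component_adapted])
       (use \<kappa> in \<open>auto simp: split_def intro!: continuous_intros\<close>)
  then show ?thesis by (simp add: qc_def[abs_def])
qed

lemma y_exists:
  "\<exists>y. continuous_adapted M F y \<and> (\<forall>w\<in>space M. \<forall>t\<ge>0.
     y t w = 1 + integral {0..t} (\<lambda>s. pc \<epsilon> s w * y s w + qc \<epsilon> s w * cnj (y s w)))"
proof (rule picard_solution)
  fix y :: "real \<Rightarrow> 'w \<Rightarrow> complex" assume y: "continuous_adapted M F y"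
  have "continuous_adapted M F (\<lambda>s w. cnj (y s w))"
    by (rule continuous_adapted_compose[OF y]) (intro continuous_intros)
  then show "continuous_adapted M F (\<lambda>s w. pc \<epsilon> s w * y s w + qc \<epsilon> s w * cnj (y s w))"
    by (intro continuous_adapted_add continuous_adapted_mult pc_adapted qc_adapted y)
next
  fix w and T :: real assume w: "w \<in> space M"
  have "bounded ((\<lambda>s. norm (pc \<epsilon> s w) + norm (qc \<epsilon> s w)) ` {0..T})"
    by (intro compact_imp_bounded compact_continuous_image continuous_intros
        continuous_on_subset[OF continuous_adaptedD(2)[OF pc_adapted w]] continuous_on_subset[OF continuous_adaptedD(2)[OF qc_adapted w]]) auto
  then obtain L where L: "L > 0" "\<forall>s\<in>{0..T}. norm (pc \<epsilon> s w) + norm (qc \<epsilon> s w) \<le> L"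
    by (auto simp: bounded_pos)
  have "norm ((pc \<epsilon> s w * x + qc \<epsilon> s w * cnj x) - (pc \<epsilon> s w * y + qc \<epsilon> s w * cnj y)) \<le> L * norm (x - y)"
    if "s \<in> {0..T}" for s x y
  proof -
    have "(pc \<epsilon> s w * x + qc \<epsilon> s w * cnj x) - (pc \<epsilon> s w * y + qc \<epsilon> s w * cnj y) = pc \<epsilon> s w * (x - y) + qc \<epsilon> s w * cnj (x - y)"
      by (simp add: algebra_simps)
    also have "norm \<dots> \<le> norm (pc \<epsilon> s w) * norm (x - y) + norm (qc \<epsilon> s w) * norm (x - y)"
      using norm_triangle_ineq[of "pc \<epsilon> s w * (x - y)" "qc \<epsilon> s w * cnj (x - y)"] by (simp only: norm_mult complex_mod_cnj)
    also have "\<dots> \<le> L * norm (x - y)"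
      using mult_right_mono[OF L(2)[rule_format, OF that] norm_ge_zero[of "x - y"]] by (simp add: distrib_right)
    finally show ?thesis .
  qed
  then show "\<exists>L\<ge>0. \<forall>s\<in>{0..T}. \<forall>x y. norm ((pc \<epsilon> s w * x + qc \<epsilon> s w * cnj x) - (pc \<epsilon> s w * y + qc \<epsilon> s w * cnj y)) \<le> L * norm (x - y)"
    using L(1) by (intro exI[of _ L]) auto
qed

text \<open>In terms of the solution \<open>\<phi>\<close> and of \<open>z = u $ nz\<close>, \<open>y\<close> is \<open>\<phi>' - (\<epsilon> z - \<epsilon>\<^sup>2 \<zeta>) \<phi> + \<i> \<kappa> \<phi>\<close>. The shear
  by \<open>\<epsilon> z\<close> removes the white noise.\<close>

definition y :: "real \<Rightarrow> real \<Rightarrow> 'w \<Rightarrow> complex" where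
  "y \<epsilon> = (SOME y. continuous_adapted M F y \<and> (\<forall>w\<in>space M. \<forall>t\<ge>0.
     y t w = 1 + integral {0..t} (\<lambda>s. pc \<epsilon> s w * y s w + qc \<epsilon> s w * cnj (y s w))))"

definition dy :: "real \<Rightarrow> real \<Rightarrow> 'w \<Rightarrow> complex" where
  "dy \<epsilon> s w = pc \<epsilon> s w * y \<epsilon> s w + qc \<epsilon> s w * cnj (y \<epsilon> s w)"

lemma y_adapted: "continuous_adapted M F (y \<epsilon>)"
  and y_eq: "\<And>w t. w \<in> space M \<Longrightarrow> t \<ge> 0 \<Longrightarrow> y \<epsilon> t w = 1 + integral {0..t} (\<lambda>s. dy \<epsilon> s w)"
  using someI_ex[OF y_exists[of \<epsilon>]] unfolding y_def[symmetric] dy_def by auto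

lemma dy_adapted: "continuous_adapted M F (dy \<epsilon>)"
proof -
  have "continuous_adapted M F (\<lambda>s w. cnj (y \<epsilon> s w))"
    by (rule continuous_adapted_compose[OF y_adapted]) (intro continuous_intros)
  then show ?thesis unfolding dy_def[abs_def]
    by (intro continuous_adapted_add continuous_adapted_mult pc_adapted qc_adapted y_adapted)
qed

lemma y_0: "w \<in> space M \<Longrightarrow> y \<epsilon> 0 w = 1"
  using y_eq[of w 0] by simp

lemma y_deriv:
  assumes "w \<in> space M" "s \<in> {0..T}"
  shows "((\<lambda>s. y \<epsilon> s w) has_vector_derivative dy \<epsilon> s w) (at s within {0..T})"
  by (rule has_vector_derivative_primitive[OF assms(1) dy_adapted y_eq assms(2)]) (rule assms)

lemma y_sq_deriv:
  assumes "w \<in> space M" "s \<in> {0..T}"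
  shows "((\<lambda>s. y \<epsilon> s w \<bullet> y \<epsilon> s w) has_vector_derivative 2 * (y \<epsilon> s w \<bullet> dy \<epsilon> s w)) (at s within {0..T})"
  using bounded_bilinear.has_vector_derivative[OF bounded_bilinear_inner y_deriv[OF assms, of \<epsilon>] y_deriv[OF assms, of \<epsilon>]]
  by (simp add: inner_commute)

text \<open>Gronwall's inequality used from below: \<open>G\<close> dominates the rate at which the
  square of the modulus of \<open>y\<close> can decrease, so its product with the exponential of the
  integral of \<open>G\<close> is nondecreasing and starts at 1.\<close>

lemma y_nonzero:
  assumes w: "w \<in> space M" and t: "t \<ge> 0"
  shows "y \<epsilon> t w \<noteq> 0"
proof -
  define G where "G s = 2 * (norm (pc \<epsilon> s w) + norm (qc \<epsilon> s w))" for s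
  have cont: "continuous_on {0..t} (\<lambda>s. Z s w)" if "continuous_adapted M F Z" for Z :: "real \<Rightarrow> 'w \<Rightarrow> complex"
    by (rule continuous_on_subset[OF continuous_adaptedD(2)[OF that w]]) auto
  have cG: "continuous_on {0..t} G" unfolding G_def by (intro continuous_intros cont pc_adapted qc_adapted)
  define g where "g s = (y \<epsilon> s w \<bullet> y \<epsilon> s w) * exp (integral {0..s} G)" for s
  have dg: "(g has_vector_derivative (y \<epsilon> s w \<bullet> y \<epsilon> s w) * (G s * exp (integral {0..s} G)) +
      2 * (y \<epsilon> s w \<bullet> dy \<epsilon> s w) * exp (integral {0..s} G)) (at s within {0..t})" if s: "s \<in> {0..t}" for s
    unfolding g_def
  proof (intro has_vector_derivative_mult y_sq_deriv w s)
    have "((\<lambda>s. integral {0..s} G) has_real_derivative G s) (at s within {0..t})"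
      using integral_has_vector_derivative[OF cG s] by (simp add: has_real_derivative_iff_has_vector_derivative)
    then have "((\<lambda>s. exp (integral {0..s} G)) has_real_derivative exp (integral {0..s} G) * G s) (at s within {0..t})"
      by (rule DERIV_chain2[OF DERIV_exp])
    then show "((\<lambda>s. exp (integral {0..s} G)) has_vector_derivative G s * exp (integral {0..s} G)) (at s within {0..t})"
      by (simp add: has_real_derivative_iff_has_vector_derivative mult.commute)
  qed
  have pos: "(y \<epsilon> s w \<bullet> y \<epsilon> s w) * (G s * exp (integral {0..s} G)) + 2 * (y \<epsilon> s w \<bullet> dy \<epsilon> s w) * exp (integral {0..s} G) \<ge> 0" for s
  proof -
    have "\<bar>y \<epsilon> s w \<bullet> dy \<epsilon> s w\<bar> \<le> norm (y \<epsilon> s w) * norm (dy \<epsilon> s w)" by (rule Cauchy_Schwarz_ineq2)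
    also have "\<dots> \<le> norm (y \<epsilon> s w) * ((norm (pc \<epsilon> s w) + norm (qc \<epsilon> s w)) * norm (y \<epsilon> s w))"
      unfolding dy_def
      by (intro mult_left_mono order.trans[OF norm_triangle_ineq]) (auto simp: norm_mult distrib_right)
    also have "\<dots> = (y \<epsilon> s w \<bullet> y \<epsilon> s w) * G s / 2"
      by (simp add: G_def dot_square_norm power2_eq_square)
    finally have "(y \<epsilon> s w \<bullet> y \<epsilon> s w) * G s + 2 * (y \<epsilon> s w \<bullet> dy \<epsilon> s w) \<ge> 0" by linarith
    then have "((y \<epsilon> s w \<bullet> y \<epsilon> s w) * G s + 2 * (y \<epsilon> s w \<bullet> dy \<epsilon> s w)) * exp (integral {0..s} G) \<ge> 0" by simp
    then show ?thesis by (simp add: algebra_simps)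
  qed
  have "g 0 \<le> g t"
  proof (rule DERIV_nonneg_imp_increasing_open[OF t])
    fix s assume s: "0 < s" "s < t"
    then have "(g has_real_derivative (y \<epsilon> s w \<bullet> y \<epsilon> s w) * (G s * exp (integral {0..s} G)) +
      2 * (y \<epsilon> s w \<bullet> dy \<epsilon> s w) * exp (integral {0..s} G)) (at s)"
      using dg[of s] at_within_Icc_at[of 0 s t] by (simp add: has_real_derivative_iff_has_vector_derivative)
    with pos show "\<exists>d. (g has_real_derivative d) (at s) \<and> 0 \<le> d" by blast
  next
    show "continuous_on {0..t} g"
      by (rule continuous_on_vector_derivative) (rule dg)
  qed
  moreover have "g 0 = 1" using y_0[OF w] by (simp add: g_def dot_square_norm)
  ultimately show ?thesis by (auto simp: g_def)
qed

text \<open>\<open>E\<close> is \<open>exp (- 2 \<i> \<theta>)\<close> for the argument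
  \<open>\<theta>\<close> of \<open>y\<close>, a coordinate on the projective line. By linearity the
  growth rate depends on \<open>y\<close> through \<open>E\<close> only, and \<open>E\<close>
  satisfies a closed equation.\<close>

definition E :: "real \<Rightarrow> real \<Rightarrow> 'w \<Rightarrow> complex" where
  "E \<epsilon> s w = cnj (y \<epsilon> s w) / y \<epsilon> s w"

text \<open>The Riccati equation E' = cnj qc + (cnj pc - pc) E - qc E^2 with its coefficients
  written out; the damping cancels.\<close>

definition dE :: "real \<Rightarrow> real \<Rightarrow> 'w \<Rightarrow> complex" where
  "dE \<epsilon> s w = - 2 * \<i> * of_real \<kappa> * E \<epsilon> s w + of_real (\<epsilon> * u s w $ nz) * ((E \<epsilon> s w)\<^sup>2 - 1)
     + \<i> * of_real (be \<epsilon> s w / (2 * \<kappa>)) * (2 * E \<epsilon> s w - 1 - (E \<epsilon> s w)\<^sup>2)"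

lemma norm_E: "w \<in> space M \<Longrightarrow> s \<ge> 0 \<Longrightarrow> norm (E \<epsilon> s w) = 1"
  using y_nonzero by (simp add: E_def norm_divide)

lemma E_adapted: "continuous_adapted M F (E \<epsilon>)"
  unfolding continuous_adapted_def
proof (intro conjI allI impI ballI)
  fix t :: real assume t: "t \<ge> 0"
  have "y \<epsilon> t \<in> borel_measurable (F t)" by (rule continuous_adaptedD(1)[OF y_adapted t])
  moreover have "cnj \<in> borel_measurable borel" by (intro borel_measurable_continuous_onI continuous_intros)
  ultimately show "E \<epsilon> t \<in> borel_measurable (F t)"
    unfolding E_def[abs_def] by (intro borel_measurable_divide measurable_compose[of "y \<epsilon> t" _ borel cnj])
next
  fix w assume w: "w \<in> space M"
  show "continuous_on {0..} (\<lambda>t. E \<epsilon> t w)"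
    unfolding E_def
    by (intro continuous_on_divide continuous_on_cnj continuous_adaptedD(2)[OF y_adapted w])
       (use y_nonzero[OF w] in auto)
qed

lemma dE_adapted: "continuous_adapted M F (dE \<epsilon>)"
proof -
  have b: "continuous_adapted M F (\<lambda>s w. complex_of_real (be \<epsilon> s w / (2 * \<kappa>)))"
    by (rule continuous_adapted_compose[OF be_adapted]) (use \<kappa> in \<open>auto intro!: continuous_intros\<close>)
  have z: "continuous_adapted M F (\<lambda>s w. complex_of_real (\<epsilon> * u s w $ nz))"
    by (rule continuous_adapted_compose[OF u_component_adapted]) (auto intro!: continuous_intros)
  show ?thesis
    unfolding dE_def[abs_def] power2_eq_square
    by (intro continuous_adapted_add continuous_adapted_diff continuous_adapted_mult continuous_adapted_const b z E_adapted)
qed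

lemma dy_div_y:
  assumes "w \<in> space M" "s \<ge> 0"
  shows "dy \<epsilon> s w / y \<epsilon> s w = pc \<epsilon> s w + qc \<epsilon> s w * E \<epsilon> s w"
  using y_nonzero[OF assms] by (simp add: dy_def E_def add_divide_distrib)

lemma E_deriv:
  assumes w: "w \<in> space M" and s: "s \<in> {0..T}"
  shows "((\<lambda>s. E \<epsilon> s w) has_vector_derivative dE \<epsilon> s w) (at s within {0..T})"
proof -
  let ?y = "y \<epsilon> s w" and ?d = "dy \<epsilon> s w"
  have s0: "s \<ge> 0" using s by simp
  have y0: "?y \<noteq> 0" by (rule y_nonzero[OF w s0])
  have i: "((\<lambda>s. inverse (y \<epsilon> s w)) has_vector_derivative ?d * - (inverse ?y ^ Suc (Suc 0))) (at s within {0..T})"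
    using field_vector_diff_chain_within[OF y_deriv[OF w s] DERIV_inverse[OF y0]] by (simp add: o_def)
  have c: "((\<lambda>s. cnj (y \<epsilon> s w)) has_vector_derivative cnj ?d) (at s within {0..T})"
    by (rule has_vector_derivative_cnj[OF y_deriv[OF w s]])
  have "((\<lambda>s. E \<epsilon> s w) has_vector_derivative cnj ?y * (?d * - (inverse ?y ^ Suc (Suc 0))) + cnj ?d * inverse ?y) (at s within {0..T})"
    unfolding E_def divide_inverse by (rule has_vector_derivative_mult[OF c i])
  moreover have "cnj ?y * (?d * - (inverse ?y ^ Suc (Suc 0))) + cnj ?d * inverse ?y = cnj ?d / ?y - E \<epsilon> s w * (?d / ?y)"
    by (simp add: E_def divide_inverse mult_ac)
  moreover have "cnj ?d / ?y = cnj (pc \<epsilon> s w) * E \<epsilon> s w + cnj (qc \<epsilon> s w)"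
    using y0 by (simp add: dy_def E_def add_divide_distrib)
  moreover have "cnj (pc \<epsilon> s w) * E \<epsilon> s w + cnj (qc \<epsilon> s w) - E \<epsilon> s w * (pc \<epsilon> s w + qc \<epsilon> s w * E \<epsilon> s w) = dE \<epsilon> s w"
  proof -
    have p: "cnj (pc \<epsilon> s w) - pc \<epsilon> s w = - 2 * \<i> * of_real \<kappa> + 2 * \<i> * of_real (be \<epsilon> s w / (2 * \<kappa>))"
      by (simp add: pc_def complex_eq_iff)
    have q: "qc \<epsilon> s w = - of_real (\<epsilon> * u s w $ nz) + \<i> * of_real (be \<epsilon> s w / (2 * \<kappa>))"
      "cnj (qc \<epsilon> s w) = - of_real (\<epsilon> * u s w $ nz) - \<i> * of_real (be \<epsilon> s w / (2 * \<kappa>))"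
      by (simp_all add: qc_def complex_eq_iff)
    have "cnj (pc \<epsilon> s w) * E \<epsilon> s w + cnj (qc \<epsilon> s w) - E \<epsilon> s w * (pc \<epsilon> s w + qc \<epsilon> s w * E \<epsilon> s w) =
        (cnj (pc \<epsilon> s w) - pc \<epsilon> s w) * E \<epsilon> s w + cnj (qc \<epsilon> s w) - qc \<epsilon> s w * (E \<epsilon> s w)\<^sup>2"
      by (simp add: algebra_simps power2_eq_square)
    also have "\<dots> = dE \<epsilon> s w"
      unfolding p q dE_def by (simp add: algebra_simps power2_eq_square)
    finally show ?thesis .
  qed
  ultimately show ?thesis using dy_div_y[OF w s0] by simp
qed

text \<open>The logarithmic derivative of the modulus is the real part of y' / y, which is
  \<open>pc + qc E\<close>. Half the logarithm of the squared modulus is differentiated, as this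
  avoids the norm itself.\<close>

lemma ln_norm_y:
  assumes w: "w \<in> space M" and t: "t \<ge> 0"
  shows "((\<lambda>s. Re (pc \<epsilon> s w + qc \<epsilon> s w * E \<epsilon> s w)) has_integral ln (norm (y \<epsilon> t w))) {0..t}"
proof -
  have "((\<lambda>s. Re (pc \<epsilon> s w + qc \<epsilon> s w * E \<epsilon> s w)) has_integral
      ln (y \<epsilon> t w \<bullet> y \<epsilon> t w) / 2 - ln (y \<epsilon> 0 w \<bullet> y \<epsilon> 0 w) / 2) {0..t}"
  proof (rule fundamental_theorem_of_calculus[OF t])
    fix s assume s: "s \<in> {0..t}"
    then have s0: "s \<ge> 0" by simp
    have y0: "y \<epsilon> s w \<noteq> 0" by (rule y_nonzero[OF w s0])
    then have pos: "y \<epsilon> s w \<bullet> y \<epsilon> s w > 0" by simp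
    have "((\<lambda>s. y \<epsilon> s w \<bullet> y \<epsilon> s w) has_real_derivative 2 * (y \<epsilon> s w \<bullet> dy \<epsilon> s w)) (at s within {0..t})"
      using y_sq_deriv[OF w s] by (simp add: has_real_derivative_iff_has_vector_derivative)
    from DERIV_cdivide[OF DERIV_chain2[OF DERIV_ln[OF pos] this], of 2]
    have "((\<lambda>s. ln (y \<epsilon> s w \<bullet> y \<epsilon> s w) / 2) has_real_derivative (y \<epsilon> s w \<bullet> dy \<epsilon> s w) / (y \<epsilon> s w \<bullet> y \<epsilon> s w)) (at s within {0..t})"
      by (simp add: field_simps)
    moreover have "(y \<epsilon> s w \<bullet> dy \<epsilon> s w) / (y \<epsilon> s w \<bullet> y \<epsilon> s w) = Re (dy \<epsilon> s w / y \<epsilon> s w)"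
      by (simp add: Re_divide inner_complex_def power2_eq_square mult.commute)
    ultimately show "((\<lambda>s. ln (y \<epsilon> s w \<bullet> y \<epsilon> s w) / 2) has_vector_derivative Re (pc \<epsilon> s w + qc \<epsilon> s w * E \<epsilon> s w)) (at s within {0..t})"
      using dy_div_y[OF w s0] by (simp add: has_real_derivative_iff_has_vector_derivative)
  qed
  moreover have "ln (y \<epsilon> t w \<bullet> y \<epsilon> t w) / 2 = ln (norm (y \<epsilon> t w))"
    using y_nonzero[OF w t] by (simp add: dot_square_norm ln_realpow)
  moreover have "ln (y \<epsilon> 0 w \<bullet> y \<epsilon> 0 w) = 0" using y_0[OF w] by (simp add: dot_square_norm)
  ultimately show ?thesis by simp
qed


text \<open>The drift of \<open>E\<close> is quadratic in \<open>E\<close>: \<open>avc q\<close>, \<open>avd q\<close> and \<open>ave q\<close> are the coefficients of \<open>E ^ q\<close> in its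
  parts of order \<open>\<epsilon>\<close>, \<open>\<epsilon>\<^sup>2\<close> and \<open>\<epsilon>\<^sup>4\<close>.\<close>

definition sc :: "nat \<Rightarrow> complex" where
  "sc q = (if q = 0 then - 1 else if q = 1 then 0 else 1)"

definition ac :: "nat \<Rightarrow> complex" where
  "ac q = \<i> / of_real (2 * \<kappa>) * (if q = 1 then 2 else - 1)"

definition avc :: "nat \<Rightarrow> 'n \<Rightarrow> complex" where
  "avc q k = of_bool (k = nz) * sc q + of_real (av k) * ac q"

definition avd :: "nat \<Rightarrow> 'n \<Rightarrow> 'n \<Rightarrow> complex" where
  "avd q k l = of_bool (k = nz) * (of_bool (l = nz) * (- ac q))"

definition ave :: "nat \<Rightarrow> complex" where
  "ave q = of_real (\<zeta>\<^sup>2) * ac q"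

text \<open>The parameter is \<open>p = (\<epsilon>, T)\<close>; all bounds below are uniform in it.\<close>

definition params :: "(real \<times> real) set" where
  "params = {p. 0 < fst p \<and> fst p \<le> 1 \<and> 1 \<le> snd p}"

definition mu :: "real \<times> real \<Rightarrow> (real \<times> 'w) measure" where
  "mu p = density (time_measure (snd p) \<Otimes>\<^sub>M M) (\<lambda>_. ennreal (1 / snd p))"

definition EE :: "real \<times> real \<Rightarrow> real \<times> 'w \<Rightarrow> complex" where
  "EE p x = E (fst p) (fst x) (snd x)"

definition uu :: "real \<times> real \<Rightarrow> 'n \<Rightarrow> real \<times> 'w \<Rightarrow> real" where
  "uu p i x = u (fst x) (snd x) $ i"

definition SS :: "real \<Rightarrow> 'w \<Rightarrow> real" where
  "SS s w = 1 + (\<Sum>i\<in>UNIV. \<bar>u s w $ i\<bar>)"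

text \<open>Fixed once for all: \<open>u\<close> does not involve \<open>\<epsilon>\<close>, so one
  moment bound serves all parameters.\<close>

definition Ku :: real where
  "Ku = (SOME K. K \<ge> 0 \<and> (\<forall>t\<ge>0. integrable M (\<lambda>w. SS t w ^ 6) \<and> (\<integral>w. SS t w ^ 6 \<partial>M) \<le> K))"

lemma Ku: "Ku \<ge> 0" "\<And>t. t \<ge> 0 \<Longrightarrow> integrable M (\<lambda>w. SS t w ^ 6)" "\<And>t. t \<ge> 0 \<Longrightarrow> (\<integral>w. SS t w ^ 6 \<partial>M) \<le> Ku"
proof -
  have "\<exists>K. K \<ge> 0 \<and> (\<forall>t\<ge>0. integrable M (\<lambda>w. SS t w ^ 6) \<and> (\<integral>w. SS t w ^ 6 \<partial>M) \<le> K)"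
    using u_moment unfolding SS_def by blast
  from someI_ex[OF this] show "Ku \<ge> 0" "\<And>t. t \<ge> 0 \<Longrightarrow> integrable M (\<lambda>w. SS t w ^ 6)"
    "\<And>t. t \<ge> 0 \<Longrightarrow> (\<integral>w. SS t w ^ 6 \<partial>M) \<le> Ku"
    unfolding Ku_def[symmetric] by auto
qed

lemma SS1: "1 \<le> SS s w"
  by (simp add: SS_def sum_nonneg)

lemma u_le_SS: "\<bar>u s w $ i\<bar> \<le> SS s w"
  using member_le_sum[of i UNIV "\<lambda>i. \<bar>u s w $ i\<bar>"] by (simp add: SS_def)

lemma paramsD: "p \<in> params \<Longrightarrow> 0 < fst p" "p \<in> params \<Longrightarrow> fst p \<le> 1" "p \<in> params \<Longrightarrow> 1 \<le> snd p" "p \<in> params \<Longrightarrow> 0 \<le> snd p"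
  by (auto simp: params_def)

lemma sets_mu [simp, measurable_cong]: "sets (mu p) = sets (time_measure (snd p) \<Otimes>\<^sub>M M)"
  by (simp add: mu_def)

lemma space_mu: "space (mu p) = {0..snd p} \<times> space M"
  by (simp add: mu_def space_pair_measure space_restrict_space)

lemma integrable_mu:
  fixes f :: "real \<times> 'w \<Rightarrow> 'b::{banach, second_countable_topology}"
  assumes p: "p \<in> params" and f: "integrable (time_measure (snd p) \<Otimes>\<^sub>M M) f"
  shows "integrable (mu p) f"
  unfolding mu_def using f paramsD[OF p] by (subst integrable_density) auto

lemma integral_mu:
  fixes f :: "real \<times> 'w \<Rightarrow> 'b::{banach, second_countable_topology}"
  assumes p: "p \<in> params" and f: "f \<in> borel_measurable (time_measure (snd p) \<Otimes>\<^sub>M M)"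
  shows "(\<integral>x. f x \<partial>mu p) = (1 / snd p) *\<^sub>R (\<integral>x. f x \<partial>(time_measure (snd p) \<Otimes>\<^sub>M M))"
  unfolding mu_def using f paramsD[OF p] by (subst integral_density) auto

lemma measurable_SS_joint: "(\<lambda>x. SS (fst x) (snd x)) \<in> borel_measurable (time_measure T \<Otimes>\<^sub>M M)"
proof -
  have "(\<lambda>x. u (fst x) (snd x) $ i) \<in> borel_measurable (time_measure T \<Otimes>\<^sub>M M)" for i
    by (rule continuous_adapted_joint_restrict[OF u_component_adapted])
  then show ?thesis unfolding SS_def by measurable
qed

lemma integrable_SS_joint:
  "integrable (time_measure T \<Otimes>\<^sub>M M) (\<lambda>x. SS (fst x) (snd x) ^ 6)"
proof (rule integrable_time_space[where D="\<lambda>s w. SS s w ^ 6" and K=Ku])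
  show "(\<lambda>x. SS (fst x) (snd x) ^ 6) \<in> borel_measurable (time_measure T \<Otimes>\<^sub>M M)"
    by (intro borel_measurable_power measurable_SS_joint)
qed (use Ku SS1 in \<open>auto simp: power_even_abs intro!: power_mono\<close>)

lemma integral_SS_joint:
  assumes "T \<ge> 0"
  shows "(\<integral>x. SS (fst x) (snd x) ^ 6 \<partial>(time_measure T \<Otimes>\<^sub>M M)) \<le> T * Ku"
proof -
  interpret T: finite_measure "time_measure T" by (rule finite_measure_time)
  interpret P: pair_sigma_finite "time_measure T" M ..
  have "(\<integral>x. SS (fst x) (snd x) ^ 6 \<partial>(time_measure T \<Otimes>\<^sub>M M)) = (\<integral>s. (\<integral>w. SS s w ^ 6 \<partial>M) \<partial>time_measure T)"
    using P.integral_fst'[OF integrable_SS_joint] by simp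
  also have "\<dots> \<le> (\<integral>s. Ku \<partial>time_measure T)"
    by (rule integral_mono') (use Ku in \<open>auto simp: space_restrict_space\<close>)
  also have "\<dots> = T * Ku"
    using assms by (simp add: measure_restrict_space space_restrict_space)
  finally show ?thesis .
qed

text \<open>The frequency is \<open>2 * \<kappa>\<close> because \<open>E\<close> turns twice as
  fast as \<open>y\<close>. The interpretation comes in two stages, since the Dynkin relations are
  stated with the functionals \<open>J\<close> and \<open>JH\<close> that this first stage
  provides.\<close>

sublocale av: averaging A "\<lambda>i j. \<beta> i \<bullet> \<beta> j" "2 * \<kappa>" avc avd ave params mu EE uu fst "\<lambda>p. 1 / snd p" Ku
proof
  show "EE p \<in> borel_measurable (mu p)" for p
    unfolding EE_def by (subst measurable_cong_sets[OF sets_mu refl]) (rule continuous_adapted_joint_restrict[OF E_adapted])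
  show "uu p i \<in> borel_measurable (mu p)" for p i
    unfolding uu_def by (subst measurable_cong_sets[OF sets_mu refl]) (rule continuous_adapted_joint_restrict[OF u_component_adapted])
  show "norm (EE p x) \<le> 1" if "x \<in> space (mu p)" for p x
    using that by (auto simp: EE_def space_mu norm_E)
  fix p assume p: "p \<in> params"
  have eq: "(1 + (\<Sum>i\<in>UNIV. \<bar>uu p i x\<bar>)) ^ 6 = SS (fst x) (snd x) ^ 6" for x by (simp add: SS_def uu_def)
  show "integrable (mu p) (\<lambda>x. (1 + (\<Sum>i\<in>UNIV. \<bar>uu p i x\<bar>)) ^ 6)"
    unfolding eq by (rule integrable_mu[OF p integrable_SS_joint])
  have "(\<integral>x. SS (fst x) (snd x) ^ 6 \<partial>mu p) = (1 / snd p) * (\<integral>x. SS (fst x) (snd x) ^ 6 \<partial>(time_measure (snd p) \<Otimes>\<^sub>M M))"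
    by (subst integral_mu[OF p]) (auto intro!: borel_measurable_power measurable_SS_joint)
  also have "\<dots> \<le> (1 / snd p) * (snd p * Ku)"
    using paramsD[OF p] by (intro mult_left_mono integral_SS_joint) auto
  finally show "(\<integral>x. (1 + (\<Sum>i\<in>UNIV. \<bar>uu p i x\<bar>)) ^ 6 \<partial>mu p) \<le> Ku"
    unfolding eq using paramsD[OF p] by simp
qed (use stable \<kappa> Ku paramsD in \<open>auto simp: less_imp_le\<close>)

lemma av_S: "av.S p x = SS (fst x) (snd x)"
  by (simp add: av.S_def SS_def uu_def)

text \<open>Certifies the coefficient families: the abstract perturbation \<open>H\<close> equals
  the drift of \<open>E\<close> with the fast rotation removed.\<close>

lemma av_H: "av.H p (s, w) = dE (fst p) s w + 2 * \<i> * of_real \<kappa> * E (fst p) s w"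
proof -
  let ?e = "of_real (fst p) :: complex" and ?z = "of_real (u s w $ nz) :: complex" and ?E = "E (fst p) s w"
  have 1: "(\<Sum>k\<in>UNIV. avc q k * of_real (uu p k (s, w))) = ?z * sc q + of_real (al s w) * ac q" for q
  proof -
    have "(\<Sum>k\<in>UNIV. avc q k * of_real (uu p k (s, w))) =
        (\<Sum>k\<in>UNIV. (of_real (u s w $ k) * sc q) * of_bool (k = nz)) + (\<Sum>k\<in>UNIV. of_real (av k * u s w $ k) * ac q)"
      by (simp add: avc_def uu_def algebra_simps sum.distrib)
    also have "\<dots> = ?z * sc q + of_real (al s w) * ac q"
      unfolding sum_of_bool_right by (simp add: al_def sum_distrib_right)
    finally show ?thesis .
  qed
  have 2: "(\<Sum>k\<in>UNIV. \<Sum>l\<in>UNIV. avd q k l * of_real (uu p k (s, w) * uu p l (s, w))) = - (?z\<^sup>2 * ac q)" for q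
  proof -
    have "(\<Sum>k\<in>UNIV. \<Sum>l\<in>UNIV. avd q k l * of_real (uu p k (s, w) * uu p l (s, w))) =
      (\<Sum>k\<in>UNIV. (\<Sum>l\<in>UNIV. (- ac q * of_real (u s w $ k * u s w $ l)) * of_bool (l = nz)) * of_bool (k = nz))"
      by (simp add: avd_def uu_def sum_distrib_left sum_distrib_right mult_ac)
    also have "\<dots> = - (?z\<^sup>2 * ac q)"
      unfolding sum_of_bool_right by (simp add: power2_eq_square mult_ac)
    finally show ?thesis .
  qed
  have "av.H p (s, w) = (\<Sum>q<3. ?E ^ q * (?e * (?z * sc q + of_real (al s w) * ac q) + ?e\<^sup>2 * (- (?z\<^sup>2 * ac q)) + ?e ^ 4 * (of_real (\<zeta>\<^sup>2) * ac q)))"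
    unfolding av.H_def 1 2 ave_def of_real_power by (simp add: EE_def)
  also have "\<dots> = (\<Sum>q<3. ?E ^ q * (?e * ?z * sc q + of_real (be (fst p) s w) * ac q))"
    by (intro sum.cong refl) (simp add: be_def algebra_simps)
  also have "\<dots> = ?e * ?z * (?E\<^sup>2 - 1) + of_real (be (fst p) s w) * (\<i> / of_real (2 * \<kappa>)) * (2 * ?E - 1 - ?E\<^sup>2)"
    by (simp add: numeral_3_eq_3 sc_def ac_def algebra_simps power2_eq_square)
  also have "\<dots> = dE (fst p) s w + 2 * \<i> * of_real \<kappa> * ?E"
    by (simp add: dE_def)
  finally show ?thesis .
qed

section \<open>Dynkin's relations for powers of the angle times monomials\<close>

definition cE :: real where
  "cE = 2 * \<kappa> + 2 + (2 / \<kappa>) * ((\<Sum>i\<in>UNIV. \<bar>av i\<bar>) + 1 + \<zeta>\<^sup>2)"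

lemma abs_al_le: "\<bar>al s w\<bar> \<le> (\<Sum>i\<in>UNIV. \<bar>av i\<bar>) * SS s w"
  unfolding al_def sum_distrib_right
  by (intro order.trans[OF sum_abs sum_mono] order.trans[OF eq_refl[OF abs_mult]] mult_left_mono u_le_SS) auto

lemma abs_be_le:
  assumes "0 \<le> \<epsilon>" "\<epsilon> \<le> 1"
  shows "\<bar>be \<epsilon> s w\<bar> \<le> ((\<Sum>i\<in>UNIV. \<bar>av i\<bar>) + 1 + \<zeta>\<^sup>2) * (SS s w)\<^sup>2"
proof -
  let ?A = "\<Sum>i\<in>UNIV. \<bar>av i\<bar>"
  have A: "?A \<ge> 0" by (simp add: sum_nonneg)
  have SS2: "SS s w \<le> (SS s w)\<^sup>2" using SS1[of s w] by (simp add: power2_eq_square)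
  have S21: "1 \<le> (SS s w)\<^sup>2" using SS1[of s w] by (simp add: one_le_power)
  have "\<bar>\<epsilon> * al s w\<bar> \<le> 1 * (?A * (SS s w)\<^sup>2)"
    unfolding abs_mult using assms abs_al_le[of s w] mult_left_mono[OF SS2 A] by (intro mult_mono) auto
  moreover have "\<bar>\<epsilon>\<^sup>2 * (u s w $ nz)\<^sup>2\<bar> \<le> 1 * (SS s w)\<^sup>2"
    unfolding abs_mult using assms u_le_SS[of s w nz]
    by (intro mult_mono) (auto simp: power_le_one abs_le_square_iff[symmetric] intro: order.trans[OF _ abs_ge_self])
  moreover have "\<bar>\<epsilon> ^ 4 * \<zeta>\<^sup>2\<bar> \<le> 1 * (\<zeta>\<^sup>2 * (SS s w)\<^sup>2)"
    unfolding abs_mult using assms mult_left_mono[OF S21, of "\<zeta>\<^sup>2"]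
    by (intro mult_mono) (auto simp: power_le_one)
  moreover have "\<bar>be \<epsilon> s w\<bar> \<le> \<bar>\<epsilon> * al s w\<bar> + \<bar>\<epsilon>\<^sup>2 * (u s w $ nz)\<^sup>2\<bar> + \<bar>\<epsilon> ^ 4 * \<zeta>\<^sup>2\<bar>"
    unfolding be_def by linarith
  ultimately have "\<bar>be \<epsilon> s w\<bar> \<le> ?A * (SS s w)\<^sup>2 + (SS s w)\<^sup>2 + \<zeta>\<^sup>2 * (SS s w)\<^sup>2" by linarith
  then show ?thesis by (simp add: distrib_right)
qed

lemma norm_dE_le:
  assumes "0 \<le> \<epsilon>" "\<epsilon> \<le> 1" "w \<in> space M" "s \<ge> 0"
  shows "norm (dE \<epsilon> s w) \<le> cE * (SS s w)\<^sup>2"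
proof -
  let ?A = "(\<Sum>i\<in>UNIV. \<bar>av i\<bar>) + 1 + \<zeta>\<^sup>2"
  have S21: "1 \<le> (SS s w)\<^sup>2" using SS1[of s w] by (simp add: one_le_power)
  have SS2: "SS s w \<le> (SS s w)\<^sup>2" using SS1[of s w] by (simp add: power2_eq_square)
  have E: "norm (E \<epsilon> s w) = 1" by (rule norm_E) (use assms in auto)
  have 1: "norm (- 2 * \<i> * of_real \<kappa> * E \<epsilon> s w) \<le> 2 * \<kappa> * (SS s w)\<^sup>2"
    using \<kappa> S21 by (simp add: norm_mult E)
  have 2: "norm (of_real (\<epsilon> * u s w $ nz) * ((E \<epsilon> s w)\<^sup>2 - 1)) \<le> (1 * (SS s w)\<^sup>2) * 2"
  proof -
    have "norm ((E \<epsilon> s w)\<^sup>2 - 1) \<le> 2"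
      using norm_triangle_ineq4[of "(E \<epsilon> s w)\<^sup>2" 1] by (simp add: norm_power E)
    moreover have "\<bar>\<epsilon> * u s w $ nz\<bar> \<le> 1 * (SS s w)\<^sup>2"
      unfolding abs_mult using assms u_le_SS[of s w nz] SS2 by (intro mult_mono) auto
    ultimately show ?thesis unfolding norm_mult norm_of_real by (intro mult_mono) auto
  qed
  have 3: "norm (\<i> * of_real (be \<epsilon> s w / (2 * \<kappa>)) * (2 * E \<epsilon> s w - 1 - (E \<epsilon> s w)\<^sup>2)) \<le> (?A * (SS s w)\<^sup>2 / (2 * \<kappa>)) * 4"
  proof -
    have "norm (2 * E \<epsilon> s w - 1 - (E \<epsilon> s w)\<^sup>2) \<le> 4"
      using norm_triangle_ineq4[of "2 * E \<epsilon> s w - 1" "(E \<epsilon> s w)\<^sup>2"] norm_triangle_ineq4[of "2 * E \<epsilon> s w" 1]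
      by (simp add: norm_power norm_mult E)
    moreover have "norm (\<i> * of_real (be \<epsilon> s w / (2 * \<kappa>))) \<le> ?A * (SS s w)\<^sup>2 / (2 * \<kappa>)"
      using abs_be_le[OF assms(1,2), of s w] \<kappa> by (simp add: norm_mult abs_divide divide_right_mono del: of_real_divide)
    ultimately show ?thesis
      unfolding norm_mult[of _ "2 * E \<epsilon> s w - 1 - (E \<epsilon> s w)\<^sup>2"]
      by (intro mult_mono order.trans[OF norm_ge_zero, of _ "?A * (SS s w)\<^sup>2 / (2 * \<kappa>)"]) auto
  qed
  have "norm (dE \<epsilon> s w) \<le> 2 * \<kappa> * (SS s w)\<^sup>2 + (1 * (SS s w)\<^sup>2) * 2 + (?A * (SS s w)\<^sup>2 / (2 * \<kappa>)) * 4"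
    unfolding dE_def by (intro order.trans[OF norm_triangle_ineq] add_mono 1 2 3)
  also have "\<dots> = cE * (SS s w)\<^sup>2" using \<kappa> by (simp add: cE_def field_simps)
  finally show ?thesis .
qed

text \<open>The index \<open>None\<close> stands for the constant 1, so that one formula covers all products of at most
  three components of \<open>u\<close>.\<close>

fun Xo :: "'n option \<Rightarrow> real \<Rightarrow> 'w \<Rightarrow> real" where
  "Xo None s w = 1" | "Xo (Some i) s w = u s w $ i"

fun Ao :: "'n option \<Rightarrow> real \<Rightarrow> 'w \<Rightarrow> real" where
  "Ao None s w = 0" | "Ao (Some i) s w = (\<Sum>l\<in>UNIV. A $ i $ l * u s w $ l)"

fun Bo :: "'n option \<Rightarrow> real^'m" where
  "Bo None = 0" | "Bo (Some i) = \<beta> i"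

text \<open>Large enough for \<open>cL n * SS\<close> to meet all the bounds asked of the weight
  \<open>L\<close>: at least 1 for the components, the sum of the entries of \<open>A\<close> for
  the drifts, and \<open>n * cE\<close> for the derivative of \<open>E ^ n\<close>.\<close>

definition cL :: "nat \<Rightarrow> real" where
  "cL n = 1 + real n * cE + (\<Sum>i\<in>UNIV. \<Sum>l\<in>UNIV. \<bar>A $ i $ l\<bar>)"

lemma cE_nonneg: "cE \<ge> 0"
  using \<kappa> by (simp add: cE_def sum_nonneg)

lemma cL1: "1 \<le> cL n"
  using cE_nonneg by (simp add: cL_def sum_nonneg)

lemma E_pow_eq:
  assumes w: "w \<in> space M" and t: "t \<ge> 0"
  shows "E \<epsilon> t w ^ n = E \<epsilon> 0 w ^ n + integral {0..t} (\<lambda>s. of_nat n * E \<epsilon> s w ^ (n - 1) * dE \<epsilon> s w)"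
proof -
  have "((\<lambda>s. of_nat n * E \<epsilon> s w ^ (n - 1) * dE \<epsilon> s w) has_integral E \<epsilon> t w ^ n - E \<epsilon> 0 w ^ n) {0..t}"
  proof (rule fundamental_theorem_of_calculus[OF t])
    fix s assume s: "s \<in> {0..t}"
    have "((\<lambda>z. z ^ n) has_field_derivative of_nat n * E \<epsilon> s w ^ (n - Suc 0)) (at (E \<epsilon> s w) within (\<lambda>s. E \<epsilon> s w) ` {0..t})"
      using DERIV_power[OF DERIV_ident, of n "E \<epsilon> s w" "(\<lambda>s. E \<epsilon> s w) ` {0..t}"] by simp
    from field_vector_diff_chain_within[OF E_deriv[OF w s] this]
    show "((\<lambda>s. E \<epsilon> s w ^ n) has_vector_derivative of_nat n * E \<epsilon> s w ^ (n - 1) * dE \<epsilon> s w) (at s within {0..t})"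
      by (simp add: o_def mult.commute)
  qed
  then show ?thesis by (simp add: integral_unique)
qed

lemma E_pow_adapted: "continuous_adapted M F (\<lambda>s w. E \<epsilon> s w ^ n)"
  by (rule continuous_adapted_compose[OF E_adapted]) (intro continuous_intros)

lemma Xo_adapted: "continuous_adapted M F (Xo i)"
proof (cases i)
  case None
  then have "Xo i = (\<lambda>s w. 1)" by (intro ext) simp
  then show ?thesis by (simp add: continuous_adapted_const)
next
  case (Some j)
  then have "Xo i = (\<lambda>s w. u s w $ j)" by (intro ext) simp
  then show ?thesis by (simp add: u_component_adapted)
qed

lemma Ao_adapted: "continuous_adapted M F (Ao i)"
proof (cases i)
  case None
  then have "Ao i = (\<lambda>s w. 0)" by (intro ext) simp
  then show ?thesis by (simp add: continuous_adapted_const)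
next
  case (Some j)
  then have "Ao i = (\<lambda>s w. \<Sum>l\<in>UNIV. A $ j $ l * u s w $ l)" by (intro ext) simp
  then show ?thesis
    by (simp add: continuous_adapted_sum continuous_adapted_mult continuous_adapted_const u_component_adapted)
qed

lemma Xo_eq:
  assumes "w \<in> space M" "t \<ge> 0"
  shows "Xo i t w = Xo i 0 w + integral {0..t} (\<lambda>s. Ao i s w) + Bo i \<bullet> (W t w - W 0 w)"
proof (cases i)
  case (Some j)
  then show ?thesis using u_eq[OF assms, of j] u_eq[OF assms(1) order_refl, of j] by simp
qed simp

lemma Xo_le: "\<bar>Xo i s w\<bar> \<le> SS s w"
  using SS1[of s w] u_le_SS[of s w] by (cases i) auto

lemma Ao_le: "\<bar>Ao i s w\<bar> \<le> (\<Sum>i\<in>UNIV. \<Sum>l\<in>UNIV. \<bar>A $ i $ l\<bar>) * SS s w"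
proof (cases i)
  case None
  then show ?thesis using SS1[of s w] by (simp add: sum_nonneg mult_nonneg_nonneg)
next
  case (Some j)
  have "\<bar>Ao i s w\<bar> \<le> (\<Sum>l\<in>UNIV. \<bar>A $ j $ l\<bar>) * SS s w"
    unfolding Some Ao.simps sum_distrib_right
    by (intro order.trans[OF sum_abs sum_mono] order.trans[OF eq_refl[OF abs_mult]] mult_left_mono u_le_SS) auto
  also have "\<dots> \<le> (\<Sum>i\<in>UNIV. \<Sum>l\<in>UNIV. \<bar>A $ i $ l\<bar>) * SS s w"
    using SS1[of s w] member_le_sum[of j UNIV "\<lambda>i. \<Sum>l\<in>UNIV. \<bar>A $ i $ l\<bar>"]
    by (intro mult_right_mono) (auto simp: sum_nonneg)
  finally show ?thesis .
qed

lemma dynkin_instance: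
  assumes p: "p \<in> params"
  shows "dynkin M F W (\<lambda>s w. E (fst p) s w ^ n) (\<lambda>s w. of_nat n * E (fst p) s w ^ (n - 1) * dE (fst p) s w)
    (Xo i) (Xo j) (Xo k) (Ao i) (Ao j) (Ao k) (\<lambda>s w. cL n * SS s w) (Bo i) (Bo j) (Bo k) (snd p) (cL n ^ 6 * Ku)"
proof -
  let ?\<epsilon> = "fst p"
  have \<epsilon>: "0 \<le> ?\<epsilon>" "?\<epsilon> \<le> 1" and T: "snd p \<ge> 0" using paramsD[OF p] by auto
  have XL: "\<bar>Xo i s w\<bar> \<le> cL n * SS s w" for i s w
    using mult_right_mono[OF cL1[of n] order.trans[OF zero_le_one SS1[of s w]]] Xo_le[of i s w] by linarith
  have AL: "\<bar>Ao i s w\<bar> \<le> cL n * SS s w" for i s w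
  proof -
    have "(\<Sum>i\<in>UNIV. \<Sum>l\<in>UNIV. \<bar>A $ i $ l\<bar>) \<le> cL n" using cE_nonneg by (simp add: cL_def)
    then have "(\<Sum>i\<in>UNIV. \<Sum>l\<in>UNIV. \<bar>A $ i $ l\<bar>) * SS s w \<le> cL n * SS s w"
      using SS1[of s w] by (intro mult_right_mono) auto
    with Ao_le[of i s w] show ?thesis by linarith
  qed
  show ?thesis
  proof
    show "continuous_adapted M F (\<lambda>s w. of_nat n * E ?\<epsilon> s w ^ (n - 1) * dE ?\<epsilon> s w)"
      by (intro continuous_adapted_mult continuous_adapted_const E_pow_adapted dE_adapted)
    show "1 \<le> cL n * SS s w" for s w using mult_mono[OF cL1 SS1[of s w]] cL1[of n] by simp
    show "norm (E ?\<epsilon> s w ^ n) \<le> 1" if "w \<in> space M" "s \<ge> 0" for s w using norm_E[OF that] by (simp add: norm_power)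
    show "norm (of_nat n * E ?\<epsilon> s w ^ (n - 1) * dE ?\<epsilon> s w) \<le> (cL n * SS s w)\<^sup>2" if w: "w \<in> space M" and s: "s \<ge> 0" for s w
    proof -
      have "norm (of_nat n * E ?\<epsilon> s w ^ (n - 1) * dE ?\<epsilon> s w) = real n * norm (dE ?\<epsilon> s w)"
        using norm_E[OF w s] by (simp add: norm_mult norm_power)
      also have "\<dots> \<le> real n * (cE * (SS s w)\<^sup>2)" by (intro mult_left_mono norm_dE_le \<epsilon> w s) auto
      also have "\<dots> \<le> (cL n)\<^sup>2 * (SS s w)\<^sup>2"
      proof -
        have "real n * cE \<le> cL n" by (simp add: cL_def sum_nonneg)
        also have "\<dots> \<le> (cL n)\<^sup>2" using cL1[of n] by (simp add: power2_eq_square)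
        finally show ?thesis by (simp add: mult.assoc[symmetric] mult_right_mono)
      qed
      finally show ?thesis by (simp add: power_mult_distrib)
    qed
    fix s assume "s \<in> {0..snd p}"
    then have s: "s \<ge> 0" by simp
    show "integrable M (\<lambda>w. (cL n * SS s w) ^ 6)" using Ku(2)[OF s] by (simp add: power_mult_distrib)
    show "(\<integral>w. (cL n * SS s w) ^ 6 \<partial>M) \<le> cL n ^ 6 * Ku"
      using Ku(3)[OF s] cL1[of n] by (simp add: power_mult_distrib mult_left_mono)
  next
    show "E ?\<epsilon> s w ^ n = E ?\<epsilon> 0 w ^ n + integral {0..s} (\<lambda>r. of_nat n * E ?\<epsilon> r w ^ (n - 1) * dE ?\<epsilon> r w)"
      if "w \<in> space M" "s \<ge> 0" for s w by (rule E_pow_eq[OF that])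
  qed (use T XL AL in \<open>auto intro!: E_pow_adapted Xo_adapted Ao_adapted Xo_eq\<close>)
qed

definition fo :: "'n option \<Rightarrow> 'n option \<Rightarrow> 'n option \<Rightarrow> real \<times> real \<Rightarrow> real \<times> 'w \<Rightarrow> real" where
  "fo i j k p x = Xo i (fst x) (snd x) * (Xo j (fst x) (snd x) * (Xo k (fst x) (snd x) * 1))"

text \<open>Contribution of the drift acting on one slot: \<open>i\<close> is the index in that slot
  and \<open>f\<close> the monomial as a function of it. The padding index has no drift.\<close>

definition Jo :: "nat \<Rightarrow> 'n option \<Rightarrow> ('n option \<Rightarrow> real \<times> real \<Rightarrow> real \<times> 'w \<Rightarrow> real) \<Rightarrow> real \<times> real \<Rightarrow> complex" where
  "Jo n i f p = (case i of None \<Rightarrow> 0 | Some i' \<Rightarrow> \<Sum>l\<in>UNIV. of_real (A $ i' $ l) * av.J n (f (Some l)) p)"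

lemma fo_admissible: "av.admissible 3 (fo i j k)"
proof -
  have m: "(\<lambda>x. Xo i (fst x) (snd x)) \<in> borel_measurable (mu p)" for i p
    by (subst measurable_cong_sets[OF sets_mu refl]) (rule continuous_adapted_joint_restrict[OF Xo_adapted])
  have "\<bar>fo i j k p x\<bar> \<le> SS (fst x) (snd x) * (SS (fst x) (snd x) * (SS (fst x) (snd x) * 1))" for p x
    unfolding fo_def abs_mult by (intro mult_mono' Xo_le) auto
  then show ?thesis
    unfolding av.admissible_def av_S fo_def
    using m by (auto simp: power3_eq_cube mult.assoc)
qed

text \<open>Dynkin's formula leaves only the boundary terms at 0 and \<open>T\<close>, each bounded
  by the moments uniformly in time, hence the factor 2; the normalisation of \<open>mu\<close>
  divides them by \<open>T\<close>.\<close>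

lemma dominated_generator:
  "dominated params (\<lambda>p. of_nat n * (av.JH (n - 1) (fo i j k) p - \<i> * of_real (2 * \<kappa>) * av.J n (fo i j k) p)
     + (Jo n i (\<lambda>l. fo l j k) p + Jo n j (\<lambda>l. fo i l k) p + Jo n k (\<lambda>l. fo i j l) p
     + (of_real (Bo i \<bullet> Bo j) * av.J n (fo None None k) p + of_real (Bo i \<bullet> Bo k) * av.J n (fo None j None) p
     + of_real (Bo j \<bullet> Bo k) * av.J n (fo i None None) p))) (\<lambda>p. 1 / snd p)"
proof (rule dominatedI[of "2 * (cL n ^ 6 * Ku)"])
  show "2 * (cL n ^ 6 * Ku) \<ge> 0" using Ku cL1[of n] by simp
  fix p assume p: "p \<in> params"
  let ?T = "snd p" and ?\<epsilon> = "fst p"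
  have T: "?T \<ge> 0" "?T \<ge> 1" using paramsD[OF p] by auto
  interpret dyn: dynkin M F W "\<lambda>s w. E (fst p) s w ^ n" "\<lambda>s w. of_nat n * E (fst p) s w ^ (n - 1) * dE (fst p) s w"
    "Xo i" "Xo j" "Xo k" "Ao i" "Ao j" "Ao k" "\<lambda>s w. cL n * SS s w" "Bo i" "Bo j" "Bo k" "snd p" "cL n ^ 6 * Ku"
    by (rule dynkin_instance[OF p])
  have b: "norm (\<integral>w. E ?\<epsilon> s w ^ n * of_real (Xo i s w) * of_real (Xo j s w) * of_real (Xo k s w) \<partial>M) \<le> cL n ^ 6 * Ku"
    if s: "s \<in> {0..?T}" for s
  proof -
    have "norm (\<integral>w. E ?\<epsilon> s w ^ n * of_real (Xo i s w) * of_real (Xo j s w) * of_real (Xo k s w) \<partial>M)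
      \<le> (\<integral>w. norm (E ?\<epsilon> s w ^ n * of_real (Xo i s w) * of_real (Xo j s w) * of_real (Xo k s w)) \<partial>M)"
      by (rule integral_norm_bound)
    also have "\<dots> \<le> (\<integral>w. (cL n * SS s w) ^ 6 \<partial>M)"
    proof (rule integral_mono'[OF dyn.L6(1)[OF s]])
      fix w assume w: "w \<in> space M"
      have "norm (E ?\<epsilon> s w ^ n * of_real (Xo i s w) * of_real (Xo j s w) * of_real (Xo k s w)) \<le>
          1 * (cL n * SS s w) * (cL n * SS s w) * (cL n * SS s w)"
        using s w by (intro dyn.norm_mult_le dyn.C_le dyn.X_le) auto
      also have "\<dots> = (cL n * SS s w) ^ 3" by (simp add: power3_eq_cube)
      also have "\<dots> \<le> (cL n * SS s w) ^ 6" by (rule dyn.L_power_mono) simp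
      finally show "norm (E ?\<epsilon> s w ^ n * of_real (Xo i s w) * of_real (Xo j s w) * of_real (Xo k s w)) \<le> (cL n * SS s w) ^ 6" .
    qed (use dyn.L0 in simp)
    also have "\<dots> \<le> cL n ^ 6 * Ku" by (rule dyn.L6(2)[OF s])
    finally show ?thesis .
  qed
  have "norm (\<integral>x. dyn.generator_term (fst x) (snd x) \<partial>mu p) =
    (1 / ?T) * norm ((\<integral>w. E ?\<epsilon> ?T w ^ n * of_real (Xo i ?T w) * of_real (Xo j ?T w) * of_real (Xo k ?T w) \<partial>M)
    - (\<integral>w. E ?\<epsilon> 0 w ^ n * of_real (Xo i 0 w) * of_real (Xo j 0 w) * of_real (Xo k 0 w) \<partial>M))"
    using T by (subst integral_mu[OF p dyn.measurable_generator], subst dyn.dynkin_formula) simp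
  also have "\<dots> \<le> (1 / ?T) * (cL n ^ 6 * Ku + cL n ^ 6 * Ku)"
    using T by (intro mult_left_mono order.trans[OF norm_triangle_ineq4] add_mono b) auto
  also have "\<dots> = 2 * (cL n ^ 6 * Ku) * (1 / ?T)" by simp
  finally have bound: "norm (\<integral>x. dyn.generator_term (fst x) (snd x) \<partial>mu p) \<le> 2 * (cL n ^ 6 * Ku) * (1 / ?T)" .
  have iJ: "has_bochner_integral (mu p) (\<lambda>x. EE p x ^ n * of_real (fo i j k p x)) (av.J n (fo i j k) p)" for n i j k
    unfolding av.J_def by (rule has_bochner_integral_integrable[OF av.integrable_J(1)[OF fo_admissible _ p]]) simp
  have iJH: "has_bochner_integral (mu p) (\<lambda>x. EE p x ^ n * av.H p x * of_real (fo i j k p x)) (av.JH n (fo i j k) p)" for n i j k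
    unfolding av.JH_def by (rule has_bochner_integral_integrable[OF av.JH_expand(1)[OF fo_admissible _ p]]) simp
  have iJo: "has_bochner_integral (mu p) (\<lambda>x. case i of None \<Rightarrow> 0 | Some i' \<Rightarrow> \<Sum>l\<in>UNIV. of_real (A $ i' $ l) * (EE p x ^ n * of_real (g (Some l) p x)))
      (Jo n i g p)" if "\<And>l. has_bochner_integral (mu p) (\<lambda>x. EE p x ^ n * of_real (g l p x)) (av.J n (g l) p)" for i g
    unfolding Jo_def using that
    by (cases i) (auto intro!: has_bochner_integral_sum has_bochner_integral_mult_right has_bochner_integral_zero)
  have "has_bochner_integral (mu p) (\<lambda>x. of_nat n * (EE p x ^ (n - 1) * av.H p x * of_real (fo i j k p x)
       - \<i> * of_real (2 * \<kappa>) * (EE p x ^ n * of_real (fo i j k p x)))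
     + ((case i of None \<Rightarrow> 0 | Some i' \<Rightarrow> \<Sum>l\<in>UNIV. of_real (A $ i' $ l) * (EE p x ^ n * of_real (fo (Some l) j k p x)))
      + (case j of None \<Rightarrow> 0 | Some i' \<Rightarrow> \<Sum>l\<in>UNIV. of_real (A $ i' $ l) * (EE p x ^ n * of_real (fo i (Some l) k p x)))
      + (case k of None \<Rightarrow> 0 | Some i' \<Rightarrow> \<Sum>l\<in>UNIV. of_real (A $ i' $ l) * (EE p x ^ n * of_real (fo i j (Some l) p x)))
      + (of_real (Bo i \<bullet> Bo j) * (EE p x ^ n * of_real (fo None None k p x)) + of_real (Bo i \<bullet> Bo k) * (EE p x ^ n * of_real (fo None j None p x))
     + of_real (Bo j \<bullet> Bo k) * (EE p x ^ n * of_real (fo i None None p x)))))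
    (of_nat n * (av.JH (n - 1) (fo i j k) p - \<i> * of_real (2 * \<kappa>) * av.J n (fo i j k) p)
     + (Jo n i (\<lambda>l. fo l j k) p + Jo n j (\<lambda>l. fo i l k) p + Jo n k (\<lambda>l. fo i j l) p
     + (of_real (Bo i \<bullet> Bo j) * av.J n (fo None None k) p + of_real (Bo i \<bullet> Bo k) * av.J n (fo None j None) p
     + of_real (Bo j \<bullet> Bo k) * av.J n (fo i None None) p)))"
    by (intro has_bochner_integral_add has_bochner_integral_diff has_bochner_integral_mult_right iJ iJH iJo)
  moreover have "of_nat n * (EE p x ^ (n - 1) * av.H p x * of_real (fo i j k p x)
       - \<i> * of_real (2 * \<kappa>) * (EE p x ^ n * of_real (fo i j k p x)))
     + ((case i of None \<Rightarrow> 0 | Some i' \<Rightarrow> \<Sum>l\<in>UNIV. of_real (A $ i' $ l) * (EE p x ^ n * of_real (fo (Some l) j k p x)))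
      + (case j of None \<Rightarrow> 0 | Some i' \<Rightarrow> \<Sum>l\<in>UNIV. of_real (A $ i' $ l) * (EE p x ^ n * of_real (fo i (Some l) k p x)))
      + (case k of None \<Rightarrow> 0 | Some i' \<Rightarrow> \<Sum>l\<in>UNIV. of_real (A $ i' $ l) * (EE p x ^ n * of_real (fo i j (Some l) p x)))
      + (of_real (Bo i \<bullet> Bo j) * (EE p x ^ n * of_real (fo None None k p x)) + of_real (Bo i \<bullet> Bo k) * (EE p x ^ n * of_real (fo None j None p x))
     + of_real (Bo j \<bullet> Bo k) * (EE p x ^ n * of_real (fo i None None p x)))) = dyn.generator_term (fst x) (snd x)" for x
  proof -
    obtain s w where x: "x = (s, w)" by force
    let ?E = "E ?\<epsilon> s w"
    \<comment> \<open>For \<open>n = 0\<close> both sides vanish with the factor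
      \<open>of_nat n\<close>, so the truncated exponent \<open>n - 1\<close> is harmless; otherwise
      one factor \<open>E\<close> recombines with the rotation.\<close>
    have 1: "of_nat n * (EE p x ^ (n - 1) * av.H p x * of_real (fo i j k p x)
       - \<i> * of_real (2 * \<kappa>) * (EE p x ^ n * of_real (fo i j k p x))) =
       (of_nat n * ?E ^ (n - 1) * dE ?\<epsilon> s w) * of_real (Xo i s w) * of_real (Xo j s w) * of_real (Xo k s w)"
      by (cases n) (simp_all add: x av_H EE_def fo_def algebra_simps)
    have 2: "(case i of None \<Rightarrow> 0 | Some i' \<Rightarrow> \<Sum>l\<in>UNIV. of_real (A $ i' $ l) * (EE p x ^ n * of_real (g (Some l) p x))) =
      ?E ^ n * of_real (Ao i s w) * of_real r * of_real r'" if "\<And>l. g (Some l) p x = u s w $ l * (r * r')" for i g r r'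
      using that by (cases i) (simp_all add: x EE_def sum_distrib_left sum_distrib_right mult_ac)
    have 3: "(case i of None \<Rightarrow> 0 | Some i' \<Rightarrow> \<Sum>l\<in>UNIV. of_real (A $ i' $ l) * (EE p x ^ n * of_real (fo (Some l) j k p x))) =
        ?E ^ n * of_real (Ao i s w) * of_real (Xo j s w) * of_real (Xo k s w)"
      by (rule 2[of "\<lambda>l. fo l j k"]) (simp add: fo_def x)
    have 4: "(case j of None \<Rightarrow> 0 | Some i' \<Rightarrow> \<Sum>l\<in>UNIV. of_real (A $ i' $ l) * (EE p x ^ n * of_real (fo i (Some l) k p x))) =
        ?E ^ n * of_real (Ao j s w) * of_real (Xo i s w) * of_real (Xo k s w)"
      by (rule 2[of "\<lambda>l. fo i l k"]) (simp add: fo_def x)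
    have 5: "(case k of None \<Rightarrow> 0 | Some i' \<Rightarrow> \<Sum>l\<in>UNIV. of_real (A $ i' $ l) * (EE p x ^ n * of_real (fo i j (Some l) p x))) =
        ?E ^ n * of_real (Ao k s w) * of_real (Xo i s w) * of_real (Xo j s w)"
      by (rule 2[of "\<lambda>l. fo i j l"]) (simp add: fo_def x)
    show ?thesis
      unfolding 1 3 4 5 dyn.generator_term_def by (simp add: x EE_def fo_def)
  qed
  ultimately show "norm (of_nat n * (av.JH (n - 1) (fo i j k) p - \<i> * of_real (2 * \<kappa>) * av.J n (fo i j k) p)
     + (Jo n i (\<lambda>l. fo l j k) p + Jo n j (\<lambda>l. fo i l k) p + Jo n k (\<lambda>l. fo i j l) p
     + (of_real (Bo i \<bullet> Bo j) * av.J n (fo None None k) p + of_real (Bo i \<bullet> Bo k) * av.J n (fo None j None) p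
     + of_real (Bo j \<bullet> Bo k) * av.J n (fo i None None) p))) \<le> 2 * (cL n ^ 6 * Ku) * (1 / ?T)"
    using bound by (simp add: has_bochner_integral_iff)
qed

sublocale av: averaging_dynkin A "\<lambda>i j. \<beta> i \<bullet> \<beta> j" "2 * \<kappa>" avc avd ave params mu EE uu fst "\<lambda>p. 1 / snd p" Ku
proof
  have f: "fo None None None = (\<lambda>p x. 1)" "\<And>i. fo (Some i) None None = (\<lambda>p x. uu p i x * 1)"
    "\<And>i. fo None (Some i) None = (\<lambda>p x. uu p i x * 1)" "\<And>i. fo None None (Some i) = (\<lambda>p x. uu p i x * 1)"
    "\<And>i j. fo (Some i) (Some j) None = (\<lambda>p x. uu p i x * (uu p j x * 1))"
    "\<And>i j k. fo (Some i) (Some j) (Some k) = (\<lambda>p x. uu p i x * (uu p j x * (uu p k x * 1)))"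
    by (intro ext; simp add: fo_def uu_def)+
  note g = dominated_generator[unfolded Jo_def]
  fix n
  show "dominated params (\<lambda>p. of_nat n * (av.JH (n - 1) (\<lambda>p x. 1) p - \<i> * of_real (2 * \<kappa>) * av.J n (\<lambda>p x. 1) p)) (\<lambda>p. 1 / snd p)"
    using g[of n None None None] by (simp only: f option.case Bo.simps inner_zero_left inner_zero_right of_real_0 mult_zero_left add_0 add_0_right)
  fix i
  show "dominated params (\<lambda>p. of_nat n * (av.JH (n - 1) (\<lambda>p x. uu p i x * 1) p - \<i> * of_real (2 * \<kappa>) * av.J n (\<lambda>p x. uu p i x * 1) p)
      + (\<Sum>l\<in>UNIV. of_real (A $ i $ l) * av.J n (\<lambda>p x. uu p l x * 1) p)) (\<lambda>p. 1 / snd p)"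
    using g[of n "Some i" None None] by (simp only: f option.case Bo.simps inner_zero_left inner_zero_right of_real_0 mult_zero_left add_0 add_0_right)
  fix j
  show "dominated params (\<lambda>p. of_nat n * (av.JH (n - 1) (\<lambda>p x. uu p i x * (uu p j x * 1)) p
        - \<i> * of_real (2 * \<kappa>) * av.J n (\<lambda>p x. uu p i x * (uu p j x * 1)) p)
      + ((\<Sum>l\<in>UNIV. of_real (A $ i $ l) * av.J n (\<lambda>p x. uu p l x * (uu p j x * 1)) p)
      + (\<Sum>l\<in>UNIV. of_real (A $ j $ l) * av.J n (\<lambda>p x. uu p i x * (uu p l x * 1)) p)
      + of_real (\<beta> i \<bullet> \<beta> j) * av.J n (\<lambda>p x. 1) p)) (\<lambda>p. 1 / snd p)"
    using g[of n "Some i" "Some j" None] by (simp only: f option.case Bo.simps inner_zero_left inner_zero_right of_real_0 mult_zero_left add_0 add_0_right)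
  fix k
  show "dominated params (\<lambda>p. of_nat n * (av.JH (n - 1) (\<lambda>p x. uu p i x * (uu p j x * (uu p k x * 1))) p
        - \<i> * of_real (2 * \<kappa>) * av.J n (\<lambda>p x. uu p i x * (uu p j x * (uu p k x * 1))) p)
      + ((\<Sum>l\<in>UNIV. of_real (A $ i $ l) * av.J n (\<lambda>p x. uu p l x * (uu p j x * (uu p k x * 1))) p)
      + (\<Sum>l\<in>UNIV. of_real (A $ j $ l) * av.J n (\<lambda>p x. uu p i x * (uu p l x * (uu p k x * 1))) p)
      + (\<Sum>l\<in>UNIV. of_real (A $ k $ l) * av.J n (\<lambda>p x. uu p i x * (uu p j x * (uu p l x * 1))) p)
      + (of_real (\<beta> i \<bullet> \<beta> j) * av.J n (\<lambda>p x. uu p k x * 1) p + of_real (\<beta> i \<bullet> \<beta> k) * av.J n (\<lambda>p x. uu p j x * 1) p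
      + of_real (\<beta> j \<bullet> \<beta> k) * av.J n (\<lambda>p x. uu p i x * 1) p))) (\<lambda>p. 1 / snd p)"
    using g[of n "Some i" "Some j" "Some k"] by (simp only: f option.case Bo.simps)
qed

end

section \<open>The mean growth rate\<close>

text \<open>The almost sure limit is known for \<open>\<Lambda>\<close>, for which no integrability
  is given, while the means are those of \<open>X\<close>. The two are close in mean, and the
  decomposition \<open>R + Y\<close> with mean of \<open>Y\<close> at most \<open>C / R\<close>
  expresses uniform integrability of \<open>X\<close>.\<close>

lemma (in prob_space) limit_of_means:
  fixes X \<Lambda> D :: "nat \<Rightarrow> 'a \<Rightarrow> real"
  assumes X: "\<And>n. integrable M (X n)" and \<Lambda>: "\<And>n. \<Lambda> n \<in> borel_measurable M"
    and lim: "AE w in M. (\<lambda>n. \<Lambda> n w) \<longlonglongrightarrow> L"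
    and D: "\<And>n. integrable M (D n)" "\<And>n. (\<integral>w. D n w \<partial>M) \<le> d"
    and diff: "\<And>n w. w \<in> space M \<Longrightarrow> \<bar>X n w - \<Lambda> n w\<bar> \<le> D n w / real (Suc n)"
    and ui: "\<And>R n. R > 0 \<Longrightarrow> \<exists>Y. integrable M Y \<and> (\<forall>w\<in>space M. 0 \<le> Y w \<and> \<bar>X n w\<bar> \<le> R + Y w) \<and> (\<integral>w. Y w \<partial>M) \<le> C / R"
  shows "(\<lambda>n. \<integral>w. X n w \<partial>M) \<longlonglongrightarrow> L"
proof (rule LIMSEQ_I)
  fix r :: real assume r: "r > 0"
  define R where "R = 3 * (\<bar>C\<bar> + 1) / r"
  have R: "R > 0" using r by (simp add: R_def)
  have CR: "C / R < r / 3"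
  proof -
    have "C / R \<le> \<bar>C\<bar> / R" using R by (intro divide_right_mono) auto
    also have "\<dots> < (\<bar>C\<bar> + 1) / R" using R by (intro divide_strict_right_mono) auto
    also have "\<dots> = r / 3"
      unfolding R_def using r abs_ge_zero[of C] by (simp add: divide_simps del: abs_ge_zero)
    finally show ?thesis .
  qed
  define Q where "Q = R + \<bar>L\<bar>"
  have Q: "Q > 0" using R by (simp add: Q_def)
  \<comment> \<open>Truncation makes the deviation of \<open>\<Lambda>\<close> from its limit
    bounded, so that dominated convergence applies.\<close>
  define m where "m n w = min \<bar>\<Lambda> n w - L\<bar> Q" for n w
  have mm: "m n \<in> borel_measurable M" for n unfolding m_def[abs_def] using \<Lambda> by measurable
  have mb: "\<bar>m n w\<bar> \<le> Q" for n w using Q by (auto simp: m_def)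
  have im: "integrable M (m n)" for n
    by (rule integrable_const_bound[where B=Q]) (use mm mb in auto)
  have "(\<lambda>n. \<integral>w. m n w \<partial>M) \<longlonglongrightarrow> (\<integral>w. 0 \<partial>M)"
  proof (rule integral_dominated_convergence[where w="\<lambda>_. Q"])
    show "AE w in M. (\<lambda>n. m n w) \<longlonglongrightarrow> 0"
      using lim
    proof eventually_elim
      case (elim w)
      have "(\<lambda>n. m n w) \<longlonglongrightarrow> min \<bar>L - L\<bar> Q" unfolding m_def by (intro tendsto_intros elim)
      then show ?case using Q by simp
    qed
  qed (use mm mb in auto)
  then have "\<forall>\<^sub>F n in sequentially. (\<integral>w. m n w \<partial>M) < r / 3"
    using order_tendstoD(2)[of _ 0 sequentially "r / 3"] r by simp
  moreover have "\<forall>\<^sub>F n in sequentially. d / real (Suc n) < r / 3"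
  proof -
    have "(\<lambda>n. d * inverse (real (Suc n))) \<longlonglongrightarrow> d * 0" by (intro tendsto_mult tendsto_const LIMSEQ_inverse_real_of_nat)
    then have "(\<lambda>n. d * inverse (real (Suc n))) \<longlonglongrightarrow> 0" by (simp only: mult_zero_right)
    then show ?thesis unfolding divide_inverse by (rule order_tendstoD(2)) (use r in simp)
  qed
  ultimately have "\<forall>\<^sub>F n in sequentially. norm ((\<integral>w. X n w \<partial>M) - L) < r"
  proof eventually_elim
    case (elim n)
    obtain Y where Y: "integrable M Y" "\<And>w. w \<in> space M \<Longrightarrow> 0 \<le> Y w" "\<And>w. w \<in> space M \<Longrightarrow> \<bar>X n w\<bar> \<le> R + Y w"
      "(\<integral>w. Y w \<partial>M) \<le> C / R" using ui[OF R, of n] by blast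
    have "(\<integral>w. X n w \<partial>M) - L = (\<integral>w. X n w - L \<partial>M)" using X by (simp add: prob_space)
    also have "norm \<dots> \<le> (\<integral>w. norm (X n w - L) \<partial>M)" by (rule integral_norm_bound)
    also have "\<dots> \<le> (\<integral>w. m n w + (Y w + D n w / real (Suc n)) \<partial>M)"
    proof (rule integral_mono)
      fix w assume w: "w \<in> space M"
      have D0: "D n w / real (Suc n) \<ge> 0" using diff[OF w, of n] by (rule order.trans[OF abs_ge_zero])
      show "norm (X n w - L) \<le> m n w + (Y w + D n w / real (Suc n))"
      \<comment> \<open>Either the truncation is inactive and the deviation of \<open>X\<close> is
        that of \<open>\<Lambda>\<close> up to \<open>D\<close>, or \<open>m\<close> equals
        \<open>R + \<bar>L\<bar>\<close>, which together with \<open>Y\<close> exceeds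
        \<open>\<bar>X\<bar> + \<bar>L\<bar>\<close>.\<close>
      proof (cases "\<bar>\<Lambda> n w - L\<bar> \<le> Q")
        case True
        then show ?thesis using diff[OF w, of n] Y(2)[OF w] by (simp add: m_def min_def del: of_nat_Suc)
      next
        case False
        then show ?thesis using Y(3)[OF w] D0 by (simp add: m_def min_def Q_def del: of_nat_Suc)
      qed
    qed (use X im Y D in auto)
    also have "\<dots> = (\<integral>w. m n w \<partial>M) + ((\<integral>w. Y w \<partial>M) + (\<integral>w. D n w \<partial>M) / real (Suc n))"
      using im Y D by simp
    also have "\<dots> < r / 3 + (r / 3 + r / 3)"
    proof -
      have "(\<integral>w. D n w \<partial>M) / real (Suc n) \<le> d / real (Suc n)" by (intro divide_right_mono D) auto
      then show ?thesis using elim Y(4) CR by linarith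
    qed
    finally show ?case by simp
  qed
  then show "\<exists>n0. \<forall>n\<ge>n0. norm ((\<integral>w. X n w \<partial>M) - L) < r" by (simp add: eventually_sequentially)
qed

section \<open>The growth rate as a function of the angle and of \<open>u\<close>\<close>

context oscillator
begin

definition lnrate :: "real \<Rightarrow> real \<Rightarrow> 'w \<Rightarrow> real" where
  "lnrate \<epsilon> s w = Re (pc \<epsilon> s w + qc \<epsilon> s w * E \<epsilon> s w)"

lemma lnrate_adapted: "continuous_adapted M F (lnrate \<epsilon>)"
proof -
  have "continuous_adapted M F (\<lambda>s w. pc \<epsilon> s w + qc \<epsilon> s w * E \<epsilon> s w)"
    by (intro continuous_adapted_add continuous_adapted_mult pc_adapted qc_adapted E_adapted)
  then show ?thesis
    unfolding lnrate_def[abs_def] by (rule continuous_adapted_compose) (intro continuous_intros)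
qed

lemma continuous_on_lnrate: "w \<in> space M \<Longrightarrow> continuous_on {0..T} (\<lambda>s. lnrate \<epsilon> s w)"
  by (rule continuous_on_subset[OF continuous_adaptedD(2)[OF lnrate_adapted]]) auto

lemma ln_norm_y_eq:
  assumes "w \<in> space M" "T \<ge> 0"
  shows "ln (norm (y \<epsilon> T w)) = (\<integral>s. lnrate \<epsilon> s w \<partial>time_measure T)"
  using ln_norm_y[OF assms, of \<epsilon>] lebesgue_integral_time[OF continuous_on_lnrate[OF assms(1)], of T \<epsilon>]
  by (simp add: lnrate_def integral_unique)

definition cf :: real where
  "cf = \<bar>\<zeta>\<bar> + 1 + ((\<Sum>i\<in>UNIV. \<bar>av i\<bar>) + 1 + \<zeta>\<^sup>2) / (2 * \<kappa>)"

lemma abs_lnrate_le: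
  assumes "0 \<le> \<epsilon>" "\<epsilon> \<le> 1" "w \<in> space M" "s \<ge> 0"
  shows "\<bar>lnrate \<epsilon> s w\<bar> \<le> cf * (SS s w)\<^sup>2"
proof -
  let ?A = "(\<Sum>i\<in>UNIV. \<bar>av i\<bar>) + 1 + \<zeta>\<^sup>2"
  have S21: "1 \<le> (SS s w)\<^sup>2" using SS1[of s w] by (simp add: one_le_power)
  have SS2: "SS s w \<le> (SS s w)\<^sup>2" using SS1[of s w] by (simp add: power2_eq_square)
  have "\<bar>lnrate \<epsilon> s w\<bar> \<le> \<bar>Re (pc \<epsilon> s w)\<bar> + \<bar>Re (qc \<epsilon> s w * E \<epsilon> s w)\<bar>"
    by (simp add: lnrate_def)
  also have "\<bar>Re (pc \<epsilon> s w)\<bar> \<le> \<bar>\<zeta>\<bar> * (SS s w)\<^sup>2"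
  proof -
    have "\<bar>Re (pc \<epsilon> s w)\<bar> \<le> 1 * \<bar>\<zeta>\<bar>"
      unfolding pc_def complex.sel abs_minus_cancel abs_mult using assms by (intro mult_right_mono) (auto simp: power_le_one)
    also have "\<dots> \<le> (SS s w)\<^sup>2 * \<bar>\<zeta>\<bar>" using S21 by (intro mult_right_mono) auto
    finally show ?thesis by (simp add: mult.commute)
  qed
  also have "\<bar>Re (qc \<epsilon> s w * E \<epsilon> s w)\<bar> \<le> norm (qc \<epsilon> s w)"
    using abs_Re_le_cmod[of "qc \<epsilon> s w * E \<epsilon> s w"] norm_E[OF assms(3,4)] by (simp add: norm_mult)
  also have "\<dots> \<le> \<bar>\<epsilon> * u s w $ nz\<bar> + \<bar>be \<epsilon> s w / (2 * \<kappa>)\<bar>"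
    using cmod_le[of "qc \<epsilon> s w"] by (simp add: qc_def)
  also have "\<bar>\<epsilon> * u s w $ nz\<bar> \<le> 1 * (SS s w)\<^sup>2"
    unfolding abs_mult using assms u_le_SS[of s w nz] SS2 by (intro mult_mono) auto
  also have "\<bar>be \<epsilon> s w / (2 * \<kappa>)\<bar> \<le> ?A * (SS s w)\<^sup>2 / (2 * \<kappa>)"
    using abs_be_le[OF assms(1,2), of s w] \<kappa> by (simp add: abs_divide divide_right_mono)
  finally show ?thesis by (simp add: cf_def algebra_simps)
qed

text \<open>Linear coefficients of the growth rate: the first term stems from \<open>be\<close>, the
  second from the shear. The quadratic ones, in \<open>lq\<close>, stem from the square of
  \<open>z\<close> in \<open>be\<close>.\<close>

definition ll :: "'n \<Rightarrow> complex" where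
  "ll k = \<i> * of_real (av k) / of_real (2 * \<kappa>) - of_bool (k = nz)"

definition lq :: "'n \<Rightarrow> 'n \<Rightarrow> complex" where
  "lq k l = of_bool (k = nz) * (of_bool (l = nz) * (- \<i> / of_real (2 * \<kappa>)))"

lemma lnrate_expand:
  "lnrate \<epsilon> s w = - (\<epsilon>\<^sup>2 * \<zeta>) + Re (of_real \<epsilon> * (\<Sum>k\<in>UNIV. ll k * (E \<epsilon> s w * of_real (u s w $ k)))
     + of_real (\<epsilon>\<^sup>2) * (\<Sum>k\<in>UNIV. \<Sum>l\<in>UNIV. lq k l * (E \<epsilon> s w * of_real (u s w $ k * u s w $ l)))
     + of_real (\<epsilon> ^ 4) * (\<i> * of_real (\<zeta>\<^sup>2 / (2 * \<kappa>)) * E \<epsilon> s w))"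
proof -
  let ?E = "E \<epsilon> s w" and ?z = "of_real (u s w $ nz) :: complex" and ?i = "\<i> / of_real (2 * \<kappa>)"
  have 1: "(\<Sum>k\<in>UNIV. ll k * (?E * of_real (u s w $ k))) = ?E * (?i * of_real (al s w) - ?z)"
  proof -
    have "(\<Sum>k\<in>UNIV. ll k * (?E * of_real (u s w $ k))) =
      (\<Sum>k\<in>UNIV. ?E * (?i * of_real (av k * u s w $ k))) - (\<Sum>k\<in>UNIV. (?E * of_real (u s w $ k)) * of_bool (k = nz))"
      by (simp add: ll_def algebra_simps sum_subtractf)
    then show ?thesis
      unfolding sum_of_bool_right by (simp add: al_def sum_distrib_left algebra_simps)
  qed
  have 2: "(\<Sum>k\<in>UNIV. \<Sum>l\<in>UNIV. lq k l * (?E * of_real (u s w $ k * u s w $ l))) = - ?i * (?E * ?z\<^sup>2)"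
  proof -
    have "(\<Sum>k\<in>UNIV. \<Sum>l\<in>UNIV. lq k l * (?E * of_real (u s w $ k * u s w $ l))) =
      (\<Sum>k\<in>UNIV. (\<Sum>l\<in>UNIV. (- ?i * (?E * of_real (u s w $ k * u s w $ l))) * of_bool (l = nz)) * of_bool (k = nz))"
      by (simp add: lq_def sum_distrib_left sum_distrib_right mult_ac)
    then show ?thesis unfolding sum_of_bool_right by (simp add: power2_eq_square)
  qed
  have q: "qc \<epsilon> s w = - of_real (\<epsilon> * u s w $ nz) + ?i * of_real (be \<epsilon> s w)"
    by (simp add: qc_def complex_eq_iff Re_divide Im_divide power2_eq_square)
  have "qc \<epsilon> s w * ?E = of_real \<epsilon> * (?E * (?i * of_real (al s w) - ?z)) + of_real (\<epsilon>\<^sup>2) * (- ?i * (?E * ?z\<^sup>2))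
     + of_real (\<epsilon> ^ 4) * (\<i> * of_real (\<zeta>\<^sup>2 / (2 * \<kappa>)) * ?E)"
    unfolding q be_def by (simp add: algebra_simps)
  then show ?thesis unfolding lnrate_def 1 2 by (simp add: pc_def)
qed

lemma integrable_lnrate:
  assumes p: "p \<in> params"
  shows "integrable (time_measure (snd p) \<Otimes>\<^sub>M M) (\<lambda>x. lnrate (fst p) (fst x) (snd x))"
proof (rule integrable_time_space[where D="\<lambda>s w. cf * SS s w ^ 6" and K="cf * Ku"])
  have cf: "cf \<ge> 0" using \<kappa> by (simp add: cf_def sum_nonneg)
  show "(\<lambda>x. lnrate (fst p) (fst x) (snd x)) \<in> borel_measurable (time_measure (snd p) \<Otimes>\<^sub>M M)"
    by (rule continuous_adapted_joint_restrict[OF lnrate_adapted])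
  fix s assume s: "s \<in> {0..snd p}"
  show "integrable M (\<lambda>w. cf * SS s w ^ 6)" using Ku(2)[of s] s by auto
  show "(\<integral>w. cf * SS s w ^ 6 \<partial>M) \<le> cf * Ku" using Ku(3)[of s] s cf by (simp add: mult_left_mono)
  fix w assume w: "w \<in> space M"
  have "\<bar>lnrate (fst p) s w\<bar> \<le> cf * (SS s w)\<^sup>2" by (rule abs_lnrate_le) (use paramsD[OF p] w s in auto)
  also have "\<dots> \<le> cf * SS s w ^ 6" using cf SS1[of s w] by (intro mult_left_mono power_increasing) auto
  finally show "norm (lnrate (fst p) (fst (s, w)) (snd (s, w))) \<le> cf * SS s w ^ 6" by simp
qed

lemma mean_ln_norm_y:
  assumes p: "p \<in> params"
  shows "integrable M (\<lambda>w. ln (norm (y (fst p) (snd p) w)) / snd p)"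
    and "(\<integral>w. ln (norm (y (fst p) (snd p) w)) / snd p \<partial>M) = (\<integral>x. lnrate (fst p) (fst x) (snd x) \<partial>mu p)"
proof -
  interpret T: finite_measure "time_measure (snd p)" by (rule finite_measure_time)
  interpret P: pair_sigma_finite "time_measure (snd p)" M ..
  note i = integrable_lnrate[OF p]
  have T: "snd p \<ge> 0" by (rule paramsD(4)[OF p])
  have "integrable M (\<lambda>w. \<integral>s. lnrate (fst p) s w \<partial>time_measure (snd p))"
    using P.integrable_snd[of "\<lambda>s w. lnrate (fst p) s w"] i by (simp add: split_def)
  then show "integrable M (\<lambda>w. ln (norm (y (fst p) (snd p) w)) / snd p)"
    by (subst Bochner_Integration.integrable_cong[OF refl, where g="\<lambda>w. (\<integral>s. lnrate (fst p) s w \<partial>time_measure (snd p)) / snd p"])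
       (auto simp: ln_norm_y_eq[OF _ T])
  have "(\<integral>w. ln (norm (y (fst p) (snd p) w)) / snd p \<partial>M) = (\<integral>w. (\<integral>s. lnrate (fst p) s w \<partial>time_measure (snd p)) / snd p \<partial>M)"
    by (rule Bochner_Integration.integral_cong[OF refl]) (simp add: ln_norm_y_eq[OF _ T])
  also have "\<dots> = (\<integral>w. (\<integral>s. lnrate (fst p) s w \<partial>time_measure (snd p)) \<partial>M) / snd p" by simp
  also have "(\<integral>w. (\<integral>s. lnrate (fst p) s w \<partial>time_measure (snd p)) \<partial>M) = (\<integral>x. lnrate (fst p) (fst x) (snd x) \<partial>(time_measure (snd p) \<Otimes>\<^sub>M M))"
    using P.integral_snd[of "\<lambda>s w. lnrate (fst p) s w"] i by (simp add: split_def)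
  also have "\<dots> / snd p = (\<integral>x. lnrate (fst p) (fst x) (snd x) \<partial>mu p)"
    by (subst integral_mu[OF p]) (use i in auto)
  finally show "(\<integral>w. ln (norm (y (fst p) (snd p) w)) / snd p \<partial>M) = (\<integral>x. lnrate (fst p) (fst x) (snd x) \<partial>mu p)" .
qed

lemma mu_prob:
  assumes p: "p \<in> params"
  shows "av.J0 0 p = 1" "(\<integral>x. (c::real) \<partial>mu p) = c" "integrable (mu p) (\<lambda>x. c)"
proof -
  interpret T: finite_measure "time_measure (snd p)" by (rule finite_measure_time)
  interpret P: pair_sigma_finite "time_measure (snd p)" M ..
  have T: "snd p \<ge> 1" by (rule paramsD(3)[OF p])
  interpret TM: finite_measure "time_measure (snd p) \<Otimes>\<^sub>M M"
    by (rule finite_measure_pair_measure) (unfold_locales)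
  have i: "integrable (time_measure (snd p) \<Otimes>\<^sub>M M) (\<lambda>x. c)" for c :: real by simp
  have one: "(\<integral>x. c \<partial>mu p) = c" for c :: real
  proof -
    have "(\<integral>x. c \<partial>(time_measure (snd p) \<Otimes>\<^sub>M M)) = (\<integral>s. (\<integral>w. c \<partial>M) \<partial>time_measure (snd p))"
      using P.integral_fst'[OF i[of c]] by (simp only:)
    also have "\<dots> = snd p * c" using T by (simp add: prob_space measure_restrict_space space_restrict_space)
    finally show ?thesis using T by (subst integral_mu[OF p]) auto
  qed
  show "(\<integral>x. c \<partial>mu p) = c" by (rule one)
  show "integrable (mu p) (\<lambda>x. c)" by (rule integrable_mu[OF p i])
  have "av.J0 0 p = (\<integral>x. of_real 1 \<partial>mu p)" unfolding av.J_def by (simp only: power_0 of_real_1 mult_1)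
  also have "\<dots> = of_real (\<integral>x. 1 \<partial>mu p)" by (rule integral_complex_of_real)
  finally show "av.J0 0 p = 1" unfolding one by (simp only: of_real_1)
qed

lemma mean_lnrate:
  assumes p: "p \<in> params"
  shows "(\<integral>x. lnrate (fst p) (fst x) (snd x) \<partial>mu p) = - ((fst p)\<^sup>2 * \<zeta>)
     + Re (of_real (fst p) * (\<Sum>k\<in>UNIV. ll k * av.J1 1 k p)
     + of_real (fst p ^ 2) * (\<Sum>k\<in>UNIV. \<Sum>l\<in>UNIV. lq k l * av.J2 1 k l p)
     + of_real (fst p ^ 4) * (\<i> * of_real (\<zeta>\<^sup>2 / (2 * \<kappa>)) * av.J0 1 p))"
proof -
  have i0: "has_bochner_integral (mu p) (\<lambda>x. EE p x ^ 1 * of_real 1) (av.J0 1 p)"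
    unfolding av.J_def by (rule has_bochner_integral_integrable[OF av.integrable_J(1)[OF av.admissible_1 _ p]]) simp
  have i1: "has_bochner_integral (mu p) (\<lambda>x. EE p x ^ 1 * of_real (uu p k x * 1)) (av.J1 1 k p)" for k
    unfolding av.J_def by (rule has_bochner_integral_integrable[OF av.integrable_J(1)[OF av.adm(1) _ p]]) simp
  have i2: "has_bochner_integral (mu p) (\<lambda>x. EE p x ^ 1 * of_real (uu p k x * (uu p l x * 1))) (av.J2 1 k l p)" for k l
    unfolding av.J_def by (rule has_bochner_integral_integrable[OF av.integrable_J(1)[OF av.adm(2) _ p]]) simp
  have c: "has_bochner_integral (mu p) (\<lambda>x. - ((fst p)\<^sup>2 * \<zeta>)) (- ((fst p)\<^sup>2 * \<zeta>))"
    using mu_prob(2,3)[OF p, of "- ((fst p)\<^sup>2 * \<zeta>)"] by (simp only: has_bochner_integral_iff)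
  have "has_bochner_integral (mu p) (\<lambda>x. - ((fst p)\<^sup>2 * \<zeta>) + Re (of_real (fst p) * (\<Sum>k\<in>UNIV. ll k * (EE p x ^ 1 * of_real (uu p k x * 1)))
     + of_real (fst p ^ 2) * (\<Sum>k\<in>UNIV. \<Sum>l\<in>UNIV. lq k l * (EE p x ^ 1 * of_real (uu p k x * (uu p l x * 1))))
     + of_real (fst p ^ 4) * (\<i> * of_real (\<zeta>\<^sup>2 / (2 * \<kappa>)) * (EE p x ^ 1 * of_real 1))))
     (- ((fst p)\<^sup>2 * \<zeta>)
     + Re (of_real (fst p) * (\<Sum>k\<in>UNIV. ll k * av.J1 1 k p)
     + of_real (fst p ^ 2) * (\<Sum>k\<in>UNIV. \<Sum>l\<in>UNIV. lq k l * av.J2 1 k l p)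
     + of_real (fst p ^ 4) * (\<i> * of_real (\<zeta>\<^sup>2 / (2 * \<kappa>)) * av.J0 1 p)))"
    by (intro has_bochner_integral_add c has_bochner_integral_Re has_bochner_integral_mult_right has_bochner_integral_sum i0 i1 i2)
  moreover have "lnrate (fst p) (fst x) (snd x) = - ((fst p)\<^sup>2 * \<zeta>) + Re (of_real (fst p) * (\<Sum>k\<in>UNIV. ll k * (EE p x ^ 1 * of_real (uu p k x * 1)))
     + of_real (fst p ^ 2) * (\<Sum>k\<in>UNIV. \<Sum>l\<in>UNIV. lq k l * (EE p x ^ 1 * of_real (uu p k x * (uu p l x * 1))))
     + of_real (fst p ^ 4) * (\<i> * of_real (\<zeta>\<^sup>2 / (2 * \<kappa>)) * (EE p x ^ 1 * of_real 1)))" for x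
    unfolding lnrate_expand by (simp add: EE_def uu_def)
  ultimately show ?thesis by (simp only: has_bochner_integral_iff)
qed

text \<open>The averaged drift supplies the coefficient; the last term of \<open>be\<close> enters
  the growth rate at order \<open>\<epsilon> ^ 4\<close> with bounded mean and joins the
  remainder.\<close>

theorem mean_growth_rate:
  assumes R: "\<And>i j. (\<Sum>l\<in>UNIV. A $ i $ l * R l j) + (\<Sum>l\<in>UNIV. A $ j $ l * R i l) + \<beta> i \<bullet> \<beta> j = 0"
    and m: "\<And>k. (\<Sum>l\<in>UNIV. m l * of_real (A $ l $ k)) - \<i> * of_real (2 * \<kappa>) * m k = - ll k"
  shows "\<exists>C\<ge>0. \<forall>p\<in>params. \<bar>(\<integral>w. ln (norm (y (fst p) (snd p) w)) / snd p \<partial>M)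
     - (fst p)\<^sup>2 * (- \<zeta> + Re (\<Sum>k\<in>UNIV. \<Sum>i\<in>UNIV. avc 0 k * m i * of_real (R k i)))\<bar> \<le> C * (fst p ^ 4 + 1 / snd p)"
proof -
  let ?g = "\<lambda>p. fst p ^ 4 + 1 / snd p"
  let ?c = "\<Sum>k\<in>UNIV. \<Sum>i\<in>UNIV. avc 0 k * m i * of_real (R k i)"
  have 1: "dominated params (\<lambda>p. of_real (fst p) * (\<Sum>k\<in>UNIV. ll k * av.J1 1 k p)
     + of_real (fst p ^ 2) * (\<Sum>k\<in>UNIV. \<Sum>l\<in>UNIV. lq k l * av.J2 1 k l p) - of_real (fst p ^ 2) * ?c) ?g"
    by (rule av.averaged_drift[OF R mu_prob(1) m])
  have "dominated params (\<lambda>p. of_real (fst p ^ 4) * (\<i> * of_real (\<zeta>\<^sup>2 / (2 * \<kappa>)) * av.J0 1 p)) (\<lambda>p. fst p ^ 4 * 1)"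
    by (intro dominated_mult_real dominated_cmult av.dominated_J[OF av.admissible_1]) (auto dest: paramsD)
  then have "dominated params (\<lambda>p. of_real (fst p ^ 4) * (\<i> * of_real (\<zeta>\<^sup>2 / (2 * \<kappa>)) * av.J0 1 p)) ?g"
    by (rule dominated_mono[where c=1]) (auto dest: paramsD(4))
  from dominated_add[OF 1 this] obtain C where C: "C \<ge> 0" "\<And>p. p \<in> params \<Longrightarrow> norm (of_real (fst p) * (\<Sum>k\<in>UNIV. ll k * av.J1 1 k p)
     + of_real (fst p ^ 2) * (\<Sum>k\<in>UNIV. \<Sum>l\<in>UNIV. lq k l * av.J2 1 k l p) - of_real (fst p ^ 2) * ?c
     + of_real (fst p ^ 4) * (\<i> * of_real (\<zeta>\<^sup>2 / (2 * \<kappa>)) * av.J0 1 p)) \<le> C * ?g p"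
    unfolding dominated_def by blast
  have "\<bar>(\<integral>w. ln (norm (y (fst p) (snd p) w)) / snd p \<partial>M) - (fst p)\<^sup>2 * (- \<zeta> + Re ?c)\<bar> \<le> C * ?g p" if p: "p \<in> params" for p
  proof -
    let ?r = "of_real (fst p) * (\<Sum>k\<in>UNIV. ll k * av.J1 1 k p)
     + of_real (fst p ^ 2) * (\<Sum>k\<in>UNIV. \<Sum>l\<in>UNIV. lq k l * av.J2 1 k l p)" and
      ?s = "of_real (fst p ^ 4) * (\<i> * of_real (\<zeta>\<^sup>2 / (2 * \<kappa>)) * av.J0 1 p)"
    have "(\<integral>w. ln (norm (y (fst p) (snd p) w)) / snd p \<partial>M) - (fst p)\<^sup>2 * (- \<zeta> + Re ?c) = Re (?r + ?s) - Re (of_real (fst p ^ 2) * ?c)"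
      unfolding mean_ln_norm_y(2)[OF p] mean_lnrate[OF p] by (simp add: algebra_simps)
    also have "\<dots> = Re (?r - of_real (fst p ^ 2) * ?c + ?s)" by simp
    also have "\<bar>\<dots>\<bar> \<le> C * ?g p" by (rule order.trans[OF abs_Re_le_cmod C(2)[OF p]])
    finally show ?thesis .
  qed
  with C(1) show ?thesis by blast
qed

end

section \<open>The Lyapunov exponent\<close>

context oscillator
begin

section \<open>Position and velocity recovered from \<open>y\<close>\<close>

definition pos :: "real \<Rightarrow> real \<Rightarrow> 'w \<Rightarrow> real" where
  "pos \<epsilon> s w = Im (y \<epsilon> s w) / \<kappa>"

definition shear :: "real \<Rightarrow> real \<Rightarrow> 'w \<Rightarrow> real" where
  "shear \<epsilon> s w = \<epsilon> * u s w $ nz - \<epsilon>\<^sup>2 * \<zeta>"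

definition vel :: "real \<Rightarrow> real \<Rightarrow> 'w \<Rightarrow> real" where
  "vel \<epsilon> s w = Re (y \<epsilon> s w) + shear \<epsilon> s w * pos \<epsilon> s w"

lemma pos_adapted: "continuous_adapted M F (pos \<epsilon>)"
  unfolding pos_def[abs_def]
  by (rule continuous_adapted_compose[OF y_adapted]) (use \<kappa> in \<open>intro continuous_intros, simp\<close>)

lemma shear_adapted: "continuous_adapted M F (shear \<epsilon>)"
  unfolding shear_def[abs_def]
  by (intro continuous_adapted_diff continuous_adapted_mult continuous_adapted_const u_component_adapted)

lemma vel_adapted: "continuous_adapted M F (vel \<epsilon>)"
proof -
  have "continuous_adapted M F (\<lambda>s w. Re (y \<epsilon> s w))"
    by (rule continuous_adapted_compose[OF y_adapted]) (intro continuous_intros)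
  then show ?thesis unfolding vel_def[abs_def]
    by (intro continuous_adapted_add continuous_adapted_mult shear_adapted pos_adapted)
qed

lemma pos_0: "w \<in> space M \<Longrightarrow> pos \<epsilon> 0 w = 0" and vel_0: "w \<in> space M \<Longrightarrow> vel \<epsilon> 0 w = 1"
  by (simp_all add: pos_def vel_def y_0)

lemma y_components: "Re (y \<epsilon> s w) = vel \<epsilon> s w - shear \<epsilon> s w * pos \<epsilon> s w" "Im (y \<epsilon> s w) = \<kappa> * pos \<epsilon> s w"
  using \<kappa> by (simp_all add: vel_def pos_def)

lemma Im_dy: "Im (dy \<epsilon> s w) = \<kappa> * vel \<epsilon> s w"
  using \<kappa> by (simp add: dy_def pc_def qc_def y_components shear_def field_simps)

lemma Re_dy: "Re (dy \<epsilon> s w) = - (\<epsilon>\<^sup>2 * \<zeta> + \<epsilon> * u s w $ nz) * (vel \<epsilon> s w - shear \<epsilon> s w * pos \<epsilon> s w)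
    - \<kappa>\<^sup>2 * pos \<epsilon> s w + be \<epsilon> s w * pos \<epsilon> s w"
  using \<kappa> by (simp add: dy_def pc_def qc_def y_components field_simps power2_eq_square)

lemma pos_deriv:
  assumes "w \<in> space M" "s \<in> {0..T}"
  shows "((\<lambda>s. pos \<epsilon> s w) has_vector_derivative vel \<epsilon> s w) (at s within {0..T})"
proof -
  have "((\<lambda>s. Im (y \<epsilon> s w) / \<kappa>) has_vector_derivative Im (dy \<epsilon> s w) / \<kappa>) (at s within {0..T})"
    by (intro has_vector_derivative_divide bounded_linear.has_vector_derivative[OF bounded_linear_Im] y_deriv assms)
  then show ?thesis using \<kappa> by (simp add: pos_def Im_dy)
qed

lemma pos_eq:
  assumes "w \<in> space M" "t \<ge> 0"
  shows "pos \<epsilon> t w = pos \<epsilon> 0 w + integral {0..t} (\<lambda>s. vel \<epsilon> s w)"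
  using fundamental_theorem_of_calculus[OF assms(2) pos_deriv[OF assms(1)], of \<epsilon>] by (simp add: integral_unique)

text \<open>Subtracting \<open>\<epsilon> (\<beta> nz \<bullet> (W s - W 0)) \<phi>\<close> from the velocity removes its noise and leaves a path
  of class \<open>C\<^sup>1\<close>.\<close>

lemma vel_eq:
  assumes A_nz: "\<And>l. A $ nz $ l = - of_bool (l = nz)" and w: "w \<in> space M" and t: "t \<ge> 0"
  shows "vel \<epsilon> t w = vel \<epsilon> 0 w
    + integral {0..t} (\<lambda>s. - 2 * \<epsilon>\<^sup>2 * \<zeta> * vel \<epsilon> s w - (\<kappa>\<^sup>2 - \<epsilon> * (al s w - u s w $ nz)) * pos \<epsilon> s w)
    + \<epsilon> * (pos \<epsilon> t w * (\<beta> nz \<bullet> (W t w - W 0 w)) - integral {0..t} (\<lambda>s. vel \<epsilon> s w * (\<beta> nz \<bullet> (W s w - W 0 w))))"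
proof -
  define N where "N s = \<beta> nz \<bullet> (W s w - W 0 w)" for s
  define G where "G s = - 2 * \<epsilon>\<^sup>2 * \<zeta> * vel \<epsilon> s w - (\<kappa>\<^sup>2 - \<epsilon> * (al s w - u s w $ nz)) * pos \<epsilon> s w" for s
  have cont: "continuous_on {0..t} (\<lambda>s. Z s w)" if "continuous_adapted M F Z" for Z :: "real \<Rightarrow> 'w \<Rightarrow> real"
    by (rule continuous_on_subset[OF continuous_adaptedD(2)[OF that w]]) auto
  have cW: "continuous_on {0..t} (\<lambda>s. W s w)"
    by (rule continuous_on_subset[OF continuous_adaptedD(2)[OF W_adapted w]]) auto
  have iG: "G integrable_on {0..t}"
    unfolding G_def by (intro integrable_continuous_real continuous_intros cont vel_adapted al_adapted u_component_adapted pos_adapted)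
  have iN: "(\<lambda>s. vel \<epsilon> s w * N s) integrable_on {0..t}"
    unfolding N_def by (intro integrable_continuous_real continuous_intros cont vel_adapted cW)
  have "((\<lambda>s. Re (y \<epsilon> s w) + (\<epsilon> * (u s w $ nz - N s) - \<epsilon>\<^sup>2 * \<zeta>) * pos \<epsilon> s w) has_vector_derivative G s - \<epsilon> * (vel \<epsilon> s w * N s))
      (at s within {0..t})" if s: "s \<in> {0..t}" for s
  proof -
    have "((\<lambda>s. u s w $ nz - N s) has_vector_derivative - (u s w $ nz)) (at s within {0..t})"
    proof (rule has_vector_derivative_primitive[OF w _ _ s, where z=0])
      show "continuous_adapted M F (\<lambda>s w. - (u s w $ nz))"
        by (rule continuous_adapted_compose[OF u_component_adapted]) (intro continuous_intros)
      show "u s w $ nz - N s = 0 + integral {0..s} (\<lambda>r. - (u r w $ nz))" if "s \<ge> 0" for s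
      proof -
        have "(\<Sum>l\<in>UNIV. A $ nz $ l * u r w $ l) = - (u r w $ nz)" for r
          unfolding A_nz using sum_of_bool_right[of "\<lambda>l. u r w $ l" nz] by (simp add: sum_negf mult.commute)
        then show ?thesis using u_eq[OF w that, of nz] by (simp add: N_def)
      qed
    qed
    then have "((\<lambda>s. \<epsilon> * (u s w $ nz - N s) - \<epsilon>\<^sup>2 * \<zeta>) has_vector_derivative \<epsilon> * (- (u s w $ nz)) - 0) (at s within {0..t})"
      by (intro has_vector_derivative_diff has_vector_derivative_mult_right has_vector_derivative_const)
    from has_vector_derivative_add[OF bounded_linear.has_vector_derivative[OF bounded_linear_Re y_deriv[OF w s, of \<epsilon>]]
      has_vector_derivative_mult[OF this pos_deriv[OF w s, of \<epsilon>]]]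
    have d: "((\<lambda>s. Re (y \<epsilon> s w) + (\<epsilon> * (u s w $ nz - N s) - \<epsilon>\<^sup>2 * \<zeta>) * pos \<epsilon> s w) has_vector_derivative
      Re (dy \<epsilon> s w) + ((\<epsilon> * (u s w $ nz - N s) - \<epsilon>\<^sup>2 * \<zeta>) * vel \<epsilon> s w + (\<epsilon> * (- (u s w $ nz)) - 0) * pos \<epsilon> s w)) (at s within {0..t})" .
    have eq: "Re (dy \<epsilon> s w) + ((\<epsilon> * (u s w $ nz - N s) - \<epsilon>\<^sup>2 * \<zeta>) * vel \<epsilon> s w + (\<epsilon> * (- (u s w $ nz)) - 0) * pos \<epsilon> s w)
        = G s - \<epsilon> * (vel \<epsilon> s w * N s)"
      unfolding Re_dy G_def shear_def be_def by algebra
    show ?thesis using d unfolding eq .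
  qed
  from fundamental_theorem_of_calculus[OF t this]
  have "((\<lambda>s. G s - \<epsilon> * (vel \<epsilon> s w * N s)) has_integral
      (Re (y \<epsilon> t w) + (\<epsilon> * (u t w $ nz - N t) - \<epsilon>\<^sup>2 * \<zeta>) * pos \<epsilon> t w) - 1) {0..t}"
    using pos_0[OF w, of \<epsilon>] y_0[OF w, of \<epsilon>] by simp
  moreover have "((\<lambda>s. G s - \<epsilon> * (vel \<epsilon> s w * N s)) has_integral integral {0..t} G - \<epsilon> * integral {0..t} (\<lambda>s. vel \<epsilon> s w * N s)) {0..t}"
    by (intro has_integral_diff has_integral_mult_right integrable_integral iG iN)
  ultimately have "(Re (y \<epsilon> t w) + (\<epsilon> * (u t w $ nz - N t) - \<epsilon>\<^sup>2 * \<zeta>) * pos \<epsilon> t w) - 1 =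
      integral {0..t} G - \<epsilon> * integral {0..t} (\<lambda>s. vel \<epsilon> s w * N s)" by (rule has_integral_unique)
  then have "vel \<epsilon> t w = 1 + integral {0..t} G + \<epsilon> * (pos \<epsilon> t w * N t - integral {0..t} (\<lambda>s. vel \<epsilon> s w * N s))"
    by (simp add: vel_def shear_def algebra_simps)
  then show ?thesis unfolding G_def N_def vel_0[OF w] .
qed

text \<open>Bounds the constant \<open>k = 1 + \<kappa> + 1 / \<kappa>\<close> of the change of
  coordinates times the size of the shear, per unit of \<open>SS\<close>.\<close>

definition cmp :: real where
  "cmp = (1 + \<kappa> + 1 / \<kappa>) * (2 + \<bar>\<zeta>\<bar>)"

lemma cmp_nonneg: "cmp \<ge> 0"
  using \<kappa> by (simp add: cmp_def)

text \<open>The change of coordinates and its inverse are bounded by \<open>L\<close>, affine in the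
  absolute value of the shear, so the logarithms differ by at most \<open>ln L \<le> L\<close>.
  Uniform moments of \<open>u\<close> make this negligible after division by \<open>T\<close>; the
  sixth power serves to reuse \<open>Ku\<close>.\<close>

lemma ln_norm_compare:
  assumes \<epsilon>: "0 \<le> \<epsilon>" "\<epsilon> \<le> 1" and w: "w \<in> space M" and s: "s \<ge> 0"
  shows "\<bar>ln (norm (y \<epsilon> s w)) - ln (norm (pos \<epsilon> s w, vel \<epsilon> s w))\<bar> \<le> cmp * SS s w ^ 6"
proof -
  let ?y = "norm (y \<epsilon> s w)" and ?n = "norm (pos \<epsilon> s w, vel \<epsilon> s w)" and ?r = "\<bar>shear \<epsilon> s w\<bar>"
  define k where "k = 1 + \<kappa> + 1 / \<kappa>"
  define L where "L = k * (1 + ?r)"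
  have k1: "1 \<le> k" using \<kappa> by (simp add: k_def)
  have L1: "1 \<le> L" unfolding L_def using mult_mono[OF k1, of 1 "1 + ?r"] k1 by simp
  have L0: "L > 0" using L1 by simp
  have y0: "?y > 0" using y_nonzero[OF w s] by simp
  have pn: "\<bar>pos \<epsilon> s w\<bar> \<le> ?n" "\<bar>vel \<epsilon> s w\<bar> \<le> ?n"
    using norm_fst_le[of "pos \<epsilon> s w" "vel \<epsilon> s w"] norm_snd_le[of "vel \<epsilon> s w" "pos \<epsilon> s w"] by simp_all
  have n_le: "?n \<le> L * ?y"
  proof -
    have p: "\<bar>pos \<epsilon> s w\<bar> \<le> ?y / \<kappa>" unfolding pos_def using abs_Im_le_cmod[of "y \<epsilon> s w"] \<kappa> by (simp add: abs_divide divide_right_mono)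
    have "?n \<le> norm (pos \<epsilon> s w) + norm (vel \<epsilon> s w)" by (rule norm_Pair_le)
    also have "norm (vel \<epsilon> s w) \<le> \<bar>Re (y \<epsilon> s w)\<bar> + ?r * \<bar>pos \<epsilon> s w\<bar>"
      unfolding vel_def real_norm_def by (rule order.trans[OF abs_triangle_ineq]) (simp add: abs_mult)
    also have "\<dots> \<le> ?y + ?r * (?y / \<kappa>)" by (intro add_mono mult_left_mono p abs_Re_le_cmod) auto
    finally have "?n \<le> ?y / \<kappa> + (?y + ?r * (?y / \<kappa>))" using p by simp
    also have "\<dots> = (1 + 1 / \<kappa> * (1 + ?r)) * ?y" by (simp add: algebra_simps)
    also have "\<dots> \<le> L * ?y"
    proof (intro mult_right_mono)
      have "1 + 1 / \<kappa> * (1 + ?r) \<le> (1 + \<kappa>) * (1 + ?r) + 1 / \<kappa> * (1 + ?r)"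
        using mult_mono[of 1 "1 + \<kappa>" 1 "1 + ?r"] \<kappa> by simp
      then show "1 + 1 / \<kappa> * (1 + ?r) \<le> L" by (simp add: L_def k_def algebra_simps)
    qed simp
    finally show ?thesis .
  qed
  have y_le: "?y \<le> L * ?n"
  proof -
    have "?y \<le> \<bar>Re (y \<epsilon> s w)\<bar> + \<bar>Im (y \<epsilon> s w)\<bar>" by (rule cmod_le)
    also have "\<dots> \<le> (\<bar>vel \<epsilon> s w\<bar> + ?r * \<bar>pos \<epsilon> s w\<bar>) + \<kappa> * \<bar>pos \<epsilon> s w\<bar>"
      unfolding y_components using \<kappa> by (intro add_mono order.trans[OF abs_triangle_ineq4]) (auto simp: abs_mult)
    also have "\<dots> \<le> (?n + ?r * ?n) + \<kappa> * ?n"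
      using \<kappa> by (intro add_mono mult_left_mono pn) auto
    also have "\<dots> = (1 + ?r + \<kappa>) * ?n" by (simp add: algebra_simps)
    also have "\<dots> \<le> L * ?n"
    proof (intro mult_right_mono)
      have "0 \<le> \<kappa> * ?r" "0 \<le> 1 / \<kappa> * (1 + ?r)" using \<kappa> by simp_all
      then show "1 + ?r + \<kappa> \<le> L" by (simp add: L_def k_def algebra_simps)
    qed simp
    finally show ?thesis .
  qed
  have n0: "?n > 0"
  proof (rule ccontr)
    assume "\<not> ?n > 0"
    then have "?n = 0" using norm_ge_zero[of "(pos \<epsilon> s w, vel \<epsilon> s w)"] by linarith
    then show False using y_le y0 by simp
  qed
  have "ln ?n \<le> ln L + ln ?y"
    using n_le n0 y0 L0 by (simp add: ln_mult_pos[symmetric])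
  moreover have "ln ?y \<le> ln L + ln ?n"
    using y_le n0 y0 L0 by (simp add: ln_mult_pos[symmetric])
  ultimately have "\<bar>ln ?y - ln ?n\<bar> \<le> ln L" by linarith
  also have "\<dots> \<le> L" using ln_le_minus_one[OF L0] by simp
  also have "\<dots> \<le> k * ((2 + \<bar>\<zeta>\<bar>) * SS s w)"
    unfolding L_def
  proof (intro mult_left_mono)
    have "?r \<le> \<bar>\<epsilon> * u s w $ nz\<bar> + \<bar>\<epsilon>\<^sup>2 * \<zeta>\<bar>" unfolding shear_def by (rule abs_triangle_ineq4)
    also have "\<dots> \<le> 1 * SS s w + 1 * \<bar>\<zeta>\<bar>"
      unfolding abs_mult using \<epsilon> by (intro add_mono mult_mono u_le_SS) (auto simp: power_le_one)
    also have "\<dots> \<le> SS s w + SS s w * \<bar>\<zeta>\<bar>" using SS1[of s w] by (simp add: mult_right_mono[of 1 _ "\<bar>\<zeta>\<bar>", simplified])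
    finally show "1 + ?r \<le> (2 + \<bar>\<zeta>\<bar>) * SS s w" using SS1[of s w] by (simp add: algebra_simps)
  qed (use k1 in simp)
  also have "\<dots> = cmp * SS s w" by (simp add: cmp_def k_def)
  also have "\<dots> \<le> cmp * SS s w ^ 6"
    using SS1[of s w] cmp_nonneg power_increasing[of 1 6 "SS s w"] by (intro mult_left_mono) auto
  finally show ?thesis .
qed

text \<open>Under the time average the growth rate, of size \<open>cf * SS ^ 3\<close> at most, is
  split as \<open>R\<close> plus its square divided by \<open>4 * R\<close>; the mean of the latter
  is controlled by the sixth moment and decays like \<open>1 / R\<close>.\<close>

lemma mean_uniformly_integrable:
  assumes p: "p \<in> params" and R: "R > 0"
  shows "\<exists>Y. integrable M Y \<and> (\<forall>w\<in>space M. 0 \<le> Y w \<and> \<bar>ln (norm (y (fst p) (snd p) w)) / snd p\<bar> \<le> R + Y w) \<and>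
    (\<integral>w. Y w \<partial>M) \<le> (cf\<^sup>2 * Ku / 4) / R"
proof (intro exI conjI ballI)
  interpret T: finite_measure "time_measure (snd p)" by (rule finite_measure_time)
  interpret P: pair_sigma_finite "time_measure (snd p)" M ..
  have T: "snd p \<ge> 0" "snd p > 0" using paramsD[OF p] by auto
  let ?c = "cf\<^sup>2 / (4 * R)"
  let ?Y = "\<lambda>w. ?c * (\<integral>s. SS s w ^ 6 \<partial>time_measure (snd p)) / snd p"
  have i: "integrable M (\<lambda>w. \<integral>s. SS s w ^ 6 \<partial>time_measure (snd p))"
    using P.integrable_snd[of "\<lambda>s w. SS s w ^ 6"] integrable_SS_joint by (simp add: split_def)
  then show "integrable M ?Y" by (intro integrable_divide integrable_mult_right) auto
  have "(\<integral>w. ?Y w \<partial>M) = ?c / snd p * (\<integral>w. (\<integral>s. SS s w ^ 6 \<partial>time_measure (snd p)) \<partial>M)" by simp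
  also have "(\<integral>w. (\<integral>s. SS s w ^ 6 \<partial>time_measure (snd p)) \<partial>M) = (\<integral>x. SS (fst x) (snd x) ^ 6 \<partial>(time_measure (snd p) \<Otimes>\<^sub>M M))"
    using P.integral_snd[of "\<lambda>s w. SS s w ^ 6"] integrable_SS_joint by (simp add: split_def)
  also have "?c / snd p * \<dots> \<le> ?c / snd p * (snd p * Ku)"
    using T R by (intro mult_left_mono integral_SS_joint) auto
  also have "\<dots> = (cf\<^sup>2 * Ku / 4) / R" using T by simp
  finally show "(\<integral>w. ?Y w \<partial>M) \<le> (cf\<^sup>2 * Ku / 4) / R" .
  fix w assume w: "w \<in> space M"
  show "0 \<le> ?Y w" using T R SS1 by (intro divide_nonneg_nonneg mult_nonneg_nonneg integral_nonneg_AE) (auto intro: order.trans[OF zero_le_one])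
  have cS: "continuous_on {0..snd p} (\<lambda>s. SS s w ^ 6)"
    unfolding SS_def
    by (intro continuous_intros continuous_on_subset[OF continuous_adaptedD(2)[OF u_component_adapted w]]) auto
  have iS: "integrable (time_measure (snd p)) (\<lambda>s. SS s w ^ 6)" by (rule integrable_time[OF cS])
  have il: "integrable (time_measure (snd p)) (\<lambda>s. lnrate (fst p) s w)"
    by (rule integrable_time[OF continuous_on_lnrate[OF w]])
  have "\<bar>ln (norm (y (fst p) (snd p) w))\<bar> \<le> (\<integral>s. \<bar>lnrate (fst p) s w\<bar> \<partial>time_measure (snd p))"
    unfolding ln_norm_y_eq[OF w T(1)] using integral_norm_bound[of "time_measure (snd p)" "\<lambda>s. lnrate (fst p) s w"] by simp
  also have "\<dots> \<le> (\<integral>s. R + ?c * SS s w ^ 6 \<partial>time_measure (snd p))"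
  proof (rule integral_mono)
    fix s assume "s \<in> space (time_measure (snd p))"
    then have s: "s \<ge> 0" by (simp add: space_restrict_space)
    have "\<bar>lnrate (fst p) s w\<bar> \<le> cf * (SS s w)\<^sup>2" by (rule abs_lnrate_le) (use paramsD[OF p] w s in auto)
    also have "\<dots> \<le> cf * SS s w ^ 3"
      using \<kappa> SS1[of s w] by (intro mult_left_mono power_increasing) (auto simp: cf_def sum_nonneg)
    \<comment> \<open>The inequality of arithmetic and geometric means in the form
      \<open>x \<le> R + x\<^sup>2 / (4 R)\<close>.\<close>
    also have "\<dots> \<le> R + (cf * SS s w ^ 3)\<^sup>2 / (4 * R)"
    proof -
      have "0 \<le> (2 * R - cf * SS s w ^ 3)\<^sup>2 / (4 * R)" using R by simp
      also have "\<dots> = R + (cf * SS s w ^ 3)\<^sup>2 / (4 * R) - cf * SS s w ^ 3"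
        using R by (simp add: field_simps power2_eq_square)
      finally show ?thesis by simp
    qed
    also have "(cf * SS s w ^ 3)\<^sup>2 = cf\<^sup>2 * SS s w ^ 6" by (simp add: power_mult_distrib power_mult[symmetric])
    finally show "\<bar>lnrate (fst p) s w\<bar> \<le> R + ?c * SS s w ^ 6" by simp
  qed (use il iS in auto)
  also have "\<dots> = R * snd p + ?c * (\<integral>s. SS s w ^ 6 \<partial>time_measure (snd p))"
    using iS T by (subst Bochner_Integration.integral_add) (auto simp: measure_restrict_space space_restrict_space)
  finally have "\<bar>ln (norm (y (fst p) (snd p) w))\<bar> / snd p \<le> (R * snd p + ?c * (\<integral>s. SS s w ^ 6 \<partial>time_measure (snd p))) / snd p"
    using T by (intro divide_right_mono) auto
  then show "\<bar>ln (norm (y (fst p) (snd p) w)) / snd p\<bar> \<le> R + ?Y w"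
    using T by (simp add: abs_divide add_divide_distrib)
qed

text \<open>Integer times are enough to identify the limit. The logarithm of the physical norm plays
  the role of \<open>\<Lambda>\<close>, and that of the modulus of \<open>y\<close> the role of
  \<open>X\<close>.\<close>

lemma mean_tends_to_exponent:
  assumes \<epsilon>: "0 < \<epsilon>" "\<epsilon> \<le> 1"
    and lim: "AE w in M. ((\<lambda>t. ln (norm (pos \<epsilon> t w, vel \<epsilon> t w)) / t) \<longlongrightarrow> L) at_top"
  shows "(\<lambda>n. \<integral>w. ln (norm (y \<epsilon> (real (Suc n)) w)) / real (Suc n) \<partial>M) \<longlonglongrightarrow> L"
proof (rule limit_of_means)
  have p: "(\<epsilon>, real (Suc n)) \<in> params" for n using \<epsilon> by (simp add: params_def)
  show "integrable M (\<lambda>w. ln (norm (y \<epsilon> (real (Suc n)) w)) / real (Suc n))" for n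
    using mean_ln_norm_y(1)[OF p[of n]] by (simp only: fst_conv snd_conv)
  show "\<exists>Y. integrable M Y \<and> (\<forall>w\<in>space M. 0 \<le> Y w \<and> \<bar>ln (norm (y \<epsilon> (real (Suc n)) w)) / real (Suc n)\<bar> \<le> R + Y w) \<and>
    (\<integral>w. Y w \<partial>M) \<le> (cf\<^sup>2 * Ku / 4) / R" if "R > 0" for R n
    using mean_uniformly_integrable[OF p[of n] that] by (simp only: fst_conv snd_conv)
  show "(\<lambda>w. ln (norm (pos \<epsilon> (real (Suc n)) w, vel \<epsilon> (real (Suc n)) w)) / real (Suc n)) \<in> borel_measurable M" for n
    by (intro borel_measurable_divide borel_measurable_ln borel_measurable_const
        measurable_compose[OF borel_measurable_Pair borel_measurable_norm]
        continuous_adapted_measurable[OF pos_adapted] continuous_adapted_measurable[OF vel_adapted]) auto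
  show "AE w in M. (\<lambda>n. ln (norm (pos \<epsilon> (real (Suc n)) w, vel \<epsilon> (real (Suc n)) w)) / real (Suc n)) \<longlonglongrightarrow> L"
    using lim
  proof eventually_elim
    case (elim w)
    have "filterlim (\<lambda>n. real (Suc n)) at_top sequentially"
      by (rule filterlim_compose[OF filterlim_real_sequentially filterlim_Suc])
    from filterlim_compose[OF elim this] show ?case .
  qed
  show "integrable M (\<lambda>w. cmp * SS (real (Suc n)) w ^ 6)" for n
    using Ku(2)[of "real (Suc n)"] by (intro integrable_mult_right) simp
  show "(\<integral>w. cmp * SS (real (Suc n)) w ^ 6 \<partial>M) \<le> cmp * Ku" for n
    using Ku(3)[of "real (Suc n)"] cmp_nonneg by (simp add: mult_left_mono del: of_nat_Suc)
  show "\<bar>ln (norm (y \<epsilon> (real (Suc n)) w)) / real (Suc n) - ln (norm (pos \<epsilon> (real (Suc n)) w, vel \<epsilon> (real (Suc n)) w)) / real (Suc n)\<bar>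
      \<le> cmp * SS (real (Suc n)) w ^ 6 / real (Suc n)" if "w \<in> space M" for n w
    unfolding diff_divide_distrib[symmetric] abs_divide abs_of_nat
    by (intro divide_right_mono ln_norm_compare that) (use \<epsilon> in auto)
qed

text \<open>At fixed \<open>\<epsilon>\<close> the horizon tends to infinity, which removes the
  error \<open>1 / T\<close>. The constant is chosen before \<open>\<epsilon>\<close> and
  \<open>L\<close>, as the final big-O requires.\<close>

theorem exponent_expansion:
  assumes R: "\<And>i j. (\<Sum>l\<in>UNIV. A $ i $ l * R l j) + (\<Sum>l\<in>UNIV. A $ j $ l * R i l) + \<beta> i \<bullet> \<beta> j = 0"
    and m: "\<And>k. (\<Sum>l\<in>UNIV. m l * of_real (A $ l $ k)) - \<i> * of_real (2 * \<kappa>) * m k = - ll k"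
  shows "\<exists>C. \<forall>\<epsilon> L. 0 < \<epsilon> \<longrightarrow> \<epsilon> \<le> 1 \<longrightarrow>
     (AE w in M. ((\<lambda>t. ln (norm (pos \<epsilon> t w, vel \<epsilon> t w)) / t) \<longlongrightarrow> L) at_top) \<longrightarrow>
     \<bar>L - \<epsilon>\<^sup>2 * (- \<zeta> + Re (\<Sum>k\<in>UNIV. \<Sum>i\<in>UNIV. avc 0 k * m i * of_real (R k i)))\<bar> \<le> C * \<epsilon> ^ 4"
proof -
  let ?c = "- \<zeta> + Re (\<Sum>k\<in>UNIV. \<Sum>i\<in>UNIV. avc 0 k * m i * of_real (R k i))"
  obtain C where C: "\<And>p. p \<in> params \<Longrightarrow> \<bar>(\<integral>w. ln (norm (y (fst p) (snd p) w)) / snd p \<partial>M) - (fst p)\<^sup>2 * ?c\<bar> \<le> C * (fst p ^ 4 + 1 / snd p)"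
    using mean_growth_rate[OF R m] by blast
  have "\<bar>L - \<epsilon>\<^sup>2 * ?c\<bar> \<le> C * \<epsilon> ^ 4"
    if \<epsilon>: "0 < \<epsilon>" "\<epsilon> \<le> 1" and lim: "AE w in M. ((\<lambda>t. ln (norm (pos \<epsilon> t w, vel \<epsilon> t w)) / t) \<longlongrightarrow> L) at_top" for \<epsilon> L
  proof (rule LIMSEQ_le)
    show "(\<lambda>n. \<bar>(\<integral>w. ln (norm (y \<epsilon> (real (Suc n)) w)) / real (Suc n) \<partial>M) - \<epsilon>\<^sup>2 * ?c\<bar>) \<longlonglongrightarrow> \<bar>L - \<epsilon>\<^sup>2 * ?c\<bar>"
      by (intro tendsto_rabs tendsto_diff tendsto_const mean_tends_to_exponent[OF \<epsilon> lim])
    have "(\<lambda>n. C * (\<epsilon> ^ 4 + inverse (real (Suc n)))) \<longlonglongrightarrow> C * (\<epsilon> ^ 4 + 0)"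
      by (intro tendsto_mult tendsto_add tendsto_const LIMSEQ_inverse_real_of_nat)
    then show "(\<lambda>n. C * (\<epsilon> ^ 4 + inverse (real (Suc n)))) \<longlonglongrightarrow> C * \<epsilon> ^ 4" by (simp only: add_0_right)
    have "\<bar>(\<integral>w. ln (norm (y \<epsilon> (real (Suc n)) w)) / real (Suc n) \<partial>M) - \<epsilon>\<^sup>2 * ?c\<bar> \<le> C * (\<epsilon> ^ 4 + inverse (real (Suc n)))" for n
      using C[of "(\<epsilon>, real (Suc n))"] \<epsilon> by (simp add: params_def inverse_eq_divide)
    then show "\<exists>N. \<forall>n\<ge>N. \<bar>(\<integral>w. ln (norm (y \<epsilon> (real (Suc n)) w)) / real (Suc n) \<partial>M) - \<epsilon>\<^sup>2 * ?c\<bar> \<le> C * (\<epsilon> ^ 4 + inverse (real (Suc n)))"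
      by blast
  qed
  then show ?thesis by blast
qed

end

text \<open>The random equation, solved on each path, gives a solution of the Ito system: the noise
  term of \<open>vel_eq\<close> is already in the form of an integration by parts, which
  \<open>is_ito_integral_by_parts\<close> recognises as an Ito integral.\<close>

lemma (in oscillator) is_solution_pos_vel:
  fixes A' :: "real^'d^'d" and B :: "real^'m^'d"
  assumes A_nz: "\<And>l. A $ nz $ l = - of_bool (l = nz)"
    and v_adapted: "continuous_adapted M F v"
    and v: "\<And>w t. w \<in> space M \<Longrightarrow> t \<ge> 0 \<Longrightarrow>
      v t w = v 0 w + integral {0..t} (\<lambda>s. A' *v v s w) + B *v (W t w - W 0 w)"
    and al: "\<And>s w. al s w = a \<bullet> v s w + u s w $ nz"
  shows "is_solution M F W A' B a (\<beta> nz) \<kappa> \<zeta> \<epsilon> v (pos \<epsilon>) (vel \<epsilon>)"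
proof -
  have Wl: "continuous_adapted M F (\<lambda>s w. W s w $ l)" for l
    by (rule continuous_adapted_compose[OF W_adapted]) (intro continuous_intros)
  \<comment> \<open>Written with \<open>W\<close> itself, as the definition of a solution demands,
    whereas \<open>vel_eq\<close> uses increments from time 0. The terms with \<open>W 0\<close>
    cancel because the position is the integral of the velocity and starts at 0.\<close>
  define J where "J l t w = pos \<epsilon> t w * W t w $ l - pos \<epsilon> 0 w * W 0 w $ l - integral {0..t} (\<lambda>s. vel \<epsilon> s w * W s w $ l)"
    for l t w
  have J: "is_ito_integral M F (\<lambda>s w. W s w $ l) (pos \<epsilon>) t (J l t)" if "t \<ge> 0" for l t
    unfolding J_def[abs_def] by (rule is_ito_integral_by_parts[OF pos_adapted vel_adapted Wl pos_eq that])
  have eq: "vel \<epsilon> t w = vel \<epsilon> 0 w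
     + integral {0..t} (\<lambda>s. - 2 * \<epsilon>\<^sup>2 * \<zeta> * vel \<epsilon> s w - (\<kappa>\<^sup>2 - \<epsilon> * (a \<bullet> v s w)) * pos \<epsilon> s w)
     + (\<Sum>l\<in>UNIV. \<epsilon> * \<beta> nz $ l * J l t w)" if w: "w \<in> space M" and t: "t \<ge> 0" for t w
  proof -
    have cont: "continuous_on {0..t} (\<lambda>s. Z s w)" if "continuous_adapted M F Z" for Z :: "real \<Rightarrow> 'w \<Rightarrow> real"
      by (rule continuous_on_subset[OF continuous_adaptedD(2)[OF that w]]) auto
    have i: "(\<lambda>s. vel \<epsilon> s w) integrable_on {0..t}"
      by (intro integrable_continuous_real cont vel_adapted)
    have iW: "(\<lambda>s. vel \<epsilon> s w * W s w $ l) integrable_on {0..t}" for l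
      by (intro integrable_continuous_real continuous_on_mult cont vel_adapted Wl)
    have pos: "pos \<epsilon> t w = integral {0..t} (\<lambda>s. vel \<epsilon> s w)"
      using pos_eq[OF w t] pos_0[OF w] by simp
    have "integral {0..t} (\<lambda>s. vel \<epsilon> s w * (\<beta> nz \<bullet> (W s w - W 0 w))) =
        integral {0..t} (\<lambda>s. \<Sum>l\<in>UNIV. \<beta> nz $ l * (vel \<epsilon> s w * W s w $ l) - \<beta> nz $ l * W 0 w $ l * vel \<epsilon> s w)"
      by (intro integral_cong) (simp add: inner_vec_def sum_distrib_left algebra_simps)
    also have "\<dots> = (\<Sum>l\<in>UNIV. \<beta> nz $ l * integral {0..t} (\<lambda>s. vel \<epsilon> s w * W s w $ l) - \<beta> nz $ l * W 0 w $ l * pos \<epsilon> t w)"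
      unfolding pos
      by (intro integral_unique has_integral_sum has_integral_diff has_integral_mult_right integrable_integral i iW) auto
    finally have "pos \<epsilon> t w * (\<beta> nz \<bullet> (W t w - W 0 w)) - integral {0..t} (\<lambda>s. vel \<epsilon> s w * (\<beta> nz \<bullet> (W s w - W 0 w))) =
      (\<Sum>l\<in>UNIV. \<beta> nz $ l * J l t w)"
      by (simp add: J_def pos_0[OF w] inner_vec_def sum_distrib_left sum_subtractf[symmetric] algebra_simps)
    then show ?thesis
      using vel_eq[OF A_nz w t, of \<epsilon>] by (simp add: al sum_distrib_left mult.assoc)
  qed
  show ?thesis
    unfolding is_solution_def
  proof (intro conjI allI impI v_adapted pos_adapted vel_adapted exI[of _ J])
    fix t :: real assume t: "t \<ge> 0"
    show "AE w in M. v t w = v 0 w + integral {0..t} (\<lambda>s. A' *v v s w) + B *v (W t w - W 0 w)"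
      by (rule AE_I2) (rule v[OF _ t])
    show "AE w in M. pos \<epsilon> t w = pos \<epsilon> 0 w + integral {0..t} (\<lambda>s. vel \<epsilon> s w)"
      by (rule AE_I2) (rule pos_eq[OF _ t])
    show "is_ito_integral M F (\<lambda>s w. W s w $ l) (pos \<epsilon>) t (J l t)" for l by (rule J[OF t])
    show "AE w in M. vel \<epsilon> t w = vel \<epsilon> 0 w
       + integral {0..t} (\<lambda>s. - 2 * \<epsilon>\<^sup>2 * \<zeta> * vel \<epsilon> s w - (\<kappa>\<^sup>2 - \<epsilon> * (a \<bullet> v s w)) * pos \<epsilon> s w)
       + (\<Sum>l\<in>UNIV. \<epsilon> * \<beta> nz $ l * J l t w)"
      by (rule AE_I2) (rule eq[OF _ t])
  qed
qed

section \<open>The augmented system and the closed form of the coefficient\<close>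

lemma sum_UNIV_option: "(\<Sum>k\<in>(UNIV :: 'a::finite option set). f k) = f None + (\<Sum>k\<in>UNIV. f (Some k))"
  by (simp add: UNIV_option_conv sum.reindex)

text \<open>The index \<open>None\<close> is an auxiliary process \<open>z\<close> with \<open>dz = - z dt + \<langle>\<gamma>, dW\<rangle>\<close>. It absorbs the
  multiplicative noise of the velocity, so that the system becomes a random ODE.\<close>

definition augmented_matrix :: "real^'d^'d \<Rightarrow> real^('d option)^('d option)" where
  "augmented_matrix A = (\<chi> i j. case i of None \<Rightarrow> - of_bool (j = None)
     | Some i' \<Rightarrow> (case j of None \<Rightarrow> 0 | Some j' \<Rightarrow> A $ i' $ j'))"

lemma augmented_matrix_nth [simp]:
  "augmented_matrix A $ None $ j = - of_bool (j = None)"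
  "augmented_matrix A $ Some i $ None = 0" "augmented_matrix A $ Some i $ Some l = A $ i $ l"
  by (simp_all add: augmented_matrix_def)

text \<open>The matrix is block diagonal: an eigenvector with a nonzero part on the
  \<open>Some\<close> indices yields one of \<open>A\<close>, and any other is concentrated on
  \<open>None\<close>, with eigenvalue -1.\<close>

lemma augmented_matrix_stable:
  assumes "\<And>z. complex_eigenvalue A z \<Longrightarrow> Re z < 0" and "complex_eigenvalue (augmented_matrix A) z"
  shows "Re z < 0"
proof -
  obtain x where x: "x \<noteq> 0" "map_matrix complex_of_real (augmented_matrix A) *v x = z *s x"
    using assms(2) by (auto simp: complex_eigenvalue_def)
  define x' where "x' = (\<chi> i. x $ Some i)"
  have c: "(\<Sum>j\<in>UNIV. of_real (augmented_matrix A $ i $ j) * x $ j) = z * x $ i" for i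
    using arg_cong[OF x(2), of "\<lambda>y. y $ i"] by (simp add: matrix_vector_mult_def map_matrix_def)
  have "map_matrix complex_of_real A *v x' = z *s x'"
    using c[of "Some _"] by (simp add: vec_eq_iff matrix_vector_mult_def map_matrix_def x'_def sum_UNIV_option)
  then have "Re z < 0" if "x' \<noteq> 0" using that assms(1) by (auto simp: complex_eigenvalue_def)
  moreover have "Re z < 0" if "x' = 0"
  proof -
    have "x $ Some i = 0" for i using arg_cong[OF that, of "\<lambda>y. y $ i"] by (simp add: x'_def)
    with x(1) have "x $ None \<noteq> 0" by (auto simp: vec_eq_iff) (metis option.exhaust)
    moreover have "- x $ None = z * x $ None" using c[of None] by (simp add: sum_UNIV_option)
    then have "(z + 1) * x $ None = 0" by (simp add: distrib_right flip: \<open>- x $ None = z * x $ None\<close>)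
    ultimately have "z = - 1" by (simp add: add_eq_0_iff2)
    then show ?thesis by simp
  qed
  ultimately show ?thesis by blast
qed

text \<open>1 is not an eigenvalue of a stable matrix. With right-hand side
  \<open>- (B *v \<gamma>)\<close> the solution is the stationary cross covariance of
  \<open>v\<close> and \<open>z\<close>, the 1 being the decay rate of \<open>z\<close>.\<close>

lemma stable_resolvent_at_1:
  fixes A :: "real^'d^'d"
  assumes stable: "\<And>z. complex_eigenvalue A z \<Longrightarrow> Re z < 0"
  shows "\<exists>g. A *v g - g = b"
proof -
  have "x = 0" if "(A - mat 1) *v x = 0" for x
  proof (rule ccontr)
    assume "x \<noteq> 0"
    define x' :: "complex^'d" where "x' = (\<chi> i. of_real (x $ i))"
    have "A *v x = x" using that by (simp add: matrix_vector_mult_diff_rdistrib)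
    then have e: "(\<Sum>j\<in>UNIV. A $ i $ j * x $ j) = x $ i" for i by (simp add: vec_eq_iff matrix_vector_mult_def)
    have "map_matrix complex_of_real A *v x' = 1 *s x'"
      by (simp add: vec_eq_iff matrix_vector_mult_def map_matrix_def x'_def of_real_mult[symmetric] of_real_sum[symmetric] e
          del: of_real_mult of_real_sum)
    moreover have "x' \<noteq> 0" using \<open>x \<noteq> 0\<close> by (auto simp: vec_eq_iff x'_def)
    ultimately show False using stable[of 1] by (auto simp: complex_eigenvalue_def)
  qed
  then have "invertible (A - mat 1)"
    by (simp add: invertible_left_inverse matrix_left_invertible_ker)
  then obtain C where "(A - mat 1) ** C = mat 1" by (auto simp: invertible_def)
  then have "(A - mat 1) *v (C *v b) = b" by (simp add: matrix_vector_mul_assoc)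
  then show ?thesis by (auto simp: matrix_vector_mult_diff_rdistrib)
qed

lemma inner_matrix_vector: "x \<bullet> (A *v y) = (\<Sum>i\<in>UNIV. \<Sum>j\<in>UNIV. x $ i * A $ i $ j * y $ j)"
  for A :: "real^'n^'m"
  by (simp add: inner_vec_def matrix_vector_mult_def sum_distrib_left mult.assoc)

text \<open>The blocks of the augmented covariance contribute three terms. The first gives the part
  with the covariance of \<open>v\<close>; the cross covariance \<open>g\<close> combines with the
  resolvent \<open>r\<close> so that only \<open>B *v \<gamma>\<close> is left; the variance of
  \<open>z\<close>, half the squared norm of \<open>\<gamma>\<close>, keeps only the real part of
  its factor \<open>1 - 2 * \<i> * of_real \<kappa>\<close>.\<close>

lemma lambda2_eq:
  fixes A :: "real^'d^'d" and r :: "'d \<Rightarrow> complex"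
  assumes \<kappa>: "\<kappa> > 0"
    and Re_r: "\<And>k. Re (r k) = pi * (\<Sum>i\<in>UNIV. a $ i * S_hat A (2 * \<kappa>) $ i $ k)"
    and r: "\<And>k. (\<Sum>l\<in>UNIV. r l * of_real (A $ l $ k)) - \<i> * of_real (2 * \<kappa>) * r k = - of_real (a $ k)"
    and g: "A *v g - g = - (B *v \<gamma>)"
  shows "Re ((\<Sum>k\<in>UNIV. \<Sum>i\<in>UNIV. of_real (a $ k) * r i * of_real (stationary_cov A B $ i $ k))
      + (\<Sum>k\<in>UNIV. of_real (a $ k) * of_real (g $ k))
      + (1 - 2 * \<i> * of_real \<kappa>) * ((\<Sum>k\<in>UNIV. r k * of_real (g $ k)) + of_real ((norm \<gamma>)\<^sup>2 / 2))) / (2 * \<kappa>)\<^sup>2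
    = lambda2 A B a \<gamma> (2 * \<kappa>)"
proof -
  let ?S = "S_hat A (2 * \<kappa>)"
  have S: "pi * (a \<bullet> (?S *v x)) = (\<Sum>k\<in>UNIV. Re (r k) * x $ k)" for x
  proof -
    have "a \<bullet> (?S *v x) = (\<Sum>k\<in>UNIV. \<Sum>i\<in>UNIV. a $ i * ?S $ i $ k * x $ k)"
      unfolding inner_matrix_vector by (rule sum.swap)
    then show ?thesis by (simp add: Re_r sum_distrib_left sum_distrib_right mult_ac)
  qed
  have 1: "Re (\<Sum>k\<in>UNIV. \<Sum>i\<in>UNIV. of_real (a $ k) * r i * of_real (stationary_cov A B $ i $ k)) =
      pi * (a \<bullet> (?S *v (stationary_cov A B *v a)))"
  proof -
    have "Re (\<Sum>k\<in>UNIV. \<Sum>i\<in>UNIV. of_real (a $ k) * r i * of_real (stationary_cov A B $ i $ k)) =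
      (\<Sum>k\<in>UNIV. \<Sum>i\<in>UNIV. Re (r i) * (stationary_cov A B $ i $ k * a $ k))" by (simp add: mult_ac)
    also have "\<dots> = (\<Sum>i\<in>UNIV. \<Sum>k\<in>UNIV. Re (r i) * (stationary_cov A B $ i $ k * a $ k))" by (rule sum.swap)
    also have "\<dots> = pi * (a \<bullet> (?S *v (stationary_cov A B *v a)))"
      unfolding S by (simp add: matrix_vector_mult_def sum_distrib_left)
    finally show ?thesis .
  qed
  \<comment> \<open>A resolvent identity: replacing \<open>a\<close> through the equation of
    \<open>r\<close> leaves \<open>r\<close> applied to \<open>g - A g\<close>, which is
    \<open>B *v \<gamma>\<close>. Here the auxiliary decay rate disappears.\<close>
  have 2: "(\<Sum>k\<in>UNIV. of_real (a $ k) * of_real (g $ k)) + (1 - 2 * \<i> * of_real \<kappa>) * (\<Sum>k\<in>UNIV. r k * of_real (g $ k)) =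
      (\<Sum>k\<in>UNIV. r k * of_real ((B *v \<gamma>) $ k))"
  proof -
    have a: "of_real (a $ k) = 2 * \<i> * of_real \<kappa> * r k - (\<Sum>l\<in>UNIV. r l * of_real (A $ l $ k))" for k
      using r[of k] by (simp add: algebra_simps add_eq_0_iff2)
    have "(\<Sum>k\<in>UNIV. of_real (a $ k) * of_real (g $ k)) + (1 - 2 * \<i> * of_real \<kappa>) * (\<Sum>k\<in>UNIV. r k * of_real (g $ k)) =
       (\<Sum>k\<in>UNIV. r k * of_real (g $ k)) - (\<Sum>k\<in>UNIV. \<Sum>l\<in>UNIV. r l * of_real (A $ l $ k) * of_real (g $ k))"
      unfolding a by (simp add: algebra_simps sum_subtractf sum_distrib_left sum_distrib_right)
    also have "(\<Sum>k\<in>UNIV. \<Sum>l\<in>UNIV. r l * of_real (A $ l $ k) * of_real (g $ k)) = (\<Sum>l\<in>UNIV. \<Sum>k\<in>UNIV. r l * of_real (A $ l $ k) * of_real (g $ k))"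
      by (rule sum.swap)
    also have "\<dots> = (\<Sum>l\<in>UNIV. r l * of_real ((A *v g) $ l))"
      by (simp add: matrix_vector_mult_def sum_distrib_left mult.assoc)
    also have "(\<Sum>k\<in>UNIV. r k * of_real (g $ k)) - \<dots> = (\<Sum>k\<in>UNIV. r k * of_real ((B *v \<gamma>) $ k))"
    proof -
      have eq: "(B *v \<gamma>) $ k = g $ k - (A *v g) $ k" for k using arg_cong[OF g, of "\<lambda>x. x $ k"] by simp
      show ?thesis unfolding eq by (simp add: right_diff_distrib sum_subtractf)
    qed
    finally show ?thesis .
  qed
  have 3: "Re (\<Sum>k\<in>UNIV. r k * of_real ((B *v \<gamma>) $ k)) = pi * (a \<bullet> (?S *v (B *v \<gamma>)))"
    unfolding S by simp
  have "Re ((\<Sum>k\<in>UNIV. \<Sum>i\<in>UNIV. of_real (a $ k) * r i * of_real (stationary_cov A B $ i $ k))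
      + (\<Sum>k\<in>UNIV. of_real (a $ k) * of_real (g $ k))
      + (1 - 2 * \<i> * of_real \<kappa>) * ((\<Sum>k\<in>UNIV. r k * of_real (g $ k)) + of_real ((norm \<gamma>)\<^sup>2 / 2)))
     = Re (\<Sum>k\<in>UNIV. \<Sum>i\<in>UNIV. of_real (a $ k) * r i * of_real (stationary_cov A B $ i $ k))
      + Re ((\<Sum>k\<in>UNIV. of_real (a $ k) * of_real (g $ k)) + (1 - 2 * \<i> * of_real \<kappa>) * (\<Sum>k\<in>UNIV. r k * of_real (g $ k)))
      + (norm \<gamma>)\<^sup>2 / 2"
    unfolding distrib_left plus_complex.sel by simp
  also have "\<dots> = pi * (a \<bullet> (?S *v (stationary_cov A B *v a))) + pi * (a \<bullet> (?S *v (B *v \<gamma>))) + (norm \<gamma>)\<^sup>2 / 2"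
    unfolding 1 2 3 ..
  finally show ?thesis unfolding lambda2_def by (simp only:) (simp add: distrib_left add_divide_distrib)
qed

lemma bigo_at_right_0:
  fixes f :: "real \<Rightarrow> real"
  assumes "\<forall>\<^sub>F \<epsilon> in at_right 0. \<bar>f \<epsilon>\<bar> \<le> C * \<epsilon> ^ n"
  shows "f \<in> O[at_right 0](\<lambda>\<epsilon>. \<epsilon> ^ n)"
proof (rule bigoI[of _ C])
  show "\<forall>\<^sub>F \<epsilon> in at_right 0. norm (f \<epsilon>) \<le> C * norm (\<epsilon> ^ n)"
    using assms eventually_at_right_less[of 0] by eventually_elim simp
qed

theorem theorem6p1:
  fixes M :: "'w measure" and F :: "real \<Rightarrow> 'w measure" and W :: "real \<Rightarrow> 'w \<Rightarrow> real^'m"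
    and A :: "real^'d^'d" and B :: "real^'m^'d" and a :: "real^'d" and \<gamma> :: "real^'m"
    and \<kappa> \<zeta>\<^sub>2 :: real and lyap :: "real \<Rightarrow> real"
  assumes W: "standard_brownian_motion M F W"
    and A_stable: "\<And>z. complex_eigenvalue A z \<Longrightarrow> Re z < 0"
    and controllable: "controllable_pair A B"
    and \<kappa>: "\<kappa> > 0" and \<zeta>: "\<zeta>\<^sub>2 > 0"
    and lyap: "\<forall>\<^sub>F \<epsilon> in at_right 0. is_lyapunov_exponent M F W A B a \<gamma> \<kappa> \<zeta>\<^sub>2 \<epsilon> (lyap \<epsilon>)"
  shows "(\<lambda>\<epsilon>. lyap \<epsilon> - \<epsilon>\<^sup>2 * (- \<zeta>\<^sub>2 + lambda2 A B a \<gamma> (2 * \<kappa>))) \<in> O[at_right 0](\<lambda>\<epsilon>. \<epsilon> ^ 4)"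
proof -
  interpret brownian M F W by unfold_locales (rule W)
  \<comment> \<open>Noise vectors of the augmented process: \<open>\<gamma>\<close> drives
    \<open>z\<close> and the rows of \<open>B\<close> drive \<open>v\<close>.\<close>
  define \<beta> where "\<beta> = case_option \<gamma> (\<lambda>i. B $ i)"
  define av where "av = case_option 1 (\<lambda>i. a $ i)"
  have \<beta>: "\<beta> None = \<gamma>" "\<beta> (Some i) = B $ i" and av: "av None = 1" "av (Some i) = a $ i" for i
    by (simp_all add: \<beta>_def av_def)
  obtain u where u: "continuous_adapted M F u" "\<And>w t i. w \<in> space M \<Longrightarrow> t \<ge> 0 \<Longrightarrow>
      u t w $ i = integral {0..t} (\<lambda>s. \<Sum>l\<in>UNIV. augmented_matrix A $ i $ l * u s w $ l) + \<beta> i \<bullet> (W t w - W 0 w)"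
    using ornstein_uhlenbeck_exists[of "augmented_matrix A" \<beta>] by blast
  interpret oscillator M F W "augmented_matrix A" \<beta> u \<kappa> \<zeta>\<^sub>2 None av
    by unfold_locales (use u \<kappa> augmented_matrix_stable[OF A_stable] in auto)
  define v where "v s w = (\<chi> i. u s w $ Some i)" for s w
  have v_adapted: "continuous_adapted M F v"
    unfolding v_def[abs_def] by (rule continuous_adapted_compose[OF u(1)]) (intro continuous_intros)
  have v_eq: "v t w = v 0 w + integral {0..t} (\<lambda>s. A *v v s w) + B *v (W t w - W 0 w)"
    if w: "w \<in> space M" and t: "t \<ge> 0" for t w
  proof -
    have i: "(\<lambda>s. A *v v s w) integrable_on {0..t}"
      by (intro integrable_continuous_real continuous_on_compose2[OF matrix_vector_mult_linear_continuous_on[of UNIV A]]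
        continuous_on_subset[OF continuous_adaptedD(2)[OF v_adapted w]]) auto
    have "v t w $ k = integral {0..t} (\<lambda>s. A *v v s w) $ k + (B *v (W t w - W 0 w)) $ k" for k
    proof -
      have "integral {0..t} (\<lambda>s. A *v v s w) $ k = integral {0..t} (\<lambda>s. (A *v v s w) $ k)"
        using integral_component_eq_cart[OF i] by simp
      then show ?thesis
        using u(2)[OF w t, of "Some k"]
        by (simp add: v_def matrix_vector_mult_def sum_UNIV_option \<beta> inner_vec_def)
    qed
    moreover have "v 0 w = 0" using u(2)[OF w order_refl] by (simp add: v_def vec_eq_iff)
    ultimately show ?thesis by (simp add: vec_eq_iff)
  qed
  have al: "al s w = a \<bullet> v s w + u s w $ None" for s w
    by (simp add: al_def sum_UNIV_option av v_def inner_vec_def)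
  have sol: "is_solution M F W A B a \<gamma> \<kappa> \<zeta>\<^sub>2 \<epsilon> v (pos \<epsilon>) (vel \<epsilon>)" for \<epsilon>
    using is_solution_pos_vel[OF _ v_adapted v_eq al] by (simp add: \<beta>)
  obtain r where Re_r: "\<And>k. Re (r k) = pi * (\<Sum>i\<in>UNIV. a $ i * S_hat A (2 * \<kappa>) $ i $ k)"
    and r: "\<And>k. (\<Sum>l\<in>UNIV. r l * of_real (A $ l $ k)) - \<i> * of_real (2 * \<kappa>) * r k = - of_real (a $ k)"
    using S_hat_resolvent[OF A_stable, where a=a and \<omega>="2 * \<kappa>"] by blast
  obtain g where g: "A *v g - g = - (B *v \<gamma>)" using stable_resolvent_at_1[OF A_stable] by blast
  have g': "(\<Sum>l\<in>UNIV. A $ i $ l * g $ l) - g $ i + B $ i \<bullet> \<gamma> = 0" for i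
    using arg_cong[OF g, of "\<lambda>x. x $ i"] by (simp add: matrix_vector_mult_def inner_vec_def)
  \<comment> \<open>The blocks decouple. On the indices of \<open>v\<close> the resolvent
    \<open>r\<close> of \<open>A\<close> is rescaled; on \<open>None\<close> the equation is scalar
    with factor \<open>- 1 - 2 \<i> \<kappa>\<close>, and it has this simple solution because
    \<open>ll None\<close> is the product of \<open>1 + 2 \<i> \<kappa>\<close> and
    \<open>\<i> / (2 \<kappa>)\<close>.\<close>
  define m where "m = case_option (\<i> / of_real (2 * \<kappa>)) (\<lambda>l. \<i> / of_real (2 * \<kappa>) * r l)"
  \<comment> \<open>The transpose of \<open>stationary_cov A B\<close> spares the proof that it is symmetric.\<close>
  define R where "R i j = (case i of None \<Rightarrow> (case j of None \<Rightarrow> (norm \<gamma>)\<^sup>2 / 2 | Some j' \<Rightarrow> g $ j')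
    | Some i' \<Rightarrow> (case j of None \<Rightarrow> g $ i' | Some j' \<Rightarrow> stationary_cov A B $ j' $ i'))" for i j
  have m_eq: "(\<Sum>l\<in>UNIV. m l * of_real (augmented_matrix A $ l $ k)) - \<i> * of_real (2 * \<kappa>) * m k = - ll k" for k
  proof (cases k)
    case None
    then show ?thesis using \<kappa> by (simp add: sum_UNIV_option m_def ll_def av)
  next
    case (Some k')
    have "(\<Sum>l\<in>UNIV. m l * of_real (augmented_matrix A $ l $ k)) - \<i> * of_real (2 * \<kappa>) * m k =
      \<i> / of_real (2 * \<kappa>) * ((\<Sum>l\<in>UNIV. r l * of_real (A $ l $ k')) - \<i> * of_real (2 * \<kappa>) * r k')"
      by (simp add: Some sum_UNIV_option m_def sum_distrib_left right_diff_distrib mult_ac)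
    then show ?thesis unfolding r by (simp add: Some ll_def av)
  qed
  have R_eq: "(\<Sum>l\<in>UNIV. augmented_matrix A $ i $ l * R l j) + (\<Sum>l\<in>UNIV. augmented_matrix A $ j $ l * R i l) + \<beta> i \<bullet> \<beta> j = 0" for i j
  proof (cases i; cases j)
    fix i' j' assume ij: "i = Some i'" "j = Some j'"
    have "(B ** transpose B) $ j' $ i' = B $ i' \<bullet> B $ j'"
      by (simp add: matrix_matrix_mult_def transpose_def inner_vec_def mult.commute)
    then show ?thesis using stationary_cov_lyapunov[where A=A and B=B and i=j' and j=i', OF A_stable] by (simp add: ij sum_UNIV_option R_def \<beta> add_ac)
  qed (use g' in \<open>auto simp: sum_UNIV_option R_def \<beta> dot_square_norm inner_commute\<close>)
  have "(\<Sum>k\<in>UNIV. \<Sum>i\<in>UNIV. avc 0 k * m i * of_real (R k i)) =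
    ((\<Sum>k\<in>UNIV. \<Sum>i\<in>UNIV. of_real (a $ k) * r i * of_real (stationary_cov A B $ i $ k))
      + (\<Sum>k\<in>UNIV. of_real (a $ k) * of_real (g $ k))
      + (1 - 2 * \<i> * of_real \<kappa>) * ((\<Sum>k\<in>UNIV. r k * of_real (g $ k)) + of_real ((norm \<gamma>)\<^sup>2 / 2))) / of_real ((2 * \<kappa>)\<^sup>2)"
  proof -
    let ?K = "of_real (2 * \<kappa>) :: complex"
    have K: "?K \<noteq> 0" using \<kappa> by simp
    \<comment> \<open>The prefactors \<open>- \<i> / (2 \<kappa>)\<close> of \<open>ac 0\<close> and
      \<open>\<i> / (2 \<kappa>)\<close> of \<open>m\<close> multiply to the factor
      \<open>1 / \<omega>\<^sup>2\<close> of \<open>lambda2\<close>. On \<open>None\<close> the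
      shear adds -1 to the former, which accounts for
      \<open>1 - 2 * \<i> * of_real \<kappa>\<close>.\<close>
    have 1: "avc 0 (Some k) * (\<i> / ?K * x) = of_real (a $ k) * x / ?K\<^sup>2" for k x
      using K by (simp add: avc_def ac_def av field_simps power2_eq_square)
    have 2: "avc 0 None * (\<i> / ?K * x) = (1 - 2 * \<i> * of_real \<kappa>) * x / ?K\<^sup>2" for x
      using K by (simp add: avc_def ac_def sc_def av field_simps power2_eq_square)
    have m: "m None = \<i> / ?K * 1" "m (Some l) = \<i> / ?K * r l" for l by (simp_all add: m_def)
    have "(\<Sum>k\<in>UNIV. \<Sum>i\<in>UNIV. avc 0 k * m i * of_real (R k i)) =
      (1 - 2 * \<i> * of_real \<kappa>) * 1 / ?K\<^sup>2 * of_real ((norm \<gamma>)\<^sup>2 / 2)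
      + (\<Sum>i\<in>UNIV. (1 - 2 * \<i> * of_real \<kappa>) * r i / ?K\<^sup>2 * of_real (g $ i))
      + (\<Sum>k\<in>UNIV. of_real (a $ k) * 1 / ?K\<^sup>2 * of_real (g $ k)
          + (\<Sum>i\<in>UNIV. of_real (a $ k) * r i / ?K\<^sup>2 * of_real (stationary_cov A B $ i $ k)))"
      unfolding sum_UNIV_option m 1 2 by (simp add: R_def)
    then show ?thesis
      by (simp add: sum.distrib sum_divide_distrib sum_distrib_left add_divide_distrib distrib_left mult_ac)
  qed
  then have c: "Re (\<Sum>k\<in>UNIV. \<Sum>i\<in>UNIV. avc 0 k * m i * of_real (R k i)) = lambda2 A B a \<gamma> (2 * \<kappa>)"
    unfolding lambda2_eq[OF \<kappa> Re_r r g, symmetric] by (simp only: Re_divide_of_real)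
  obtain C where C: "\<And>\<epsilon> L. 0 < \<epsilon> \<Longrightarrow> \<epsilon> \<le> 1 \<Longrightarrow>
     (AE w in M. ((\<lambda>t. ln (norm (pos \<epsilon> t w, vel \<epsilon> t w)) / t) \<longlongrightarrow> L) at_top) \<Longrightarrow>
     \<bar>L - \<epsilon>\<^sup>2 * (- \<zeta>\<^sub>2 + lambda2 A B a \<gamma> (2 * \<kappa>))\<bar> \<le> C * \<epsilon> ^ 4"
    using exponent_expansion[OF R_eq m_eq] unfolding c by blast
  have "\<forall>\<^sub>F \<epsilon> in at_right 0. 0 < \<epsilon> \<and> \<epsilon> \<le> (1::real)"
    unfolding eventually_at_right_field by (intro exI[of _ 1]) auto
  with lyap have "\<forall>\<^sub>F \<epsilon> in at_right 0. \<bar>lyap \<epsilon> - \<epsilon>\<^sup>2 * (- \<zeta>\<^sub>2 + lambda2 A B a \<gamma> (2 * \<kappa>))\<bar> \<le> C * \<epsilon> ^ 4"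
  proof eventually_elim
    case (elim \<epsilon>)
    \<comment> \<open>The constructed solution starts at position 0 with velocity 1, so the exponent
      of the system governs it.\<close>
    have "AE w in M. (pos \<epsilon> 0 w, vel \<epsilon> 0 w) \<noteq> (0, 0)" by (rule AE_I2) (simp add: vel_0)
    then have "AE w in M. ((\<lambda>t. ln (norm (pos \<epsilon> t w, vel \<epsilon> t w)) / t) \<longlongrightarrow> lyap \<epsilon>) at_top"
      using elim(1) sol[of \<epsilon>] unfolding is_lyapunov_exponent_def by blast
    then show ?case using elim(2) by (intro C) auto
  qed
  then show ?thesis by (rule bigo_at_right_0)
qed

end
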